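(* For $1\le p\le2$, the modulation space $M^{p,1}(\mathbf{R})$ is a proper, dense subset of the Fourier Segal algebra $\mathcal{F}A_p(\mathbf{R})$: $M^{p,1}(\mathbf{R})\subsetneq\mathcal{F}A_p(\mathbf{R})$, and $M^{p,1}(\mathbf{R})$ is dense in $\mathcal{F}A_p(\mathbf{R})$.
   Context: $\widehat f(\xi)=\int_{\mathbf{R}} f(x)e^{-ix\xi}dx$ (extended to $\mathcal{S}'$). For $f\in\mathcal{S}'(\mathbf{R})$ and a window $\phi\in\mathcal{S}(\mathbf{R})\setminus\{0\}$, $V_\phi f(x,\xi)=\int_{\mathbf{R}} f(t)\overline{\phi(t-x)}e^{-it\xi}\,dt$ (by duality). The modulation space $M^{p,1}(\mathbf{R})$ consists of all $f\in\mathcal{S}'(\mathbf{R})$ with $\|f\|_{M^{p,1}}=\int_{\mathbf{R}}\big(\int_{\mathbf{R}}|V_\phi f(x,\xi)|^p\,dx\big)^{1/p}d\xi<\infty$; different windows give equivalent norms. The Fourier Segal algebra $\mathcal{F}A_p(\mathbf{R})$ is the space of all $f\in\mathcal S'(\mathbf R)$ for which the norm $\|f\|_{\mathcal{F}A_p}=\|f\|_{L^p}+\|\widehat f\|_{L^1}$ is finite; density is with respect to this norm. *)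

theory Defs
  imports "HOL-Analysis.Analysis"
begin

definition iter_deriv :: "nat \<Rightarrow> (real \<Rightarrow> complex) \<Rightarrow> real \<Rightarrow> complex" where
  "iter_deriv k f = ((\<lambda>g x. vector_derivative g (at x)) ^^ k) f"

definition schwartz :: "(real \<Rightarrow> complex) set" where
  "schwartz = {f. (\<forall>k x. iter_deriv k f differentiable (at x)) \<and>
                  (\<forall>j k. \<exists>C. \<forall>x. cmod (of_real (x ^ j) * iter_deriv k f x) \<le> C)}"

text \<open>The supremum below is meaningful for \<open>f \<in> schwartz\<close> only, where the set is bounded.\<close>

definition schwartz_seminorm :: "nat \<Rightarrow> nat \<Rightarrow> (real \<Rightarrow> complex) \<Rightarrow> real" where
  "schwartz_seminorm j k f = (SUP x. cmod (of_real (x ^ j) * iter_deriv k f x))"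

text \<open>A tempered distribution is a continuous linear functional on the Schwartz space. Functionals
  are total in HOL; requiring the value 0 outside the Schwartz space makes equality of functionals
  coincide with equality of distributions.\<close>

definition tempered_distributions :: "((real \<Rightarrow> complex) \<Rightarrow> complex) set" where
  "tempered_distributions = {u.
     (\<forall>f. f \<notin> schwartz \<longrightarrow> u f = 0) \<and>
     (\<forall>f\<in>schwartz. \<forall>g\<in>schwartz. u (\<lambda>x. f x + g x) = u f + u g) \<and>
     (\<forall>c. \<forall>f\<in>schwartz. u (\<lambda>x. c * f x) = c * u f) \<and>
     (\<exists>C N. \<forall>f\<in>schwartz. cmod (u f) \<le> C * (\<Sum>j\<le>N. \<Sum>k\<le>N. schwartz_seminorm j k f))}"

definition fourier :: "(real \<Rightarrow> complex) \<Rightarrow> real \<Rightarrow> complex" where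
  "fourier f \<xi> = (\<integral>x. f x * cis (- (x * \<xi>)) \<partial>lborel)"

definition dist_fourier :: "((real \<Rightarrow> complex) \<Rightarrow> complex) \<Rightarrow> (real \<Rightarrow> complex) \<Rightarrow> complex" where
  "dist_fourier u f = (if f \<in> schwartz then u (fourier f) else 0)"

definition represents :: "(real \<Rightarrow> complex) \<Rightarrow> ((real \<Rightarrow> complex) \<Rightarrow> complex) \<Rightarrow> bool" where
  "represents g u \<longleftrightarrow> g \<in> borel_measurable lborel \<and>
     (\<forall>f\<in>schwartz. integrable lborel (\<lambda>x. g x * f x) \<and> u f = (\<integral>x. g x * f x \<partial>lborel))"

definition ennreal_root :: "real \<Rightarrow> ennreal \<Rightarrow> ennreal" where
  "ennreal_root p a = (if a = \<infinity> then \<infinity> else ennreal (enn2real a powr (1 / p)))"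

definition Lp_norm :: "real \<Rightarrow> (real \<Rightarrow> complex) \<Rightarrow> ennreal" where
  "Lp_norm p g = ennreal_root p (\<integral>\<^sup>+x. ennreal (cmod (g x) powr p) \<partial>lborel)"

text \<open>A function representing a distribution is unique almost everywhere, so the infimum is the
  $L^p$ norm of that function; it is \<open>\<infinity>\<close> if the distribution is not a function.\<close>

definition dist_Lp_norm :: "real \<Rightarrow> ((real \<Rightarrow> complex) \<Rightarrow> complex) \<Rightarrow> ennreal" where
  "dist_Lp_norm p u = (INF g\<in>{g. represents g u}. Lp_norm p g)"

definition STFT :: "(real \<Rightarrow> complex) \<Rightarrow> ((real \<Rightarrow> complex) \<Rightarrow> complex) \<Rightarrow> real \<Rightarrow> real \<Rightarrow> complex" where
  "STFT \<phi> u x \<xi> = u (\<lambda>t. cnj (\<phi> (t - x)) * cis (- (t * \<xi>)))"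

definition modulation_norm ::
    "(real \<Rightarrow> complex) \<Rightarrow> real \<Rightarrow> ((real \<Rightarrow> complex) \<Rightarrow> complex) \<Rightarrow> ennreal" where
  "modulation_norm \<phi> p u = (\<integral>\<^sup>+\<xi>. Lp_norm p (\<lambda>x. STFT \<phi> u x \<xi>) \<partial>lborel)"

text \<open>The space $M^{p,1}$, computed with the window \<open>\<phi>\<close>.\<close>

definition modulation_space ::
    "(real \<Rightarrow> complex) \<Rightarrow> real \<Rightarrow> ((real \<Rightarrow> complex) \<Rightarrow> complex) set" where
  "modulation_space \<phi> p = {u \<in> tempered_distributions. modulation_norm \<phi> p u < \<infinity>}"

definition FA_norm :: "real \<Rightarrow> ((real \<Rightarrow> complex) \<Rightarrow> complex) \<Rightarrow> ennreal" where
  "FA_norm p u = dist_Lp_norm p u + dist_Lp_norm 1 (dist_fourier u)"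

definition fourier_segal :: "real \<Rightarrow> ((real \<Rightarrow> complex) \<Rightarrow> complex) set" where
  "fourier_segal p = {u \<in> tempered_distributions. FA_norm p u < \<infinity>}"

end

theory Submission
  imports Defs "HOL-Probability.Probability"
begin

text \<open>
  Write \<open>V(x,\<xi>)\<close> for the short-time Fourier transform of \<open>u\<close>, \<open>\<gamma>\<close> for the Fourier transform of the
  window \<open>\<phi>\<close>, and \<open>U\<close> for the Fourier transform of \<open>u\<close>. Everything rests on one identity
  (\<open>STFT_pairing\<close>): integrating \<open>V(x,\<xi>)\<close> in \<open>x\<close> against the Fourier transform of \<open>r\<close> gives \<open>U\<close>
  applied to \<open>r(\<eta> - \<xi>) cnj (\<gamma>(\<eta> - \<xi>))\<close>. On the Fourier side the slice \<open>V(\<sqdot>,\<xi>)\<close> is thus the piece of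
  \<open>U\<close> cut out by a window around \<open>\<xi>\<close>.

  Inclusion. By the Hausdorff--Young inequality the Fourier transform of a slice is in the dual
  Lebesgue space, so that its product with one more factor \<open>\<gamma>\<close> is integrable, with norm at most a
  constant times the \<open>L\<^sup>p\<close> norm of the slice; this weighted form has an elementary proof
  (\<open>weighted_hausdorff_young\<close>). It says that \<open>U \<bar>\<gamma>(\<sqdot> - \<xi>)\<bar>\<^sup>2\<close> is integrable for almost every \<open>\<xi>\<close>,
  with norms that are integrable in \<open>\<xi>\<close>. Since the integral of these pieces over \<open>\<xi>\<close> is a multiple
  of \<open>U\<close>, also \<open>U\<close> is an integrable function (\<open>synthesis_L1_limit\<close>, \<open>modulation_fourier_L1\<close>). Then
  \<open>u\<close> is a bounded continuous function \<open>f\<close>, and \<open>V(x,\<sqdot>)\<close> is the Fourier transform of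
  \<open>f cnj (\<phi>(\<sqdot> - x))\<close>. Inversion at the point \<open>x + a\<close>, where \<open>\<phi> a \<noteq> 0\<close>, bounds \<open>\<bar>f(x + a)\<bar>\<close> by the
  integral of \<open>\<bar>V(x,\<xi>)\<bar>\<close> over \<open>\<xi>\<close>, and by Minkowski's integral inequality (\<open>minkowski_finite\<close>) this
  is an \<open>L\<^sup>p\<close> function of \<open>x\<close>.

  Density. Let \<open>u\<close> be the function \<open>f\<close> with integrable Fourier transform \<open>H\<close>. Multiplication by a
  wide Gaussian changes \<open>f\<close> little in \<open>L\<^sup>p\<close>, and it changes \<open>H\<close> little in \<open>L\<^sup>1\<close>, because there it is
  convolution with an approximate identity (\<open>convol_gauss_L1\<close>). The product is in the modulation
  space: its short-time Fourier transform is the convolution, in \<open>\<xi>\<close>, of \<open>H\<close> with a kernel that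
  decays quadratically in \<open>x\<close> and in \<open>\<xi>\<close> (\<open>gaussian_cutoff_distribution\<close>).

  Properness. Let \<open>U\<close> be a sum of bumps at the positive integers, of heights \<open>a\<^sub>n\<close> and widths \<open>w\<^sub>n\<close>.
  It is integrable if \<open>a\<^sub>n * w\<^sub>n\<close> is summable, and its inverse Fourier transform is bounded and
  integrable if moreover \<open>U\<close> has a square integrable derivative, which holds if \<open>a\<^sub>n\<^sup>2 * w\<^sub>n\<close> and
  \<open>a\<^sub>n\<^sup>2 / w\<^sub>n\<close> are summable (\<open>fourier_H_integrable\<close>). For \<open>\<xi>\<close> in an interval of fixed length the
  slice \<open>V(\<sqdot>,\<xi>)\<close> sees the bump of number \<open>n\<close>, whose inverse Fourier transform has \<open>L\<^sup>p\<close> norm of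
  order \<open>a\<^sub>n * w\<^sub>n powr (1 - 1/p)\<close>, and this is at least of order \<open>a\<^sub>n * sqrt w\<^sub>n\<close> for \<open>p \<le> 2\<close>
  (\<open>STFT_Lp_lower_bound\<close>). So the modulation norm is infinite if the sum of \<open>a\<^sub>n * sqrt w\<^sub>n\<close>
  diverges, and suitable powers of \<open>n\<close> satisfy all four requirements.

  The distribution theory behind this comes down to one fact: a tempered distribution may be
  exchanged with the integral of a family of test functions (\<open>tempered_integral_exchange\<close>). The
  families that occur are products of translates and modulations, and their seminorms are estimated
  by means of sets of kernels that are closed under differentiation.
\<close>

section \<open>The Fourier transform of integrable functions\<close>

lemma cis_measurable [measurable]: "cis \<in> borel_measurable borel"
  by (intro borel_measurable_continuous_onI continuous_on_cis continuous_on_id)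

lemma cnj_measurable [measurable]: "cnj \<in> borel_measurable borel"
  by (intro borel_measurable_continuous_onI continuous_intros)

lemma integrable_inverse_quadratic: "integrable lborel (\<lambda>x::real. 1 / (1 + x\<^sup>2))"
  and integral_inverse_quadratic: "(\<integral>x. 1 / (1 + x\<^sup>2) \<partial>lborel) = pi"
proof -
  have "set_integrable lborel UNIV (\<lambda>x::real. inverse (1 + x^2))"
    using integrable_inverse_1_plus_square by simp
  then show "integrable lborel (\<lambda>x::real. 1 / (1 + x\<^sup>2))"
    by (simp add: set_integrable_def inverse_eq_divide)
  show "(\<integral>x. 1 / (1 + x\<^sup>2) \<partial>lborel) = pi"
    using LBINT_inverse_1_plus_square
    by (simp add: interval_lebesgue_integral_def set_lebesgue_integral_def inverse_eq_divide)
qed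

lemma integrable_times_cis:
  assumes "integrable M f" "g \<in> borel_measurable M"
  shows "integrable M (\<lambda>x. f x * cis (g x))"
proof (rule Bochner_Integration.integrable_bound[OF assms(1)])
  have [measurable]: "f \<in> borel_measurable M" using assms(1) by auto
  note [measurable] = assms(2)
  show "(\<lambda>x. f x * cis (g x)) \<in> borel_measurable M" by measurable
qed (simp add: norm_mult)

lemma integrable_mult_bounded:
  fixes f g :: "'a \<Rightarrow> complex"
  assumes f: "integrable M f" and [measurable]: "g \<in> borel_measurable M" and g: "\<And>x. cmod (g x) \<le> C"
  shows "integrable M (\<lambda>x. f x * g x)" "integrable M (\<lambda>x. g x * f x)"
proof -
  have [measurable]: "f \<in> borel_measurable M" using f by auto
  have C: "0 \<le> C" using order_trans[OF norm_ge_zero g] .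
  show "integrable M (\<lambda>x. f x * g x)"
  proof (rule Bochner_Integration.integrable_bound)
    show "integrable M (\<lambda>x. complex_of_real C * f x)" using f by simp
    have "cmod (f x * g x) \<le> cmod (complex_of_real C * f x)" for x
      using mult_right_mono[OF g, of "cmod (f x)" x] C by (simp add: norm_mult mult.commute)
    then show "AE x in M. cmod (f x * g x) \<le> cmod (complex_of_real C * f x)" by simp
  qed measurable
  then show "integrable M (\<lambda>x. g x * f x)" by (simp add: mult.commute)
qed

lemma fourier_integrand_integrable [intro]:
  "integrable lborel f \<Longrightarrow> integrable lborel (\<lambda>x. f x * cis (- (x * \<xi>)))"
  by (rule integrable_times_cis) auto

lemma cmod_fourier_le: "cmod (fourier f \<xi>) \<le> (\<integral>x. cmod (f x) \<partial>lborel)"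
  unfolding fourier_def
  by (rule order_trans[OF integral_norm_bound]) (simp add: norm_mult)

lemma fourier_measurable [measurable]:
  assumes [measurable]: "f \<in> borel_measurable borel"
  shows "fourier f \<in> borel_measurable borel"
  unfolding fourier_def[abs_def] by measurable

lemma integrable_pair_mult:
  fixes a b :: "real \<Rightarrow> complex"
  assumes a: "integrable lborel a" and b: "integrable lborel b"
    and [measurable]: "c \<in> borel_measurable borel" and c: "\<And>z. cmod (c z) \<le> C"
  shows "integrable (lborel \<Otimes>\<^sub>M lborel) (\<lambda>(x, y). a x * b y * c (x, y))"
proof -
  have [measurable]: "a \<in> borel_measurable borel" "b \<in> borel_measurable borel"
    using a b by auto
  have [measurable]: "c \<in> borel_measurable (borel \<Otimes>\<^sub>M borel)" by (simp add: borel_prod)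
  have C0: "0 \<le> C" using c[of "(0,0)"] by (meson norm_ge_zero order_trans)
  have *: "integrable (lborel \<Otimes>\<^sub>M lborel) (\<lambda>(x, y). a x * b y)"
  proof (rule lborel_pair.Fubini_integrable)
    show "integrable lborel (\<lambda>x. \<integral>y. norm (case (x, y) of (x, y) \<Rightarrow> a x * b y) \<partial>lborel)"
      using a by (simp add: norm_mult)
    show "AE x in lborel. integrable lborel (\<lambda>y. case (x, y) of (x, y) \<Rightarrow> a x * b y)"
      using b by simp
  qed measurable
  show ?thesis
  proof (rule Bochner_Integration.integrable_bound[OF integrable_mult_right[OF *, of "complex_of_real C"]])
    have "cmod (a x * b y * c (x, y)) \<le> cmod (complex_of_real C * (a x * b y))" for x y
      using mult_left_mono[OF c, of "cmod (a x * b y)" "(x, y)"] C0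
      by (simp add: norm_mult mult_ac)
    then show "AE x in lborel \<Otimes>\<^sub>M lborel. norm (case x of (x, y) \<Rightarrow> a x * b y * c (x, y))
        \<le> norm (complex_of_real C * (case x of (x, y) \<Rightarrow> a x * b y))"
      by (auto split: prod.splits)
  qed measurable
qed

lemma fubini_mult:
  fixes a b :: "real \<Rightarrow> complex"
  assumes a: "integrable lborel a" and b: "integrable lborel b"
    and [measurable]: "c \<in> borel_measurable borel" and c: "\<And>z. cmod (c z) \<le> C"
  shows "(\<integral>x. a x * (\<integral>y. b y * c (x, y) \<partial>lborel) \<partial>lborel) = (\<integral>y. b y * (\<integral>x. a x * c (x, y) \<partial>lborel) \<partial>lborel)"
proof -
  from lborel_pair.Fubini_integral[OF integrable_pair_mult[OF assms]]
  have "(\<integral>y. (\<integral>x. a x * b y * c (x, y) \<partial>lborel) \<partial>lborel) = (\<integral>x. (\<integral>y. a x * b y * c (x, y) \<partial>lborel) \<partial>lborel)"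
    by simp
  moreover have "(\<integral>x. a x * b y * c (x, y) \<partial>lborel) = b y * (\<integral>x. a x * c (x, y) \<partial>lborel)" for y
    by (subst integral_mult_right_zero[symmetric]) (simp add: mult_ac)
  moreover have "(\<integral>y. a x * b y * c (x, y) \<partial>lborel) = a x * (\<integral>y. b y * c (x, y) \<partial>lborel)" for x
    by (subst integral_mult_right_zero[symmetric]) (simp add: mult_ac)
  ultimately show ?thesis by simp
qed

text \<open>Fubini's theorem. This is how the Fourier transform is moved from one factor of an integral to the
  other.\<close>

lemma fourier_multiplication_formula:
  assumes a: "integrable lborel a" and b: "integrable lborel b"
  shows "(\<integral>\<eta>. fourier a \<eta> * b \<eta> \<partial>lborel) = (\<integral>x. a x * fourier b x \<partial>lborel)"
proof -
  have m: "(\<lambda>(x::real, y). cis (- (x * y))) \<in> borel_measurable borel"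
    by (simp flip: borel_prod)
  have "(\<integral>y. b y * fourier a y \<partial>lborel) = (\<integral>x. a x * fourier b x \<partial>lborel)"
    using fubini_mult[OF a b m, of 1] by (simp add: fourier_def mult_ac split_beta)
  then show ?thesis by (simp add: mult.commute)
qed

text \<open>The Gaussian is a rescaled normal density, and its Fourier transform is the characteristic
  function of that distribution.\<close>

lemma fourier_gaussian:
  assumes "0 < a"
  shows "integrable lborel (\<lambda>x. complex_of_real (exp (- (a * x\<^sup>2))))"
    and "fourier (\<lambda>x. complex_of_real (exp (- (a * x\<^sup>2)))) \<xi> = complex_of_real (sqrt (pi / a) * exp (- (\<xi>\<^sup>2 / (4 * a))))"
proof -
  have "integrable lborel std_normal_density" by simp
  then have "integrable lborel (\<lambda>x. std_normal_density (0 + sqrt (2 * a) * x))"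
    using assms by (subst lborel_integrable_real_affine_iff) auto
  moreover have "(\<lambda>x. std_normal_density (0 + sqrt (2 * a) * x)) = (\<lambda>x. 1 / sqrt (2 * pi) * exp (- (a * x\<^sup>2)))"
    using assms by (auto simp: std_normal_density_def power_mult_distrib fun_eq_iff)
  ultimately have "integrable lborel (\<lambda>x. 1 / sqrt (2 * pi) * exp (- (a * x\<^sup>2)))" by simp
  from integrable_mult_right[OF this, of "sqrt (2 * pi)"]
  have "integrable lborel (\<lambda>x. exp (- (a * x\<^sup>2)))" by simp
  then show "integrable lborel (\<lambda>x. complex_of_real (exp (- (a * x\<^sup>2))))" by simp
  define t where "t = - \<xi> / sqrt (2 * a)"
  have "complex_of_real (exp (- (t^2) / 2)) = (\<integral>x. std_normal_density x *\<^sub>R cis (t * x) \<partial>lborel)"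
    using fun_cong[OF char_std_normal_distribution, of t]
    by (subst (asm) char_def, subst (asm) integral_density) (auto simp: cis_conv_exp mult_ac)
  also have "\<dots> = \<bar>sqrt (2 * a)\<bar> *\<^sub>R (\<integral>x. std_normal_density (0 + sqrt (2 * a) * x) *\<^sub>R cis (t * (0 + sqrt (2 * a) * x)) \<partial>lborel)"
    using assms by (intro lborel_integral_real_affine) auto
  also have "\<dots> = sqrt (2 * a) *\<^sub>R (\<integral>x. (1 / sqrt (2 * pi)) *\<^sub>R (complex_of_real (exp (- (a * x\<^sup>2))) * cis (- (x * \<xi>))) \<partial>lborel)"
    using assms by (simp add: std_normal_density_def power_mult_distrib t_def scaleR_conv_of_real mult_ac)
  also have "\<dots> = complex_of_real (sqrt (a / pi)) * fourier (\<lambda>x. complex_of_real (exp (- (a * x\<^sup>2)))) \<xi>"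
    using assms by (simp add: fourier_def scaleR_conv_of_real real_sqrt_mult real_sqrt_divide)
  finally have *: "complex_of_real (exp (- (t^2) / 2)) = complex_of_real (sqrt (a / pi)) * fourier (\<lambda>x. complex_of_real (exp (- (a * x\<^sup>2)))) \<xi>" .
  have "complex_of_real (sqrt (pi / a)) * complex_of_real (sqrt (a / pi)) = 1"
    using assms by (simp flip: of_real_mult real_sqrt_mult)
  then have "fourier (\<lambda>x. complex_of_real (exp (- (a * x\<^sup>2)))) \<xi> = complex_of_real (sqrt (pi / a)) * complex_of_real (exp (- (t^2) / 2))"
    unfolding * by (metis mult.assoc mult.left_neutral)
  also have "exp (- (t^2) / 2) = exp (- (\<xi>\<^sup>2 / (4 * a)))"
    using assms by (simp add: t_def power_divide)
  finally show "fourier (\<lambda>x. complex_of_real (exp (- (a * x\<^sup>2)))) \<xi> = complex_of_real (sqrt (pi / a) * exp (- (\<xi>\<^sup>2 / (4 * a))))"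
    by simp
qed

lemma fourier_modulate: "fourier (\<lambda>x. f x * cis (x * c)) \<xi> = fourier f (\<xi> - c)"
  unfolding fourier_def by (intro Bochner_Integration.integral_cong refl) (simp add: cis_mult mult.assoc algebra_simps)

lemma integral_gaussian: 
  assumes "0 < a" shows "(\<integral>x. exp (- (a * x\<^sup>2)) \<partial>lborel) = sqrt (pi / a)"
proof -
  have "complex_of_real (\<integral>x. exp (- (a * x\<^sup>2)) \<partial>lborel) = fourier (\<lambda>x. complex_of_real (exp (- (a * x\<^sup>2)))) 0"
    by (simp add: fourier_def)
  also have "\<dots> = complex_of_real (sqrt (pi / a))"
    by (subst fourier_gaussian[OF assms]) simp
  finally show ?thesis by (simp only: of_real_eq_iff)
qed

text \<open>The factor in front makes the integral 1; the mass concentrates at 0 as the index grows.\<close>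

definition gauss_kernel :: "nat \<Rightarrow> real \<Rightarrow> complex" where
  "gauss_kernel n z = complex_of_real (real (Suc n) / sqrt pi * exp (- ((real (Suc n))\<^sup>2 * z\<^sup>2)))"

lemma gauss_kernel_measurable [measurable]: "gauss_kernel n \<in> borel_measurable borel"
  unfolding gauss_kernel_def[abs_def] by measurable

definition convol :: "(real \<Rightarrow> complex) \<Rightarrow> (real \<Rightarrow> complex) \<Rightarrow> real \<Rightarrow> complex" where
  "convol a b x = (\<integral>y. a y * b (x - y) \<partial>lborel)"

text \<open>After rescaling around \<open>x\<close> the Gaussian does not depend on \<open>n\<close>, while \<open>g\<close> is evaluated at points
  that tend to \<open>x\<close>.\<close>

lemma convol_gauss_tendsto:
  fixes g :: "real \<Rightarrow> complex"
  assumes g [measurable]: "g \<in> borel_measurable borel" and B: "\<And>x. cmod (g x) \<le> B" and cont: "isCont g x"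
  shows "(\<lambda>n. convol g (gauss_kernel n) x) \<longlonglongrightarrow> g x"
proof -
  have eq: "convol g (gauss_kernel n) x = (\<integral>z. g (x + z / real (Suc n)) * complex_of_real (1 / sqrt pi * exp (- z\<^sup>2)) \<partial>lborel)" for n
  proof -
    define N where "N = real (Suc n)"
    have N: "0 < N" by (simp add: N_def)
    have "convol g (gauss_kernel n) x = (\<integral>y. g y * complex_of_real (N / sqrt pi * exp (- (N\<^sup>2 * (x - y)\<^sup>2))) \<partial>lborel)"
      unfolding convol_def gauss_kernel_def N_def ..
    also have "\<dots> = \<bar>1 / N\<bar> *\<^sub>R (\<integral>z. g (x + 1 / N * z) * complex_of_real (N / sqrt pi * exp (- (N\<^sup>2 * (x - (x + 1 / N * z))\<^sup>2))) \<partial>lborel)"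
      using N by (intro lborel_integral_real_affine) simp
    also have "\<dots> = (\<integral>z. (1 / N) *\<^sub>R (g (x + 1 / N * z) * complex_of_real (N / sqrt pi * exp (- (N\<^sup>2 * (x - (x + 1 / N * z))\<^sup>2)))) \<partial>lborel)"
      using N by simp
    also have "\<dots> = (\<integral>z. g (x + z / N) * complex_of_real (1 / sqrt pi * exp (- z\<^sup>2)) \<partial>lborel)"
      using N by (intro Bochner_Integration.integral_cong) (auto simp: scaleR_conv_of_real power_divide)
    finally show ?thesis by (simp add: N_def)
  qed
  have "(\<lambda>n. convol g (gauss_kernel n) x) \<longlonglongrightarrow> (\<integral>z. g x * complex_of_real (1 / sqrt pi * exp (- z\<^sup>2)) \<partial>lborel)"
    unfolding eq
  proof (rule integral_dominated_convergence)
    show "integrable lborel (\<lambda>z. B * (1 / sqrt pi * exp (- z\<^sup>2)))"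
      using fourier_gaussian(1)[of 1] by (simp add: complex_of_real_integrable_eq)
    have *: "(\<lambda>n. g (x + z / real (Suc n))) \<longlonglongrightarrow> g x" for z
      by (rule isCont_tendsto_compose[OF cont]) real_asymp
    show "AE z in lborel. (\<lambda>n. g (x + z / real (Suc n)) * complex_of_real (1 / sqrt pi * exp (- z\<^sup>2))) \<longlonglongrightarrow> g x * complex_of_real (1 / sqrt pi * exp (- z\<^sup>2))"
      by (intro AE_I2 tendsto_intros *)
    show "AE z in lborel. cmod (g (x + z / real (Suc n)) * complex_of_real (1 / sqrt pi * exp (- z\<^sup>2))) \<le> B * (1 / sqrt pi * exp (- z\<^sup>2))" for n
      unfolding norm_mult norm_of_real by (intro AE_I2 mult_mono B) (auto simp: order_trans[OF norm_ge_zero B])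
  qed measurable
  also have "(\<integral>z. g x * complex_of_real (1 / sqrt pi * exp (- z\<^sup>2)) \<partial>lborel) = g x * complex_of_real (1 / sqrt pi * (\<integral>z. exp (- z\<^sup>2) \<partial>lborel))"
    by (simp only: integral_mult_right_zero integral_complex_of_real)
  also have "\<dots> = g x" using integral_gaussian[of 1] by simp
  finally show ?thesis .
qed

text \<open>The inversion integral of \<open>f\<close> need not converge. A Gaussian factor makes it converge absolutely
  and turns it into an average of \<open>f\<close> around \<open>x\<close>.\<close>

lemma gaussian_mean_fourier:
  fixes N :: real
  assumes f: "integrable lborel f" and N: "0 < N"
  shows "(\<integral>\<eta>. fourier f \<eta> * (complex_of_real (exp (- (\<eta>\<^sup>2 / (4 * N\<^sup>2)))) * cis (\<eta> * x)) \<partial>lborel)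
    = (\<integral>y. f y * complex_of_real (2 * N * sqrt pi * exp (- (N\<^sup>2 * (y - x)\<^sup>2))) \<partial>lborel)"
proof -
  define a where "a = 1 / (4 * N\<^sup>2)"
  have a: "0 < a" using N by (simp add: a_def)
  have *: "sqrt (pi / a) * exp (- (z\<^sup>2 / (4 * a))) = 2 * N * sqrt pi * exp (- (N\<^sup>2 * z\<^sup>2))" for z
    using N by (simp add: a_def real_sqrt_mult)
  have "(\<integral>\<eta>. fourier f \<eta> * (complex_of_real (exp (- (a * \<eta>\<^sup>2))) * cis (\<eta> * x)) \<partial>lborel)
    = (\<integral>y. f y * fourier (\<lambda>\<eta>. complex_of_real (exp (- (a * \<eta>\<^sup>2))) * cis (\<eta> * x)) y \<partial>lborel)"
    by (intro fourier_multiplication_formula f integrable_times_cis fourier_gaussian a) simp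
  then show ?thesis
    unfolding fourier_modulate fourier_gaussian(2)[OF a] * by (simp add: a_def)
qed

text \<open>The Gaussian means of the inversion integral converge to that integral, since the Fourier
  transform of \<open>h\<close> is integrable, and as averages of \<open>h\<close> around a point of continuity they converge
  to the value of \<open>h\<close>.\<close>

lemma fourier_inversion:
  fixes h :: "real \<Rightarrow> complex"
  assumes h: "integrable lborel h" and B: "\<And>x. cmod (h x) \<le> B"
    and fh: "integrable lborel (fourier h)" and cont: "isCont h x"
  shows "fourier (fourier h) (- x) = 2 * pi * h x"
proof -
  have [measurable]: "h \<in> borel_measurable borel" "fourier h \<in> borel_measurable borel" using h fh by auto
  define L where "L n = (\<integral>\<eta>. fourier h \<eta> * (complex_of_real (exp (- (\<eta>\<^sup>2 / (4 * (real (Suc n))\<^sup>2)))) * cis (\<eta> * x)) \<partial>lborel)" for n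
  have "L \<longlonglongrightarrow> (\<integral>\<eta>. fourier h \<eta> * (complex_of_real 1 * cis (\<eta> * x)) \<partial>lborel)"
    unfolding L_def
  proof (rule integral_dominated_convergence)
    show "integrable lborel (\<lambda>\<eta>. cmod (fourier h \<eta>))" using fh by simp
    have "(\<lambda>n. exp (- (\<eta>\<^sup>2 / (4 * (real (Suc n))\<^sup>2)))) \<longlonglongrightarrow> 1" for \<eta> :: real
      by real_asymp
    then show "AE \<eta> in lborel. (\<lambda>n. fourier h \<eta> * (complex_of_real (exp (- (\<eta>\<^sup>2 / (4 * (real (Suc n))\<^sup>2)))) * cis (\<eta> * x))) \<longlonglongrightarrow> fourier h \<eta> * (complex_of_real 1 * cis (\<eta> * x))"
      by (intro AE_I2 tendsto_intros)
    have "cmod (fourier h \<eta> * (complex_of_real (exp (- (\<eta>\<^sup>2 / (4 * (real (Suc n))\<^sup>2)))) * cis (\<eta> * x))) \<le> cmod (fourier h \<eta>) * 1" for n \<eta>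
      unfolding norm_mult norm_of_real by (intro mult_mono) auto
    then show "AE \<eta> in lborel. cmod (fourier h \<eta> * (complex_of_real (exp (- (\<eta>\<^sup>2 / (4 * (real (Suc n))\<^sup>2)))) * cis (\<eta> * x))) \<le> cmod (fourier h \<eta>)" for n
      by simp
  qed measurable
  then have L1: "L \<longlonglongrightarrow> fourier (fourier h) (- x)" by (simp add: fourier_def)
  have "L n = 2 * pi * convol h (gauss_kernel n) x" for n
  proof -
    define N where "N = real (Suc n)"
    have "complex_of_real (2 * N * sqrt pi * exp (- (N\<^sup>2 * (y - x)\<^sup>2))) = 2 * pi * gauss_kernel n (x - y)" for y
    proof -
      have eq: "2 * N * sqrt pi * E = 2 * pi * (N / sqrt pi * E)" for E
        using real_sqrt_mult_self[of pi] by (simp add: field_simps)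
      show ?thesis
        unfolding gauss_kernel_def N_def[symmetric] power2_commute[of x y] eq of_real_mult by (simp add: mult.assoc)
    qed
    then have "L n = (\<integral>y. 2 * pi * (h y * gauss_kernel n (x - y)) \<partial>lborel)"
      unfolding L_def using gaussian_mean_fourier[OF h, of N x] by (simp add: N_def mult_ac del: of_nat_Suc of_real_mult of_real_exp)
    then show ?thesis by (simp add: convol_def)
  qed
  then have L: "L = (\<lambda>n. 2 * pi * convol h (gauss_kernel n) x)" by (rule ext)
  have "L \<longlonglongrightarrow> 2 * pi * h x"
    unfolding L by (intro tendsto_intros convol_gauss_tendsto[OF _ B cont]) simp
  then show ?thesis using L1 LIMSEQ_unique by blast
qed

lemma fourier_cnj: "cnj (fourier f \<xi>) = fourier (\<lambda>x. cnj (f x)) (- \<xi>)"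
proof -
  have "cnj (fourier f \<xi>) = (\<integral>x. cnj (f x * cis (- (x * \<xi>))) \<partial>lborel)"
    unfolding fourier_def by (rule Bochner_Integration.integral_cnj[symmetric])
  then show ?thesis by (simp add: fourier_def cis_cnj)
qed

lemma nn_integral_lborel_shift:
  fixes c :: real
  assumes [measurable]: "f \<in> borel_measurable borel"
  shows "(\<integral>\<^sup>+x. f (x - c) \<partial>lborel) = (\<integral>\<^sup>+x. f x \<partial>lborel)"
  using nn_integral_real_affine[of f 1 "- c"] by (simp add: add.commute[of "- c"])

text \<open>The inequality in Plancherel's theorem. With a Gaussian factor on the left, Fubini's theorem
  writes the left-hand side as the double integral of \<open>F x * cnj (F y) * k (x - y)\<close>, where \<open>k\<close> is a
  positive kernel of mass \<open>2 * pi\<close>. Schur's test bounds it: estimate \<open>\<bar>F x\<bar> \<bar>F y\<bar>\<close> by half the sum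
  of the squares. Fatou's lemma removes the Gaussian factor.\<close>

lemma fourier_L2_bound:
  assumes F: "integrable lborel F"
  shows "(\<integral>\<^sup>+\<eta>. ennreal ((cmod (fourier F \<eta>))\<^sup>2) \<partial>lborel) \<le> 2 * pi * (\<integral>\<^sup>+x. ennreal ((cmod (F x))\<^sup>2) \<partial>lborel)"
proof -
  have [measurable]: "F \<in> borel_measurable borel" using F by auto
  \<comment> \<open>the Fourier transform of the Gaussian factor\<close>
  define k where "k N z = 2 * N * sqrt pi * exp (- (N\<^sup>2 * z\<^sup>2))" for N z :: real
  have k0: "0 \<le> k N z" if "0 < N" for N z using that by (simp add: k_def)
  have [measurable]: "k N \<in> borel_measurable borel" for N unfolding k_def by measurable
  have ki: "integrable lborel (k N)" and kI: "(\<integral>z. k N z \<partial>lborel) = 2 * pi" if "0 < N" for N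
  proof -
    show "integrable lborel (k N)"
      unfolding k_def using fourier_gaussian(1)[of "N\<^sup>2"] that
      by (intro integrable_mult_right) (simp add: complex_of_real_integrable_eq)
    show "(\<integral>z. k N z \<partial>lborel) = 2 * pi"
      unfolding k_def using integral_gaussian[of "N\<^sup>2"] that by (simp add: real_sqrt_divide)
  qed
  have kn: "(\<integral>\<^sup>+z. ennreal (k N (z - c)) \<partial>lborel) = 2 * pi" if "0 < N" for N c
    using nn_integral_eq_integral[OF ki[OF that]] k0[OF that] kI[OF that]
    by (subst nn_integral_lborel_shift) (auto simp: ennreal_mult)
  have ksym: "k N (x - y) = k N (y - x)" for N x y by (simp add: k_def power2_commute)
  let ?R = "\<integral>\<^sup>+x. ennreal ((cmod (F x))\<^sup>2) \<partial>lborel"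
  have bound: "(\<integral>\<^sup>+\<eta>. ennreal ((cmod (fourier F \<eta>))\<^sup>2 * exp (- (\<eta>\<^sup>2 / (4 * N\<^sup>2)))) \<partial>lborel) \<le> 2 * pi * ?R" if N: "0 < N" for N
  proof -
    define g where "g \<eta> = complex_of_real (exp (- (\<eta>\<^sup>2 / (4 * N\<^sup>2))))" for \<eta>
    have gi: "integrable lborel g"
      unfolding g_def using fourier_gaussian(1)[of "1 / (4 * N\<^sup>2)"] N by simp
    have [measurable]: "g \<in> borel_measurable borel" using gi by auto
    define b where "b \<eta> = cnj (fourier F \<eta>) * g \<eta>" for \<eta>
    define M where "M = (\<integral>x. cmod (F x) \<partial>lborel)"
    have bi: "integrable lborel b"
      unfolding b_def[abs_def] by (rule integrable_mult_bounded(2)[OF gi, where C = M]) (simp_all add: M_def cmod_fourier_le)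
    have fb: "fourier b x = (\<integral>y. cnj (F y) * complex_of_real (k N (y - x)) \<partial>lborel)" for x
    proof -
      have "fourier b x = (\<integral>\<eta>. fourier (\<lambda>x. cnj (F x)) (- \<eta>) * (g \<eta> * cis (- (\<eta> * x))) \<partial>lborel)"
        by (simp add: fourier_def[of b] b_def fourier_cnj mult.assoc)
      also have "\<dots> = (\<integral>\<eta>. fourier (\<lambda>x. cnj (F x)) \<eta> * (g \<eta> * cis (\<eta> * x)) \<partial>lborel)"
        by (subst lborel_integral_real_affine[where c = "-1" and t = 0]) (auto simp: g_def)
      also have "\<dots> = (\<integral>y. cnj (F y) * complex_of_real (k N (y - x)) \<partial>lborel)"
        unfolding g_def k_def using F N by (intro gaussian_mean_fourier) auto
      finally show ?thesis .
    qed
    have "complex_of_real ((cmod (fourier F \<eta>))\<^sup>2 * exp (- (\<eta>\<^sup>2 / (4 * N\<^sup>2)))) = fourier F \<eta> * b \<eta>" for \<eta>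
      using complex_norm_square[of "fourier F \<eta>"] by (simp add: b_def g_def)
    note eq = this
    have int: "integrable lborel (\<lambda>\<eta>. fourier F \<eta> * b \<eta>)"
      by (rule integrable_mult_bounded(2)[OF bi, where C = M]) (simp_all add: M_def cmod_fourier_le)
    have int2: "integrable lborel (\<lambda>\<eta>. (cmod (fourier F \<eta>))\<^sup>2 * exp (- (\<eta>\<^sup>2 / (4 * N\<^sup>2))))"
      using int unfolding eq[symmetric] by (simp only: complex_of_real_integrable_eq)
    have "(\<integral>\<^sup>+\<eta>. ennreal ((cmod (fourier F \<eta>))\<^sup>2 * exp (- (\<eta>\<^sup>2 / (4 * N\<^sup>2)))) \<partial>lborel)
       = ennreal (\<integral>\<eta>. (cmod (fourier F \<eta>))\<^sup>2 * exp (- (\<eta>\<^sup>2 / (4 * N\<^sup>2))) \<partial>lborel)"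
      by (rule nn_integral_eq_integral[OF int2]) simp
    also have "(\<integral>\<eta>. (cmod (fourier F \<eta>))\<^sup>2 * exp (- (\<eta>\<^sup>2 / (4 * N\<^sup>2))) \<partial>lborel)
       = cmod (complex_of_real (\<integral>\<eta>. (cmod (fourier F \<eta>))\<^sup>2 * exp (- (\<eta>\<^sup>2 / (4 * N\<^sup>2))) \<partial>lborel))"
      by (simp add: integral_nonneg_AE)
    also have "complex_of_real (\<integral>\<eta>. (cmod (fourier F \<eta>))\<^sup>2 * exp (- (\<eta>\<^sup>2 / (4 * N\<^sup>2))) \<partial>lborel)
       = (\<integral>\<eta>. fourier F \<eta> * b \<eta> \<partial>lborel)"
      by (simp only: eq[symmetric] integral_complex_of_real)
    also have "\<dots> = (\<integral>x. F x * fourier b x \<partial>lborel)"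
      by (rule fourier_multiplication_formula[OF F bi])
    also have "ennreal (cmod \<dots>) \<le> (\<integral>\<^sup>+x. ennreal (cmod (F x * fourier b x)) \<partial>lborel)"
      using bi by (intro integral_norm_bound_ennreal integrable_mult_bounded(1)[OF F _ cmod_fourier_le]) auto
    also have "\<dots> \<le> (\<integral>\<^sup>+x. \<integral>\<^sup>+y. ennreal ((cmod (F x))\<^sup>2 / 2 * k N (y - x)) + ennreal ((cmod (F y))\<^sup>2 / 2 * k N (x - y)) \<partial>lborel \<partial>lborel)"
    proof (intro nn_integral_mono)
      fix x
      have "ennreal (cmod (F x * fourier b x)) = ennreal (cmod (F x)) * ennreal (cmod (fourier b x))"
        by (simp add: norm_mult ennreal_mult)
      also have "ennreal (cmod (fourier b x)) \<le> (\<integral>\<^sup>+y. ennreal (cmod (cnj (F y) * complex_of_real (k N (y - x)))) \<partial>lborel)"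
        unfolding fb
      proof (rule integral_norm_bound_ennreal, rule integrable_mult_bounded[where C = "2 * N * sqrt pi"])
        show "cmod (complex_of_real (k N (y - x))) \<le> 2 * N * sqrt pi" for y
          using N unfolding norm_of_real by (simp add: k_def abs_mult)
      qed (use F in auto)
      also have "ennreal (cmod (F x)) * \<dots> = (\<integral>\<^sup>+y. ennreal (cmod (F x)) * ennreal (cmod (F y) * k N (y - x)) \<partial>lborel)"
        by (subst nn_integral_cmult[symmetric]) (simp_all add: norm_mult k0[OF N])
      also have "\<dots> \<le> (\<integral>\<^sup>+y. ennreal ((cmod (F x))\<^sup>2 / 2 * k N (y - x)) + ennreal ((cmod (F y))\<^sup>2 / 2 * k N (x - y)) \<partial>lborel)"
      proof (intro nn_integral_mono)
        fix y
        have "cmod (F x) * cmod (F y) \<le> (cmod (F x))\<^sup>2 / 2 + (cmod (F y))\<^sup>2 / 2"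
          using sum_squares_bound[of "cmod (F x)" "cmod (F y)"] by simp
        from mult_right_mono[OF this k0[OF N, of "y - x"]]
        have "cmod (F x) * (cmod (F y) * k N (y - x)) \<le> (cmod (F x))\<^sup>2 / 2 * k N (y - x) + (cmod (F y))\<^sup>2 / 2 * k N (x - y)"
          by (simp add: ksym[of N x y] algebra_simps)
        then show "ennreal (cmod (F x)) * ennreal (cmod (F y) * k N (y - x)) \<le> ennreal ((cmod (F x))\<^sup>2 / 2 * k N (y - x)) + ennreal ((cmod (F y))\<^sup>2 / 2 * k N (x - y))"
          using k0[OF N] by (simp flip: ennreal_mult ennreal_plus add: ennreal_leI)
      qed
      finally show "ennreal (cmod (F x * fourier b x)) \<le> (\<integral>\<^sup>+y. ennreal ((cmod (F x))\<^sup>2 / 2 * k N (y - x)) + ennreal ((cmod (F y))\<^sup>2 / 2 * k N (x - y)) \<partial>lborel)"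
        by (simp add: mult_left_mono)
    qed
    also have "\<dots> = (\<integral>\<^sup>+x. \<integral>\<^sup>+y. ennreal ((cmod (F x))\<^sup>2 / 2 * k N (y - x)) \<partial>lborel \<partial>lborel)
       + (\<integral>\<^sup>+x. \<integral>\<^sup>+y. ennreal ((cmod (F y))\<^sup>2 / 2 * k N (x - y)) \<partial>lborel \<partial>lborel)"
      by (simp add: nn_integral_add)
    also have "(\<integral>\<^sup>+x. \<integral>\<^sup>+y. ennreal ((cmod (F y))\<^sup>2 / 2 * k N (x - y)) \<partial>lborel \<partial>lborel)
       = (\<integral>\<^sup>+y. \<integral>\<^sup>+x. ennreal ((cmod (F y))\<^sup>2 / 2 * k N (x - y)) \<partial>lborel \<partial>lborel)"
      by (rule lborel_pair.Fubini') measurable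
    also have "(\<integral>\<^sup>+x. \<integral>\<^sup>+y. ennreal ((cmod (F x))\<^sup>2 / 2 * k N (y - x)) \<partial>lborel \<partial>lborel) = pi * ?R"
    proof -
      have "(\<integral>\<^sup>+y. ennreal ((cmod (F x))\<^sup>2 / 2 * k N (y - x)) \<partial>lborel) = ennreal pi * ennreal ((cmod (F x))\<^sup>2)" for x
      proof -
        have "(\<integral>\<^sup>+y. ennreal ((cmod (F x))\<^sup>2 / 2 * k N (y - x)) \<partial>lborel) = ennreal ((cmod (F x))\<^sup>2 / 2) * (\<integral>\<^sup>+y. ennreal (k N (y - x)) \<partial>lborel)"
          by (subst nn_integral_cmult[symmetric]) (auto intro!: nn_integral_cong ennreal_mult k0[OF N] simp del: times_divide_eq_left)
        also have "\<dots> = ennreal ((cmod (F x))\<^sup>2 / 2 * (2 * pi))"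
          by (subst kn[OF N]) (simp add: ennreal_mult'[symmetric])
        also have "(cmod (F x))\<^sup>2 / 2 * (2 * pi) = pi * (cmod (F x))\<^sup>2" by simp
        finally show ?thesis by (simp add: ennreal_mult)
      qed
      then show ?thesis by (simp add: nn_integral_cmult)
    qed
    also have "ennreal pi * ?R + ennreal pi * ?R = 2 * pi * ?R"
      by (simp only: mult_2 distrib_right ennreal_plus[OF pi_ge_zero pi_ge_zero])
    finally show ?thesis .
  qed
  have "(\<integral>\<^sup>+\<eta>. ennreal ((cmod (fourier F \<eta>))\<^sup>2) \<partial>lborel)
      = (\<integral>\<^sup>+\<eta>. liminf (\<lambda>n. ennreal ((cmod (fourier F \<eta>))\<^sup>2 * exp (- (\<eta>\<^sup>2 / (4 * (real (Suc n))\<^sup>2))))) \<partial>lborel)"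
  proof (rule nn_integral_cong)
    fix \<eta> :: real
    have "(\<lambda>n. exp (- (\<eta>\<^sup>2 / (4 * (real (Suc n))\<^sup>2)))) \<longlonglongrightarrow> 1" by real_asymp
    then have "(\<lambda>n. ennreal ((cmod (fourier F \<eta>))\<^sup>2 * exp (- (\<eta>\<^sup>2 / (4 * (real (Suc n))\<^sup>2))))) \<longlonglongrightarrow> ennreal ((cmod (fourier F \<eta>))\<^sup>2 * 1)"
      by (intro tendsto_intros)
    from lim_imp_Liminf[OF _ this]
    show "ennreal ((cmod (fourier F \<eta>))\<^sup>2) = liminf (\<lambda>n. ennreal ((cmod (fourier F \<eta>))\<^sup>2 * exp (- (\<eta>\<^sup>2 / (4 * (real (Suc n))\<^sup>2)))))"
      by (simp del: of_nat_Suc)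
  qed
  also have "\<dots> \<le> liminf (\<lambda>n. \<integral>\<^sup>+\<eta>. ennreal ((cmod (fourier F \<eta>))\<^sup>2 * exp (- (\<eta>\<^sup>2 / (4 * (real (Suc n))\<^sup>2)))) \<partial>lborel)"
    by (rule nn_integral_liminf) measurable
  also have "\<dots> \<le> liminf (\<lambda>n::nat. 2 * pi * ?R)"
    by (intro Liminf_mono always_eventually allI bound) simp
  also have "\<dots> = 2 * pi * ?R" by (simp add: Liminf_const)
  finally show ?thesis .
qed

section \<open>A weighted Hausdorff--Young inequality\<close>

lemma ennreal_root_simps:
  "ennreal_root p \<infinity> = \<infinity>" "0 \<le> i \<Longrightarrow> ennreal_root p (ennreal i) = ennreal (i powr (1 / p))"
  by (auto simp: ennreal_root_def)

lemma ennreal_root_mono: "0 < p \<Longrightarrow> a \<le> b \<Longrightarrow> ennreal_root p a \<le> ennreal_root p b"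
  by (cases a; cases b) (auto simp: ennreal_root_def top_unique intro!: ennreal_leI powr_mono2)

lemma ennreal_root_less_top: "ennreal_root p a < \<infinity> \<longleftrightarrow> a < \<infinity>"
  by (cases a) (auto simp: ennreal_root_def)

lemma ennreal_root_measurable [measurable]: "ennreal_root p \<in> borel_measurable borel"
  unfolding ennreal_root_def[abs_def] by measurable

lemma ennreal_root_tendsto_0:
  assumes p: "0 < p" and I: "I \<longlonglongrightarrow> 0" shows "(\<lambda>n. ennreal_root p (I n)) \<longlonglongrightarrow> 0"
proof -
  have ev: "eventually (\<lambda>n. I n < 1) sequentially" using order_tendstoD(2)[OF I, of 1] by simp
  have "(\<lambda>n. enn2real (I n)) \<longlonglongrightarrow> 0"
    by (rule tendsto_enn2real) (use I in simp_all)
  then have "(\<lambda>n. enn2real (I n) powr (1 / p)) \<longlonglongrightarrow> 0"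
    using p by (intro tendsto_zero_powrI[of _ _ _ "1 / p"]) (auto intro: tendsto_const)
  then have "(\<lambda>n. ennreal (enn2real (I n) powr (1 / p))) \<longlonglongrightarrow> ennreal 0" by (rule tendsto_ennrealI)
  moreover have "eventually (\<lambda>n. ennreal (enn2real (I n) powr (1 / p)) = ennreal_root p (I n)) sequentially"
    using ev by eventually_elim (auto simp: ennreal_root_def)
  ultimately show ?thesis by (simp add: tendsto_cong)
qed

text \<open>Dominated convergence, transported through the \<open>p\<close>-th root.\<close>

lemma Lp_norm_dominated_tendsto:
  assumes p: "0 < p" and [measurable]: "\<And>n. s n \<in> borel_measurable borel" "F \<in> borel_measurable borel"
    and fin: "Lp_norm p F < \<infinity>" and le: "\<And>n x. cmod (s n x) \<le> cmod (F x)" and lim: "\<And>x. (\<lambda>n. s n x) \<longlonglongrightarrow> 0"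
  shows "(\<lambda>n. Lp_norm p (s n)) \<longlonglongrightarrow> 0"
  unfolding Lp_norm_def
proof (rule ennreal_root_tendsto_0[OF p])
  have "(\<lambda>n. \<integral>\<^sup>+x. ennreal (cmod (s n x) powr p) \<partial>lborel) \<longlonglongrightarrow> (\<integral>\<^sup>+x. 0 \<partial>(lborel :: real measure))"
  proof (rule nn_integral_dominated_convergence)
    show "(\<integral>\<^sup>+x. ennreal (cmod (F x) powr p) \<partial>lborel) < \<infinity>"
      using fin unfolding Lp_norm_def ennreal_root_less_top .
    show "AE x in lborel. ennreal (cmod (s n x) powr p) \<le> ennreal (cmod (F x) powr p)" for n
      using p le by (intro AE_I2 ennreal_leI powr_mono2) auto
    show "AE x in lborel. (\<lambda>n. ennreal (cmod (s n x) powr p)) \<longlonglongrightarrow> 0"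
    proof (rule AE_I2)
      fix x
      have "(\<lambda>n. cmod (s n x) powr p) \<longlonglongrightarrow> 0"
        using p tendsto_norm_zero[OF lim] by (intro tendsto_zero_powrI[of _ _ _ p]) (auto intro: tendsto_const)
      from tendsto_ennrealI[OF this] show "(\<lambda>n. ennreal (cmod (s n x) powr p)) \<longlonglongrightarrow> 0" by simp
    qed
  qed measurable
  then show "(\<lambda>n. \<integral>\<^sup>+x. ennreal (cmod (s n x) powr p) \<partial>lborel) \<longlonglongrightarrow> 0" by simp
qed

lemma Lp_norm_mono_AE:
  assumes "0 < p" "AE x in lborel. cmod (f x) \<le> cmod (g x)"
  shows "Lp_norm p f \<le> Lp_norm p g"
  unfolding Lp_norm_def using assms
  by (intro ennreal_root_mono nn_integral_mono_AE) (auto intro!: ennreal_leI powr_mono2)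

lemma Lp_norm_1: "Lp_norm 1 f = (\<integral>\<^sup>+x. ennreal (cmod (f x)) \<partial>lborel)"
  by (cases "\<integral>\<^sup>+x. ennreal (cmod (f x)) \<partial>lborel") (auto simp: Lp_norm_def ennreal_root_def)

text \<open>Arguments that split a function at the height of its norm need a norm that is neither zero nor
  infinite.\<close>

lemma Lp_norm_cases:
  assumes p: "0 < p" and [measurable]: "f \<in> borel_measurable borel"
  obtains (infinite) "Lp_norm p f = \<infinity>"
  | (zero) "Lp_norm p f = 0" "AE x in lborel. f x = 0"
  | (pos) A where "0 < A" "Lp_norm p f = ennreal A" "(\<integral>\<^sup>+x. ennreal (cmod (f x) powr p) \<partial>lborel) = ennreal (A powr p)"
proof (cases "\<integral>\<^sup>+x. ennreal (cmod (f x) powr p) \<partial>lborel")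
  case (real i)
  show ?thesis
  proof (cases "i = 0")
    case True
    then have "(\<integral>\<^sup>+x. ennreal (cmod (f x) powr p) \<partial>lborel) = 0" using real by simp
    then have "AE x in lborel. ennreal (cmod (f x) powr p) = 0"
      by (subst (asm) nn_integral_0_iff_AE) auto
    then have "AE x in lborel. f x = 0" by eventually_elim (simp add: ennreal_eq_0_iff)
    then show ?thesis using that(2) real True by (simp add: Lp_norm_def ennreal_root_def)
  next
    case False
    then show ?thesis using real p
      by (intro that(3)[of "i powr (1 / p)"]) (auto simp: Lp_norm_def ennreal_root_def powr_powr)
  qed
qed (use that(1) in \<open>simp add: Lp_norm_def ennreal_root_def\<close>)

lemma fourier_AE_zero: "AE x in lborel. f x = 0 \<Longrightarrow> fourier f \<xi> = 0"
  unfolding fourier_def by (rule integral_eq_zero_AE) auto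

text \<open>A substitute for the Hausdorff--Young inequality. Split \<open>F\<close> at the height \<open>A\<close> of its \<open>L\<^sup>p\<close> norm.
  The large values have \<open>L\<^sup>1\<close> norm at most \<open>A\<close>, so that their transform is bounded by \<open>A\<close> and may be
  integrated against \<open>c\<close>. The small values have \<open>L\<^sup>2\<close> norm at most \<open>A\<close>, since \<open>p \<le> 2\<close>, so that their
  transform may be integrated against the square integrable \<open>c\<close>. The right-hand side is homogeneous
  in \<open>F\<close>, as it has to be, but not in \<open>c\<close>, which will be a fixed function.\<close>

lemma weighted_hausdorff_young:
  fixes c :: "real \<Rightarrow> real"
  assumes p: "1 \<le> p" "p \<le> 2" and F: "integrable lborel F"
    and [measurable]: "c \<in> borel_measurable borel" and c: "\<And>\<eta>. 0 \<le> c \<eta>"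
  shows "(\<integral>\<^sup>+\<eta>. ennreal (cmod (fourier F \<eta>) * c \<eta>) \<partial>lborel)
    \<le> ((\<integral>\<^sup>+\<eta>. ennreal (c \<eta>) \<partial>lborel) + pi + (\<integral>\<^sup>+\<eta>. ennreal ((c \<eta>)\<^sup>2) \<partial>lborel)) * Lp_norm p F"
    (is "?L \<le> ?C * _")
proof -
  have [measurable]: "F \<in> borel_measurable borel" using F by auto
  have p0: "0 < p" using p by simp
  show ?thesis
  proof (cases rule: Lp_norm_cases[OF p0, of F, case_names meas infinite zero pos])
    case infinite
    have "?C \<noteq> 0" using pi_gt_zero by (simp add: ennreal_eq_0_iff del: pi_gt_zero)
    with infinite show ?thesis by (simp add: ennreal_mult_top)
  next
    case zero
    then show ?thesis by (simp add: fourier_AE_zero)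
  next
    case (pos A)
    \<comment> \<open>\<open>A\<close> is the norm of \<open>F\<close>\<close>
    define F1 where "F1 x = (if A < cmod (F x) then F x else 0)" for x
    define F2 where "F2 x = (if A < cmod (F x) then 0 else F x)" for x
    have [measurable]: "F1 \<in> borel_measurable borel" "F2 \<in> borel_measurable borel"
      unfolding F1_def[abs_def] F2_def[abs_def] by measurable
    have F1: "integrable lborel F1" and F2: "integrable lborel F2"
      by (rule Bochner_Integration.integrable_bound[OF F]; simp add: F1_def F2_def)+
    have "F x = F1 x + F2 x" for x by (simp add: F1_def F2_def)
    then have split: "fourier F \<eta> = fourier F1 \<eta> + fourier F2 \<eta>" for \<eta>
      unfolding fourier_def using F1 F2
      by (subst Bochner_Integration.integral_add[symmetric]) (auto simp: distrib_right)
    have b1: "cmod (F1 x) \<le> A powr (1 - p) * cmod (F x) powr p" for x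
    proof (cases "A < cmod (F x)")
      case True
      have "cmod (F x) = cmod (F x) powr (1 - p) * cmod (F x) powr p"
        using True pos(1) by (simp flip: powr_add)
      also have "\<dots> \<le> A powr (1 - p) * cmod (F x) powr p"
        using True pos(1) p by (intro mult_right_mono powr_mono2') auto
      finally show ?thesis by (simp add: F1_def True)
    qed (simp add: F1_def)
    have b2: "(cmod (F2 x))\<^sup>2 \<le> A powr (2 - p) * cmod (F x) powr p" for x
    proof (cases "A < cmod (F x) \<or> F x = 0")
      case False
      then have "(cmod (F x))\<^sup>2 = cmod (F x) powr (2 - p) * cmod (F x) powr p"
        by (simp flip: powr_add)
      also have "\<dots> \<le> A powr (2 - p) * cmod (F x) powr p"
        using False p by (intro mult_right_mono powr_mono2) auto
      finally show ?thesis using False by (simp add: F2_def)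
    qed (auto simp: F2_def)
    have I1: "(\<integral>\<^sup>+x. ennreal (cmod (F1 x)) \<partial>lborel) \<le> ennreal A"
    proof -
      have "(\<integral>\<^sup>+x. ennreal (cmod (F1 x)) \<partial>lborel) \<le> (\<integral>\<^sup>+x. ennreal (A powr (1 - p)) * ennreal (cmod (F x) powr p) \<partial>lborel)"
        using b1 by (intro nn_integral_mono) (simp flip: ennreal_mult add: ennreal_leI)
      also have "\<dots> = ennreal (A powr (1 - p) * A powr p)"
        by (simp add: nn_integral_cmult pos(3) ennreal_mult)
      also have "A powr (1 - p) * A powr p = A" using pos(1) by (simp flip: powr_add)
      finally show ?thesis .
    qed
    have I2: "(\<integral>\<^sup>+x. ennreal ((cmod (F2 x))\<^sup>2) \<partial>lborel) \<le> ennreal (A * A)"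
    proof -
      have "(\<integral>\<^sup>+x. ennreal ((cmod (F2 x))\<^sup>2) \<partial>lborel) \<le> (\<integral>\<^sup>+x. ennreal (A powr (2 - p)) * ennreal (cmod (F x) powr p) \<partial>lborel)"
        using b2 by (intro nn_integral_mono) (simp flip: ennreal_mult add: ennreal_leI)
      also have "\<dots> = ennreal (A powr (2 - p) * A powr p)"
        by (simp add: nn_integral_cmult pos(3) ennreal_mult)
      also have "A powr (2 - p) * A powr p = A * A" using pos(1) by (simp flip: powr_add add: power2_eq_square)
      finally show ?thesis .
    qed
    have f1: "cmod (fourier F1 \<eta>) \<le> A" for \<eta>
    proof -
      have "ennreal (\<integral>x. cmod (F1 x) \<partial>lborel) \<le> ennreal A"
        using I1 by (subst nn_integral_eq_integral[symmetric]) (use F1 in auto)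
      then show ?thesis using cmod_fourier_le[of F1 \<eta>] pos(1) by (simp add: ennreal_le_iff)
    qed
    have "cmod (fourier F \<eta>) * c \<eta> \<le> A * c \<eta> + (1 / (2 * A) * (cmod (fourier F2 \<eta>))\<^sup>2 + A * (c \<eta>)\<^sup>2)" for \<eta>
    proof -
      \<comment> \<open>the arithmetic-geometric mean inequality, balanced so that both squares contribute a
        multiple of \<open>A\<close>\<close>
      have "2 * A * (cmod (fourier F2 \<eta>) * c \<eta>) \<le> (cmod (fourier F2 \<eta>))\<^sup>2 + (A * c \<eta>)\<^sup>2"
        using sum_squares_bound[of "cmod (fourier F2 \<eta>)" "A * c \<eta>"] by (simp add: mult_ac)
      also have "\<dots> \<le> (cmod (fourier F2 \<eta>))\<^sup>2 + 2 * (A * c \<eta>)\<^sup>2" by simp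
      finally have "cmod (fourier F2 \<eta>) * c \<eta> \<le> 1 / (2 * A) * (cmod (fourier F2 \<eta>))\<^sup>2 + A * (c \<eta>)\<^sup>2"
        using pos(1) by (simp add: field_simps power2_eq_square)
      moreover have "cmod (fourier F \<eta>) * c \<eta> \<le> (A + cmod (fourier F2 \<eta>)) * c \<eta>"
        unfolding split using f1[of \<eta>] norm_triangle_ineq[of "fourier F1 \<eta>" "fourier F2 \<eta>"] c
        by (intro mult_right_mono) auto
      ultimately show ?thesis by (simp add: distrib_right)
    qed
    then have "?L \<le> (\<integral>\<^sup>+\<eta>. ennreal A * ennreal (c \<eta>) + (ennreal (1 / (2 * A)) * ennreal ((cmod (fourier F2 \<eta>))\<^sup>2) + ennreal A * ennreal ((c \<eta>)\<^sup>2)) \<partial>lborel)"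
      using pos(1) c by (intro nn_integral_mono) (simp flip: ennreal_mult ennreal_plus add: ennreal_leI)
    also have "\<dots> = ennreal A * (\<integral>\<^sup>+\<eta>. ennreal (c \<eta>) \<partial>lborel) + (ennreal (1 / (2 * A)) * (\<integral>\<^sup>+\<eta>. ennreal ((cmod (fourier F2 \<eta>))\<^sup>2) \<partial>lborel)
        + ennreal A * (\<integral>\<^sup>+\<eta>. ennreal ((c \<eta>)\<^sup>2) \<partial>lborel))"
      by (simp add: nn_integral_add nn_integral_cmult)
    also have "ennreal (1 / (2 * A)) * (\<integral>\<^sup>+\<eta>. ennreal ((cmod (fourier F2 \<eta>))\<^sup>2) \<partial>lborel) \<le> ennreal (1 / (2 * A)) * (2 * pi * ennreal (A * A))"
      by (intro mult_left_mono order_trans[OF fourier_L2_bound[OF F2]] I2) auto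
    also have "\<dots> = ennreal A * pi"
      using pos(1) by (simp flip: ennreal_mult)
    finally show ?thesis
      by (simp add: pos(2) algebra_simps)
  qed auto
qed

section \<open>Schwartz functions\<close>

text \<open>The function \<open>D k\<close> is the \<open>k\<close>-th derivative of \<open>D 0\<close>. Exhibiting all derivatives of a function at
  once proves that it is smooth and computes its iterated derivatives.\<close>

definition deriv_chain :: "(nat \<Rightarrow> real \<Rightarrow> complex) \<Rightarrow> bool" where
  "deriv_chain D \<longleftrightarrow> (\<forall>k x. (D k has_vector_derivative D (Suc k) x) (at x))"

lemma deriv_chainD: "deriv_chain D \<Longrightarrow> (D k has_vector_derivative D (Suc k) x) (at x)"
  by (simp add: deriv_chain_def)

lemma iter_deriv_0 [simp]: "iter_deriv 0 f = f"
  by (simp add: iter_deriv_def)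

lemma iter_deriv_Suc: "iter_deriv (Suc k) f = (\<lambda>x. vector_derivative (iter_deriv k f) (at x))"
  by (simp add: iter_deriv_def)

lemma iter_deriv_add: "iter_deriv k (iter_deriv j f) = iter_deriv (k + j) f"
  by (simp add: iter_deriv_def funpow_add)

lemma iter_deriv_chain: "deriv_chain D \<Longrightarrow> iter_deriv k (D 0) = D k"
proof (induction k)
  case (Suc k)
  then have "iter_deriv (Suc k) (D 0) = (\<lambda>x. vector_derivative (D k) (at x))" by (simp add: iter_deriv_Suc)
  also have "\<dots> = D (Suc k)" using vector_derivative_at[OF deriv_chainD[OF Suc.prems]] by blast
  finally show ?case .
qed simp

lemma schwartz_chain: "f \<in> schwartz \<Longrightarrow> deriv_chain (\<lambda>k. iter_deriv k f)"
  by (auto simp: schwartz_def deriv_chain_def iter_deriv_Suc vector_derivative_works)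

lemma schwartz_deriv: "f \<in> schwartz \<Longrightarrow> (iter_deriv k f has_vector_derivative iter_deriv (Suc k) f x) (at x)"
  using deriv_chainD[OF schwartz_chain] .

lemma schwartz_deriv_0: "f \<in> schwartz \<Longrightarrow> (f has_vector_derivative iter_deriv 1 f x) (at x)"
  using schwartz_deriv[of f 0] by simp

lemma schwartz_bound_power:
  assumes "f \<in> schwartz" obtains C where "\<And>x. \<bar>x\<bar> ^ j * cmod (iter_deriv k f x) \<le> C"
proof -
  have "\<exists>C. \<forall>x. cmod (of_real (x ^ j) * iter_deriv k f x) \<le> C" using assms by (simp add: schwartz_def)
  then show ?thesis using that by (auto simp: norm_mult norm_power)
qed

lemma schwartzI:
  assumes D: "deriv_chain D" and b: "\<And>j k. \<exists>C. \<forall>x. \<bar>x\<bar> ^ j * cmod (D k x) \<le> C"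
  shows "D 0 \<in> schwartz"
proof -
  have "\<exists>C. \<forall>x. cmod (of_real (x ^ j) * D k x) \<le> C" for j k
    using b[of j k] by (simp add: norm_mult norm_power)
  then show ?thesis unfolding schwartz_def
    by (auto simp: iter_deriv_chain[OF D] simp del: of_real_power intro!: differentiableI_vector deriv_chainD[OF D])
qed

lemma schwartz_bound:
  assumes f: "f \<in> schwartz"
  obtains C where "0 \<le> C" "\<And>x. (1 + \<bar>x\<bar>) ^ j * cmod (iter_deriv k f x) \<le> C"
proof -
  obtain C0 where C0: "\<And>x. \<bar>x\<bar> ^ 0 * cmod (iter_deriv k f x) \<le> C0" using schwartz_bound_power[OF f] by blast
  obtain C1 where C1: "\<And>x. \<bar>x\<bar> ^ j * cmod (iter_deriv k f x) \<le> C1" using schwartz_bound_power[OF f] by blast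
  have "(1 + \<bar>x\<bar>) ^ j * cmod (iter_deriv k f x) \<le> 2 ^ j * (C0 + C1)" for x
  proof -
    have "(1 + \<bar>x\<bar>) ^ j \<le> (2 * max 1 \<bar>x\<bar>) ^ j" by (intro power_mono) auto
    also have "\<dots> \<le> 2 ^ j * (1 + \<bar>x\<bar> ^ j)" by (auto simp: power_mult_distrib max_def)
    finally have "(1 + \<bar>x\<bar>) ^ j * cmod (iter_deriv k f x) \<le> 2 ^ j * (1 + \<bar>x\<bar> ^ j) * cmod (iter_deriv k f x)"
      by (intro mult_right_mono) auto
    also have "\<dots> = 2 ^ j * (\<bar>x\<bar> ^ 0 * cmod (iter_deriv k f x) + \<bar>x\<bar> ^ j * cmod (iter_deriv k f x))"
      by (simp add: algebra_simps)
    also have "\<dots> \<le> 2 ^ j * (C0 + C1)" by (intro mult_left_mono add_mono C0 C1) auto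
    finally show ?thesis .
  qed
  moreover have "0 \<le> 2 ^ j * (C0 + C1)"
    by (rule order_trans[OF _ calculation[of 0]]) simp
  ultimately show ?thesis using that by blast
qed

lemma schwartz_bound_0:
  assumes f: "f \<in> schwartz"
  obtains C where "0 \<le> C" "\<And>x. (1 + \<bar>x\<bar>) ^ j * cmod (f x) \<le> C"
  using schwartz_bound[OF f, of j 0] by auto

lemma schwartz_iter_deriv: assumes f: "f \<in> schwartz" shows "iter_deriv k f \<in> schwartz"
proof -
  have *: "deriv_chain (\<lambda>j. iter_deriv (j + k) f)"
    using schwartz_chain[OF f] by (simp add: deriv_chain_def)
  have "\<exists>C. \<forall>x. \<bar>x\<bar> ^ j * cmod (iter_deriv (i + k) f x) \<le> C" for i j
    using schwartz_bound_power[OF f, of j "i + k"] by metis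
  from schwartzI[OF * this] show ?thesis by simp
qed

lemma schwartz_isCont: "f \<in> schwartz \<Longrightarrow> isCont f x"
  using schwartz_deriv_0 has_vector_derivative_continuous by blast

lemma schwartz_measurable [measurable_dest]: "f \<in> schwartz \<Longrightarrow> f \<in> borel_measurable borel"
  by (intro borel_measurable_continuous_onI) (simp add: continuous_at_imp_continuous_on schwartz_isCont)

lemma one_plus_square_le: "1 + x\<^sup>2 \<le> (1 + \<bar>x\<bar>)\<^sup>2" for x :: real
  by (simp add: power2_sum)

lemma schwartz_decay:
  assumes f: "f \<in> schwartz"
  obtains C where "0 \<le> C" "\<And>x. cmod (f x) \<le> C * (1 / (1 + x\<^sup>2))"
proof -
  obtain C where C: "0 \<le> C" "\<And>x. (1 + \<bar>x\<bar>) ^ 2 * cmod (f x) \<le> C" using schwartz_bound_0[OF f] by blast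
  have "cmod (f x) \<le> C * (1 / (1 + x\<^sup>2))" for x
  proof -
    have "(1 + x\<^sup>2) * cmod (f x) \<le> C"
      by (rule order_trans[OF mult_right_mono[OF one_plus_square_le] C(2)]) simp
    then show ?thesis by (simp add: field_simps add_pos_nonneg)
  qed
  with C(1) that show ?thesis by blast
qed

lemma schwartz_bounded: assumes f: "f \<in> schwartz" obtains C where "0 \<le> C" "\<And>x. cmod (f x) \<le> C"
  using schwartz_bound_0[OF f, of 0] by auto

lemma integrable_quadratic_decay:
  fixes f :: "real \<Rightarrow> complex"
  assumes "f \<in> borel_measurable borel" "\<And>x. cmod (f x) \<le> C * (1 / (1 + x\<^sup>2))"
  shows "integrable lborel f"
proof (rule Bochner_Integration.integrable_bound)
  show "integrable lborel (\<lambda>x. C * (1 / (1 + x\<^sup>2)))" by (rule integrable_mult_right[OF integrable_inverse_quadratic])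
  have "norm (f x) \<le> norm (C * (1 / (1 + x\<^sup>2)))" for x
    using order_trans[OF assms(2) abs_ge_self] by (simp only: real_norm_def)
  then show "AE x in lborel. norm (f x) \<le> norm (C * (1 / (1 + x\<^sup>2)))" by simp
qed (use assms(1) in simp)

lemma integral_quadratic_decay:
  fixes f :: "real \<Rightarrow> complex"
  assumes "f \<in> borel_measurable borel" "\<And>x. cmod (f x) \<le> M * (1 / (1 + x\<^sup>2))"
  shows "(\<integral>x. cmod (f x) \<partial>lborel) \<le> M * pi"
proof -
  have "(\<integral>x. cmod (f x) \<partial>lborel) \<le> (\<integral>x. M * (1 / (1 + x\<^sup>2)) \<partial>lborel)"
    using assms integrable_quadratic_decay[OF assms] by (intro integral_mono integrable_mult_right integrable_inverse_quadratic) auto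
  also have "\<dots> = M * pi" by (subst integral_mult_right_zero) (simp only: integral_inverse_quadratic)
  finally show ?thesis .
qed

lemma schwartz_integrable: "f \<in> schwartz \<Longrightarrow> integrable lborel f"
  by (metis schwartz_decay integrable_quadratic_decay schwartz_measurable)

lemma schwartz_add: assumes "f \<in> schwartz" "g \<in> schwartz" shows "(\<lambda>x. f x + g x) \<in> schwartz"
proof -
  have "deriv_chain (\<lambda>k x. iter_deriv k f x + iter_deriv k g x)"
    using assms by (auto simp: deriv_chain_def intro!: derivative_intros schwartz_deriv)
  moreover have "\<exists>C. \<forall>x. \<bar>x\<bar> ^ j * cmod (iter_deriv k f x + iter_deriv k g x) \<le> C" for j k
  proof -
    obtain C1 where C1: "\<And>x. \<bar>x\<bar> ^ j * cmod (iter_deriv k f x) \<le> C1" using schwartz_bound_power assms by blast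
    obtain C2 where C2: "\<And>x. \<bar>x\<bar> ^ j * cmod (iter_deriv k g x) \<le> C2" using schwartz_bound_power assms by blast
    have "\<bar>x\<bar> ^ j * cmod (iter_deriv k f x + iter_deriv k g x) \<le> C1 + C2" for x
      using mult_left_mono[OF norm_triangle_ineq[of "iter_deriv k f x" "iter_deriv k g x"], of "\<bar>x\<bar> ^ j"] C1[of x] C2[of x]
      by (simp add: distrib_left)
    then show ?thesis by blast
  qed
  ultimately show ?thesis using schwartzI by fastforce
qed

lemma schwartz_linear_map:
  assumes f: "f \<in> schwartz" and L: "bounded_linear L"
  shows "(\<lambda>x. L (f x)) \<in> schwartz" "iter_deriv k (\<lambda>x. L (f x)) = (\<lambda>x. L (iter_deriv k f x))"
proof -
  have c: "deriv_chain (\<lambda>k x. L (iter_deriv k f x))"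
    unfolding deriv_chain_def using bounded_linear.has_vector_derivative[OF L schwartz_deriv[OF f]] by blast
  obtain M where M: "\<And>x. cmod (L x) \<le> cmod x * M" "0 \<le> M" using bounded_linear.nonneg_bounded[OF L] by blast
  have "\<exists>C. \<forall>x. \<bar>x\<bar> ^ j * cmod (L (iter_deriv k f x)) \<le> C" for j k
  proof -
    obtain C1 where C1: "\<And>x. \<bar>x\<bar> ^ j * cmod (iter_deriv k f x) \<le> C1" using schwartz_bound_power f by blast
    have "\<bar>x\<bar> ^ j * cmod (L (iter_deriv k f x)) \<le> C1 * M" for x
      using mult_left_mono[OF M(1)[of "iter_deriv k f x"], of "\<bar>x\<bar> ^ j"] mult_right_mono[OF C1[of x] M(2)]
      by (simp add: mult.assoc)
    then show ?thesis by blast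
  qed
  with schwartzI[OF c] show "(\<lambda>x. L (f x)) \<in> schwartz" by simp
  show "iter_deriv k (\<lambda>x. L (f x)) = (\<lambda>x. L (iter_deriv k f x))" using iter_deriv_chain[OF c] by simp
qed

lemmas schwartz_cmult = schwartz_linear_map[OF _ bounded_linear_mult_right]
lemmas schwartz_cnj = schwartz_linear_map[OF _ bounded_linear_cnj]

lemma schwartz_diff: "f \<in> schwartz \<Longrightarrow> g \<in> schwartz \<Longrightarrow> (\<lambda>x. f x - g x) \<in> schwartz"
  using schwartz_add[OF _ schwartz_cmult(1)[of g "-1"], of f] by simp

lemma iter_deriv_diff:
  assumes "f \<in> schwartz" "g \<in> schwartz"
  shows "iter_deriv k (\<lambda>x. f x - g x) = (\<lambda>x. iter_deriv k f x - iter_deriv k g x)"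
proof -
  have "deriv_chain (\<lambda>k x. iter_deriv k f x - iter_deriv k g x)"
    using assms by (auto simp: deriv_chain_def intro!: derivative_intros schwartz_deriv)
  from iter_deriv_chain[OF this] show ?thesis by simp
qed

lemma has_vector_derivative_reflect:
  fixes x :: real
  assumes f: "(f has_vector_derivative f') (at (- x))"
  shows "((\<lambda>x. f (- x)) has_vector_derivative - f') (at x)"
proof -
  have "(uminus has_vector_derivative -1) (at x)" by (auto intro!: derivative_eq_intros)
  from vector_diff_chain_at[OF this f] show ?thesis by (simp add: o_def)
qed

lemma schwartz_reflect: assumes f: "f \<in> schwartz" shows "(\<lambda>x. f (- x)) \<in> schwartz"
proof -
  have "((\<lambda>x. (-1) ^ k * iter_deriv k f (- x)) has_vector_derivative (-1) ^ Suc k * iter_deriv (Suc k) f (- x)) (at x)" for k x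
    using bounded_linear.has_vector_derivative[OF bounded_linear_mult_right[of "(-1) ^ k"] has_vector_derivative_reflect[OF schwartz_deriv[OF f, of k]], of x]
    by simp
  then have c: "deriv_chain (\<lambda>k x. (-1) ^ k * iter_deriv k f (- x))" by (simp add: deriv_chain_def)
  have "\<exists>C. \<forall>x. \<bar>x\<bar> ^ j * cmod ((-1) ^ k * iter_deriv k f (- x)) \<le> C" for j k
  proof -
    obtain C1 where "\<And>x. \<bar>x\<bar> ^ j * cmod (iter_deriv k f x) \<le> C1" using schwartz_bound_power f by blast
    from this[of "- x" for x] show ?thesis by (auto simp: norm_mult norm_power)
  qed
  from schwartzI[OF c this] show ?thesis by simp
qed

lemma schwartz_mult_id:
  assumes f: "f \<in> schwartz"
  shows "(\<lambda>x. of_real x * f x) \<in> schwartz"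
    and "iter_deriv k (\<lambda>x. of_real x * f x) = (\<lambda>x. of_real x * iter_deriv k f x + of_nat k * iter_deriv (k - 1) f x)"
proof -
  define D where "D k x = of_real x * iter_deriv k f x + of_nat k * iter_deriv (k - 1) f x" for k x
  have "(D k has_vector_derivative D (Suc k) x) (at x)" for k x
  proof (cases k)
    case 0
    then show ?thesis unfolding D_def
      by (auto intro!: derivative_eq_intros schwartz_deriv_0[OF f, unfolded One_nat_def])
  next
    case (Suc m)
    then show ?thesis unfolding D_def
      by (auto intro!: derivative_eq_intros schwartz_deriv f simp: algebra_simps)
  qed
  then have c: "deriv_chain D" by (simp add: deriv_chain_def)
  have "\<exists>C. \<forall>x. \<bar>x\<bar> ^ j * cmod (D k x) \<le> C" for j k
  proof -
    obtain C1 where C1: "\<And>x. \<bar>x\<bar> ^ Suc j * cmod (iter_deriv k f x) \<le> C1" using schwartz_bound_power f by blast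
    obtain C2 where C2: "\<And>x. \<bar>x\<bar> ^ j * cmod (iter_deriv (k - 1) f x) \<le> C2" using schwartz_bound_power f by blast
    have "\<bar>x\<bar> ^ j * cmod (D k x) \<le> C1 + of_nat k * C2" for x
    proof -
      have "\<bar>x\<bar> ^ j * cmod (D k x) \<le> \<bar>x\<bar> ^ j * (\<bar>x\<bar> * cmod (iter_deriv k f x) + real k * cmod (iter_deriv (k - 1) f x))"
        unfolding D_def by (intro mult_left_mono order_trans[OF norm_triangle_ineq]) (auto simp: norm_mult)
      also have "\<dots> = \<bar>x\<bar> ^ Suc j * cmod (iter_deriv k f x) + real k * (\<bar>x\<bar> ^ j * cmod (iter_deriv (k - 1) f x))"
        by (simp add: algebra_simps)
      also have "\<dots> \<le> C1 + of_nat k * C2" by (intro add_mono mult_left_mono C1 C2) auto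
      finally show ?thesis .
    qed
    then show ?thesis by blast
  qed
  from schwartzI[OF c this] show "(\<lambda>x. of_real x * f x) \<in> schwartz" by (simp add: D_def[abs_def])
  show "iter_deriv k (\<lambda>x. of_real x * f x) = (\<lambda>x. of_real x * iter_deriv k f x + of_nat k * iter_deriv (k - 1) f x)"
    using iter_deriv_chain[OF c, of k] by (simp add: D_def[abs_def])
qed

lemma schwartz_mult_power:
  assumes "f \<in> schwartz" shows "(\<lambda>x. (c * of_real x) ^ n * f x) \<in> schwartz"
proof (induction n)
  case (Suc n)
  from schwartz_cmult(1)[OF schwartz_mult_id(1)[OF this], of c] show ?case by (simp add: mult_ac)
qed (use assms in simp)

text \<open>A quadratic error bound passes through integrals and bounded functionals. Derivatives of such
  expressions are therefore computed from these bounds and not from limits of difference quotients.\<close>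

lemma has_vector_derivative_quadratic_error:
  fixes f :: "real \<Rightarrow> 'a::real_normed_vector"
  assumes d: "0 < d" and err: "\<And>y. \<bar>y - x\<bar> < d \<Longrightarrow> norm (f y - f x - (y - x) *\<^sub>R f') \<le> M * (y - x)\<^sup>2"
  shows "(f has_vector_derivative f') (at x)"
  unfolding has_vector_derivative_def has_derivative_at_alt
proof (intro conjI allI impI)
  fix e :: real assume e: "0 < e"
  show "\<exists>d>0. \<forall>y. norm (y - x) < d \<longrightarrow> norm (f y - f x - (y - x) *\<^sub>R f') \<le> e * norm (y - x)"
  proof (intro exI[of _ "min d (e / (\<bar>M\<bar> + 1))"] conjI allI impI)
    fix y assume y: "norm (y - x) < min d (e / (\<bar>M\<bar> + 1))"
    then have "norm (f y - f x - (y - x) *\<^sub>R f') \<le> M * (y - x)\<^sup>2" by (intro err) auto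
    also have "\<dots> \<le> (\<bar>M\<bar> + 1) * (y - x)\<^sup>2" by (intro mult_right_mono) auto
    also have "\<dots> = (\<bar>M\<bar> + 1) * \<bar>y - x\<bar> * \<bar>y - x\<bar>" by (simp add: power2_eq_square)
    also have "\<dots> \<le> (\<bar>M\<bar> + 1) * (e / (\<bar>M\<bar> + 1)) * \<bar>y - x\<bar>"
      using y by (intro mult_right_mono mult_left_mono) auto
    finally show "norm (f y - f x - (y - x) *\<^sub>R f') \<le> e * norm (y - x)" by simp
  qed (use d e in auto)
qed (intro bounded_linear_scaleR_left)

lemma taylor_quadratic_bound:
  fixes f :: "real \<Rightarrow> 'a::real_normed_vector"
  assumes f: "\<And>x. (f has_vector_derivative f' x) (at x)" and f': "\<And>x. (f' has_vector_derivative f'' x) (at x)"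
    and M: "\<And>x. norm (f'' x) \<le> M"
  shows "norm (f y - f x - (y - x) *\<^sub>R f' x) \<le> M * (y - x)\<^sup>2"
proof -
  have M0: "0 \<le> M" using order_trans[OF norm_ge_zero M] .
  have lip: "norm (f' z - f' x) \<le> M * \<bar>z - x\<bar>" for z
  proof -
    have "norm (f' z - f' x) \<le> M * norm (z - x)"
    proof (rule differentiable_bound[of UNIV f' "\<lambda>x h. h *\<^sub>R f'' x"])
      show "onorm (\<lambda>h. h *\<^sub>R f'' u) \<le> M" for u
        by (intro onorm_le) (simp add: mult.commute[of M] mult_left_mono[OF M])
    qed (use f' in \<open>auto simp: has_vector_derivative_def\<close>)
    then show ?thesis by simp
  qed
  have "norm (f y - f x - (y - x) *\<^sub>R f' x) \<le> norm (y - x) * (M * \<bar>y - x\<bar>)"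
  proof (rule vector_differentiable_bound_linearization[where S = "closed_segment x y"])
    show "norm (f' z - f' x) \<le> M * \<bar>y - x\<bar>" if "z \<in> closed_segment x y" for z
    proof -
      have "\<bar>z - x\<bar> \<le> \<bar>y - x\<bar>" using that by (auto simp: closed_segment_eq_real_ivl split: if_splits)
      then show ?thesis using lip[of z] M0 mult_left_mono by (meson order_trans)
    qed
  qed (simp_all add: has_vector_derivative_at_within[OF f])
  then show ?thesis by (simp add: power2_eq_square mult_ac)
qed

text \<open>Differentiation under the integral sign. The second derivative bounds the error of the linear
  approximation, uniformly enough to be integrated. The weight \<open>w\<close> allows for integrals over
  subsets.\<close>

lemma deriv_chain_integral:
  fixes D :: "nat \<Rightarrow> real \<Rightarrow> real \<Rightarrow> complex"
  assumes chain: "\<And>x. deriv_chain (\<lambda>k. D k x)"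
    and meas: "\<And>k t. (\<lambda>x. D k x t) \<in> borel_measurable borel"
    and bound: "\<And>k x t. cmod (D k x t) \<le> C k * g x"
    and g: "integrable lborel g" 
    and w: "w \<in> borel_measurable borel" "\<And>x. cmod (w x) \<le> 1"
  shows "deriv_chain (\<lambda>k t. \<integral>x. w x * D k x t \<partial>lborel)"
  unfolding deriv_chain_def
proof (intro allI)
  fix k t
  note [measurable] = meas w(1)
  have int: "integrable lborel (\<lambda>x. w x * D k x t)" for k t
  proof (rule Bochner_Integration.integrable_bound)
    show "integrable lborel (\<lambda>x. C k * g x)" using g by simp
    have "norm (w x * D k x t) \<le> norm (C k * g x)" for x
      using mult_mono[OF w(2)[of x] bound[of k x t]] abs_ge_self[of "C k * g x"] by (simp add: norm_mult)
    then show "AE x in lborel. norm (w x * D k x t) \<le> norm (C k * g x)" by simp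
  qed measurable
  show "((\<lambda>t. \<integral>x. w x * D k x t \<partial>lborel) has_vector_derivative (\<integral>x. w x * D (Suc k) x t \<partial>lborel)) (at t)"
  proof (rule has_vector_derivative_quadratic_error[of 1])
    fix s
    have "cmod ((\<integral>x. w x * D k x s \<partial>lborel) - (\<integral>x. w x * D k x t \<partial>lborel) - (s - t) *\<^sub>R (\<integral>x. w x * D (Suc k) x t \<partial>lborel))
      = cmod (\<integral>x. w x * (D k x s - D k x t - (s - t) *\<^sub>R D (Suc k) x t) \<partial>lborel)"
    proof -
      have "(\<integral>x. w x * (D k x s - D k x t - (s - t) *\<^sub>R D (Suc k) x t) \<partial>lborel)
        = (\<integral>x. (w x * D k x s - w x * D k x t) - (s - t) *\<^sub>R (w x * D (Suc k) x t) \<partial>lborel)"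
        by (simp add: right_diff_distrib)
      also have "\<dots> = (\<integral>x. w x * D k x s \<partial>lborel) - (\<integral>x. w x * D k x t \<partial>lborel) - (s - t) *\<^sub>R (\<integral>x. w x * D (Suc k) x t \<partial>lborel)"
        using int by (simp del: scaleR_right_diff_distrib)
      finally show ?thesis by simp
    qed
    also have "\<dots> \<le> (\<integral>x. C (Suc (Suc k)) * g x * (s - t)\<^sup>2 \<partial>lborel)"
    proof (rule order_trans[OF integral_norm_bound integral_mono])
      show "integrable lborel (\<lambda>x. C (Suc (Suc k)) * g x * (s - t)\<^sup>2)" using g by simp
      show "integrable lborel (\<lambda>x. cmod (w x * (D k x s - D k x t - (s - t) *\<^sub>R D (Suc k) x t)))"
        using int[of k s] int[of k t] int[of "Suc k" t] by (intro integrable_norm) (simp add: right_diff_distrib)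
      fix x
      have "cmod (D k x s - D k x t - (s - t) *\<^sub>R D (Suc k) x t) \<le> C (Suc (Suc k)) * g x * (s - t)\<^sup>2"
        by (rule taylor_quadratic_bound[OF deriv_chainD[OF chain] deriv_chainD[OF chain] bound])
      then have "cmod (w x) * cmod (D k x s - D k x t - (s - t) *\<^sub>R D (Suc k) x t) \<le> 1 * (C (Suc (Suc k)) * g x * (s - t)\<^sup>2)"
        using w(2) by (intro mult_mono) auto
      then show "norm (w x * (D k x s - D k x t - (s - t) *\<^sub>R D (Suc k) x t)) \<le> C (Suc (Suc k)) * g x * (s - t)\<^sup>2"
        by (simp add: norm_mult)
    qed
    finally show "norm ((\<integral>x. w x * D k x s \<partial>lborel) - (\<integral>x. w x * D k x t \<partial>lborel) - (s - t) *\<^sub>R (\<integral>x. w x * D (Suc k) x t \<partial>lborel))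
       \<le> (C (Suc (Suc k)) * (\<integral>x. g x \<partial>lborel)) * (s - t)\<^sup>2"
      by (simp add: mult_ac)
  qed simp
qed

section \<open>The Fourier transform of Schwartz functions\<close>

lemma integral_vector_derivative_eq_0:
  fixes F :: "real \<Rightarrow> complex"
  assumes F: "\<And>x. (F has_vector_derivative f x) (at x)" and cont: "continuous_on UNIV f"
    and f: "integrable lborel f" and lim: "(F \<longlongrightarrow> 0) at_top" "(F \<longlongrightarrow> 0) at_bot"
  shows "(\<integral>x. f x \<partial>lborel) = 0"
proof -
  have [measurable]: "f \<in> borel_measurable borel" using f by auto
  have 1: "(\<lambda>n. \<integral>x. indicator {- real n..real n} x *\<^sub>R f x \<partial>lborel) \<longlonglongrightarrow> (\<integral>x. f x \<partial>lborel)"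
  proof (rule integral_dominated_convergence[where w = "\<lambda>x. norm (f x)"])
    have "eventually (\<lambda>n. indicator {- real n..real n} x *\<^sub>R f x = f x) sequentially" for x
    proof -
      have "eventually (\<lambda>n. \<bar>x\<bar> \<le> real n) sequentially" by real_asymp
      then show ?thesis by eventually_elim (auto simp: indicator_def)
    qed
    then show "AE x in lborel. (\<lambda>n. indicator {- real n..real n} x *\<^sub>R f x) \<longlonglongrightarrow> f x"
      by (intro AE_I2 tendsto_eventually)
  qed (use f in \<open>auto simp: indicator_def\<close>)
  have "(\<integral>x. indicator {- real n..real n} x *\<^sub>R f x \<partial>lborel) = F (real n) - F (- real n)" for n
    by (rule integral_FTC_atLeastAtMost) (auto intro: has_vector_derivative_at_within F continuous_on_subset[OF cont])
  moreover have "(\<lambda>n. F (real n) - F (- real n)) \<longlonglongrightarrow> 0 - 0"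
    by (intro tendsto_diff filterlim_compose[OF lim(1)] filterlim_compose[OF lim(2)]) real_asymp+
  ultimately show ?thesis using 1 LIMSEQ_unique by fastforce
qed

lemma has_vector_derivative_cis_linear:
  "((\<lambda>x. cis (- (x * c))) has_vector_derivative - \<i> * of_real c * cis (- (x * c))) (at x)" for c x :: real
proof -
  have "((\<lambda>x. cis (- (x * c))) has_derivative (\<lambda>t. (- (t * c)) *\<^sub>R (\<i> * cis (- (x * c))))) (at x)"
    by (intro derivative_eq_intros) auto
  then show ?thesis
    by (simp add: has_vector_derivative_def scaleR_conv_of_real mult_ac)
qed

text \<open>The product of \<open>h\<close> with the exponential has a derivative of integral zero; this is integration by
  parts.\<close>

lemma fourier_of_derivative:
  fixes h h' :: "real \<Rightarrow> complex"
  assumes d: "\<And>x. (h has_vector_derivative h' x) (at x)" and c: "continuous_on UNIV h'"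
    and lim: "(h \<longlongrightarrow> 0) at_top" "(h \<longlongrightarrow> 0) at_bot" and i: "integrable lborel h" "integrable lborel h'"
  shows "fourier h' \<xi> = \<i> * of_real \<xi> * fourier h \<xi>"
proof -
  have i1: "integrable lborel (\<lambda>x. h x * cis (- (x * \<xi>)))" and i2: "integrable lborel (\<lambda>x. h' x * cis (- (x * \<xi>)))"
    using i by auto
  have cont: "continuous_on UNIV h"
    by (intro continuous_at_imp_continuous_on ballI has_vector_derivative_continuous[OF d])
  have "(\<integral>x. h x * (- \<i> * of_real \<xi> * cis (- (x * \<xi>))) + h' x * cis (- (x * \<xi>)) \<partial>lborel) = 0"
  proof (rule integral_vector_derivative_eq_0)
    show "((\<lambda>x. h x * cis (- (x * \<xi>))) has_vector_derivative h x * (- \<i> * of_real \<xi> * cis (- (x * \<xi>))) + h' x * cis (- (x * \<xi>))) (at x)" for x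
      by (intro has_vector_derivative_mult d has_vector_derivative_cis_linear)
    show "continuous_on UNIV (\<lambda>x. h x * (- \<i> * of_real \<xi> * cis (- (x * \<xi>))) + h' x * cis (- (x * \<xi>)))"
      by (intro continuous_intros c cont)
    show "integrable lborel (\<lambda>x. h x * (- \<i> * of_real \<xi> * cis (- (x * \<xi>))) + h' x * cis (- (x * \<xi>)))"
      using integrable_mult_right[OF i1, of "- \<i> * of_real \<xi>"] i2 by (auto simp: mult_ac)
    show "((\<lambda>x. h x * cis (- (x * \<xi>))) \<longlongrightarrow> 0) at_top" "((\<lambda>x. h x * cis (- (x * \<xi>))) \<longlongrightarrow> 0) at_bot"
      by (rule tendsto_norm_zero_cancel, use tendsto_norm_zero[OF lim(1)] tendsto_norm_zero[OF lim(2)] in \<open>simp add: norm_mult\<close>)+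
  qed
  then show ?thesis
    using integrable_mult_right[OF i1, of "- \<i> * of_real \<xi>"] i2
    by (simp add: fourier_def mult_ac eq_neg_iff_add_eq_0 add.commute flip: integral_mult_right_zero)
qed

lemma schwartz_tendsto_0:
  assumes "f \<in> schwartz" shows "(f \<longlongrightarrow> 0) at_top" "(f \<longlongrightarrow> 0) at_bot"
proof -
  obtain C where C: "0 \<le> C" "\<And>x. cmod (f x) \<le> C * (1 / (1 + x\<^sup>2))" using schwartz_decay[OF assms] by blast
  show "(f \<longlongrightarrow> 0) at_top" by (rule Lim_null_comparison[OF always_eventually[rule_format, OF C(2)]]) real_asymp
  show "(f \<longlongrightarrow> 0) at_bot" by (rule Lim_null_comparison[OF always_eventually[rule_format, OF C(2)]]) real_asymp
qed

lemma fourier_deriv: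
  assumes f: "f \<in> schwartz"
  shows "fourier (iter_deriv 1 f) \<xi> = \<i> * of_real \<xi> * fourier f \<xi>"
proof -
  have d: "iter_deriv 1 f \<in> schwartz" by (rule schwartz_iter_deriv[OF f])
  have "continuous_on UNIV (iter_deriv 1 f)" by (intro continuous_at_imp_continuous_on ballI schwartz_isCont d)
  from fourier_of_derivative[OF schwartz_deriv_0[OF f] this schwartz_tendsto_0[OF f] schwartz_integrable[OF f] schwartz_integrable[OF d]]
  show ?thesis .
qed

lemma fourier_iter_deriv:
  assumes f: "f \<in> schwartz"
  shows "fourier (iter_deriv k f) \<xi> = (\<i> * of_real \<xi>) ^ k * fourier f \<xi>"
proof (induction k)
  case (Suc k)
  have "iter_deriv (Suc k) f = iter_deriv 1 (iter_deriv k f)" by (simp add: iter_deriv_add)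
  then show ?case using fourier_deriv[OF schwartz_iter_deriv[OF f, of k]] Suc by simp
qed simp

text \<open>Differentiation in the frequency multiplies the integrand by \<open>- \<i> x\<close>.\<close>

lemma fourier_chain:
  assumes f: "f \<in> schwartz"
  shows "deriv_chain (\<lambda>k. fourier (\<lambda>x. (- \<i> * of_real x) ^ k * f x))"
proof -
  define D where "D k x t = (- \<i> * of_real x) ^ k * f x * cis (- (x * t))" for k x t
  have "\<exists>C. \<forall>x t. cmod (D k x t) \<le> C * (1 / (1 + x\<^sup>2))" for k
  proof -
    obtain C where "\<And>x. cmod ((- \<i> * of_real x) ^ k * f x) \<le> C * (1 / (1 + x\<^sup>2))"
      using schwartz_decay[OF schwartz_mult_power[OF f]] by blast
    then show ?thesis by (intro exI[of _ C]) (simp add: D_def norm_mult)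
  qed
  then obtain C where C: "\<And>k x t. cmod (D k x t) \<le> C k * (1 / (1 + x\<^sup>2))" by metis
  have "deriv_chain (\<lambda>k t. \<integral>x. 1 * D k x t \<partial>lborel)"
  proof (rule deriv_chain_integral[OF _ _ C integrable_inverse_quadratic])
    show "deriv_chain (\<lambda>k. D k x)" for x
    proof -
      have "((\<lambda>t. ((- \<i> * of_real x) ^ k * f x) * cis (- (t * x))) has_vector_derivative
          ((- \<i> * of_real x) ^ k * f x) * (- \<i> * of_real x * cis (- (t * x)))) (at t)" for k t
        by (rule bounded_linear.has_vector_derivative[OF bounded_linear_mult_right has_vector_derivative_cis_linear])
      then show ?thesis by (simp add: deriv_chain_def D_def[abs_def] mult_ac)
    qed
    show "(\<lambda>x. D k x t) \<in> borel_measurable borel" for k t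
      unfolding D_def using schwartz_measurable[OF f] by measurable
  qed auto
  then show ?thesis by (simp add: D_def fourier_def[abs_def])
qed

lemma iter_deriv_fourier:
  assumes f: "f \<in> schwartz"
  shows "iter_deriv k (fourier f) = fourier (\<lambda>x. (- \<i> * of_real x) ^ k * f x)"
  using iter_deriv_chain[OF fourier_chain[OF f], of k] by simp

lemma fourier_weighted:
  assumes f: "f \<in> schwartz"
  shows "\<bar>\<xi>\<bar> ^ j * cmod (iter_deriv k (fourier f) \<xi>) = cmod (fourier (iter_deriv j (\<lambda>x. (- \<i> * of_real x) ^ k * f x)) \<xi>)"
  unfolding iter_deriv_fourier[OF f] fourier_iter_deriv[OF schwartz_mult_power[OF f]]
  by (simp add: norm_mult norm_power)

lemma schwartz_fourier: assumes f: "f \<in> schwartz" shows "fourier f \<in> schwartz"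
proof -
  have "\<exists>C. \<forall>x. \<bar>x\<bar> ^ j * cmod (fourier (\<lambda>x. (- \<i> * of_real x) ^ k * f x) x) \<le> C" for j k
    unfolding fourier_weighted[OF f, of _ j k, unfolded iter_deriv_fourier[OF f]] using cmod_fourier_le by blast
  from schwartzI[OF fourier_chain[OF f] this] show ?thesis by simp
qed

lemma schwartz_fourier_inversion:
  fixes f :: "real \<Rightarrow> complex"
  assumes f: "f \<in> schwartz" shows "fourier (fourier f) x = 2 * pi * f (- x)"
proof -
  obtain C where "\<And>x. cmod (f x) \<le> C" using schwartz_bounded[OF f] by blast
  from fourier_inversion[OF schwartz_integrable[OF f] this schwartz_integrable[OF schwartz_fourier[OF f]] schwartz_isCont[OF f], of "- x"]
  show ?thesis by simp
qed

lemma schwartz_fourier_surj: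
  fixes f :: "real \<Rightarrow> complex"
  assumes f: "f \<in> schwartz"
  defines "q \<equiv> \<lambda>\<eta>. 1 / (2 * pi) * fourier f (- \<eta>)"
  shows "q \<in> schwartz" "fourier q = f"
proof -
  show "q \<in> schwartz" unfolding q_def by (intro schwartz_cmult(1) schwartz_reflect schwartz_fourier f)
  have "fourier q x = 1 / (2 * pi) * fourier (fourier f) (- x)" for x
  proof -
    have "fourier q x = (\<integral>\<eta>. 1 / (2 * pi) * (fourier f (- \<eta>) * cis (- (\<eta> * x))) \<partial>lborel)"
      unfolding fourier_def[of q] by (intro Bochner_Integration.integral_cong) (simp_all add: q_def)
    also have "\<dots> = 1 / (2 * pi) * (\<integral>\<eta>. fourier f (- \<eta>) * cis (- (\<eta> * x)) \<partial>lborel)"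
      by (rule integral_mult_right_zero)
    also have "(\<integral>\<eta>. fourier f (- \<eta>) * cis (- (\<eta> * x)) \<partial>lborel) = fourier (fourier f) (- x)"
      by (subst lborel_integral_real_affine[where c = "-1" and t = 0]) (auto simp: fourier_def[of "fourier f"])
    finally show ?thesis .
  qed
  then show "fourier q = f" using schwartz_fourier_inversion[OF f] by auto
qed

text \<open>A quadratically decaying second derivative yields the factor \<open>\<xi>\<^sup>2\<close>.\<close>

lemma fourier_quadratic_decay:
  assumes f: "f \<in> schwartz"
    and b: "\<And>x. cmod (f x) \<le> M * (1 / (1 + x\<^sup>2))" "\<And>x. cmod (iter_deriv 2 f x) \<le> M * (1 / (1 + x\<^sup>2))"
  shows "cmod (fourier f \<xi>) \<le> 2 * pi * M * (1 / (1 + \<xi>\<^sup>2))"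
proof -
  have "(1 + \<xi>\<^sup>2) * cmod (fourier f \<xi>) = cmod (fourier f \<xi>) + cmod (fourier (iter_deriv 2 f) \<xi>)"
    by (simp add: fourier_iter_deriv[OF f] norm_mult norm_power distrib_right)
  also have "\<dots> \<le> M * pi + M * pi"
    by (intro add_mono order_trans[OF cmod_fourier_le] integral_quadratic_decay schwartz_measurable f b schwartz_iter_deriv)
  finally show ?thesis by (simp add: field_simps add_pos_nonneg)
qed

section \<open>Tempered distributions\<close>

lemma le_schwartz_seminorm: "f \<in> schwartz \<Longrightarrow> cmod (of_real (x ^ j) * iter_deriv k f x) \<le> schwartz_seminorm j k f"
  unfolding schwartz_seminorm_def by (rule cSUP_upper) (auto simp: schwartz_def bdd_above_def)

lemma temperedD:
  assumes "u \<in> tempered_distributions"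
  shows "f \<in> schwartz \<Longrightarrow> g \<in> schwartz \<Longrightarrow> u (\<lambda>x. f x + g x) = u f + u g"
    and "f \<in> schwartz \<Longrightarrow> u (\<lambda>x. c * f x) = c * u f"
    and "f \<notin> schwartz \<Longrightarrow> u f = 0"
  using assms by (auto simp: tempered_distributions_def)

lemma tempered_diff:
  assumes u: "u \<in> tempered_distributions" and f: "f \<in> schwartz" "g \<in> schwartz"
  shows "u (\<lambda>x. f x - g x) = u f - u g"
  using temperedD(1)[OF u f(1) schwartz_cmult(1)[OF f(2), of "-1"]] temperedD(2)[OF u f(2), of "-1"] by simp

lemma le_double_sum:
  fixes C :: "nat \<Rightarrow> nat \<Rightarrow> real"
  assumes "\<And>j k. 0 \<le> C j k" "j \<le> N" "k \<le> N"
  shows "C j k \<le> (\<Sum>j\<le>N. \<Sum>k\<le>N. C j k)"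
proof -
  have "C j k \<le> (\<Sum>k\<le>N. C j k)" using assms by (intro member_le_sum) auto
  also have "\<dots> \<le> (\<Sum>j\<le>N. \<Sum>k\<le>N. C j k)"
    using assms by (intro member_le_sum[of j _ "\<lambda>j. \<Sum>k\<le>N. C j k"] sum_nonneg) auto
  finally show ?thesis .
qed

text \<open>One common bound for all seminorms of order at most \<open>N\<close>. Unlike the sum of the seminorms it can be
  established pointwise, without reference to suprema.\<close>

definition schwartz_bounded_by :: "nat \<Rightarrow> (real \<Rightarrow> complex) \<Rightarrow> real \<Rightarrow> bool" where
  "schwartz_bounded_by N f M \<longleftrightarrow> (\<forall>j\<le>N. \<forall>k\<le>N. \<forall>x. \<bar>x\<bar> ^ j * cmod (iter_deriv k f x) \<le> M)"

lemma tempered_bound: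
  assumes u: "u \<in> tempered_distributions"
  obtains C N where "0 \<le> C" "\<And>f M. f \<in> schwartz \<Longrightarrow> schwartz_bounded_by N f M \<Longrightarrow> cmod (u f) \<le> C * M"
proof -
  obtain C N where C: "\<And>f. f \<in> schwartz \<Longrightarrow> cmod (u f) \<le> C * (\<Sum>j\<le>N. \<Sum>k\<le>N. schwartz_seminorm j k f)"
    using u unfolding tempered_distributions_def by blast
  have "cmod (u f) \<le> \<bar>C\<bar> * (real (Suc N) * real (Suc N)) * M" if f: "f \<in> schwartz" and M: "schwartz_bounded_by N f M" for f M
  proof -
    have le: "schwartz_seminorm j k f \<le> M" if "j \<le> N" "k \<le> N" for j k
      unfolding schwartz_seminorm_def using M that
      by (intro cSUP_least) (auto simp: schwartz_bounded_by_def norm_mult norm_power)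
    have ge: "0 \<le> schwartz_seminorm j k f" for j k
      by (rule order_trans[OF norm_ge_zero le_schwartz_seminorm[OF f]])
    have "cmod (u f) \<le> \<bar>C\<bar> * (\<Sum>j\<le>N. \<Sum>k\<le>N. schwartz_seminorm j k f)"
      by (rule order_trans[OF C[OF f]]) (intro mult_right_mono sum_nonneg ge, simp)
    also have "(\<Sum>j\<le>N. \<Sum>k\<le>N. schwartz_seminorm j k f) \<le> (\<Sum>j\<le>N. \<Sum>k\<le>N. M)"
      by (intro sum_mono le) auto
    also have "\<dots> = real (Suc N) * real (Suc N) * M" by simp
    finally show ?thesis by (simp add: mult_left_mono mult.assoc)
  qed
  then show ?thesis by (rule that[rotated]) auto
qed

lemma temperedI:
  assumes "\<And>f. f \<notin> schwartz \<Longrightarrow> u f = 0"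
    and "\<And>f g. f \<in> schwartz \<Longrightarrow> g \<in> schwartz \<Longrightarrow> u (\<lambda>x. f x + g x) = u f + u g"
    and "\<And>c f. f \<in> schwartz \<Longrightarrow> u (\<lambda>x. c * f x) = c * u f"
    and b: "\<And>f M. f \<in> schwartz \<Longrightarrow> schwartz_bounded_by N f M \<Longrightarrow> cmod (u f) \<le> C * M"
  shows "u \<in> tempered_distributions"
proof -
  have "cmod (u f) \<le> C * (\<Sum>j\<le>N. \<Sum>k\<le>N. schwartz_seminorm j k f)" if f: "f \<in> schwartz" for f
  proof (rule b[OF f])
    have ge: "0 \<le> schwartz_seminorm j k f" for j k
      by (rule order_trans[OF norm_ge_zero le_schwartz_seminorm[OF f]])
    show "schwartz_bounded_by N f (\<Sum>j\<le>N. \<Sum>k\<le>N. schwartz_seminorm j k f)"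
      unfolding schwartz_bounded_by_def
    proof (intro allI impI)
      fix j k x assume jk: "j \<le> N" "k \<le> N"
      have "\<bar>x\<bar> ^ j * cmod (iter_deriv k f x) \<le> schwartz_seminorm j k f"
        using le_schwartz_seminorm[OF f, of x j k] by (simp add: norm_mult norm_power)
      also have "\<dots> \<le> (\<Sum>j\<le>N. \<Sum>k\<le>N. schwartz_seminorm j k f)" by (rule le_double_sum[OF ge jk])
      finally show "\<bar>x\<bar> ^ j * cmod (iter_deriv k f x) \<le> (\<Sum>j\<le>N. \<Sum>k\<le>N. schwartz_seminorm j k f)" .
    qed
  qed
  with assms(1-3) show ?thesis unfolding tempered_distributions_def by blast
qed

lemma schwartz_bounded_by_iter_deriv:
  assumes "schwartz_bounded_by (N + j) f M"
  shows "schwartz_bounded_by N (iter_deriv j f) M"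
  using assms by (auto simp: schwartz_bounded_by_def iter_deriv_add)

text \<open>Each multiplication with \<open>x\<close> costs one order of the seminorms and a factor from the product rule.\<close>

lemma schwartz_bounded_by_mult_power:
  assumes f: "f \<in> schwartz"
  shows "schwartz_bounded_by (N + n) f M \<Longrightarrow> schwartz_bounded_by N (\<lambda>x. (- \<i> * of_real x) ^ n * f x) ((\<Prod>i<n. real (N + i + 1)) * M)"
proof (induction n arbitrary: N)
  case (Suc n)
  define g where "g x = (- \<i> * of_real x) ^ n * f x" for x
  define c where "c = (\<Prod>i<n. real (Suc N + i + 1)) * M"
  have g: "g \<in> schwartz" unfolding g_def by (rule schwartz_mult_power[OF f])
  have b: "schwartz_bounded_by (Suc N) g c"
    using Suc.IH[of "Suc N"] Suc.prems by (simp add: g_def[abs_def] c_def)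
  have "0 \<le> \<bar>0\<bar> ^ 0 * cmod (iter_deriv 0 g 0)" by simp
  also have "\<dots> \<le> c" using b unfolding schwartz_bounded_by_def by blast
  finally have c0: "0 \<le> c" .
  have fun_eq: "(\<lambda>x. (- \<i> * of_real x) ^ Suc n * f x) = (\<lambda>x. - \<i> * (of_real x * g x))"
    by (simp add: g_def mult_ac)
  have "schwartz_bounded_by N (\<lambda>x. - \<i> * (of_real x * g x)) (real (N + 1) * c)"
    unfolding schwartz_bounded_by_def
  proof (intro allI impI)
    fix j k x assume jk: "j \<le> N" "k \<le> N"
    have "cmod (iter_deriv k (\<lambda>x. - \<i> * (of_real x * g x)) x) = cmod (of_real x * iter_deriv k g x + of_nat k * iter_deriv (k - 1) g x)"
      unfolding schwartz_cmult(2)[OF schwartz_mult_id(1)[OF g]] schwartz_mult_id(2)[OF g] by (simp add: norm_mult)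
    also have "\<dots> \<le> \<bar>x\<bar> * cmod (iter_deriv k g x) + real k * cmod (iter_deriv (k - 1) g x)"
      by (rule order_trans[OF norm_triangle_ineq]) (simp add: norm_mult)
    finally have "\<bar>x\<bar> ^ j * cmod (iter_deriv k (\<lambda>x. - \<i> * (of_real x * g x)) x)
       \<le> \<bar>x\<bar> ^ j * (\<bar>x\<bar> * cmod (iter_deriv k g x) + real k * cmod (iter_deriv (k - 1) g x))"
      by (intro mult_left_mono) auto
    also have "\<dots> = \<bar>x\<bar> ^ Suc j * cmod (iter_deriv k g x) + real k * (\<bar>x\<bar> ^ j * cmod (iter_deriv (k - 1) g x))"
      by (simp add: algebra_simps)
    also have "\<dots> \<le> c + real N * c"
      using b jk c0 unfolding schwartz_bounded_by_def by (intro add_mono mult_mono) auto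
    finally show "\<bar>x\<bar> ^ j * cmod (iter_deriv k (\<lambda>x. - \<i> * (of_real x * g x)) x) \<le> real (N + 1) * c"
      by (simp add: algebra_simps)
  qed
  moreover have "real (N + 1) * c = (\<Prod>i<Suc n. real (N + i + 1)) * M"
    by (simp add: c_def prod.lessThan_Suc_shift del: prod.lessThan_Suc)
  ultimately show ?case unfolding fun_eq by simp
qed simp

lemma schwartz_bounded_by_mono: "schwartz_bounded_by N f M \<Longrightarrow> N' \<le> N \<Longrightarrow> schwartz_bounded_by N' f M"
  by (auto simp: schwartz_bounded_by_def)

lemma schwartz_bounded_by_decay:
  assumes "schwartz_bounded_by 2 f M"
  shows "cmod (f x) \<le> 2 * M * (1 / (1 + x\<^sup>2))"
proof -
  have b: "\<bar>x\<bar> ^ j * cmod (iter_deriv 0 f x) \<le> M" if "j \<le> 2" for j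
    using assms that unfolding schwartz_bounded_by_def by blast
  have "(1 + x\<^sup>2) * cmod (f x) \<le> 2 * M" using b[of 0] b[of 2] by (simp add: distrib_right)
  then show ?thesis by (simp add: field_simps add_pos_nonneg)
qed

text \<open>The Fourier transform exchanges multiplication and differentiation, so that the seminorms of the
  transform are \<open>L\<^sup>1\<close> norms of derivatives of polynomial multiples of \<open>f\<close>. The two additional orders
  pay for the integrability.\<close>

lemma fourier_bounded_by:
  "\<exists>c. \<forall>f M. f \<in> schwartz \<longrightarrow> schwartz_bounded_by (2 * N + 2) f M \<longrightarrow> schwartz_bounded_by N (fourier f) (c * M)"
proof -
  define p where "p n = (\<Prod>i<n. real (N + 2 + i + 1))" for n
  define P where "P = (\<Sum>n\<le>N. p n)"
  have p: "0 \<le> p n" for n unfolding p_def by (intro prod_nonneg) auto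
  have pP: "p n \<le> P" if "n \<le> N" for n unfolding P_def using that p by (intro member_le_sum) auto
  have "schwartz_bounded_by N (fourier f) (2 * pi * P * M)" if f: "f \<in> schwartz" and M: "schwartz_bounded_by (2 * N + 2) f M" for f M
    unfolding schwartz_bounded_by_def
  proof (intro allI impI)
    fix j k x assume jk: "j \<le> N" "k \<le> N"
    have "0 \<le> \<bar>0\<bar> ^ 0 * cmod (iter_deriv 0 f 0)" by simp
    also have "\<dots> \<le> M" using M unfolding schwartz_bounded_by_def by blast
    finally have M0: "0 \<le> M" .
    define g where "g x = (- \<i> * of_real x) ^ k * f x" for x
    have g: "g \<in> schwartz" unfolding g_def by (rule schwartz_mult_power[OF f])
    have "schwartz_bounded_by (N + 2) g (p k * M)"
      unfolding g_def p_def by (rule schwartz_bounded_by_mult_power[OF f schwartz_bounded_by_mono[OF M]]) (use jk in simp)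
    from schwartz_bounded_by_mono[OF this, of "2 + j"]
    have "schwartz_bounded_by 2 (iter_deriv j g) (p k * M)"
      using jk by (intro schwartz_bounded_by_iter_deriv) simp
    from schwartz_bounded_by_decay[OF this]
    have "(\<integral>x. cmod (iter_deriv j g x) \<partial>lborel) \<le> 2 * (p k * M) * pi"
      by (rule integral_quadratic_decay[OF schwartz_measurable[OF schwartz_iter_deriv[OF g]]])
    also have "\<dots> \<le> 2 * (P * M) * pi" using pP[OF jk(2)] M0 by (intro mult_right_mono mult_left_mono) auto
    finally have *: "(\<integral>x. cmod (iter_deriv j g x) \<partial>lborel) \<le> 2 * pi * P * M" by (simp add: mult_ac)
    show "\<bar>x\<bar> ^ j * cmod (iter_deriv k (fourier f) x) \<le> 2 * pi * P * M"
      unfolding fourier_weighted[OF f] g_def[abs_def, symmetric] by (rule order_trans[OF cmod_fourier_le *])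
  qed
  then show ?thesis by blast
qed

lemma fourier_add:
  assumes "integrable lborel f" "integrable lborel g"
  shows "fourier (\<lambda>x. f x + g x) = (\<lambda>\<xi>. fourier f \<xi> + fourier g \<xi>)"
  unfolding fourier_def using assms by (simp add: fun_eq_iff distrib_right fourier_integrand_integrable)

lemma fourier_cmult: "fourier (\<lambda>x. c * f x) = (\<lambda>\<xi>. c * fourier f \<xi>)"
  unfolding fourier_def by (simp add: mult.assoc)

lemma dist_fourier_tempered:
  assumes u: "u \<in> tempered_distributions" shows "dist_fourier u \<in> tempered_distributions"
proof -
  obtain C N where C: "0 \<le> C" "\<And>f M. f \<in> schwartz \<Longrightarrow> schwartz_bounded_by N f M \<Longrightarrow> cmod (u f) \<le> C * M"
    using tempered_bound[OF u] by blast
  obtain c where c: "\<And>f M. f \<in> schwartz \<Longrightarrow> schwartz_bounded_by (2 * N + 2) f M \<Longrightarrow> schwartz_bounded_by N (fourier f) (c * M)"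
    using fourier_bounded_by by blast
  show ?thesis
  proof (rule temperedI)
    show "dist_fourier u f = 0" if "f \<notin> schwartz" for f using that by (simp add: dist_fourier_def)
    show "dist_fourier u (\<lambda>x. f x + g x) = dist_fourier u f + dist_fourier u g" if "f \<in> schwartz" "g \<in> schwartz" for f g
      using that by (simp add: dist_fourier_def schwartz_add fourier_add schwartz_integrable temperedD(1)[OF u] schwartz_fourier)
    show "dist_fourier u (\<lambda>x. c * f x) = c * dist_fourier u f" if "f \<in> schwartz" for c f
      using that by (simp add: dist_fourier_def schwartz_cmult(1) fourier_cmult temperedD(2)[OF u] schwartz_fourier)
    show "cmod (dist_fourier u f) \<le> C * c * M" if f: "f \<in> schwartz" and M: "schwartz_bounded_by (2 * N + 2) f M" for f M
      using C(2)[OF schwartz_fourier[OF f] c[OF f M]] f by (simp add: dist_fourier_def mult.assoc)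
  qed
qed

section \<open>Families of test functions\<close>

text \<open>Families \<open>K x\<close> of test functions that depend on \<open>x\<close> in a locally Lipschitz way, in every Schwartz
  seminorm. A tempered distribution turns such a family into a continuous function of \<open>x\<close>.\<close>

definition lip_family :: "(real \<Rightarrow> real \<Rightarrow> complex) \<Rightarrow> bool" where
  "lip_family K \<longleftrightarrow> (\<forall>x. K x \<in> schwartz) \<and>
     (\<forall>j k R. \<exists>C. \<forall>x y t. \<bar>x\<bar> \<le> R \<longrightarrow> \<bar>y\<bar> \<le> R \<longrightarrow>
        \<bar>t\<bar> ^ j * cmod (iter_deriv k (K x) t - iter_deriv k (K y) t) \<le> C * \<bar>x - y\<bar>)"

text \<open>The weight is integrable in \<open>x\<close>, so that the family can be integrated in every Schwartz seminorm.\<close>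

definition dec_family :: "(real \<Rightarrow> real \<Rightarrow> complex) \<Rightarrow> bool" where
  "dec_family K \<longleftrightarrow> (\<forall>j k. \<exists>C. \<forall>x t. \<bar>t\<bar> ^ j * cmod (iter_deriv k (K x) t) \<le> C * (1 / (1 + x\<^sup>2)))"

text \<open>In a set of kernels that is closed under differentiation in the second variable, the iterated
  derivatives can be chosen uniformly in \<open>x\<close>.\<close>

lemma kernel_sequence:
  assumes K: "K \<in> X"
    and dt: "\<And>K. K \<in> X \<Longrightarrow> \<exists>K'\<in>X. \<forall>x t. (K x has_vector_derivative K' x t) (at t)"
  obtains Ks where "\<And>k. Ks k \<in> X" "\<And>k x. iter_deriv k (K x) = Ks k x" "\<And>x. deriv_chain (\<lambda>k. Ks k x)" "Ks 0 = K"
proof -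
  obtain d where d: "\<And>K. K \<in> X \<Longrightarrow> d K \<in> X" "\<And>K x t. K \<in> X \<Longrightarrow> (K x has_vector_derivative d K x t) (at t)"
    using dt by metis
  define Ks where "Ks k = (d ^^ k) K" for k
  have X: "Ks k \<in> X" for k by (induction k) (auto simp: Ks_def K d(1))
  have c: "deriv_chain (\<lambda>k. Ks k x)" for x
    using d(2)[OF X] by (simp add: deriv_chain_def Ks_def)
  have "iter_deriv k (K x) = Ks k x" for k x
    using iter_deriv_chain[OF c[of x], of k] by (simp add: Ks_def)
  with X c show ?thesis by (intro that[of Ks]) (auto simp: Ks_def)
qed

text \<open>It suffices to bound the members of a set of kernels that is closed under differentiation in both
  variables: all iterated derivatives of \<open>K\<close> belong to the set, and the mean value theorem in \<open>x\<close>
  gives the Lipschitz bounds.\<close>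

lemma lip_family_coinduct:
  assumes K: "K \<in> X"
    and dt: "\<And>K. K \<in> X \<Longrightarrow> \<exists>K'\<in>X. \<forall>x t. (K x has_vector_derivative K' x t) (at t)"
    and dx: "\<And>K. K \<in> X \<Longrightarrow> \<exists>K'\<in>X. \<forall>x t. ((\<lambda>x. K x t) has_vector_derivative K' x t) (at x)"
    and b: "\<And>K j R. K \<in> X \<Longrightarrow> \<exists>C. \<forall>x t. \<bar>x\<bar> \<le> R \<longrightarrow> \<bar>t\<bar> ^ j * cmod (K x t) \<le> C"
  shows "lip_family K"
proof -
  obtain Ks where Ks: "\<And>k. Ks k \<in> X" "\<And>k x. iter_deriv k (K x) = Ks k x" "\<And>x. deriv_chain (\<lambda>k. Ks k x)" "Ks 0 = K"
    using kernel_sequence[OF K dt] by metis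
  have "K x \<in> schwartz" for x
  proof -
    have "\<exists>C. \<forall>t. \<bar>t\<bar> ^ j * cmod (Ks k x t) \<le> C" for j k
      using b[OF Ks(1), of "\<bar>x\<bar>" j k] by blast
    from schwartzI[OF Ks(3) this] show ?thesis by (simp add: Ks(4))
  qed
  moreover have "\<exists>C. \<forall>x y t. \<bar>x\<bar> \<le> R \<longrightarrow> \<bar>y\<bar> \<le> R \<longrightarrow> \<bar>t\<bar> ^ j * cmod (Ks k x t - Ks k y t) \<le> C * \<bar>x - y\<bar>" for j k R
  proof -
    obtain K' where K': "K' \<in> X" "\<And>x t. ((\<lambda>x. Ks k x t) has_vector_derivative K' x t) (at x)"
      using dx[OF Ks(1)] by blast
    obtain C where C: "\<And>x t. \<bar>x\<bar> \<le> R \<Longrightarrow> \<bar>t\<bar> ^ j * cmod (K' x t) \<le> C" using b[OF K'(1)] by blast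
    have "\<bar>t\<bar> ^ j * cmod (Ks k x t - Ks k y t) \<le> C * \<bar>x - y\<bar>" if xy: "\<bar>x\<bar> \<le> R" "\<bar>y\<bar> \<le> R" for x y t
    proof -
      define c where "c = complex_of_real (\<bar>t\<bar> ^ j)"
      have c: "cmod c = \<bar>t\<bar> ^ j" by (simp add: c_def norm_power)
      have "norm (c * Ks k x t - c * Ks k y t) \<le> C * norm (x - y)"
      proof (rule differentiable_bound[of "{-R..R}" _ "\<lambda>x h. h *\<^sub>R (c * K' x t)"])
        show "((\<lambda>x. c * Ks k x t) has_derivative (\<lambda>h. h *\<^sub>R (c * K' z t))) (at z within {-R..R})" for z
          using has_vector_derivative_at_within[OF bounded_linear.has_vector_derivative[OF bounded_linear_mult_right K'(2)]]
          by (simp add: has_vector_derivative_def)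
        show "onorm (\<lambda>h. h *\<^sub>R (c * K' z t)) \<le> C" if "z \<in> {-R..R}" for z
        proof (rule onorm_le)
          fix h :: real
          have "\<bar>h\<bar> * (\<bar>t\<bar> ^ j * cmod (K' z t)) \<le> \<bar>h\<bar> * C"
            using that by (intro mult_left_mono C) auto
          then show "norm (h *\<^sub>R (c * K' z t)) \<le> C * norm h" by (simp add: norm_mult c mult_ac)
        qed
      qed (use xy in auto)
      then show ?thesis by (simp add: norm_mult c flip: right_diff_distrib)
    qed
    then show ?thesis by blast
  qed
  ultimately show ?thesis unfolding lip_family_def Ks(2) by blast
qed

text \<open>The same principle; only derivatives in the second variable occur in the seminorms.\<close>

lemma dec_family_coinduct:
  assumes K: "K \<in> X"
    and dt: "\<And>K. K \<in> X \<Longrightarrow> \<exists>K'\<in>X. \<forall>x t. (K x has_vector_derivative K' x t) (at t)"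
    and b: "\<And>K j. K \<in> X \<Longrightarrow> \<exists>C. \<forall>x t. (1 + x\<^sup>2) * \<bar>t\<bar> ^ j * cmod (K x t) \<le> C"
  shows "dec_family K"
proof -
  obtain Ks where Ks: "\<And>k. Ks k \<in> X" "\<And>k x. iter_deriv k (K x) = Ks k x" "\<And>x. deriv_chain (\<lambda>k. Ks k x)" "Ks 0 = K"
    using kernel_sequence[OF K dt] by metis
  have "\<exists>C. \<forall>x t. \<bar>t\<bar> ^ j * cmod (Ks k x t) \<le> C * (1 / (1 + x\<^sup>2))" for j k
  proof -
    obtain C where C: "\<And>x t. (1 + x\<^sup>2) * \<bar>t\<bar> ^ j * cmod (Ks k x t) \<le> C" using b[OF Ks(1)] by blast
    have "\<bar>t\<bar> ^ j * cmod (Ks k x t) \<le> C * (1 / (1 + x\<^sup>2))" for x t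
      using C[of x t] by (simp add: field_simps add_pos_nonneg)
    then show ?thesis by blast
  qed
  then show ?thesis unfolding dec_family_def Ks(2) by blast
qed

text \<open>The derivative of a product is a sum of products. Sets of product kernels are therefore closed
  under differentiation only after finite sums have been added, and such sums inherit bounds and
  derivatives from the generators.\<close>

inductive_set kspan :: "(real \<Rightarrow> real \<Rightarrow> complex) set \<Rightarrow> (real \<Rightarrow> real \<Rightarrow> complex) set" for G where
  base: "K \<in> G \<Longrightarrow> K \<in> kspan G"
| add: "K \<in> kspan G \<Longrightarrow> L \<in> kspan G \<Longrightarrow> (\<lambda>x t. K x t + L x t) \<in> kspan G"

lemma kspan_dt:
  assumes G: "\<And>K. K \<in> G \<Longrightarrow> \<exists>K'\<in>kspan G. \<forall>x t. (K x has_vector_derivative K' x t) (at t)"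
    and K: "K \<in> kspan G"
  shows "\<exists>K'\<in>kspan G. \<forall>x t. (K x has_vector_derivative K' x t) (at t)"
  using K
proof induction
  case (add K L)
  then obtain K' L' where "K' \<in> kspan G" "L' \<in> kspan G" "\<And>x t. (K x has_vector_derivative K' x t) (at t)"
    "\<And>x t. (L x has_vector_derivative L' x t) (at t)" by blast
  then show ?case by (intro bexI[of _ "\<lambda>x t. K' x t + L' x t"] allI has_vector_derivative_add kspan.add)
qed (use G in blast)

lemma kspan_dx:
  assumes G: "\<And>K. K \<in> G \<Longrightarrow> \<exists>K'\<in>kspan G. \<forall>x t. ((\<lambda>x. K x t) has_vector_derivative K' x t) (at x)"
    and K: "K \<in> kspan G"
  shows "\<exists>K'\<in>kspan G. \<forall>x t. ((\<lambda>x. K x t) has_vector_derivative K' x t) (at x)"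
  using K
proof induction
  case (add K L)
  then obtain K' L' where "K' \<in> kspan G" "L' \<in> kspan G" "\<And>x t. ((\<lambda>x. K x t) has_vector_derivative K' x t) (at x)"
    "\<And>x t. ((\<lambda>x. L x t) has_vector_derivative L' x t) (at x)" by blast
  then show ?case by (intro bexI[of _ "\<lambda>x t. K' x t + L' x t"] allI has_vector_derivative_add kspan.add)
qed (use G in blast)

lemma kspan_bound:
  assumes G: "\<And>K. K \<in> G \<Longrightarrow> \<exists>C. \<forall>x t. P x \<longrightarrow> r x t * cmod (K x t) \<le> C" and r: "\<And>x t. 0 \<le> r x t"
    and K: "K \<in> kspan G"
  shows "\<exists>C. \<forall>x t. P x \<longrightarrow> r x t * cmod (K x t) \<le> (C :: real)"
  using K
proof induction
  case (add K L)
  then obtain C D where "\<And>x t. P x \<Longrightarrow> r x t * cmod (K x t) \<le> C" "\<And>x t. P x \<Longrightarrow> r x t * cmod (L x t) \<le> D" by blast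
  note b = this
  have "r x t * cmod (K x t + L x t) \<le> C + D" if "P x" for x t
  proof -
    have "r x t * cmod (K x t + L x t) \<le> r x t * cmod (K x t) + r x t * cmod (L x t)"
      using mult_left_mono[OF norm_triangle_ineq[of "K x t" "L x t"] r[of x t]] by (simp add: distrib_left)
    also have "\<dots> \<le> C + D" by (intro add_mono b that)
    finally show ?thesis .
  qed
  then show ?case by blast
qed (use G in blast)

definition deriv_closed :: "(real \<Rightarrow> complex) set \<Rightarrow> bool" where
  "deriv_closed T \<longleftrightarrow> (\<forall>f\<in>T. \<exists>f'\<in>T. \<forall>x. (f has_vector_derivative f' x) (at x))"

text \<open>These functions are the multipliers that occur below: constants, characters and Schwartz
  functions.\<close>

definition bounded_smooth :: "(real \<Rightarrow> complex) set" where
  "bounded_smooth = {f. \<exists>D. D 0 = f \<and> deriv_chain D \<and> (\<forall>k. \<exists>C. \<forall>x. cmod (D k x) \<le> C)}"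

lemma deriv_closed_schwartz: "deriv_closed schwartz"
  unfolding deriv_closed_def using schwartz_iter_deriv schwartz_deriv_0 by blast

lemma deriv_closed_bounded_smooth: "deriv_closed bounded_smooth"
  unfolding deriv_closed_def
proof
  fix f assume "f \<in> bounded_smooth"
  then obtain D where D: "D 0 = f" "deriv_chain D" "\<And>k. \<exists>C. \<forall>x. cmod (D k x) \<le> C" by (auto simp: bounded_smooth_def)
  have "deriv_chain (\<lambda>k. D (Suc k))" using D(2) by (simp add: deriv_chain_def)
  then have "D 1 \<in> bounded_smooth"
    unfolding bounded_smooth_def using D(3) by (auto intro!: exI[of _ "\<lambda>k. D (Suc k)"])
  moreover have "(f has_vector_derivative D 1 x) (at x)" for x using deriv_chainD[OF D(2), of 0 x] D(1) by simp
  ultimately show "\<exists>f'\<in>bounded_smooth. \<forall>x. (f has_vector_derivative f' x) (at x)" by blast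
qed

lemma schwartz_bounded_smooth: "f \<in> schwartz \<Longrightarrow> f \<in> bounded_smooth"
  unfolding bounded_smooth_def using schwartz_chain schwartz_bound_power[of f 0]
  by (auto intro!: exI[of _ "\<lambda>k. iter_deriv k f"]) metis

lemma bounded_smooth_const: "(\<lambda>x. c) \<in> bounded_smooth"
proof -
  have "deriv_chain (\<lambda>k x. if k = 0 then c else 0)" by (simp add: deriv_chain_def)
  moreover have "\<exists>C. \<forall>x::real. cmod (if k = 0 then c else 0) \<le> C" for k :: nat by auto
  ultimately show ?thesis unfolding bounded_smooth_def by (auto intro!: exI[of _ "\<lambda>k x. if k = 0 then c else 0"])
qed

lemma bounded_smooth_cis: "(\<lambda>t. cis (- (t * \<xi>))) \<in> bounded_smooth"
proof -
  have "((\<lambda>t. (- \<i> * of_real \<xi>) ^ k * cis (- (t * \<xi>))) has_vector_derivative (- \<i> * of_real \<xi>) ^ k * (- \<i> * of_real \<xi> * cis (- (t * \<xi>)))) (at t)" for k t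
    by (rule bounded_linear.has_vector_derivative[OF bounded_linear_mult_right has_vector_derivative_cis_linear])
  then have "deriv_chain (\<lambda>k t. (- \<i> * of_real \<xi>) ^ k * cis (- (t * \<xi>)))"
    by (simp add: deriv_chain_def mult_ac)
  then show ?thesis unfolding bounded_smooth_def
    by (auto simp: norm_mult norm_power intro!: exI[of _ "\<lambda>k t. (- \<i> * of_real \<xi>) ^ k * cis (- (t * \<xi>))"])
qed

lemma bounded_smooth_bound:
  assumes "f \<in> bounded_smooth" shows "\<exists>C\<ge>0. \<forall>x. cmod (f x) \<le> C"
proof -
  obtain D where "D 0 = f" "\<And>k. \<exists>C. \<forall>x. cmod (D k x) \<le> C" using assms by (auto simp: bounded_smooth_def)
  then obtain C where C: "\<And>x. cmod (f x) \<le> C" by metis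
  from order_trans[OF norm_ge_zero this] have "0 \<le> C" .
  with C show ?thesis by blast
qed

definition product_kernels :: "(real \<Rightarrow> complex) set \<Rightarrow> (real \<Rightarrow> complex) set \<Rightarrow> (real \<Rightarrow> real \<Rightarrow> complex) set" where
  "product_kernels S T = {K. \<exists>A\<in>S. \<exists>B\<in>schwartz. \<exists>g\<in>T. K = (\<lambda>x t. A x * B (t - x) * g t)}"

lemma has_vector_derivative_shift:
  assumes "\<And>x. (B has_vector_derivative B' x) (at x)"
  shows "((\<lambda>t. B (t - x)) has_vector_derivative B' (t - x)) (at (t::real))"
    and "((\<lambda>x. B (t - x)) has_vector_derivative - B' (t - x)) (at (x::real))"
proof -
  have "((\<lambda>t. t - x) has_vector_derivative 1) (at t)" "((\<lambda>x. t - x) has_vector_derivative -1) (at x)"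
    by (auto intro!: derivative_eq_intros)
  from vector_diff_chain_at[OF this(1) assms] vector_diff_chain_at[OF this(2) assms]
  show "((\<lambda>t. B (t - x)) has_vector_derivative B' (t - x)) (at t)" "((\<lambda>x. B (t - x)) has_vector_derivative - B' (t - x)) (at x)"
    by (auto simp: o_def)
qed

lemma product_kernels_dt:
  assumes T: "deriv_closed T" and K: "K \<in> product_kernels S T"
  shows "\<exists>K'\<in>kspan (product_kernels S T). \<forall>x t. (K x has_vector_derivative K' x t) (at t)"
proof -
  obtain A B g where K_def: "K = (\<lambda>x t. A x * B (t - x) * g t)" and A: "A \<in> S" and B: "B \<in> schwartz" and g: "g \<in> T"
    using K unfolding product_kernels_def by blast
  obtain g' where g': "g' \<in> T" "\<And>x. (g has_vector_derivative g' x) (at x)" using T g unfolding deriv_closed_def by blast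
  have "(\<lambda>x t. A x * iter_deriv 1 B (t - x) * g t) \<in> product_kernels S T"
    unfolding product_kernels_def using A schwartz_iter_deriv[OF B] g by blast
  moreover have "(\<lambda>x t. A x * B (t - x) * g' t) \<in> product_kernels S T"
    unfolding product_kernels_def using A B g' by blast
  ultimately have 1: "(\<lambda>x t. A x * B (t - x) * g' t + A x * iter_deriv 1 B (t - x) * g t) \<in> kspan (product_kernels S T)"
    by (intro kspan.intros)
  have 2: "(K x has_vector_derivative A x * B (t - x) * g' t + A x * iter_deriv 1 B (t - x) * g t) (at t)" for x t
    unfolding K_def
    by (intro has_vector_derivative_mult g' bounded_linear.has_vector_derivative[OF bounded_linear_mult_right]
        has_vector_derivative_shift(1) schwartz_deriv_0 B)
  from 2 show ?thesis by (intro bexI[OF _ 1] allI)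
qed

lemma product_kernels_dx:
  assumes S: "deriv_closed S" and K: "K \<in> product_kernels S T"
  shows "\<exists>K'\<in>kspan (product_kernels S T). \<forall>x t. ((\<lambda>x. K x t) has_vector_derivative K' x t) (at x)"
proof -
  obtain A B g where K_def: "K = (\<lambda>x t. A x * B (t - x) * g t)" and A: "A \<in> S" and B: "B \<in> schwartz" and g: "g \<in> T"
    using K unfolding product_kernels_def by blast
  obtain A' where A': "A' \<in> S" "\<And>x. (A has_vector_derivative A' x) (at x)" using S A unfolding deriv_closed_def by blast
  define B' where "B' x = -1 * iter_deriv 1 B x" for x
  have B': "B' \<in> schwartz" unfolding B'_def by (intro schwartz_cmult(1) schwartz_iter_deriv B)
  have "(\<lambda>x t. A x * B' (t - x) * g t) \<in> product_kernels S T"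
    unfolding product_kernels_def using A B' g by blast
  moreover have "(\<lambda>x t. A' x * B (t - x) * g t) \<in> product_kernels S T"
    unfolding product_kernels_def using A' B g by blast
  ultimately have 1: "(\<lambda>x t. A x * B' (t - x) * g t + A' x * B (t - x) * g t) \<in> kspan (product_kernels S T)"
    by (intro kspan.intros)
  have 2: "((\<lambda>x. K x t) has_vector_derivative A x * B' (t - x) * g t + A' x * B (t - x) * g t) (at x)" for x t
  proof -
    have "((\<lambda>x. B (t - x)) has_vector_derivative B' (t - x)) (at x)"
      using has_vector_derivative_shift(2)[OF schwartz_deriv_0[OF B]] by (simp add: B'_def)
    from bounded_linear.has_vector_derivative[OF bounded_linear_mult_left has_vector_derivative_mult[OF A'(2) this]]
    show ?thesis by (simp add: K_def distrib_right)
  qed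
  from 2 show ?thesis by (intro bexI[OF _ 1] allI)
qed

text \<open>Peetre's inequality: a weight in one of the variables \<open>x\<close>, \<open>t\<close>, \<open>t - x\<close> is controlled by the
  weights in the other two.\<close>

lemma one_plus_abs_shift: "1 + \<bar>t\<bar> \<le> (1 + \<bar>x\<bar>) * (1 + \<bar>t - x\<bar>)" "1 + \<bar>x\<bar> \<le> (1 + \<bar>t\<bar>) * (1 + \<bar>t - x\<bar>)" for x t :: real
proof -
  have "(1 + \<bar>x\<bar>) * (1 + \<bar>t - x\<bar>) = 1 + \<bar>x\<bar> + \<bar>t - x\<bar> + \<bar>x\<bar> * \<bar>t - x\<bar>" by (simp add: algebra_simps)
  moreover have "0 \<le> \<bar>x\<bar> * \<bar>t - x\<bar>" by simp
  ultimately show "1 + \<bar>t\<bar> \<le> (1 + \<bar>x\<bar>) * (1 + \<bar>t - x\<bar>)" by linarith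
  have "(1 + \<bar>t\<bar>) * (1 + \<bar>t - x\<bar>) = 1 + \<bar>t\<bar> + \<bar>t - x\<bar> + \<bar>t\<bar> * \<bar>t - x\<bar>" by (simp add: algebra_simps)
  moreover have "0 \<le> \<bar>t\<bar> * \<bar>t - x\<bar>" by simp
  ultimately show "1 + \<bar>x\<bar> \<le> (1 + \<bar>t\<bar>) * (1 + \<bar>t - x\<bar>)" by linarith
qed

lemma product_kernels_bound:
  assumes "A \<in> bounded_smooth" "B \<in> schwartz" "g \<in> bounded_smooth"
  shows "\<exists>C. \<forall>x t. \<bar>x\<bar> \<le> R \<longrightarrow> \<bar>t\<bar> ^ j * cmod (A x * B (t - x) * g t) \<le> C"
proof -
  obtain a where a: "0 \<le> a" "\<And>x. cmod (A x) \<le> a" using bounded_smooth_bound assms(1) by blast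
  obtain c where c: "0 \<le> c" "\<And>x. cmod (g x) \<le> c" using bounded_smooth_bound assms(3) by blast
  obtain b where b: "0 \<le> b" "\<And>x. (1 + \<bar>x\<bar>) ^ j * cmod (B x) \<le> b" using schwartz_bound_0[OF assms(2)] by blast
  have "\<bar>t\<bar> ^ j * cmod (A x * B (t - x) * g t) \<le> a * ((1 + R) ^ j * b) * c" if "\<bar>x\<bar> \<le> R" for x t
  proof -
    have "\<bar>t\<bar> ^ j \<le> ((1 + R) * (1 + \<bar>t - x\<bar>)) ^ j"
    proof (rule power_mono)
      have "\<bar>t\<bar> \<le> (1 + \<bar>x\<bar>) * (1 + \<bar>t - x\<bar>)" using one_plus_abs_shift(1)[of t x] by simp
      also have "\<dots> \<le> (1 + R) * (1 + \<bar>t - x\<bar>)" using that by (intro mult_right_mono) auto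
      finally show "\<bar>t\<bar> \<le> (1 + R) * (1 + \<bar>t - x\<bar>)" .
    qed simp
    then have "\<bar>t\<bar> ^ j * cmod (B (t - x)) \<le> ((1 + R) * (1 + \<bar>t - x\<bar>)) ^ j * cmod (B (t - x))"
      by (rule mult_right_mono) simp
    also have "\<dots> = (1 + R) ^ j * ((1 + \<bar>t - x\<bar>) ^ j * cmod (B (t - x)))" by (simp add: power_mult_distrib)
    also have "\<dots> \<le> (1 + R) ^ j * b" using that by (intro mult_left_mono b) auto
    finally have m: "\<bar>t\<bar> ^ j * cmod (B (t - x)) \<le> (1 + R) ^ j * b" .
    have "cmod (A x) * (\<bar>t\<bar> ^ j * cmod (B (t - x))) * cmod (g t) \<le> a * ((1 + R) ^ j * b) * c"
      by (intro mult_mono[OF mult_mono[OF a(2) m] c(2)]) (use a c b that in auto)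
    then show ?thesis by (simp add: norm_mult mult_ac)
  qed
  then show ?thesis by blast
qed

text \<open>Decay in two of the three variables \<open>x\<close>, \<open>t\<close>, \<open>t - x\<close> suffices. The factor \<open>B\<close> decays in \<open>t - x\<close>,
  and one of \<open>A\<close> and \<open>g\<close> has to provide the rest.\<close>

lemma product_kernels_decay:
  assumes A: "A \<in> bounded_smooth" and B: "B \<in> schwartz" and g: "g \<in> bounded_smooth"
    and Ag: "A \<in> schwartz \<or> g \<in> schwartz"
  shows "\<exists>C. \<forall>x t. (1 + x\<^sup>2) * \<bar>t\<bar> ^ j * cmod (A x * B (t - x) * g t) \<le> C"
proof -
  obtain a where a: "0 \<le> a" "\<And>x. cmod (A x) \<le> a" using bounded_smooth_bound A by blast
  obtain c where c: "0 \<le> c" "\<And>x. cmod (g x) \<le> c" using bounded_smooth_bound g by blast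
  have w: "(1 + x\<^sup>2) * \<bar>t\<bar> ^ j \<le> (1 + \<bar>x\<bar>) ^ 2 * (1 + \<bar>t\<bar>) ^ j" for x t :: real
    by (intro mult_mono one_plus_square_le power_mono) auto
  from Ag show ?thesis
  proof
    assume "A \<in> schwartz"
    then obtain a' where a': "0 \<le> a'" "\<And>x. (1 + \<bar>x\<bar>) ^ (2 + j) * cmod (A x) \<le> a'" using schwartz_bound_0 by blast
    obtain b where b: "0 \<le> b" "\<And>x. (1 + \<bar>x\<bar>) ^ j * cmod (B x) \<le> b" using schwartz_bound_0[OF B] by blast
    have "(1 + x\<^sup>2) * \<bar>t\<bar> ^ j * cmod (A x * B (t - x) * g t) \<le> a' * b * c" for x t
    proof -
      have "(1 + x\<^sup>2) * \<bar>t\<bar> ^ j \<le> (1 + \<bar>x\<bar>) ^ 2 * ((1 + \<bar>x\<bar>) * (1 + \<bar>t - x\<bar>)) ^ j"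
        by (rule order_trans[OF w]) (intro mult_left_mono power_mono one_plus_abs_shift, auto)
      then have "(1 + x\<^sup>2) * \<bar>t\<bar> ^ j * cmod (A x * B (t - x) * g t) \<le> (1 + \<bar>x\<bar>) ^ 2 * ((1 + \<bar>x\<bar>) * (1 + \<bar>t - x\<bar>)) ^ j * cmod (A x * B (t - x) * g t)"
        by (rule mult_right_mono) simp
      also have "\<dots> = ((1 + \<bar>x\<bar>) ^ (2 + j) * cmod (A x)) * ((1 + \<bar>t - x\<bar>) ^ j * cmod (B (t - x))) * cmod (g t)"
        by (simp add: norm_mult power_mult_distrib power_add power2_eq_square mult_ac)
      also have "\<dots> \<le> a' * b * c" by (intro mult_mono a' b c mult_nonneg_nonneg) auto
      finally show ?thesis .
    qed
    then show ?thesis by blast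
  next
    assume "g \<in> schwartz"
    then obtain c' where c': "0 \<le> c'" "\<And>x. (1 + \<bar>x\<bar>) ^ (2 + j) * cmod (g x) \<le> c'" using schwartz_bound_0 by blast
    obtain b where b: "0 \<le> b" "\<And>x. (1 + \<bar>x\<bar>) ^ 2 * cmod (B x) \<le> b" using schwartz_bound_0[OF B] by blast
    have "(1 + x\<^sup>2) * \<bar>t\<bar> ^ j * cmod (A x * B (t - x) * g t) \<le> a * b * c'" for x t
    proof -
      have "(1 + x\<^sup>2) * \<bar>t\<bar> ^ j \<le> ((1 + \<bar>t\<bar>) * (1 + \<bar>t - x\<bar>)) ^ 2 * (1 + \<bar>t\<bar>) ^ j"
        by (rule order_trans[OF w]) (intro mult_right_mono power_mono one_plus_abs_shift, auto)
      then have "(1 + x\<^sup>2) * \<bar>t\<bar> ^ j * cmod (A x * B (t - x) * g t) \<le> ((1 + \<bar>t\<bar>) * (1 + \<bar>t - x\<bar>)) ^ 2 * (1 + \<bar>t\<bar>) ^ j * cmod (A x * B (t - x) * g t)"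
        by (rule mult_right_mono) simp
      also have "\<dots> = cmod (A x) * ((1 + \<bar>t - x\<bar>) ^ 2 * cmod (B (t - x))) * ((1 + \<bar>t\<bar>) ^ (2 + j) * cmod (g t))"
        by (simp add: norm_mult power_mult_distrib power_add power2_eq_square mult_ac)
      also have "\<dots> \<le> a * b * c'" by (intro mult_mono a b c' mult_nonneg_nonneg) auto
      finally show ?thesis .
    qed
    then show ?thesis by blast
  qed
qed

lemma product_lip_family:
  assumes "A \<in> bounded_smooth" "B \<in> schwartz" "g \<in> bounded_smooth"
  shows "lip_family (\<lambda>x t. A x * B (t - x) * g t)"
proof (rule lip_family_coinduct[where X = "kspan (product_kernels bounded_smooth bounded_smooth)"])
  show "(\<lambda>x t. A x * B (t - x) * g t) \<in> kspan (product_kernels bounded_smooth bounded_smooth)"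
    using assms by (intro kspan.base) (auto simp: product_kernels_def)
  show "\<exists>C. \<forall>x t. \<bar>x\<bar> \<le> R \<longrightarrow> \<bar>t\<bar> ^ j * cmod (K x t) \<le> C" if "K \<in> kspan (product_kernels bounded_smooth bounded_smooth)" for K j R
  proof (rule kspan_bound[OF _ _ that])
    fix L assume "L \<in> product_kernels bounded_smooth bounded_smooth"
    then obtain A B g where "A \<in> bounded_smooth" "B \<in> schwartz" "g \<in> bounded_smooth" "L = (\<lambda>x t. A x * B (t - x) * g t)"
      by (auto simp: product_kernels_def)
    then show "\<exists>C. \<forall>x t. \<bar>x\<bar> \<le> R \<longrightarrow> \<bar>t\<bar> ^ j * cmod (L x t) \<le> C" by (simp only: product_kernels_bound)
  qed simp
qed (rule kspan_dt[OF product_kernels_dt[OF deriv_closed_bounded_smooth]] kspan_dx[OF product_kernels_dx[OF deriv_closed_bounded_smooth]]; assumption)+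

lemma product_dec_family:
  assumes "A \<in> bounded_smooth" "B \<in> schwartz" "g \<in> bounded_smooth" and Ag: "A \<in> schwartz \<or> g \<in> schwartz"
  shows "dec_family (\<lambda>x t. A x * B (t - x) * g t)"
proof -
  have main: "dec_family (\<lambda>x t. A x * B (t - x) * g t)"
    if ST: "A \<in> S" "g \<in> T" "S \<subseteq> bounded_smooth" "T \<subseteq> bounded_smooth" "deriv_closed T" "S = schwartz \<or> T = schwartz" for S T
  proof (rule dec_family_coinduct[where X = "kspan (product_kernels S T)"])
    show "(\<lambda>x t. A x * B (t - x) * g t) \<in> kspan (product_kernels S T)"
      using assms ST by (intro kspan.base) (auto simp: product_kernels_def)
    have "\<exists>C. \<forall>x t. (1 + x\<^sup>2) * \<bar>t\<bar> ^ j * cmod (L x t) \<le> C" if L: "L \<in> product_kernels S T" for L j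
    proof -
      obtain A B g where *: "A \<in> S" "B \<in> schwartz" "g \<in> T" and L_def: "L = (\<lambda>x t. A x * B (t - x) * g t)"
        using L by (auto simp: product_kernels_def)
      show ?thesis unfolding L_def
        by (rule product_kernels_decay) (use * ST in auto)
    qed
    then show "\<exists>C. \<forall>x t. (1 + x\<^sup>2) * \<bar>t\<bar> ^ j * cmod (K x t) \<le> C" if "K \<in> kspan (product_kernels S T)" for K j
      using kspan_bound[OF _ _ that, of "\<lambda>_. True" "\<lambda>x t. (1 + x\<^sup>2) * \<bar>t\<bar> ^ j"] by simp
  qed (rule kspan_dt[OF product_kernels_dt[OF ST(5)]]; assumption)
  have sub: "schwartz \<subseteq> bounded_smooth" using schwartz_bounded_smooth by blast
  from Ag show ?thesis
  proof
    assume "A \<in> schwartz"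
    then show ?thesis using assms sub by (intro main[of schwartz bounded_smooth] deriv_closed_bounded_smooth) auto
  next
    assume "g \<in> schwartz"
    then show ?thesis using assms sub by (intro main[of bounded_smooth schwartz] deriv_closed_schwartz) auto
  qed
qed

text \<open>Differentiating the character in \<open>t\<close> produces powers of the frequency \<open>x\<close>, and differentiating it
  in \<open>x\<close> produces powers of \<open>t\<close>, which \<open>g\<close> absorbs.\<close>

definition modulation_kernels :: "(real \<Rightarrow> real \<Rightarrow> complex) set" where
  "modulation_kernels = {K. \<exists>c n. \<exists>g\<in>schwartz. K = (\<lambda>x t. (c * of_real x ^ n) * (g t * cis (- (t * x))))}"

lemma modulation_lip_family:
  assumes g: "g \<in> schwartz" shows "lip_family (\<lambda>\<xi> t. g t * cis (- (t * \<xi>)))"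
proof (rule lip_family_coinduct[where X = "kspan modulation_kernels"])
  have mem: "(\<lambda>x t. (c * of_real x ^ n) * (h t * cis (- (t * x)))) \<in> modulation_kernels" if "h \<in> schwartz" for c n h
    using that unfolding modulation_kernels_def by blast
  have "(\<lambda>\<xi> t. g t * cis (- (t * \<xi>))) = (\<lambda>x t. (1 * of_real x ^ 0) * (g t * cis (- (t * x))))" by simp
  then show "(\<lambda>\<xi> t. g t * cis (- (t * \<xi>))) \<in> kspan modulation_kernels"
    using kspan.base[OF mem[OF g, of 1 0]] by simp
  have dt: "\<exists>K'\<in>kspan modulation_kernels. \<forall>x t. (K x has_vector_derivative K' x t) (at t)" if K: "K \<in> modulation_kernels" for K
  proof -
    obtain c n h where h: "h \<in> schwartz" and K_def: "K = (\<lambda>x t. (c * of_real x ^ n) * (h t * cis (- (t * x))))"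
      using K unfolding modulation_kernels_def by blast
    define K' where "K' x t = (- \<i> * c * of_real x ^ Suc n) * (h t * cis (- (t * x))) + (c * of_real x ^ n) * (iter_deriv 1 h t * cis (- (t * x)))" for x t
    have 1: "K' \<in> kspan modulation_kernels"
      unfolding K'_def[abs_def] by (intro kspan.add kspan.base mem h schwartz_iter_deriv)
    have "(K x has_vector_derivative K' x t) (at t)" for x t
    proof -
      have "((\<lambda>t. h t * cis (- (t * x))) has_vector_derivative h t * (- \<i> * of_real x * cis (- (t * x))) + iter_deriv 1 h t * cis (- (t * x))) (at t)"
        by (intro has_vector_derivative_mult schwartz_deriv_0 h has_vector_derivative_cis_linear)
      from bounded_linear.has_vector_derivative[OF bounded_linear_mult_right[of "c * of_real x ^ n"] this]
      show ?thesis unfolding K_def by (rule has_vector_derivative_eq_rhs) (simp add: K'_def algebra_simps)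
    qed
    with 1 show ?thesis by (intro bexI[OF _ 1] allI)
  qed
  have dx: "\<exists>K'\<in>kspan modulation_kernels. \<forall>x t. ((\<lambda>x. K x t) has_vector_derivative K' x t) (at x)" if K: "K \<in> modulation_kernels" for K
  proof -
    obtain c n h where h: "h \<in> schwartz" and K_def: "K = (\<lambda>x t. (c * of_real x ^ n) * (h t * cis (- (t * x))))"
      using K unfolding modulation_kernels_def by blast
    define K' where "K' x t = (- \<i> * c * of_real x ^ n) * ((of_real t * h t) * cis (- (t * x))) + (of_nat n * c * of_real x ^ (n - 1)) * (h t * cis (- (t * x)))" for x t
    have 1: "K' \<in> kspan modulation_kernels"
      unfolding K'_def[abs_def] by (intro kspan.add kspan.base mem h schwartz_mult_id)
    have "((\<lambda>x. K x t) has_vector_derivative K' x t) (at x)" for x t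
    proof -
      have p: "((\<lambda>x. complex_of_real x ^ n) has_vector_derivative of_nat n * of_real x ^ (n - 1)) (at x)"
        using has_vector_derivative_of_real[OF DERIV_pow[of n x]] by simp
      have "((\<lambda>x. of_real x ^ n * cis (- (x * t))) has_vector_derivative of_real x ^ n * (- \<i> * of_real t * cis (- (x * t))) + of_nat n * of_real x ^ (n - 1) * cis (- (x * t))) (at x)"
        by (intro has_vector_derivative_mult p has_vector_derivative_cis_linear)
      from bounded_linear.has_vector_derivative[OF bounded_linear_mult_right[of "c * h t"] this]
      show ?thesis unfolding K_def by (simp add: K'_def algebra_simps)
    qed
    with 1 show ?thesis by (intro bexI[OF _ 1] allI)
  qed
  show "\<exists>K'\<in>kspan modulation_kernels. \<forall>x t. (K x has_vector_derivative K' x t) (at t)" if "K \<in> kspan modulation_kernels" for K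
    by (rule kspan_dt[OF dt that])
  show "\<exists>K'\<in>kspan modulation_kernels. \<forall>x t. ((\<lambda>x. K x t) has_vector_derivative K' x t) (at x)" if "K \<in> kspan modulation_kernels" for K
    by (rule kspan_dx[OF dx that])
  have b: "\<exists>C. \<forall>x t. \<bar>x\<bar> \<le> R \<longrightarrow> \<bar>t\<bar> ^ j * cmod (K x t) \<le> C" if K: "K \<in> modulation_kernels" for K j R
  proof -
    obtain c n h where h: "h \<in> schwartz" and K_def: "K = (\<lambda>x t. (c * of_real x ^ n) * (h t * cis (- (t * x))))"
      using K unfolding modulation_kernels_def by blast
    obtain C where C: "\<And>t. \<bar>t\<bar> ^ j * cmod (iter_deriv 0 h t) \<le> C" using schwartz_bound_power[OF h] by blast
    have "\<bar>t\<bar> ^ j * cmod (K x t) \<le> cmod c * R ^ n * C" if x: "\<bar>x\<bar> \<le> R" for x t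
    proof -
      have "\<bar>t\<bar> ^ j * cmod (K x t) = cmod c * \<bar>x\<bar> ^ n * (\<bar>t\<bar> ^ j * cmod (iter_deriv 0 h t))"
        by (simp add: K_def norm_mult norm_power)
      also have "\<dots> \<le> cmod c * R ^ n * C"
        using x by (intro mult_mono[OF mult_left_mono[OF power_mono] C]) auto
      finally show ?thesis .
    qed
    then show ?thesis by blast
  qed
  show "\<exists>C. \<forall>x t. \<bar>x\<bar> \<le> R \<longrightarrow> \<bar>t\<bar> ^ j * cmod (K x t) \<le> C" if "K \<in> kspan modulation_kernels" for K j R
    by (rule kspan_bound[OF b _ that]) auto
qed

section \<open>Tempered distributions and integrals of families\<close>

lemma lip_family_schwartz: "lip_family K \<Longrightarrow> K x \<in> schwartz"
  by (simp add: lip_family_def)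

lemma lip_family_common_bound:
  assumes "lip_family K"
  obtains L where "0 \<le> L" "\<And>j k x y t. j \<le> N \<Longrightarrow> k \<le> N \<Longrightarrow> \<bar>x\<bar> \<le> R \<Longrightarrow> \<bar>y\<bar> \<le> R \<Longrightarrow>
     \<bar>t\<bar> ^ j * cmod (iter_deriv k (K x) t - iter_deriv k (K y) t) \<le> L * \<bar>x - y\<bar>"
proof -
  have "\<forall>j k. \<exists>C. \<forall>x y t. \<bar>x\<bar> \<le> R \<longrightarrow> \<bar>y\<bar> \<le> R \<longrightarrow>
        \<bar>t\<bar> ^ j * cmod (iter_deriv k (K x) t - iter_deriv k (K y) t) \<le> C * \<bar>x - y\<bar>"
    using assms by (simp add: lip_family_def)
  then obtain C where C: "\<And>j k x y t. \<bar>x\<bar> \<le> R \<Longrightarrow> \<bar>y\<bar> \<le> R \<Longrightarrow>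
        \<bar>t\<bar> ^ j * cmod (iter_deriv k (K x) t - iter_deriv k (K y) t) \<le> C j k * \<bar>x - y\<bar>" by metis
  define L where "L = (\<Sum>j\<le>N. \<Sum>k\<le>N. \<bar>C j k\<bar>)"
  have CL: "C j k \<le> L" if "j \<le> N" "k \<le> N" for j k
    unfolding L_def by (rule order_trans[OF abs_ge_self le_double_sum[where C = "\<lambda>j k. \<bar>C j k\<bar>"]]) (use that in auto)
  have "\<bar>t\<bar> ^ j * cmod (iter_deriv k (K x) t - iter_deriv k (K y) t) \<le> L * \<bar>x - y\<bar>"
    if "j \<le> N" "k \<le> N" "\<bar>x\<bar> \<le> R" "\<bar>y\<bar> \<le> R" for j k x y t
    by (intro order_trans[OF C] mult_right_mono CL that) auto
  moreover have "0 \<le> L" unfolding L_def by (intro sum_nonneg) auto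
  ultimately show ?thesis using that by blast
qed

lemma dec_family_common_bound:
  assumes "dec_family K"
  obtains L where "0 \<le> L" "\<And>j k x t. j \<le> N \<Longrightarrow> k \<le> N \<Longrightarrow> \<bar>t\<bar> ^ j * cmod (iter_deriv k (K x) t) \<le> L * (1 / (1 + x\<^sup>2))"
proof -
  have "\<forall>j k. \<exists>C. \<forall>x t. \<bar>t\<bar> ^ j * cmod (iter_deriv k (K x) t) \<le> C * (1 / (1 + x\<^sup>2))"
    using assms by (simp add: dec_family_def)
  then obtain C where C: "\<And>j k x t. \<bar>t\<bar> ^ j * cmod (iter_deriv k (K x) t) \<le> C j k * (1 / (1 + x\<^sup>2))" by metis
  define L where "L = (\<Sum>j\<le>N. \<Sum>k\<le>N. \<bar>C j k\<bar>)"
  have CL: "C j k \<le> L" if "j \<le> N" "k \<le> N" for j k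
    unfolding L_def by (rule order_trans[OF abs_ge_self le_double_sum[where C = "\<lambda>j k. \<bar>C j k\<bar>"]]) (use that in auto)
  have "\<bar>t\<bar> ^ j * cmod (iter_deriv k (K x) t) \<le> L * (1 / (1 + x\<^sup>2))" if "j \<le> N" "k \<le> N" for j k x t
    by (intro order_trans[OF C] mult_right_mono CL that) auto
  moreover have "0 \<le> L" unfolding L_def by (intro sum_nonneg) auto
  ultimately show ?thesis using that by blast
qed

lemma tempered_family_lipschitz:
  assumes u: "u \<in> tempered_distributions" and K: "lip_family K"
  shows "\<exists>L\<ge>0. \<forall>x y. \<bar>x\<bar> \<le> R \<longrightarrow> \<bar>y\<bar> \<le> R \<longrightarrow> cmod (u (K x) - u (K y)) \<le> L * \<bar>x - y\<bar>"
proof -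
  obtain C N where C: "0 \<le> C" "\<And>f M. f \<in> schwartz \<Longrightarrow> schwartz_bounded_by N f M \<Longrightarrow> cmod (u f) \<le> C * M"
    using tempered_bound[OF u] by blast
  obtain L where L: "0 \<le> L" "\<And>j k x y t. j \<le> N \<Longrightarrow> k \<le> N \<Longrightarrow> \<bar>x\<bar> \<le> R \<Longrightarrow> \<bar>y\<bar> \<le> R \<Longrightarrow>
     \<bar>t\<bar> ^ j * cmod (iter_deriv k (K x) t - iter_deriv k (K y) t) \<le> L * \<bar>x - y\<bar>"
    using lip_family_common_bound[OF K] by blast
  have "cmod (u (K x) - u (K y)) \<le> C * L * \<bar>x - y\<bar>" if "\<bar>x\<bar> \<le> R" "\<bar>y\<bar> \<le> R" for x y
  proof -
    note S = lip_family_schwartz[OF K, of x] lip_family_schwartz[OF K, of y]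
    have "schwartz_bounded_by N (\<lambda>t. K x t - K y t) (L * \<bar>x - y\<bar>)"
      unfolding schwartz_bounded_by_def iter_deriv_diff[OF S] using L(2) that by blast
    from C(2)[OF schwartz_diff[OF S] this] show ?thesis
      by (simp add: tempered_diff[OF u S] mult.assoc)
  qed
  then show ?thesis using C(1) L(1) by (intro exI[of _ "C * L"]) auto
qed

lemma continuous_on_locally_lipschitz:
  fixes f :: "real \<Rightarrow> complex"
  assumes "\<And>R. \<exists>L\<ge>0. \<forall>x y. \<bar>x\<bar> \<le> R \<longrightarrow> \<bar>y\<bar> \<le> R \<longrightarrow> cmod (f x - f y) \<le> L * \<bar>x - y\<bar>"
  shows "continuous_on UNIV f"
proof (rule continuous_at_imp_continuous_on, rule ballI)
  fix x :: real
  obtain L where L: "0 \<le> L" "\<And>y z. \<bar>y\<bar> \<le> \<bar>x\<bar> + 1 \<Longrightarrow> \<bar>z\<bar> \<le> \<bar>x\<bar> + 1 \<Longrightarrow> cmod (f y - f z) \<le> L * \<bar>y - z\<bar>"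
    using assms by blast
  have "eventually (\<lambda>y. dist y x < 1) (at x)" unfolding eventually_at by (intro exI[of _ 1]) auto
  then have ev: "eventually (\<lambda>y. norm (f y - f x) \<le> L * \<bar>y - x\<bar>) (at x)"
    by eventually_elim (rule L(2), auto simp: dist_real_def)
  have "((\<lambda>y. L * \<bar>y - x\<bar>) \<longlongrightarrow> L * \<bar>x - x\<bar>) (at x)" by (intro tendsto_intros)
  then have "((\<lambda>y. f y - f x) \<longlongrightarrow> 0) (at x)"
    by (intro Lim_null_comparison[OF ev]) simp
  then show "isCont f x" unfolding isCont_def by (simp add: LIM_zero_iff)
qed

lemma tempered_family_continuous:
  "u \<in> tempered_distributions \<Longrightarrow> lip_family K \<Longrightarrow> continuous_on UNIV (\<lambda>x. u (K x))"
  by (rule continuous_on_locally_lipschitz, rule tempered_family_lipschitz)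

lemma lip_family_measurable:
  assumes K: "lip_family K" shows "(\<lambda>x. iter_deriv k (K x) t) \<in> borel_measurable borel"
proof (rule borel_measurable_continuous_onI, rule continuous_on_locally_lipschitz)
  fix R
  obtain L where L: "0 \<le> L" "\<And>j k' x y t. j \<le> k \<Longrightarrow> k' \<le> k \<Longrightarrow> \<bar>x\<bar> \<le> R \<Longrightarrow> \<bar>y\<bar> \<le> R \<Longrightarrow>
     \<bar>t\<bar> ^ j * cmod (iter_deriv k' (K x) t - iter_deriv k' (K y) t) \<le> L * \<bar>x - y\<bar>"
    using lip_family_common_bound[OF K] by blast
  show "\<exists>L\<ge>0. \<forall>x y. \<bar>x\<bar> \<le> R \<longrightarrow> \<bar>y\<bar> \<le> R \<longrightarrow> cmod (iter_deriv k (K x) t - iter_deriv k (K y) t) \<le> L * \<bar>x - y\<bar>"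
    using L(1) L(2)[of 0 k _ _ t] by (intro exI[of _ L]) auto
qed

text \<open>By \<open>deriv_chain_integral\<close> the derivatives may be taken under the integral sign, where the decay in
  \<open>x\<close> bounds all seminorms at once.\<close>

lemma family_integral:
  assumes K: "lip_family K" "dec_family K" and w: "w \<in> borel_measurable borel" "\<And>x. cmod (w x) \<le> 1"
  shows "(\<lambda>t. \<integral>x. w x * K x t \<partial>lborel) \<in> schwartz"
    and "iter_deriv k (\<lambda>t. \<integral>x. w x * K x t \<partial>lborel) = (\<lambda>t. \<integral>x. w x * iter_deriv k (K x) t \<partial>lborel)"
    and "integrable lborel (\<lambda>x. w x * iter_deriv k (K x) t)"
proof -
  note [measurable] = lip_family_measurable[OF K(1)] w(1)
  have "\<forall>j k. \<exists>C. \<forall>x t. \<bar>t\<bar> ^ j * cmod (iter_deriv k (K x) t) \<le> C * (1 / (1 + x\<^sup>2))"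
    using K(2) by (simp add: dec_family_def)
  then obtain C where C: "\<And>j k x t. \<bar>t\<bar> ^ j * cmod (iter_deriv k (K x) t) \<le> C j k * (1 / (1 + x\<^sup>2))" by metis
  have chain: "deriv_chain (\<lambda>k t. \<integral>x. w x * iter_deriv k (K x) t \<partial>lborel)"
  proof (rule deriv_chain_integral)
    show "cmod (iter_deriv k (K x) t) \<le> C 0 k * (1 / (1 + x\<^sup>2))" for k x t using C[of t 0 k x] by simp
  qed (auto intro: schwartz_chain lip_family_schwartz K integrable_inverse_quadratic w)
  have b: "\<exists>C. \<forall>t. \<bar>t\<bar> ^ j * cmod (\<integral>x. w x * iter_deriv k (K x) t \<partial>lborel) \<le> C" for j k
  proof -
    have "\<bar>t\<bar> ^ j * cmod (\<integral>x. w x * iter_deriv k (K x) t \<partial>lborel) \<le> C j k * pi" for t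
    proof -
      have "\<bar>t\<bar> ^ j * cmod (\<integral>x. w x * iter_deriv k (K x) t \<partial>lborel) = cmod (\<integral>x. of_real (\<bar>t\<bar> ^ j) * (w x * iter_deriv k (K x) t) \<partial>lborel)"
        by (subst integral_mult_right_zero) (simp add: norm_mult norm_power)
      also have "\<dots> \<le> (\<integral>x. cmod (of_real (\<bar>t\<bar> ^ j) * (w x * iter_deriv k (K x) t)) \<partial>lborel)"
        by (rule integral_norm_bound)
      also have "\<dots> \<le> C j k * pi"
      proof (rule integral_quadratic_decay)
        show "cmod (of_real (\<bar>t\<bar> ^ j) * (w x * iter_deriv k (K x) t)) \<le> C j k * (1 / (1 + x\<^sup>2))" for x
        proof -
          have "cmod (of_real (\<bar>t\<bar> ^ j) * (w x * iter_deriv k (K x) t)) = cmod (w x) * (\<bar>t\<bar> ^ j * cmod (iter_deriv k (K x) t))"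
            by (simp add: norm_mult norm_power)
          also have "\<dots> \<le> 1 * (C j k * (1 / (1 + x\<^sup>2)))" by (intro mult_mono w C) auto
          finally show ?thesis by simp
        qed
      qed measurable
      finally show ?thesis .
    qed
    then show ?thesis by blast
  qed
  from schwartzI[OF chain b] show "(\<lambda>t. \<integral>x. w x * K x t \<partial>lborel) \<in> schwartz" by simp
  show "iter_deriv k (\<lambda>t. \<integral>x. w x * K x t \<partial>lborel) = (\<lambda>t. \<integral>x. w x * iter_deriv k (K x) t \<partial>lborel)"
    using iter_deriv_chain[OF chain, of k] by simp
  show "integrable lborel (\<lambda>x. w x * iter_deriv k (K x) t)"
  proof (rule integrable_mult_bounded(2)[where C = 1], rule integrable_quadratic_decay)
    show "cmod (iter_deriv k (K x) t) \<le> C 0 k * (1 / (1 + x\<^sup>2))" for x using C[of t 0 k x] by simp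
  qed (use w in auto)
qed

lemma indicator_interval_quadratic:
  fixes f :: "real \<Rightarrow> complex"
  assumes ab: "a \<le> b" and f: "\<And>x. a < x \<Longrightarrow> x \<le> b \<Longrightarrow> cmod (f x - f a) \<le> L * \<bar>x - a\<bar>"
    and int: "integrable lborel (\<lambda>x. indicator {a<..b} x * f x)" and L: "0 \<le> L"
  shows "cmod ((\<integral>x. indicator {a<..b} x * f x \<partial>lborel) - of_real (b - a) * f a) \<le> L * (b - a)\<^sup>2"
proof -
  have c: "integrable lborel (\<lambda>x. indicator {a<..b} x * f a)"
    by (intro integrable_mult_left integrable_real_indicator[THEN integrable_of_real, where 'a = complex, simplified of_real_indicator]) (use ab in auto)
  have m: "(\<integral>x. indicator {a<..b} x * f a \<partial>lborel) = of_real (b - a) * f a"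
  proof -
    have "(\<integral>x. indicator {a<..b} x \<partial>lborel) = complex_of_real (\<integral>x. indicator {a<..b} x \<partial>lborel)"
      by (subst integral_complex_of_real[symmetric]) (simp add: of_real_indicator)
    also have "\<dots> = of_real (b - a)" using ab by (simp add: measure_def)
    finally show ?thesis by (subst integral_mult_left_zero) simp
  qed
  have "cmod ((\<integral>x. indicator {a<..b} x * f x \<partial>lborel) - of_real (b - a) * f a)
     = cmod (\<integral>x. indicator {a<..b} x * f x - indicator {a<..b} x * f a \<partial>lborel)"
    by (subst Bochner_Integration.integral_diff[OF int c]) (simp only: m)
  also have "\<dots> \<le> (\<integral>x. cmod (indicator {a<..b} x * f x - indicator {a<..b} x * f a) \<partial>lborel)"
    by (rule integral_norm_bound)
  also have "\<dots> \<le> (\<integral>x. indicator {a<..b} x * (L * (b - a)) \<partial>lborel)"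
  proof (rule integral_mono)
    show "integrable lborel (\<lambda>x. cmod (indicator {a<..b} x * f x - indicator {a<..b} x * f a))"
      using int c by (intro integrable_norm Bochner_Integration.integrable_diff)
    show "integrable lborel (\<lambda>x. indicator {a<..b} x * (L * (b - a)))"
      by (intro integrable_mult_left integrable_real_indicator) (use ab in auto)
    show "cmod (indicator {a<..b} x * f x - indicator {a<..b} x * f a) \<le> indicator {a<..b} x * (L * (b - a))" for x
    proof (cases "x \<in> {a<..b}")
      case True
      then have "cmod (f x - f a) \<le> L * \<bar>x - a\<bar>" by (intro f) auto
      also have "\<dots> \<le> L * (b - a)" using True L by (intro mult_left_mono) auto
      finally show ?thesis using True by simp
    qed simp
  qed
  also have "\<dots> = L * (b - a)\<^sup>2"
    using ab by (subst integral_mult_left_zero) (simp add: measure_def power2_eq_square)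
  finally show ?thesis .
qed

text \<open>Let \<open>\<Lambda> w\<close> be the failure of the exchange when a weight \<open>w\<close> is put under the integrals. It is
  additive in \<open>w\<close> and bounded by the integral of \<open>\<bar>w\<bar> / (1 + x\<^sup>2)\<close>. For the indicator of an interval
  it is quadratically small in the length: on a short interval \<open>K x\<close> differs from its value at the
  left endpoint by a multiple of the length, and a constant family may be exchanged. So
  \<open>b \<mapsto> \<Lambda> (indicator {..b})\<close> has derivative zero and is constant. The indicators of the two tails
  give defects that tend to zero, and therefore \<open>\<Lambda> 1 = 0\<close>.\<close>

lemma tempered_integral_exchange:
  assumes u: "u \<in> tempered_distributions" and K: "lip_family K" "dec_family K"
  shows "integrable lborel (\<lambda>x. u (K x))"
    and "u (\<lambda>t. \<integral>x. K x t \<partial>lborel) = (\<integral>x. u (K x) \<partial>lborel)"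
proof -
  define G where "G w = (\<lambda>t. \<integral>x. w x * K x t \<partial>lborel)" for w
  define \<Lambda> where "\<Lambda> w = u (G w) - (\<integral>x. w x * u (K x) \<partial>lborel)" for w
  define W where "W = {w. w \<in> borel_measurable borel \<and> (\<forall>x::real. cmod (w x) \<le> 1)}"
  note S = lip_family_schwartz[OF K(1)]
  obtain C N where C: "0 \<le> C" "\<And>f M. f \<in> schwartz \<Longrightarrow> schwartz_bounded_by N f M \<Longrightarrow> cmod (u f) \<le> C * M"
    using tempered_bound[OF u] by blast
  obtain M where M: "0 \<le> M" "\<And>j k x t. j \<le> N \<Longrightarrow> k \<le> N \<Longrightarrow> \<bar>t\<bar> ^ j * cmod (iter_deriv k (K x) t) \<le> M * (1 / (1 + x\<^sup>2))"
    using dec_family_common_bound[OF K(2)] by blast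
  have uK_meas [measurable]: "(\<lambda>x. u (K x)) \<in> borel_measurable borel"
    by (intro borel_measurable_continuous_onI tempered_family_continuous u K)
  have uK: "cmod (u (K x)) \<le> C * M * (1 / (1 + x\<^sup>2))" for x
  proof -
    have "schwartz_bounded_by N (K x) (M * (1 / (1 + x\<^sup>2)))" unfolding schwartz_bounded_by_def using M(2) by blast
    from C(2)[OF S this] show ?thesis by (simp add: mult.assoc)
  qed
  show uK_int: "integrable lborel (\<lambda>x. u (K x))"
    by (rule integrable_quadratic_decay[OF uK_meas uK])
  have G: "G w \<in> schwartz" "\<And>k. iter_deriv k (G w) = (\<lambda>t. \<integral>x. w x * iter_deriv k (K x) t \<partial>lborel)"
    "\<And>k t. integrable lborel (\<lambda>x. w x * iter_deriv k (K x) t)" if "w \<in> W" for w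
    using family_integral[OF K, of w] that by (auto simp: G_def W_def)
  have wu: "integrable lborel (\<lambda>x. w x * u (K x))" if "w \<in> W" for w
    using that by (intro integrable_mult_bounded(2)[OF uK_int, where C = 1]) (auto simp: W_def)
  have wi: "integrable lborel (\<lambda>x. cmod (w x) * (1 / (1 + x\<^sup>2)))" if "w \<in> W" for w
  proof (rule Bochner_Integration.integrable_bound[OF integrable_inverse_quadratic])
    have [measurable]: "w \<in> borel_measurable borel" using that by (simp add: W_def)
    show "(\<lambda>x. cmod (w x) * (1 / (1 + x\<^sup>2))) \<in> borel_measurable lborel" by measurable
    have "norm (cmod (w x) * (1 / (1 + x\<^sup>2))) \<le> norm (1 / (1 + x\<^sup>2))" for x
      using that mult_right_mono[of "cmod (w x)" 1 "1 / (1 + x\<^sup>2)"] by (simp add: W_def)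
    then show "AE x in lborel. norm (cmod (w x) * (1 / (1 + x\<^sup>2))) \<le> norm (1 / (1 + x\<^sup>2))" by simp
  qed
  have bound: "cmod (\<Lambda> w) \<le> 2 * C * M * (\<integral>x. cmod (w x) * (1 / (1 + x\<^sup>2)) \<partial>lborel)" if w: "w \<in> W" for w
  proof -
    have "schwartz_bounded_by N (G w) (\<integral>x. M * (cmod (w x) * (1 / (1 + x\<^sup>2))) \<partial>lborel)"
      unfolding schwartz_bounded_by_def G(2)[OF w]
    proof (intro allI impI)
      fix j k t assume jk: "j \<le> N" "k \<le> N"
      have "\<bar>t\<bar> ^ j * cmod (\<integral>x. w x * iter_deriv k (K x) t \<partial>lborel) = cmod (\<integral>x. of_real (\<bar>t\<bar> ^ j) * (w x * iter_deriv k (K x) t) \<partial>lborel)"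
        by (subst integral_mult_right_zero) (simp add: norm_mult norm_power)
      also have "\<dots> \<le> (\<integral>x. cmod (of_real (\<bar>t\<bar> ^ j) * (w x * iter_deriv k (K x) t)) \<partial>lborel)"
        by (rule integral_norm_bound)
      also have "\<dots> \<le> (\<integral>x. M * (cmod (w x) * (1 / (1 + x\<^sup>2))) \<partial>lborel)"
      proof (rule integral_mono)
        show "integrable lborel (\<lambda>x. cmod (of_real (\<bar>t\<bar> ^ j) * (w x * iter_deriv k (K x) t)))"
          by (intro integrable_norm integrable_mult_right G(3) w)
        show "integrable lborel (\<lambda>x. M * (cmod (w x) * (1 / (1 + x\<^sup>2))))" by (intro integrable_mult_right wi w)
        show "cmod (of_real (\<bar>t\<bar> ^ j) * (w x * iter_deriv k (K x) t)) \<le> M * (cmod (w x) * (1 / (1 + x\<^sup>2)))" for x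
          using mult_left_mono[OF M(2)[OF jk, of t x], of "cmod (w x)"] by (simp add: norm_mult norm_power mult_ac)
      qed
      finally show "\<bar>t\<bar> ^ j * cmod (\<integral>x. w x * iter_deriv k (K x) t \<partial>lborel) \<le> (\<integral>x. M * (cmod (w x) * (1 / (1 + x\<^sup>2))) \<partial>lborel)" .
    qed
    from C(2)[OF G(1)[OF w] this]
    have 1: "cmod (u (G w)) \<le> C * M * (\<integral>x. cmod (w x) * (1 / (1 + x\<^sup>2)) \<partial>lborel)"
      by (simp only: integral_mult_right_zero mult.assoc)
    have "cmod (\<integral>x. w x * u (K x) \<partial>lborel) \<le> (\<integral>x. cmod (w x * u (K x)) \<partial>lborel)"
      by (rule integral_norm_bound)
    also have "\<dots> \<le> (\<integral>x. C * M * (cmod (w x) * (1 / (1 + x\<^sup>2))) \<partial>lborel)"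
    proof (rule integral_mono)
      show "cmod (w x * u (K x)) \<le> C * M * (cmod (w x) * (1 / (1 + x\<^sup>2)))" for x
        using mult_left_mono[OF uK[of x], of "cmod (w x)"] by (simp add: norm_mult mult_ac)
    qed (intro integrable_norm integrable_mult_right wu wi w)+
    also have "\<dots> = C * M * (\<integral>x. cmod (w x) * (1 / (1 + x\<^sup>2)) \<partial>lborel)" by (rule integral_mult_right_zero)
    finally show ?thesis unfolding \<Lambda>_def using 1 norm_triangle_ineq4[of "u (G w)" "\<integral>x. w x * u (K x) \<partial>lborel"] by linarith
  qed
  have add: "\<Lambda> (\<lambda>x. v x + w x) = \<Lambda> v + \<Lambda> w" if v: "v \<in> W" and w: "w \<in> W" for v w
  proof -
    have "G (\<lambda>x. v x + w x) = (\<lambda>t. G v t + G w t)"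
      unfolding G_def using G(3)[OF v, of 0] G(3)[OF w, of 0] by (simp add: fun_eq_iff distrib_right)
    then show ?thesis
      unfolding \<Lambda>_def using G(1)[OF v] G(1)[OF w] wu[OF v] wu[OF w] by (simp add: temperedD(1)[OF u] distrib_right)
  qed
  define I where "I A = (indicator A :: real \<Rightarrow> complex)" for A
  have IW: "I A \<in> W" if "A \<in> sets borel" for A using that by (auto simp: I_def W_def indicator_def)
  \<comment> \<open>the defect of an interval is quadratic in its length: both terms of \<open>\<Lambda>\<close> are compared with
    \<open>(b - a) * u (K a)\<close>\<close>
  have local: "\<exists>L. \<forall>a b. - R \<le> a \<longrightarrow> a \<le> b \<longrightarrow> b \<le> R \<longrightarrow> cmod (\<Lambda> (I {a<..b})) \<le> L * (b - a)\<^sup>2" for R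
  proof -
    obtain L where L: "0 \<le> L" "\<And>j k x y t. j \<le> N \<Longrightarrow> k \<le> N \<Longrightarrow> \<bar>x\<bar> \<le> R \<Longrightarrow> \<bar>y\<bar> \<le> R \<Longrightarrow>
       \<bar>t\<bar> ^ j * cmod (iter_deriv k (K x) t - iter_deriv k (K y) t) \<le> L * \<bar>x - y\<bar>"
      using lip_family_common_bound[OF K(1)] by blast
    obtain L' where L': "0 \<le> L'" "\<And>x y. \<bar>x\<bar> \<le> R \<Longrightarrow> \<bar>y\<bar> \<le> R \<Longrightarrow> cmod (u (K x) - u (K y)) \<le> L' * \<bar>x - y\<bar>"
      using tempered_family_lipschitz[OF u K(1)] by blast
    have "cmod (\<Lambda> (I {a<..b})) \<le> (C * L + L') * (b - a)\<^sup>2" if ab: "- R \<le> a" "a \<le> b" "b \<le> R" for a b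
    proof -
      define w where "w = I {a<..b}"
      have w: "w \<in> W" unfolding w_def by (rule IW) simp
      have cK: "(\<lambda>t. of_real (b - a) * K a t) \<in> schwartz" by (intro schwartz_cmult(1) S)
      have "schwartz_bounded_by N (\<lambda>t. G w t - of_real (b - a) * K a t) (L * (b - a)\<^sup>2)"
        unfolding schwartz_bounded_by_def iter_deriv_diff[OF G(1)[OF w] cK] schwartz_cmult(2)[OF S] G(2)[OF w]
      proof (intro allI impI)
        fix j k t assume jk: "j \<le> N" "k \<le> N"
        define f where "f x = of_real (\<bar>t\<bar> ^ j) * iter_deriv k (K x) t" for x
        have "integrable lborel (\<lambda>x. of_real (\<bar>t\<bar> ^ j) * (w x * iter_deriv k (K x) t))"
          by (intro integrable_mult_right G(3) w)
        then have fi: "integrable lborel (\<lambda>x. indicator {a<..b} x * f x)"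
          by (simp add: f_def w_def I_def mult_ac)
        have "cmod ((\<integral>x. indicator {a<..b} x * f x \<partial>lborel) - of_real (b - a) * f a) \<le> L * (b - a)\<^sup>2"
        proof (rule indicator_interval_quadratic[OF ab(2) _ fi L(1)])
          fix x assume "a < x" "x \<le> b"
          then have "\<bar>t\<bar> ^ j * cmod (iter_deriv k (K x) t - iter_deriv k (K a) t) \<le> L * \<bar>x - a\<bar>"
            using ab by (intro L(2) jk) auto
          then show "cmod (f x - f a) \<le> L * \<bar>x - a\<bar>"
            unfolding f_def right_diff_distrib[symmetric] by (simp add: norm_mult norm_power)
        qed
        also have "(\<integral>x. indicator {a<..b} x * f x \<partial>lborel) = of_real (\<bar>t\<bar> ^ j) * (\<integral>x. w x * iter_deriv k (K x) t \<partial>lborel)"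
          by (subst integral_mult_right_zero[symmetric]) (simp add: f_def w_def I_def mult_ac)
        also have "\<dots> - of_real (b - a) * f a = of_real (\<bar>t\<bar> ^ j) * ((\<integral>x. w x * iter_deriv k (K x) t \<partial>lborel) - of_real (b - a) * iter_deriv k (K a) t)"
          by (simp add: f_def algebra_simps)
        finally show "\<bar>t\<bar> ^ j * cmod ((\<integral>x. w x * iter_deriv k (K x) t \<partial>lborel) - of_real (b - a) * iter_deriv k (K a) t) \<le> L * (b - a)\<^sup>2"
          by (simp add: norm_mult norm_power)
      qed
      from C(2)[OF schwartz_diff[OF G(1)[OF w] cK] this]
      have 1: "cmod (u (G w) - of_real (b - a) * u (K a)) \<le> C * (L * (b - a)\<^sup>2)"
        by (simp only: tempered_diff[OF u G(1)[OF w] cK] temperedD(2)[OF u S])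
      have 2: "cmod ((\<integral>x. w x * u (K x) \<partial>lborel) - of_real (b - a) * u (K a)) \<le> L' * (b - a)\<^sup>2"
        unfolding w_def I_def
        by (rule indicator_interval_quadratic[OF ab(2) _ _ L'(1)], rule L'(2), use ab wu[OF w] in \<open>auto simp: w_def I_def\<close>)
      have \<Lambda>w: "\<Lambda> w = (u (G w) - of_real (b - a) * u (K a)) - ((\<integral>x. w x * u (K x) \<partial>lborel) - of_real (b - a) * u (K a))"
        by (simp add: \<Lambda>_def)
      have "cmod (\<Lambda> w) \<le> C * (L * (b - a)\<^sup>2) + L' * (b - a)\<^sup>2"
        unfolding \<Lambda>w by (rule order_trans[OF norm_triangle_ineq4 add_mono[OF 1 2]])
      then show ?thesis by (simp add: w_def algebra_simps)
    qed
    then show ?thesis by blast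
  qed
  define \<Psi> where "\<Psi> b = \<Lambda> (I {..b})" for b
  have \<Psi>_diff: "\<Psi> b - \<Psi> a = \<Lambda> (I {a<..b})" if "a \<le> b" for a b
  proof -
    have "I {..b} = (\<lambda>x. I {..a} x + I {a<..b} x)" using that by (auto simp: I_def indicator_def)
    then show ?thesis unfolding \<Psi>_def by (simp add: add IW)
  qed
  have deriv0: "(\<Psi> has_vector_derivative 0) (at x)" for x
  proof -
    obtain L where L: "\<And>a b. - (\<bar>x\<bar> + 1) \<le> a \<Longrightarrow> a \<le> b \<Longrightarrow> b \<le> \<bar>x\<bar> + 1 \<Longrightarrow> cmod (\<Lambda> (I {a<..b})) \<le> L * (b - a)\<^sup>2"
      using local by blast
    show ?thesis
    proof (rule has_vector_derivative_quadratic_error[of 1])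
      fix y assume y: "\<bar>y - x\<bar> < 1"
      show "norm (\<Psi> y - \<Psi> x - (y - x) *\<^sub>R 0) \<le> L * (y - x)\<^sup>2"
      proof (cases "x \<le> y")
        case True
        then show ?thesis using L[of x y] y by (simp add: \<Psi>_diff)
      next
        case False
        then have "norm (\<Psi> x - \<Psi> y) \<le> L * (x - y)\<^sup>2" using L[of y x] y by (simp add: \<Psi>_diff)
        then show ?thesis by (simp add: norm_minus_commute power2_commute)
      qed
    qed simp
  qed
  have const: "\<Psi> a = \<Psi> b" for a b
    by (rule has_derivative_zero_unique[of UNIV \<Psi>]) (use deriv0 in \<open>auto simp: has_vector_derivative_def\<close>)
  define T where "T n = I {..- real n} " for n
  define T' where "T' n = I {real n<..}" for n
  have lim: "(\<lambda>n. \<integral>x. cmod (w n x) * (1 / (1 + x\<^sup>2)) \<partial>lborel) \<longlonglongrightarrow> 0"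
    if w: "\<And>n. w n \<in> W" "\<And>x. eventually (\<lambda>n. w n x = 0) sequentially" for w :: "nat \<Rightarrow> real \<Rightarrow> complex"
  proof -
    have "(\<lambda>n. \<integral>x. cmod (w n x) * (1 / (1 + x\<^sup>2)) \<partial>lborel) \<longlonglongrightarrow> (\<integral>x. 0 \<partial>(lborel :: real measure))"
    proof (rule integral_dominated_convergence[OF _ _ integrable_inverse_quadratic])
      show "(\<lambda>x. cmod (w n x) * (1 / (1 + x\<^sup>2))) \<in> borel_measurable lborel" for n
        using wi[OF w(1)] by auto
      show "AE x in lborel. (\<lambda>n. cmod (w n x) * (1 / (1 + x\<^sup>2))) \<longlonglongrightarrow> 0"
      proof (intro AE_I2 tendsto_eventually)
        show "eventually (\<lambda>n. cmod (w n x) * (1 / (1 + x\<^sup>2)) = 0) sequentially" for x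
          using w(2)[of x] by eventually_elim simp
      qed
      have "norm (cmod (w n x) * (1 / (1 + x\<^sup>2))) \<le> 1 / (1 + x\<^sup>2)" for n x
        using w(1)[of n] mult_right_mono[of "cmod (w n x)" 1 "1 / (1 + x\<^sup>2)"] by (simp add: W_def)
      then show "AE x in lborel. norm (cmod (w n x) * (1 / (1 + x\<^sup>2))) \<le> 1 / (1 + x\<^sup>2)" for n by simp
    qed simp
    then show ?thesis by simp
  qed
  have TW: "T n \<in> W" "T' n \<in> W" for n unfolding T_def T'_def by (auto intro: IW)
  have lim0: "(\<lambda>n. \<Lambda> (w n)) \<longlonglongrightarrow> 0"
    if w: "\<And>n. w n \<in> W" "\<And>x. eventually (\<lambda>n. w n x = 0) sequentially" for w
  proof (rule Lim_null_comparison[OF always_eventually])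
    show "\<forall>n. norm (\<Lambda> (w n)) \<le> 2 * C * M * (\<integral>x. cmod (w n x) * (1 / (1 + x\<^sup>2)) \<partial>lborel)" using bound w(1) by blast
    show "(\<lambda>n. 2 * C * M * (\<integral>x. cmod (w n x) * (1 / (1 + x\<^sup>2)) \<partial>lborel)) \<longlonglongrightarrow> 0"
      by (intro tendsto_mult_right_zero lim w)
  qed
  have "eventually (\<lambda>n. T n x = 0) sequentially" "eventually (\<lambda>n. T' n x = 0) sequentially" for x
  proof -
    have "eventually (\<lambda>n. \<bar>x\<bar> < real n) sequentially" by real_asymp
    then show "eventually (\<lambda>n. T n x = 0) sequentially" "eventually (\<lambda>n. T' n x = 0) sequentially"
      by (eventually_elim, simp add: T_def T'_def I_def indicator_def)+
  qed
  then have "(\<lambda>n. \<Lambda> (T n) + \<Lambda> (T' n)) \<longlonglongrightarrow> 0 + 0" by (intro tendsto_add lim0 TW)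
  moreover have "\<Lambda> (T n) + \<Lambda> (T' n) = \<Lambda> (\<lambda>x. 1)" for n
  proof -
    have "\<Lambda> (\<lambda>x. 1) = \<Lambda> (\<lambda>x. I {..real n} x + T' n x)"
      by (rule arg_cong[of _ _ \<Lambda>]) (auto simp: I_def T'_def indicator_def fun_eq_iff)
    also have "\<dots> = \<Psi> (real n) + \<Lambda> (T' n)" by (simp add: add IW TW \<Psi>_def)
    also have "\<Psi> (real n) = \<Lambda> (T n)" using const[of "real n" "- real n"] by (simp add: \<Psi>_def T_def)
    finally show ?thesis by simp
  qed
  ultimately have "\<Lambda> (\<lambda>x. 1) = 0" using LIMSEQ_unique by fastforce
  then show "u (\<lambda>t. \<integral>x. K x t \<partial>lborel) = (\<integral>x. u (K x) \<partial>lborel)"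
    by (simp add: \<Lambda>_def G_def)
qed

section \<open>Pairings and inversion of the short-time Fourier transform\<close>

text \<open>Replace \<open>x\<close> by the largest multiple of \<open>1 / (n + 1)\<close> below it. This takes countably many values,
  for each of which measurability in \<open>y\<close> is given, and continuity in \<open>x\<close> yields the limit.\<close>

lemma caratheodory_measurable:
  fixes f :: "real \<Rightarrow> real \<Rightarrow> complex"
  assumes c: "\<And>y. continuous_on UNIV (\<lambda>x. f x y)" and m: "\<And>x. f x \<in> borel_measurable borel"
  shows "(\<lambda>(x, y). f x y) \<in> borel_measurable (borel \<Otimes>\<^sub>M borel)"
proof (rule borel_measurable_LIMSEQ_metric)
  define F where "F n z = f (of_int \<lfloor>real (Suc n) * fst z\<rfloor> / real (Suc n)) (snd z)" for n and z :: "real \<times> real"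
  show "F n \<in> borel_measurable (borel \<Otimes>\<^sub>M borel)" for n
    unfolding F_def
  proof (rule measurable_compose_countable[where f = "\<lambda>i z. f (of_int i / real (Suc n)) (snd z)" and g = "\<lambda>z. \<lfloor>real (Suc n) * fst z\<rfloor>"])
    show "(\<lambda>z. f (of_int i / real (Suc n)) (snd z)) \<in> borel_measurable (borel \<Otimes>\<^sub>M borel)" for i
      by (rule measurable_compose[OF measurable_snd m])
    show "(\<lambda>z. \<lfloor>real (Suc n) * fst z\<rfloor>) \<in> borel \<Otimes>\<^sub>M borel \<rightarrow>\<^sub>M count_space UNIV" by measurable
  qed
  show "(\<lambda>n. F n z) \<longlonglongrightarrow> (case z of (x, y) \<Rightarrow> f x y)" for z
  proof -
    have "(\<lambda>n. of_int \<lfloor>real (Suc n) * fst z\<rfloor> / real (Suc n)) \<longlonglongrightarrow> fst z" by real_asymp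
    moreover have "isCont (\<lambda>x. f x (snd z)) (fst z)" using c[of "snd z"] by (simp add: continuous_on_eq_continuous_at)
    ultimately have "(\<lambda>n. f (of_int \<lfloor>real (Suc n) * fst z\<rfloor> / real (Suc n)) (snd z)) \<longlonglongrightarrow> f (fst z) (snd z)"
      by (rule isCont_tendsto_compose[rotated])
    then show ?thesis by (simp add: F_def split_beta)
  qed
qed

lemma STFT_families:
  assumes "\<phi> \<in> schwartz"
  shows "lip_family (\<lambda>x t. cnj (\<phi> (t - x)) * cis (- (t * \<xi>)))" "lip_family (\<lambda>\<xi> t. cnj (\<phi> (t - x)) * cis (- (t * \<xi>)))"
proof -
  have c: "(\<lambda>t. cnj (\<phi> t)) \<in> schwartz" by (rule schwartz_cnj(1)[OF assms])
  show "lip_family (\<lambda>x t. cnj (\<phi> (t - x)) * cis (- (t * \<xi>)))"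
    using product_lip_family[OF bounded_smooth_const[of 1] c bounded_smooth_cis] by simp
  have "(\<lambda>t. cnj (\<phi> (t - x))) \<in> schwartz"
    using lip_family_schwartz[OF product_lip_family[OF bounded_smooth_const[of 1] c bounded_smooth_const[of 1]], of x] by simp
  then show "lip_family (\<lambda>\<xi> t. cnj (\<phi> (t - x)) * cis (- (t * \<xi>)))" by (rule modulation_lip_family)
qed

lemma STFT_measurable:
  assumes u: "u \<in> tempered_distributions" and \<phi>: "\<phi> \<in> schwartz"
  shows "(\<lambda>(x, \<xi>). STFT \<phi> u x \<xi>) \<in> borel_measurable (borel \<Otimes>\<^sub>M borel)"
  unfolding STFT_def
  by (intro caratheodory_measurable tempered_family_continuous[OF u] borel_measurable_continuous_onI STFT_families \<phi>)

lemma schwartz_shift: "f \<in> schwartz \<Longrightarrow> (\<lambda>t. f (t - x)) \<in> schwartz"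
  using lip_family_schwartz[OF product_lip_family[OF bounded_smooth_const[of 1] _ bounded_smooth_const[of 1]], of f x] by simp

lemma schwartz_mult: "f \<in> schwartz \<Longrightarrow> g \<in> bounded_smooth \<Longrightarrow> (\<lambda>t. f t * g t) \<in> schwartz"
  using lip_family_schwartz[OF product_lip_family[OF bounded_smooth_const[of 1]], of f g 0] by simp

lemma fourier_shift: "fourier (\<lambda>\<eta>. h (\<eta> - c)) t = cis (- (t * c)) * fourier h t"
proof -
  have "fourier (\<lambda>\<eta>. h (\<eta> - c)) t = (\<integral>\<eta>. h \<eta> * cis (- ((c + \<eta>) * t)) \<partial>lborel)"
    unfolding fourier_def by (subst lborel_integral_real_affine[where c = 1 and t = c]) simp_all
  also have "\<dots> = (\<integral>\<eta>. cis (- (t * c)) * (h \<eta> * cis (- (\<eta> * t))) \<partial>lborel)"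
    by (intro Bochner_Integration.integral_cong refl) (simp add: cis_mult algebra_simps)
  also have "\<dots> = cis (- (t * c)) * fourier h t"
    unfolding fourier_def by (rule integral_mult_right_zero)
  finally show ?thesis .
qed

lemma fourier_cnj_reflect:
  "fourier (\<lambda>x. cnj (\<phi> (t - x))) \<eta> = cis (- (t * \<eta>)) * cnj (fourier \<phi> \<eta>)"
proof -
  have "fourier (\<lambda>x. cnj (\<phi> (t - x))) \<eta> = (\<integral>y. cnj (\<phi> y) * cis (- ((t - y) * \<eta>)) \<partial>lborel)"
    unfolding fourier_def by (subst lborel_integral_real_affine[where c = "-1" and t = t]) simp_all
  also have "\<dots> = (\<integral>y. cis (- (t * \<eta>)) * (cnj (\<phi> y) * cis (- (y * - \<eta>))) \<partial>lborel)"
    by (intro Bochner_Integration.integral_cong refl) (simp add: cis_mult algebra_simps)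
  also have "\<dots> = cis (- (t * \<eta>)) * cnj (fourier \<phi> \<eta>)"
    unfolding fourier_cnj by (simp only: fourier_def integral_mult_right_zero)
  finally show ?thesis .
qed

text \<open>By \<open>tempered_integral_exchange\<close> the integral over \<open>x\<close> may be taken inside \<open>u\<close>, where it is the
  Fourier transform of the test function on the right-hand side, by the multiplication formula.\<close>

lemma STFT_pairing:
  assumes u: "u \<in> tempered_distributions" and \<phi>: "\<phi> \<in> schwartz" and r: "r \<in> schwartz"
  shows "(\<integral>x. STFT \<phi> u x \<xi> * fourier r x \<partial>lborel) = dist_fourier u (\<lambda>\<eta>. r (\<eta> - \<xi>) * cnj (fourier \<phi> (\<eta> - \<xi>)))"
proof -
  define K where "K x t = fourier r x * cnj (\<phi> (t - x)) * cis (- (t * \<xi>))" for x t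
  have K: "lip_family K" "dec_family K"
    unfolding K_def[abs_def] using schwartz_fourier[OF r] schwartz_cnj(1)[OF \<phi>]
    by (intro product_lip_family[of _ "\<lambda>t. cnj (\<phi> t)"] product_dec_family[of _ "\<lambda>t. cnj (\<phi> t)"] schwartz_bounded_smooth bounded_smooth_cis; simp)+
  have uK: "u (K x) = STFT \<phi> u x \<xi> * fourier r x" for x
    using temperedD(2)[OF u lip_family_schwartz[OF STFT_families(1)[OF \<phi>, of \<xi>], of x], of "fourier r x"]
    by (simp add: K_def[abs_def] STFT_def mult_ac)
  have h: "(\<lambda>\<eta>. r \<eta> * cnj (fourier \<phi> \<eta>)) \<in> schwartz"
    by (intro schwartz_mult r schwartz_bounded_smooth schwartz_cnj(1) schwartz_fourier \<phi>)
  have "(\<integral>x. K x t \<partial>lborel) = fourier (\<lambda>\<eta>. r (\<eta> - \<xi>) * cnj (fourier \<phi> (\<eta> - \<xi>))) t" for t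
  proof -
    have ci: "integrable lborel (\<lambda>x. cnj (\<phi> (t - x)))"
      using schwartz_integrable[OF schwartz_reflect[OF schwartz_shift[OF schwartz_cnj(1)[OF \<phi>], of "-t"]]] by simp
    have "(\<integral>x. K x t \<partial>lborel) = (\<integral>x. cis (- (t * \<xi>)) * (fourier r x * cnj (\<phi> (t - x))) \<partial>lborel)"
      by (simp add: K_def mult_ac)
    also have "\<dots> = cis (- (t * \<xi>)) * (\<integral>x. fourier r x * cnj (\<phi> (t - x)) \<partial>lborel)"
      by (rule integral_mult_right_zero)
    also have "(\<integral>x. fourier r x * cnj (\<phi> (t - x)) \<partial>lborel) = (\<integral>\<eta>. r \<eta> * fourier (\<lambda>x. cnj (\<phi> (t - x))) \<eta> \<partial>lborel)"
      by (rule fourier_multiplication_formula[OF schwartz_integrable[OF r] ci])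
    also have "\<dots> = fourier (\<lambda>\<eta>. r \<eta> * cnj (fourier \<phi> \<eta>)) t"
      unfolding fourier_cnj_reflect by (simp add: fourier_def[of "\<lambda>\<eta>. r \<eta> * cnj (fourier \<phi> \<eta>)"] mult_ac)
    finally show ?thesis by (simp add: fourier_shift[of "\<lambda>\<eta>. r \<eta> * cnj (fourier \<phi> \<eta>)"])
  qed
  then have "u (\<lambda>t. \<integral>x. K x t \<partial>lborel) = dist_fourier u (\<lambda>\<eta>. r (\<eta> - \<xi>) * cnj (fourier \<phi> (\<eta> - \<xi>)))"
    using schwartz_shift[OF h, of \<xi>] by (simp add: dist_fourier_def)
  then show ?thesis using tempered_integral_exchange(2)[OF u K] by (simp add: uK)
qed

text \<open>The average over \<open>\<xi>\<close> of the translates of \<open>B\<close> is the constant function with value the integral of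
  \<open>B\<close>.\<close>

lemma tempered_translation_average:
  assumes v: "v \<in> tempered_distributions" and B: "B \<in> schwartz" and q: "q \<in> schwartz"
  shows "v q * (\<integral>\<xi>. B \<xi> \<partial>lborel) = (\<integral>\<xi>. v (\<lambda>\<eta>. q \<eta> * B (\<eta> - \<xi>)) \<partial>lborel)"
proof -
  define K where "K \<xi> \<eta> = 1 * B (\<eta> - \<xi>) * q \<eta>" for \<xi> \<eta>
  have K: "lip_family K" "dec_family K"
    unfolding K_def[abs_def] using B q
    by (intro product_lip_family product_dec_family schwartz_bounded_smooth bounded_smooth_const; simp)+
  have "(\<integral>\<xi>. K \<xi> \<eta> \<partial>lborel) = (\<integral>\<xi>. B \<xi> \<partial>lborel) * q \<eta>" for \<eta>
  proof -
    have "(\<integral>\<xi>. B \<xi> \<partial>lborel) = (\<integral>\<xi>. B (\<eta> - \<xi>) \<partial>lborel)"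
      by (subst lborel_integral_real_affine[where c = "-1" and t = \<eta>]) simp_all
    then show ?thesis by (simp add: K_def)
  qed
  then have "v (\<lambda>\<eta>. \<integral>\<xi>. K \<xi> \<eta> \<partial>lborel) = (\<integral>\<xi>. B \<xi> \<partial>lborel) * v q"
    by (simp add: temperedD(2)[OF v q])
  then show ?thesis using tempered_integral_exchange(2)[OF v K] by (simp add: K_def[abs_def] mult_ac)
qed

text \<open>The inversion formula, tested against \<open>q\<close>. In \<open>STFT_pairing\<close> let \<open>r\<close> be the product of a translate
  of \<open>q\<close> with the transform of the window. Then the right-hand side is the transform of \<open>u\<close>, applied
  to \<open>q\<close> times a translate of the positive function \<open>\<bar>fourier \<phi>\<bar>\<^sup>2\<close>, and these are averaged over the
  translations.\<close>

lemma STFT_inversion: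
  assumes u: "u \<in> tempered_distributions" and \<phi>: "\<phi> \<in> schwartz" and q: "q \<in> schwartz"
  shows "dist_fourier u q * (\<integral>\<xi>. fourier \<phi> \<xi> * cnj (fourier \<phi> \<xi>) \<partial>lborel)
    = (\<integral>\<xi>. \<integral>x. STFT \<phi> u x \<xi> * fourier (\<lambda>\<eta>. q (\<eta> + \<xi>) * fourier \<phi> \<eta>) x \<partial>lborel \<partial>lborel)"
proof -
  have f: "fourier \<phi> \<in> schwartz" by (rule schwartz_fourier[OF \<phi>])
  have B: "(\<lambda>\<eta>. fourier \<phi> \<eta> * cnj (fourier \<phi> \<eta>)) \<in> schwartz"
    by (intro schwartz_mult f schwartz_bounded_smooth schwartz_cnj(1))
  have r: "(\<lambda>\<eta>. q (\<eta> + \<xi>) * fourier \<phi> \<eta>) \<in> schwartz" for \<xi>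
    using schwartz_mult[OF schwartz_shift[OF q, of "- \<xi>"] schwartz_bounded_smooth[OF f]] by simp
  show ?thesis
    unfolding tempered_translation_average[OF dist_fourier_tempered[OF u] B q] STFT_pairing[OF u \<phi> r]
    by (simp add: mult.assoc)
qed

lemma dec_family_fourier:
  assumes K: "lip_family K" "dec_family K"
  shows "\<exists>C\<ge>0. \<forall>x \<xi>. cmod (fourier (K x) \<xi>) \<le> C * (1 / (1 + x\<^sup>2)) * (1 / (1 + \<xi>\<^sup>2))"
proof -
  obtain L where L: "0 \<le> L" "\<And>j k x t. j \<le> 2 \<Longrightarrow> k \<le> 2 \<Longrightarrow> \<bar>t\<bar> ^ j * cmod (iter_deriv k (K x) t) \<le> L * (1 / (1 + x\<^sup>2))"
    using dec_family_common_bound[OF K(2)] by blast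
  have b: "cmod (iter_deriv k (K x) t) \<le> 2 * (L * (1 / (1 + x\<^sup>2))) * (1 / (1 + t\<^sup>2))" if "k \<le> 2" for k x t
  proof -
    have "(1 + t\<^sup>2) * cmod (iter_deriv k (K x) t) \<le> 2 * (L * (1 / (1 + x\<^sup>2)))"
      using L(2)[of 0 k t x] L(2)[of 2 k t x] that by (simp add: distrib_right)
    then show ?thesis by (simp add: field_simps add_pos_nonneg)
  qed
  have "cmod (fourier (K x) \<xi>) \<le> 2 * pi * (2 * (L * (1 / (1 + x\<^sup>2)))) * (1 / (1 + \<xi>\<^sup>2))" for x \<xi>
    using b[of 0] b[of 2] by (intro fourier_quadratic_decay lip_family_schwartz K) auto
  then show ?thesis using L(1) by (intro exI[of _ "4 * pi * L"]) (auto simp: mult_ac)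
qed

section \<open>Integrability of the Fourier transform on the modulation space\<close>

text \<open>Completeness of \<open>L\<^sup>1\<close> with a rate: the bounds \<open>T\<close> for the differences pass to the distance from
  the limit by Fatou's lemma.\<close>

lemma L1_complete:
  fixes s :: "nat \<Rightarrow> 'a \<Rightarrow> complex"
  assumes int: "\<And>n. integrable M (s n)" and T: "T \<longlonglongrightarrow> 0"
    and c: "\<And>i j. i \<le> j \<Longrightarrow> (\<integral>\<^sup>+x. ennreal (cmod (s i x - s j x)) \<partial>M) \<le> T i"
  obtains H where "integrable M H" "\<And>i. (\<integral>\<^sup>+x. ennreal (cmod (s i x - H x)) \<partial>M) \<le> T i"
proof -
  note [measurable] = borel_measurable_integrable[OF int]
  have eqI: "(\<integral>\<^sup>+x. ennreal (cmod (s i x - s j x)) \<partial>M) = ennreal (\<integral>x. cmod (s i x - s j x) \<partial>M)" for i j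
    by (intro nn_integral_eq_integral integrable_norm Bochner_Integration.integrable_diff int) auto
  have cau: "\<exists>N. \<forall>i\<ge>N. \<forall>j\<ge>N. (\<integral>x. cmod (s i x - s j x) \<partial>M) < e" if e: "0 < e" for e
  proof -
    obtain N where N: "\<And>i. i \<ge> N \<Longrightarrow> T i < ennreal e"
      using order_tendstoD(2)[OF T, of "ennreal e"] e by (auto simp: eventually_sequentially)
    have "(\<integral>x. cmod (s i x - s j x) \<partial>M) < e" if ij: "N \<le> i" "N \<le> j" for i j
    proof -
      have "ennreal (\<integral>x. cmod (s i x - s j x) \<partial>M) < ennreal e"
      proof (cases "i \<le> j")
        case True
        then show ?thesis using c[OF True] N[OF ij(1)] by (simp add: eqI)
      next
        case False
        then have "j \<le> i" by simp
        from c[OF this] show ?thesis using N[OF ij(2)] unfolding eqI[of j i, symmetric] by (simp add: eqI norm_minus_commute)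
      qed
      then show ?thesis using e by (simp add: ennreal_less_iff)
    qed
    then show ?thesis by blast
  qed
  obtain r where r: "strict_mono r" "AE x in M. Cauchy (\<lambda>i. s (r i) x)"
    using cauchy_L1_AE_cauchy_subseq[of M s, OF int cau] by blast
  define H where "H x = lim (\<lambda>i. s (r i) x)" for x
  have [measurable]: "H \<in> borel_measurable M" unfolding H_def[abs_def] by (intro borel_measurable_lim_metric) measurable
  have conv: "AE x in M. (\<lambda>i. s (r i) x) \<longlonglongrightarrow> H x"
    using r(2) by eventually_elim (simp add: H_def Cauchy_convergent convergent_LIMSEQ_iff[symmetric])
  have bnd: "(\<integral>\<^sup>+x. ennreal (cmod (s i x - H x)) \<partial>M) \<le> T i" for i
  proof -
    have "(\<integral>\<^sup>+x. ennreal (cmod (s i x - H x)) \<partial>M) = (\<integral>\<^sup>+x. liminf (\<lambda>j. ennreal (cmod (s i x - s (r j) x))) \<partial>M)"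
    proof (rule nn_integral_cong_AE, use conv in eventually_elim)
      case (elim x)
      then have "(\<lambda>j. ennreal (cmod (s i x - s (r j) x))) \<longlonglongrightarrow> ennreal (cmod (s i x - H x))" by (intro tendsto_intros)
      from lim_imp_Liminf[OF _ this] show ?case by simp
    qed
    also have "\<dots> \<le> liminf (\<lambda>j. \<integral>\<^sup>+x. ennreal (cmod (s i x - s (r j) x)) \<partial>M)"
      by (rule nn_integral_liminf) measurable
    also have "\<dots> \<le> liminf (\<lambda>j. T i)"
    proof (rule Liminf_mono)
      have "eventually (\<lambda>j. i \<le> r j) sequentially"
        using seq_suble[OF r(1)] by (intro eventually_sequentiallyI[of i]) (meson order_trans)
      then show "eventually (\<lambda>j. (\<integral>\<^sup>+x. ennreal (cmod (s i x - s (r j) x)) \<partial>M) \<le> T i) sequentially"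
        by eventually_elim (rule c)
    qed
    also have "\<dots> = T i" by (simp add: Liminf_const)
    finally show ?thesis .
  qed
  obtain n where "T n < ennreal 1" using order_tendstoD(2)[OF T, of "ennreal 1"] by (auto simp: eventually_sequentially)
  then have "T n < \<infinity>" by (rule less_trans) simp
  then have "(\<integral>\<^sup>+x. ennreal (cmod (s n x - H x)) \<partial>M) < \<infinity>" by (rule le_less_trans[OF bnd])
  then have "integrable M (\<lambda>x. s n x - H x)" by (intro integrableI_bounded) auto
  from Bochner_Integration.integrable_diff[OF int[of n] this] have "integrable M H" by simp
  then show ?thesis using bnd that by blast
qed

text \<open>Above the height \<open>A\<close> a lower power of \<open>\<bar>z\<bar>\<close> is dominated by a higher one.\<close>

lemma Lp_pointwise_split:
  assumes "1 \<le> p" "0 < A" shows "cmod z \<le> A + A powr (1 - p) * cmod z powr p"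
proof (cases "cmod z \<le> A")
  case True then show ?thesis by (simp add: add_increasing2)
next
  case False
  then have "cmod z = cmod z powr (1 - p) * cmod z powr p" using assms by (simp flip: powr_add)
  also have "\<dots> \<le> A powr (1 - p) * cmod z powr p"
    using False assms by (intro mult_right_mono powr_mono2') auto
  finally show ?thesis using assms by linarith
qed

text \<open>A case of Hoelder's inequality; the weight is bounded and integrable, so that both summands of
  \<open>Lp_pointwise_split\<close> may be integrated, with \<open>A\<close> the norm of \<open>F\<close>.\<close>

lemma Lp_weighted_integral:
  assumes p: "1 \<le> p" and [measurable]: "F \<in> borel_measurable borel"
  shows "(\<integral>\<^sup>+x. ennreal (cmod (F x) * (1 / (1 + x\<^sup>2))) \<partial>lborel) \<le> ennreal (pi + 1) * Lp_norm p F"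
proof -
  have p0: "0 < p" using p by simp
  have w0: "0 \<le> 1 / (1 + x\<^sup>2)" "1 / (1 + x\<^sup>2) \<le> 1" for x :: real by (auto simp: field_simps add_pos_nonneg)
  show ?thesis
  proof (cases rule: Lp_norm_cases[OF p0, of F, case_names meas infinite zero pos])
    case infinite
    then show ?thesis using pi_gt_zero by (simp add: ennreal_mult_top ennreal_eq_0_iff)
  next
    case zero
    have "(\<integral>\<^sup>+x. ennreal (cmod (F x) * (1 / (1 + x\<^sup>2))) \<partial>lborel) = (\<integral>\<^sup>+x. 0 \<partial>(lborel :: real measure))"
      using zero(2) by (intro nn_integral_cong_AE) auto
    then show ?thesis by simp
  next
    case (pos A)
    have "(\<integral>\<^sup>+x. ennreal (cmod (F x) * (1 / (1 + x\<^sup>2))) \<partial>lborel)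
        \<le> (\<integral>\<^sup>+x. ennreal A * ennreal (1 / (1 + x\<^sup>2)) + ennreal (A powr (1 - p)) * ennreal (cmod (F x) powr p) \<partial>lborel)"
    proof (rule nn_integral_mono)
      fix x :: real
      have "cmod (F x) * (1 / (1 + x\<^sup>2)) \<le> (A + A powr (1 - p) * cmod (F x) powr p) * (1 / (1 + x\<^sup>2))"
        by (intro mult_right_mono Lp_pointwise_split p pos w0)
      also have "\<dots> = A * (1 / (1 + x\<^sup>2)) + A powr (1 - p) * cmod (F x) powr p * (1 / (1 + x\<^sup>2))"
        by (rule distrib_right)
      also have "\<dots> \<le> A * (1 / (1 + x\<^sup>2)) + A powr (1 - p) * cmod (F x) powr p * 1"
        by (intro add_mono order_refl mult_left_mono w0) auto
      finally have "ennreal (cmod (F x) * (1 / (1 + x\<^sup>2))) \<le> ennreal (A * (1 / (1 + x\<^sup>2)) + A powr (1 - p) * cmod (F x) powr p)"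
        by (intro ennreal_leI) simp
      also have "\<dots> = ennreal A * ennreal (1 / (1 + x\<^sup>2)) + ennreal (A powr (1 - p)) * ennreal (cmod (F x) powr p)"
        using pos(1) w0(1)[of x] by (simp add: ennreal_plus ennreal_mult del: times_divide_eq_right mult_1_right)
      finally show "ennreal (cmod (F x) * (1 / (1 + x\<^sup>2))) \<le> ennreal A * ennreal (1 / (1 + x\<^sup>2)) + ennreal (A powr (1 - p)) * ennreal (cmod (F x) powr p)" .
    qed
    also have "\<dots> = ennreal A * (\<integral>\<^sup>+x. ennreal (1 / (1 + x\<^sup>2)) \<partial>lborel) + ennreal (A powr (1 - p)) * ennreal (A powr p)"
      by (simp add: nn_integral_add nn_integral_cmult pos(3))
    also have "(\<integral>\<^sup>+x. ennreal (1 / (1 + x\<^sup>2)) \<partial>(lborel :: real measure)) = ennreal pi"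
      using nn_integral_eq_integral[OF integrable_inverse_quadratic] w0 by (simp add: integral_inverse_quadratic)
    also have "ennreal (A powr (1 - p)) * ennreal (A powr p) = ennreal A"
      using pos(1) by (simp flip: ennreal_mult powr_add)
    also have "ennreal A * ennreal pi + ennreal A = ennreal (pi + 1) * ennreal A"
      using pos(1) by (simp add: distrib_left mult.commute)
    finally show ?thesis by (simp add: pos(2))
  qed auto
qed

lemma Lp_norm_restrict_tendsto:
  assumes p: "1 \<le> p" and [measurable]: "F \<in> borel_measurable borel" and fin: "Lp_norm p F < \<infinity>"
  shows "(\<lambda>n. Lp_norm p (\<lambda>x. indicator {x. real n < \<bar>x\<bar>} x * F x)) \<longlonglongrightarrow> 0"
proof (rule Lp_norm_dominated_tendsto[OF _ _ _ fin])
  show "(\<lambda>n. indicator {x. real n < \<bar>x\<bar>} x * F x) \<longlonglongrightarrow> 0" for x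
  proof (rule tendsto_eventually)
    have "eventually (\<lambda>n. \<bar>x\<bar> < real n) sequentially" by real_asymp
    then show "eventually (\<lambda>n. indicator {x. real n < \<bar>x\<bar>} x * F x = 0) sequentially"
      by eventually_elim (simp add: indicator_def)
  qed
qed (use p in \<open>auto simp: indicator_def\<close>)

lemma Lp_locally_integrable:
  assumes p: "1 \<le> p" and [measurable]: "F \<in> borel_measurable borel" and fin: "Lp_norm p F < \<infinity>"
  shows "integrable lborel (\<lambda>x. indicator {- real n..real n} x * F x)"
proof (rule integrableI_bounded)
  define M where "M = 1 + (real n)\<^sup>2"
  have M0: "0 \<le> M" by (simp add: M_def)
  have "cmod (indicator {- real n..real n} x * F x) \<le> M * (cmod (F x) * (1 / (1 + x\<^sup>2)))" for x
  proof (cases "x \<in> {- real n..real n}")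
    case True
    then have "x\<^sup>2 \<le> (real n)\<^sup>2" by (intro power2_le_iff_abs_le[THEN iffD2]) auto
    then have "cmod (F x) * (1 + x\<^sup>2) \<le> cmod (F x) * (1 + (real n)\<^sup>2)" by (intro mult_left_mono) auto
    then show ?thesis using True by (simp add: M_def field_simps add_pos_nonneg)
  qed (simp add: M0)
  then have "(\<integral>\<^sup>+x. ennreal (cmod (indicator {- real n..real n} x * F x)) \<partial>lborel)
     \<le> (\<integral>\<^sup>+x. ennreal M * ennreal (cmod (F x) * (1 / (1 + x\<^sup>2))) \<partial>lborel)"
    using M0 by (intro nn_integral_mono) (simp flip: ennreal_mult del: times_divide_eq_right mult_1_right add: ennreal_leI)
  also have "\<dots> = ennreal M * (\<integral>\<^sup>+x. ennreal (cmod (F x) * (1 / (1 + x\<^sup>2))) \<partial>lborel)"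
    by (rule nn_integral_cmult) measurable
  also have "\<dots> \<le> ennreal M * (ennreal (pi + 1) * Lp_norm p F)"
    by (intro mult_left_mono Lp_weighted_integral p) auto
  also have "\<dots> < \<infinity>" using fin by (simp add: ennreal_mult_less_top)
  finally show "(\<integral>\<^sup>+x. ennreal (cmod (indicator {- real n..real n} x * F x)) \<partial>lborel) < \<infinity>" .
qed measurable

lemma Lp_norm_measurable:
  assumes [measurable]: "(\<lambda>(x, \<xi>). V x \<xi>) \<in> borel_measurable (borel \<Otimes>\<^sub>M borel)"
  shows "(\<lambda>\<xi>. Lp_norm p (\<lambda>x. V x \<xi>)) \<in> borel_measurable borel"
  unfolding Lp_norm_def by measurable

lemma schwartz_weight_finite:
  assumes "f \<in> schwartz"
  shows "(\<integral>\<^sup>+\<eta>. ennreal (cmod (f \<eta>)) \<partial>lborel) + pi + (\<integral>\<^sup>+\<eta>. ennreal ((cmod (f \<eta>))\<^sup>2) \<partial>lborel) < \<infinity>"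
proof -
  obtain B where B: "0 \<le> B" "\<And>x. cmod (f x) \<le> B" using schwartz_bounded[OF assms] by blast
  have [measurable]: "f \<in> borel_measurable borel" by (rule schwartz_measurable[OF assms])
  have 1: "(\<integral>\<^sup>+\<eta>. ennreal (cmod (f \<eta>)) \<partial>lborel) < \<infinity>"
    using schwartz_integrable[OF assms] by (simp add: integrable_iff_bounded)
  have "(\<integral>\<^sup>+\<eta>. ennreal ((cmod (f \<eta>))\<^sup>2) \<partial>lborel) \<le> (\<integral>\<^sup>+\<eta>. ennreal B * ennreal (cmod (f \<eta>)) \<partial>lborel)"
    using B by (intro nn_integral_mono) (auto simp: power2_eq_square simp flip: ennreal_mult intro!: ennreal_leI mult_right_mono)
  also have "\<dots> < \<infinity>" using 1 by (simp add: nn_integral_cmult ennreal_mult_less_top)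
  finally show ?thesis using 1 by simp
qed

text \<open>The inversion formula of the short-time Fourier transform synthesises the transform of \<open>u\<close> from
  the Fourier transforms of the slices \<open>V(\<sqdot>,\<xi>)\<close>, each translated and multiplied by the window \<open>\<gamma>\<close>.
  The slices are only \<open>L\<^sup>p\<close> functions and are truncated to \<open>[-n, n]\<close>, which makes them integrable.
  The weighted Hausdorff--Young inequality controls the synthesised functions \<open>h n\<close> in \<open>L\<^sup>1\<close> by the
  \<open>L\<^sup>p\<close> norms of the slices, so that the \<open>h n\<close> form a Cauchy sequence, and their limit has the same
  pairings with bounded functions \<open>q\<close> as the formal synthesis. The decay assumed of the transforms
  of \<open>q(\<sqdot> + \<xi>) \<gamma>\<close> makes the formal synthesis absolutely convergent.\<close>

lemma synthesis_L1_limit: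
  fixes V :: "real \<Rightarrow> real \<Rightarrow> complex"
  assumes p: "1 \<le> p" "p \<le> 2"
    and V [measurable]: "(\<lambda>(x, \<xi>). V x \<xi>) \<in> borel_measurable (borel \<Otimes>\<^sub>M borel)"
    and N: "(\<integral>\<^sup>+\<xi>. Lp_norm p (\<lambda>x. V x \<xi>) \<partial>lborel) < \<infinity>"
    and \<gamma>: "\<gamma> \<in> schwartz"
  obtains H where "integrable lborel H"
    "\<And>q C D. q \<in> borel_measurable borel \<Longrightarrow> (\<And>\<eta>. cmod (q \<eta>) \<le> D) \<Longrightarrow>
       (\<And>x \<xi>. cmod (fourier (\<lambda>\<eta>. q (\<eta> + \<xi>) * \<gamma> \<eta>) x) \<le> C * (1 / (1 + x\<^sup>2))) \<Longrightarrow>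
       (\<integral>\<eta>. H \<eta> * q \<eta> \<partial>lborel) = (\<integral>\<xi>. \<integral>x. V x \<xi> * fourier (\<lambda>\<eta>. q (\<eta> + \<xi>) * \<gamma> \<eta>) x \<partial>lborel \<partial>lborel)"
proof -
  have p0: "0 < p" using p by simp
  have \<gamma>i: "integrable lborel \<gamma>" by (rule schwartz_integrable[OF \<gamma>])
  have [measurable]: "\<gamma> \<in> borel_measurable borel" by (rule schwartz_measurable[OF \<gamma>])
  define nV where "nV \<xi> = Lp_norm p (\<lambda>x. V x \<xi>)" for \<xi>
  have nV_meas [measurable]: "nV \<in> borel_measurable borel" unfolding nV_def by (rule Lp_norm_measurable[OF V])
  \<comment> \<open>slices of infinite norm occur only on a null set and are replaced by zero\<close>
  define good where "good = {\<xi>. nV \<xi> < \<infinity>}"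
  have [measurable]: "good \<in> sets borel" unfolding good_def by measurable
  have AE_good: "AE \<xi> in lborel. \<xi> \<in> good"
    using nn_integral_PInf_AE[of nV lborel] N unfolding nV_def[symmetric] good_def
    by (auto simp: less_top infinity_ennreal_def)
  define F where "F n \<xi> x = indicator {- real n..real n} x * (indicator good \<xi> * V x \<xi>)" for n \<xi> x
  have F_meas [measurable]: "(\<lambda>(\<xi>, x). F n \<xi> x) \<in> borel_measurable (borel \<Otimes>\<^sub>M borel)" for n
    unfolding F_def by measurable
  have F_meas1 [measurable]: "F n \<xi> \<in> borel_measurable borel" for n \<xi> unfolding F_def[abs_def] by measurable
  have gV_fin: "Lp_norm p (\<lambda>x. indicator good \<xi> * V x \<xi>) < \<infinity>" for \<xi>
  proof (cases "\<xi> \<in> good")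
    case True then show ?thesis by (simp add: good_def nV_def)
  next
    case False then show ?thesis using p0 by (simp add: Lp_norm_def ennreal_root_def)
  qed
  have Fi: "integrable lborel (F n \<xi>)" for n \<xi>
    unfolding F_def by (rule Lp_locally_integrable[OF p(1) _ gV_fin]) measurable
  \<comment> \<open>the contribution of the slice at \<open>\<xi>\<close> to the synthesis, at the frequency \<open>\<eta>\<close>\<close>
  define m where "m n \<xi> \<eta> = fourier (F n \<xi>) (\<eta> - \<xi>) * \<gamma> (\<eta> - \<xi>)" for n \<xi> \<eta>
  have m_meas [measurable]: "(\<lambda>(\<xi>, \<eta>). m n \<xi> \<eta>) \<in> borel_measurable (borel \<Otimes>\<^sub>M borel)" for n
    unfolding m_def fourier_def by measurable
  define C\<gamma> where "C\<gamma> = (\<integral>\<^sup>+\<eta>. ennreal (cmod (\<gamma> \<eta>)) \<partial>lborel) + pi + (\<integral>\<^sup>+\<eta>. ennreal ((cmod (\<gamma> \<eta>))\<^sup>2) \<partial>lborel)"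
  have C\<gamma>: "C\<gamma> < \<infinity>" unfolding C\<gamma>_def by (rule schwartz_weight_finite[OF \<gamma>])
  have HY: "(\<integral>\<^sup>+\<eta>. ennreal (cmod (fourier f (\<eta> - \<xi>) * \<gamma> (\<eta> - \<xi>))) \<partial>lborel) \<le> C\<gamma> * Lp_norm p f" if f: "integrable lborel f" for f \<xi>
  proof -
    have [measurable]: "f \<in> borel_measurable borel" using f by auto
    have "(\<integral>\<^sup>+\<eta>. ennreal (cmod (fourier f (\<eta> - \<xi>) * \<gamma> (\<eta> - \<xi>))) \<partial>lborel) = (\<integral>\<^sup>+\<eta>. ennreal (cmod (fourier f \<eta>) * cmod (\<gamma> \<eta>)) \<partial>lborel)"
      by (subst nn_integral_lborel_shift[of "\<lambda>\<eta>. ennreal (cmod (fourier f \<eta> * \<gamma> \<eta>))"]) (auto simp: norm_mult)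
    also have "\<dots> \<le> C\<gamma> * Lp_norm p f"
      unfolding C\<gamma>_def by (rule weighted_hausdorff_young[OF p f]) auto
    finally show ?thesis .
  qed
  define tail where "tail n \<xi> = Lp_norm p (\<lambda>x. indicator {x. real n < \<bar>x\<bar>} x * (indicator good \<xi> * V x \<xi>))" for n \<xi>
  have tail_meas [measurable]: "tail n \<in> borel_measurable borel" for n
    unfolding tail_def by (rule Lp_norm_measurable) measurable
  have tail_le: "tail n \<xi> \<le> nV \<xi>" for n \<xi>
    unfolding tail_def nV_def using p0 by (intro Lp_norm_mono_AE) (auto simp: indicator_def)
  have F_le: "Lp_norm p (F n \<xi>) \<le> nV \<xi>" for n \<xi>
    unfolding F_def[abs_def] nV_def using p0 by (intro Lp_norm_mono_AE) (auto simp: indicator_def)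
  have F_diff: "Lp_norm p (\<lambda>x. F i \<xi> x - F j \<xi> x) \<le> tail i \<xi>" if "i \<le> j" for i j \<xi>
    unfolding F_def tail_def using that p0 by (intro Lp_norm_mono_AE) (auto simp: indicator_def abs_le_iff not_le)
  \<comment> \<open>the rate of convergence: the total norm of what the truncation cuts off\<close>
  define T where "T n = C\<gamma> * (\<integral>\<^sup>+\<xi>. tail n \<xi> \<partial>lborel)" for n
  have T: "T \<longlonglongrightarrow> 0"
  proof -
    have "(\<lambda>n. \<integral>\<^sup>+\<xi>. tail n \<xi> \<partial>lborel) \<longlonglongrightarrow> (\<integral>\<^sup>+\<xi>. 0 \<partial>(lborel :: real measure))"
    proof (rule nn_integral_dominated_convergence)
      show "(\<integral>\<^sup>+\<xi>. nV \<xi> \<partial>lborel) < \<infinity>" using N by (simp add: nV_def)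
      show "AE \<xi> in lborel. (\<lambda>n. tail n \<xi>) \<longlonglongrightarrow> 0"
        unfolding tail_def by (intro AE_I2 Lp_norm_restrict_tendsto[OF p(1) _ gV_fin]) measurable
    qed (use tail_le in auto)
    from ennreal_tendsto_cmult[OF _ this, of C\<gamma>] show ?thesis unfolding T_def using C\<gamma> by simp
  qed
  have mi: "integrable (lborel \<Otimes>\<^sub>M lborel) (\<lambda>(\<xi>, \<eta>). m n \<xi> \<eta>)" for n
  proof (rule integrableI_bounded)
    have "(\<integral>\<^sup>+z. ennreal (norm (case z of (\<xi>, \<eta>) \<Rightarrow> m n \<xi> \<eta>)) \<partial>(lborel \<Otimes>\<^sub>M lborel)) = (\<integral>\<^sup>+\<xi>. \<integral>\<^sup>+\<eta>. ennreal (cmod (m n \<xi> \<eta>)) \<partial>lborel \<partial>lborel)"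
      by (subst lborel.nn_integral_fst[symmetric]) (auto simp: split_beta)
    also have "\<dots> \<le> (\<integral>\<^sup>+\<xi>. C\<gamma> * nV \<xi> \<partial>lborel)"
      unfolding m_def by (intro nn_integral_mono order_trans[OF HY[OF Fi]] mult_left_mono F_le) auto
    also have "\<dots> < \<infinity>" using N C\<gamma> by (simp add: nn_integral_cmult nV_def[symmetric] ennreal_mult_less_top)
    finally show "(\<integral>\<^sup>+z. ennreal (norm (case z of (\<xi>, \<eta>) \<Rightarrow> m n \<xi> \<eta>)) \<partial>(lborel \<Otimes>\<^sub>M lborel)) < \<infinity>" .
  qed (simp add: m_meas)
  define h where "h n \<eta> = (\<integral>\<xi>. m n \<xi> \<eta> \<partial>lborel)" for n \<eta>
  have hi: "integrable lborel (h n)" for n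
    unfolding h_def using lborel_pair.integrable_snd[OF mi[of n]] by simp
  have h_cauchy: "(\<integral>\<^sup>+\<eta>. ennreal (cmod (h i \<eta> - h j \<eta>)) \<partial>lborel) \<le> T i" if "i \<le> j" for i j
  proof -
    have mAE: "AE \<eta> in lborel. integrable lborel (\<lambda>\<xi>. m n \<xi> \<eta>)" for n
      using lborel_pair.AE_integrable_snd[OF mi[of n]] by simp
    have "(\<integral>\<^sup>+\<eta>. ennreal (cmod (h i \<eta> - h j \<eta>)) \<partial>lborel) \<le> (\<integral>\<^sup>+\<eta>. \<integral>\<^sup>+\<xi>. ennreal (cmod (m i \<xi> \<eta> - m j \<xi> \<eta>)) \<partial>lborel \<partial>lborel)"
    proof (rule nn_integral_mono_AE, use mAE[of i] mAE[of j] in eventually_elim)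
      case (elim \<eta>)
      have "h i \<eta> - h j \<eta> = (\<integral>\<xi>. m i \<xi> \<eta> - m j \<xi> \<eta> \<partial>lborel)" using elim by (simp add: h_def)
      then show ?case by (simp only:) (rule integral_norm_bound_ennreal, use elim in simp)
    qed
    also have "\<dots> = (\<integral>\<^sup>+\<xi>. \<integral>\<^sup>+\<eta>. ennreal (cmod (m i \<xi> \<eta> - m j \<xi> \<eta>)) \<partial>lborel \<partial>lborel)"
      by (rule lborel_pair.Fubini') measurable
    also have "\<dots> \<le> (\<integral>\<^sup>+\<xi>. C\<gamma> * tail i \<xi> \<partial>lborel)"
    proof (rule nn_integral_mono)
      fix \<xi>
      have "m i \<xi> \<eta> - m j \<xi> \<eta> = fourier (\<lambda>x. F i \<xi> x - F j \<xi> x) (\<eta> - \<xi>) * \<gamma> (\<eta> - \<xi>)" for \<eta>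
        unfolding m_def fourier_def using fourier_integrand_integrable[OF Fi] by (simp add: left_diff_distrib)
      then have "(\<integral>\<^sup>+\<eta>. ennreal (cmod (m i \<xi> \<eta> - m j \<xi> \<eta>)) \<partial>lborel) \<le> C\<gamma> * Lp_norm p (\<lambda>x. F i \<xi> x - F j \<xi> x)"
        using HY[OF Bochner_Integration.integrable_diff[OF Fi Fi]] by simp
      also have "\<dots> \<le> C\<gamma> * tail i \<xi>" by (intro mult_left_mono F_diff that) auto
      finally show "(\<integral>\<^sup>+\<eta>. ennreal (cmod (m i \<xi> \<eta> - m j \<xi> \<eta>)) \<partial>lborel) \<le> C\<gamma> * tail i \<xi>" .
    qed
    also have "\<dots> = T i" by (simp add: T_def nn_integral_cmult)
    finally show ?thesis .
  qed
  obtain H where H: "integrable lborel H" "\<And>i. (\<integral>\<^sup>+\<eta>. ennreal (cmod (h i \<eta> - H \<eta>)) \<partial>lborel) \<le> T i"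
    using L1_complete[OF hi T h_cauchy] by blast
  show ?thesis
  proof (rule that[OF H(1)])
    fix q C D
    assume q [measurable]: "q \<in> borel_measurable borel" and D: "\<And>\<eta>. cmod (q \<eta>) \<le> D"
      and C: "\<And>x \<xi>. cmod (fourier (\<lambda>\<eta>. q (\<eta> + \<xi>) * \<gamma> \<eta>) x) \<le> C * (1 / (1 + x\<^sup>2))"
    define a where "a \<xi> x = fourier (\<lambda>\<eta>. q (\<eta> + \<xi>) * \<gamma> \<eta>) x" for \<xi> x
    have a_meas [measurable]: "(\<lambda>(\<xi>, x). a \<xi> x) \<in> borel_measurable (borel \<Otimes>\<^sub>M borel)"
      unfolding a_def fourier_def by measurable
    have D0: "0 \<le> D" using order_trans[OF norm_ge_zero D] .
    have C0: "0 \<le> C" using C[of 0 0] by (simp add: order_trans[OF norm_ge_zero])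
    have h_eq: "(\<integral>\<eta>. h n \<eta> * q \<eta> \<partial>lborel) = (\<integral>\<xi>. \<integral>x. F n \<xi> x * a \<xi> x \<partial>lborel \<partial>lborel)" for n
    proof -
      have mqi: "integrable (lborel \<Otimes>\<^sub>M lborel) (\<lambda>(\<xi>, \<eta>). m n \<xi> \<eta> * q \<eta>)"
        using integrable_mult_bounded(1)[OF mi[of n], of "\<lambda>(\<xi>, \<eta>). q \<eta>" D] D by (simp add: case_prod_unfold)
      have "(\<integral>\<eta>. h n \<eta> * q \<eta> \<partial>lborel) = (\<integral>\<eta>. \<integral>\<xi>. m n \<xi> \<eta> * q \<eta> \<partial>lborel \<partial>lborel)"
        by (simp add: h_def)
      also have "\<dots> = (\<integral>\<xi>. \<integral>\<eta>. m n \<xi> \<eta> * q \<eta> \<partial>lborel \<partial>lborel)"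
        by (rule lborel_pair.Fubini_integral[OF mqi])
      also have "\<dots> = (\<integral>\<xi>. \<integral>x. F n \<xi> x * a \<xi> x \<partial>lborel \<partial>lborel)"
      proof (rule Bochner_Integration.integral_cong[OF refl])
        fix \<xi>
        have "(\<integral>\<eta>. m n \<xi> \<eta> * q \<eta> \<partial>lborel) = (\<integral>\<eta>. fourier (F n \<xi>) \<eta> * (q (\<eta> + \<xi>) * \<gamma> \<eta>) \<partial>lborel)"
          by (subst lborel_integral_real_affine[where c = 1 and t = \<xi>]) (auto simp: m_def mult_ac add.commute)
        also have "\<dots> = (\<integral>x. F n \<xi> x * a \<xi> x \<partial>lborel)"
          unfolding a_def using D by (intro fourier_multiplication_formula[OF Fi] integrable_mult_bounded(2)[OF \<gamma>i]) auto
        finally show "(\<integral>\<eta>. m n \<xi> \<eta> * q \<eta> \<partial>lborel) = (\<integral>x. F n \<xi> x * a \<xi> x \<partial>lborel)" .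
      qed
      finally show ?thesis .
    qed
    \<comment> \<open>both sides of \<open>h_eq\<close> converge, the left-hand side in \<open>L\<^sup>1\<close> and the right-hand side by
      dominated convergence\<close>
    have lim1: "(\<lambda>n. \<integral>\<eta>. h n \<eta> * q \<eta> \<partial>lborel) \<longlonglongrightarrow> (\<integral>\<eta>. H \<eta> * q \<eta> \<partial>lborel)"
    proof -
      have le: "ennreal (cmod ((\<integral>\<eta>. h n \<eta> * q \<eta> \<partial>lborel) - (\<integral>\<eta>. H \<eta> * q \<eta> \<partial>lborel))) \<le> ennreal D * T n" for n
      proof -
        have [measurable]: "h n \<in> borel_measurable borel" "H \<in> borel_measurable borel" using hi[of n] H(1) by auto
        have i: "integrable lborel (\<lambda>\<eta>. h n \<eta> * q \<eta>)" "integrable lborel (\<lambda>\<eta>. H \<eta> * q \<eta>)"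
          using D by (auto intro!: integrable_mult_bounded(1)[OF hi] integrable_mult_bounded(1)[OF H(1)])
        have "(\<integral>\<eta>. h n \<eta> * q \<eta> \<partial>lborel) - (\<integral>\<eta>. H \<eta> * q \<eta> \<partial>lborel) = (\<integral>\<eta>. h n \<eta> * q \<eta> - H \<eta> * q \<eta> \<partial>lborel)"
          using i by simp
        also have "ennreal (cmod \<dots>) \<le> (\<integral>\<^sup>+\<eta>. ennreal (cmod (h n \<eta> * q \<eta> - H \<eta> * q \<eta>)) \<partial>lborel)"
          using i by (intro integral_norm_bound_ennreal) auto
        also have "\<dots> \<le> (\<integral>\<^sup>+\<eta>. ennreal D * ennreal (cmod (h n \<eta> - H \<eta>)) \<partial>lborel)"
        proof (rule nn_integral_mono)
          fix \<eta>
          have "cmod (h n \<eta> * q \<eta> - H \<eta> * q \<eta>) = cmod (q \<eta>) * cmod (h n \<eta> - H \<eta>)"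
            by (simp flip: left_diff_distrib add: norm_mult)
          also have "\<dots> \<le> D * cmod (h n \<eta> - H \<eta>)" by (intro mult_right_mono D) auto
          finally show "ennreal (cmod (h n \<eta> * q \<eta> - H \<eta> * q \<eta>)) \<le> ennreal D * ennreal (cmod (h n \<eta> - H \<eta>))"
            using D0 by (simp flip: ennreal_mult add: ennreal_leI)
        qed
        also have "\<dots> = ennreal D * (\<integral>\<^sup>+\<eta>. ennreal (cmod (h n \<eta> - H \<eta>)) \<partial>lborel)" by (rule nn_integral_cmult) measurable
        also have "\<dots> \<le> ennreal D * T n" by (intro mult_left_mono H(2)) auto
        finally show ?thesis .
      qed
      have "(\<lambda>n. ennreal D * T n) \<longlonglongrightarrow> 0"
        using ennreal_tendsto_cmult[OF _ T, of "ennreal D"] by simp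
      then have "(\<lambda>n. ennreal (cmod ((\<integral>\<eta>. h n \<eta> * q \<eta> \<partial>lborel) - (\<integral>\<eta>. H \<eta> * q \<eta> \<partial>lborel)))) \<longlonglongrightarrow> 0"
        by (rule tendsto_sandwich[OF always_eventually always_eventually tendsto_const, rotated 2]) (use le in simp_all)
      then have "(\<lambda>n. cmod ((\<integral>\<eta>. h n \<eta> * q \<eta> \<partial>lborel) - (\<integral>\<eta>. H \<eta> * q \<eta> \<partial>lborel))) \<longlonglongrightarrow> 0"
        by (simp add: ennreal_tendsto_0_iff)
      from LIM_zero_cancel[OF tendsto_norm_zero_cancel[OF this]] show ?thesis .
    qed
    have Vw: "(\<integral>\<^sup>+x. ennreal (cmod (V x \<xi>) * (1 / (1 + x\<^sup>2))) \<partial>lborel) \<le> ennreal (pi + 1) * nV \<xi>" for \<xi>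
      unfolding nV_def by (rule Lp_weighted_integral[OF p(1)]) measurable
    have Vwi: "integrable lborel (\<lambda>x. C * (cmod (V x \<xi>) * (1 / (1 + x\<^sup>2))))" if "\<xi> \<in> good" for \<xi>
    proof (intro integrable_mult_right integrableI_bounded)
      have "(\<integral>\<^sup>+x. ennreal (norm (cmod (V x \<xi>) * (1 / (1 + x\<^sup>2)))) \<partial>lborel) \<le> ennreal (pi + 1) * nV \<xi>"
        using Vw[of \<xi>] by (simp add: abs_mult)
      also have "\<dots> < \<infinity>" using that by (simp add: good_def ennreal_mult_less_top)
      finally show "(\<integral>\<^sup>+x. ennreal (norm (cmod (V x \<xi>) * (1 / (1 + x\<^sup>2)))) \<partial>lborel) < \<infinity>" .
    qed measurable
    have pointw: "cmod (F n \<xi> x * a \<xi> x) \<le> C * (cmod (V x \<xi>) * (1 / (1 + x\<^sup>2)))" for n \<xi> x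
    proof -
      have "cmod (F n \<xi> x * a \<xi> x) \<le> cmod (V x \<xi>) * (C * (1 / (1 + x\<^sup>2)))"
        unfolding norm_mult a_def by (intro mult_mono C) (auto simp: F_def indicator_def norm_mult)
      then show ?thesis by (simp add: mult_ac)
    qed
    have lim2: "(\<lambda>n. \<integral>\<xi>. \<integral>x. F n \<xi> x * a \<xi> x \<partial>lborel \<partial>lborel) \<longlonglongrightarrow> (\<integral>\<xi>. \<integral>x. V x \<xi> * a \<xi> x \<partial>lborel \<partial>lborel)"
    proof (rule integral_dominated_convergence)
      show "integrable lborel (\<lambda>\<xi>. C * ((pi + 1) * enn2real (nV \<xi>)))"
      proof (intro integrable_mult_right integrableI_bounded)
        have "(\<integral>\<^sup>+\<xi>. ennreal (norm (enn2real (nV \<xi>))) \<partial>lborel) \<le> (\<integral>\<^sup>+\<xi>. nV \<xi> \<partial>lborel)"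
          by (intro nn_integral_mono) (simp add: ennreal_enn2real_if)
        also have "\<dots> < \<infinity>" using N by (simp add: nV_def)
        finally show "(\<integral>\<^sup>+\<xi>. ennreal (norm (enn2real (nV \<xi>))) \<partial>lborel) < \<infinity>" .
      qed measurable
      show "AE \<xi> in lborel. (\<lambda>n. \<integral>x. F n \<xi> x * a \<xi> x \<partial>lborel) \<longlonglongrightarrow> (\<integral>x. V x \<xi> * a \<xi> x \<partial>lborel)"
        using AE_good
      proof eventually_elim
        case (elim \<xi>)
        show ?case
        proof (rule integral_dominated_convergence[OF _ _ Vwi[OF elim]])
          have "eventually (\<lambda>n. F n \<xi> x * a \<xi> x = V x \<xi> * a \<xi> x) sequentially" for x
          proof -
            have "eventually (\<lambda>n. \<bar>x\<bar> \<le> real n) sequentially" by real_asymp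
            then show ?thesis by eventually_elim (use elim in \<open>auto simp: F_def indicator_def\<close>)
          qed
          then show "AE x in lborel. (\<lambda>n. F n \<xi> x * a \<xi> x) \<longlonglongrightarrow> V x \<xi> * a \<xi> x"
            by (intro AE_I2 tendsto_eventually)
        qed (use pointw in auto)
      qed
      show "AE \<xi> in lborel. norm (\<integral>x. F n \<xi> x * a \<xi> x \<partial>lborel) \<le> C * ((pi + 1) * enn2real (nV \<xi>))" for n
        using AE_good
      proof eventually_elim
        case (elim \<xi>)
        have "ennreal (norm (\<integral>x. F n \<xi> x * a \<xi> x \<partial>lborel)) \<le> (\<integral>\<^sup>+x. ennreal (norm (F n \<xi> x * a \<xi> x)) \<partial>lborel)"
        proof (rule integral_norm_bound_ennreal, rule Bochner_Integration.integrable_bound[OF Vwi[OF elim]])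
          show "AE x in lborel. norm (F n \<xi> x * a \<xi> x) \<le> norm (C * (cmod (V x \<xi>) * (1 / (1 + x\<^sup>2))))"
            unfolding real_norm_def by (intro AE_I2 order_trans[OF pointw abs_ge_self])
        qed measurable
        also have "\<dots> \<le> (\<integral>\<^sup>+x. ennreal C * ennreal (cmod (V x \<xi>) * (1 / (1 + x\<^sup>2))) \<partial>lborel)"
          using pointw C0 by (intro nn_integral_mono) (simp flip: ennreal_mult del: times_divide_eq_right mult_1_right add: ennreal_leI)
        also have "\<dots> = ennreal C * (\<integral>\<^sup>+x. ennreal (cmod (V x \<xi>) * (1 / (1 + x\<^sup>2))) \<partial>lborel)"
          by (rule nn_integral_cmult) measurable
        also have "\<dots> \<le> ennreal C * (ennreal (pi + 1) * nV \<xi>)" by (intro mult_left_mono Vw) auto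
        also have "\<dots> = ennreal (C * ((pi + 1) * enn2real (nV \<xi>)))"
          using elim C0 by (simp add: good_def ennreal_mult ennreal_enn2real_if less_top[symmetric])
        finally show ?case using C0 by (simp add: ennreal_le_iff)
      qed
    qed measurable
    show "(\<integral>\<eta>. H \<eta> * q \<eta> \<partial>lborel) = (\<integral>\<xi>. \<integral>x. V x \<xi> * fourier (\<lambda>\<eta>. q (\<eta> + \<xi>) * \<gamma> \<eta>) x \<partial>lborel \<partial>lborel)"
      using LIMSEQ_unique[OF lim1 lim2[folded h_eq]] by (simp add: a_def)
  qed
qed

text \<open>The integrand is nonnegative; if its integral were zero, then the transform of \<open>\<phi>\<close> would vanish
  almost everywhere and \<open>\<phi>\<close> itself by inversion.\<close>

lemma fourier_square_integral_nonzero: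
  assumes \<phi>: "\<phi> \<in> schwartz" "\<phi> \<noteq> (\<lambda>x. 0)"
  shows "(\<integral>\<xi>. fourier \<phi> \<xi> * cnj (fourier \<phi> \<xi>) \<partial>lborel) \<noteq> 0"
proof
  let ?f = "fourier \<phi>"
  have f: "?f \<in> schwartz" by (rule schwartz_fourier[OF \<phi>(1)])
  assume "(\<integral>\<xi>. ?f \<xi> * cnj (?f \<xi>) \<partial>lborel) = 0"
  moreover have eq: "?f \<xi> * cnj (?f \<xi>) = of_real ((cmod (?f \<xi>))\<^sup>2)" for \<xi> using complex_norm_square by metis
  ultimately have "complex_of_real (\<integral>\<xi>. (cmod (?f \<xi>))\<^sup>2 \<partial>lborel) = 0"
    by (simp only: eq integral_complex_of_real)
  then have "(\<integral>\<xi>. (cmod (?f \<xi>))\<^sup>2 \<partial>lborel) = 0" by (simp only: of_real_eq_0_iff)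
  moreover have "integrable lborel (\<lambda>\<xi>. (cmod (?f \<xi>))\<^sup>2)"
    using schwartz_integrable[OF schwartz_mult[OF f schwartz_bounded_smooth[OF schwartz_cnj(1)[OF f]]]]
    unfolding eq by (simp only: complex_of_real_integrable_eq)
  ultimately have "AE \<xi> in lborel. (cmod (?f \<xi>))\<^sup>2 = 0"
    by (subst integral_nonneg_eq_0_iff_AE[symmetric]) auto
  then have "AE \<xi> in lborel. ?f \<xi> = 0" by simp
  then have "\<phi> (- x) = 0" for x
    using fourier_AE_zero[of ?f x] schwartz_fourier_inversion[OF \<phi>(1), of x] by simp
  from this[of "- x" for x] show False using \<phi>(2) by auto
qed

text \<open>The product is small in every Schwartz seminorm when the translation is large, since then one of
  the factors is small.\<close>

lemma translated_product_fourier_decay: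
  assumes q: "q \<in> schwartz" and \<gamma>: "\<gamma> \<in> schwartz"
  shows "\<exists>C\<ge>0. \<forall>x \<xi>. cmod (fourier (\<lambda>\<eta>. \<gamma> \<eta> * q (\<eta> - x)) \<xi>) \<le> C * (1 / (1 + x\<^sup>2)) * (1 / (1 + \<xi>\<^sup>2))"
proof -
  have "lip_family (\<lambda>x \<eta>. 1 * q (\<eta> - x) * \<gamma> \<eta>)" "dec_family (\<lambda>x \<eta>. 1 * q (\<eta> - x) * \<gamma> \<eta>)"
    using q \<gamma> by (intro product_lip_family product_dec_family schwartz_bounded_smooth bounded_smooth_const; simp)+
  from dec_family_fourier[OF this] show ?thesis by (simp add: mult.commute)
qed

text \<open>The synthesised function and the transform of \<open>u\<close> satisfy the same inversion formula, up to the
  nonzero constant of \<open>STFT_inversion\<close>.\<close>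

lemma modulation_fourier_L1:
  assumes p: "1 \<le> p" "p \<le> 2" and \<phi>: "\<phi> \<in> schwartz" "\<phi> \<noteq> (\<lambda>x. 0)" and u: "u \<in> modulation_space \<phi> p"
  obtains H where "integrable lborel H" "\<And>q. q \<in> schwartz \<Longrightarrow> dist_fourier u q = (\<integral>\<eta>. H \<eta> * q \<eta> \<partial>lborel)"
proof -
  have ut: "u \<in> tempered_distributions" and fin: "(\<integral>\<^sup>+\<xi>. Lp_norm p (\<lambda>x. STFT \<phi> u x \<xi>) \<partial>lborel) < \<infinity>"
    using u by (auto simp: modulation_space_def modulation_norm_def)
  have f: "fourier \<phi> \<in> schwartz" by (rule schwartz_fourier[OF \<phi>(1)])
  define c where "c = (\<integral>\<xi>. fourier \<phi> \<xi> * cnj (fourier \<phi> \<xi>) \<partial>lborel)"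
  have c: "c \<noteq> 0" unfolding c_def by (rule fourier_square_integral_nonzero[OF \<phi>])
  obtain H where H: "integrable lborel H"
    "\<And>q C D. q \<in> borel_measurable borel \<Longrightarrow> (\<And>\<eta>. cmod (q \<eta>) \<le> D) \<Longrightarrow>
       (\<And>x \<xi>. cmod (fourier (\<lambda>\<eta>. q (\<eta> + \<xi>) * fourier \<phi> \<eta>) x) \<le> C * (1 / (1 + x\<^sup>2))) \<Longrightarrow>
       (\<integral>\<eta>. H \<eta> * q \<eta> \<partial>lborel) = (\<integral>\<xi>. \<integral>x. STFT \<phi> u x \<xi> * fourier (\<lambda>\<eta>. q (\<eta> + \<xi>) * fourier \<phi> \<eta>) x \<partial>lborel \<partial>lborel)"
    using synthesis_L1_limit[OF p STFT_measurable[OF ut \<phi>(1)] fin f] by blast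
  have "dist_fourier u q * c = (\<integral>\<eta>. H \<eta> * q \<eta> \<partial>lborel)" if q: "q \<in> schwartz" for q
  proof -
    obtain D where D: "\<And>\<eta>. cmod (q \<eta>) \<le> D" using schwartz_bounded[OF q] by blast
    obtain C where C: "0 \<le> C" "\<And>x \<xi>. cmod (fourier (\<lambda>\<eta>. fourier \<phi> \<eta> * q (\<eta> - x)) \<xi>) \<le> C * (1 / (1 + x\<^sup>2)) * (1 / (1 + \<xi>\<^sup>2))"
      using translated_product_fourier_decay[OF q f] by blast
    have "cmod (fourier (\<lambda>\<eta>. q (\<eta> + \<xi>) * fourier \<phi> \<eta>) x) \<le> C * (1 / (1 + x\<^sup>2))" for x \<xi>
    proof -
      have "cmod (fourier (\<lambda>\<eta>. q (\<eta> + \<xi>) * fourier \<phi> \<eta>) x) \<le> C * (1 / (1 + (- \<xi>)\<^sup>2)) * (1 / (1 + x\<^sup>2))"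
        using C(2)[of "- \<xi>" x] by (simp add: mult.commute)
      also have "\<dots> \<le> C * 1 * (1 / (1 + x\<^sup>2))"
        using C(1) by (intro mult_right_mono mult_left_mono) (auto simp: field_simps add_pos_nonneg)
      finally show ?thesis by simp
    qed
    from H(2)[OF schwartz_measurable[OF q] D this] show ?thesis
      unfolding c_def STFT_inversion[OF ut \<phi>(1) q] by simp
  qed
  then have "dist_fourier u q = (\<integral>\<eta>. (1 / c * H \<eta>) * q \<eta> \<partial>lborel)" if "q \<in> schwartz" for q
    using that c by (simp add: mult.assoc eq_divide_eq)
  then show ?thesis using H(1) by (intro that[of "\<lambda>\<eta>. 1 / c * H \<eta>"]) auto
qed

section \<open>The modulation space is contained in the Segal algebra\<close>

lemma fourier_continuous:
  assumes H: "integrable lborel H" shows "isCont (fourier H) x"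
proof -
  have [measurable]: "H \<in> borel_measurable borel" using H by auto
  have "continuous (at x within UNIV) (fourier H)"
    unfolding continuous_within_sequentially o_def
  proof (intro allI impI)
    fix y :: "nat \<Rightarrow> real" assume y: "(\<forall>n. y n \<in> UNIV) \<and> y \<longlonglongrightarrow> x"
    show "(\<lambda>n. fourier H (y n)) \<longlonglongrightarrow> fourier H x"
      unfolding fourier_def
    proof (rule integral_dominated_convergence[where w = "\<lambda>t. cmod (H t)"])
      show "AE t in lborel. (\<lambda>n. H t * cis (- (t * y n))) \<longlonglongrightarrow> H t * cis (- (t * x))"
        using y by (intro AE_I2 tendsto_intros tendsto_cis) auto
    qed (use H in \<open>auto simp: norm_mult\<close>)
  qed
  then show ?thesis by simp
qed

text \<open>Fourier inversion for distributions: every test function is a Fourier transform, by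
  \<open>schwartz_fourier_surj\<close>.\<close>

lemma fourier_L1_represents:
  fixes H :: "real \<Rightarrow> complex"
  assumes u: "u \<in> tempered_distributions" and H: "integrable lborel H"
    and rep: "\<And>q. q \<in> schwartz \<Longrightarrow> dist_fourier u q = (\<integral>\<eta>. H \<eta> * q \<eta> \<partial>lborel)" and s: "s \<in> schwartz"
  shows "u s = (\<integral>t. 1 / (2 * pi) * fourier H (- t) * s t \<partial>lborel)"
proof -
  have sr: "(\<lambda>t. s (- t)) \<in> schwartz" by (rule schwartz_reflect[OF s])
  have q: "(\<lambda>\<eta>. 1 / (2 * pi) * fourier s (- \<eta>)) \<in> schwartz" "fourier (\<lambda>\<eta>. 1 / (2 * pi) * fourier s (- \<eta>)) = s"
    using schwartz_fourier_surj[OF s] by auto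
  have fr: "fourier (\<lambda>t. s (- t)) \<eta> = fourier s (- \<eta>)" for \<eta>
    unfolding fourier_def by (subst lborel_integral_real_affine[where c = "-1" and t = 0]) simp_all
  have "u s = dist_fourier u (\<lambda>\<eta>. 1 / (2 * pi) * fourier s (- \<eta>))"
    unfolding dist_fourier_def using q by simp
  also have "\<dots> = (\<integral>\<eta>. 1 / (2 * pi) * (H \<eta> * fourier (\<lambda>t. s (- t)) \<eta>) \<partial>lborel)"
    unfolding rep[OF q(1)] fr by (simp add: mult_ac)
  also have "\<dots> = 1 / (2 * pi) * (\<integral>\<eta>. H \<eta> * fourier (\<lambda>t. s (- t)) \<eta> \<partial>lborel)"
    by (rule integral_mult_right_zero)
  also have "(\<integral>\<eta>. H \<eta> * fourier (\<lambda>t. s (- t)) \<eta> \<partial>lborel) = (\<integral>t. fourier H t * s (- t) \<partial>lborel)"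
    by (rule fourier_multiplication_formula[OF H schwartz_integrable[OF sr], symmetric])
  also have "\<dots> = (\<integral>t. fourier H (- t) * s t \<partial>lborel)"
    by (subst lborel_integral_real_affine[where c = "-1" and t = 0]) simp_all
  also have "1 / (2 * pi) * (\<integral>t. fourier H (- t) * s t \<partial>lborel) = (\<integral>t. 1 / (2 * pi) * (fourier H (- t) * s t) \<partial>lborel)"
    by (rule integral_mult_right_zero[symmetric])
  finally show ?thesis by (simp add: mult.assoc)
qed

lemma convolution_integrable:
  fixes a b :: "real \<Rightarrow> complex"
  assumes a: "integrable lborel a" and b: "integrable lborel b"
  shows "integrable lborel (\<lambda>\<xi>. \<integral>\<eta>. a \<eta> * b (\<xi> - \<eta>) \<partial>lborel)"
    and "integrable (lborel \<Otimes>\<^sub>M lborel) (\<lambda>(\<eta>, \<xi>). a \<eta> * b (\<xi> - \<eta>))"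
proof -
  have [measurable]: "a \<in> borel_measurable borel" "b \<in> borel_measurable borel" using a b by auto
  show i: "integrable (lborel \<Otimes>\<^sub>M lborel) (\<lambda>(\<eta>, \<xi>). a \<eta> * b (\<xi> - \<eta>))"
  proof (rule integrableI_bounded)
    have "(\<integral>\<^sup>+z. ennreal (norm (case z of (\<eta>, \<xi>) \<Rightarrow> a \<eta> * b (\<xi> - \<eta>))) \<partial>(lborel \<Otimes>\<^sub>M lborel)) = (\<integral>\<^sup>+\<eta>. \<integral>\<^sup>+\<xi>. ennreal (cmod (a \<eta>)) * ennreal (cmod (b (\<xi> - \<eta>))) \<partial>lborel \<partial>lborel)"
      by (subst lborel.nn_integral_fst[symmetric]) (auto simp: split_beta norm_mult ennreal_mult)
    also have "\<dots> = (\<integral>\<^sup>+\<eta>. ennreal (cmod (a \<eta>)) * (\<integral>\<^sup>+\<xi>. ennreal (cmod (b \<xi>)) \<partial>lborel) \<partial>lborel)"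
      by (subst nn_integral_cmult) (simp_all add: nn_integral_lborel_shift[of "\<lambda>x. ennreal (cmod (b x))"])
    also have "\<dots> = (\<integral>\<^sup>+\<eta>. ennreal (cmod (a \<eta>)) \<partial>lborel) * (\<integral>\<^sup>+\<xi>. ennreal (cmod (b \<xi>)) \<partial>lborel)"
      by (rule nn_integral_multc) measurable
    also have "\<dots> < \<infinity>" using a b by (simp add: integrable_iff_bounded ennreal_mult_less_top)
    finally show "(\<integral>\<^sup>+z. ennreal (norm (case z of (\<eta>, \<xi>) \<Rightarrow> a \<eta> * b (\<xi> - \<eta>))) \<partial>(lborel \<Otimes>\<^sub>M lborel)) < \<infinity>" .
  qed measurable
  from lborel_pair.integrable_snd[OF i] show "integrable lborel (\<lambda>\<xi>. \<integral>\<eta>. a \<eta> * b (\<xi> - \<eta>) \<partial>lborel)" by simp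
qed

lemma fourier_product_convolution:
  assumes H: "integrable lborel H" and k: "integrable lborel k"
  shows "fourier (\<lambda>t. fourier H (- t) * k t) \<xi> = (\<integral>\<eta>. H \<eta> * fourier k (\<xi> - \<eta>) \<partial>lborel)"
proof -
  have m: "(\<lambda>(\<eta>, t). cis (t * \<eta>) * cis (- (t * \<xi>))) \<in> borel_measurable (borel :: (real \<times> real) measure)"
    by (simp flip: borel_prod)
  have "(\<integral>\<eta>. H \<eta> * (\<integral>t. k t * (cis (t * \<eta>) * cis (- (t * \<xi>))) \<partial>lborel) \<partial>lborel)
    = (\<integral>t. k t * (\<integral>\<eta>. H \<eta> * (cis (t * \<eta>) * cis (- (t * \<xi>))) \<partial>lborel) \<partial>lborel)"
    using fubini_mult[OF H k m, of 1] by (simp add: norm_mult split_beta)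
  moreover have "(\<integral>t. k t * (cis (t * \<eta>) * cis (- (t * \<xi>))) \<partial>lborel) = fourier k (\<xi> - \<eta>)" for \<eta>
    unfolding fourier_def by (intro Bochner_Integration.integral_cong refl) (simp add: cis_mult algebra_simps)
  moreover have "k t * (\<integral>\<eta>. H \<eta> * (cis (t * \<eta>) * cis (- (t * \<xi>))) \<partial>lborel) = fourier H (- t) * k t * cis (- (t * \<xi>))" for t
  proof -
    have "(\<integral>\<eta>. H \<eta> * (cis (t * \<eta>) * cis (- (t * \<xi>))) \<partial>lborel) = (\<integral>\<eta>. H \<eta> * cis (t * \<eta>) \<partial>lborel) * cis (- (t * \<xi>))"
      by (subst integral_mult_left_zero[symmetric]) (simp add: mult.assoc)
    then show ?thesis by (simp add: fourier_def mult_ac)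
  qed
  ultimately show ?thesis by (simp add: fourier_def[of "\<lambda>t. fourier H (- t) * k t"])
qed

text \<open>The convex function \<open>z \<mapsto> z powr p\<close> lies above its tangent at \<open>w\<close>.\<close>

lemma young_tangent:
  fixes z w p :: real
  assumes p: "1 \<le> p" and z: "0 \<le> z" and w: "0 \<le> w"
  shows "p * (z * w powr (p - 1)) \<le> z powr p + (p - 1) * w powr p"
proof (cases "z = 0 \<or> w = 0")
  case True
  then show ?thesis using p by auto
next
  case False
  then have pos: "0 < z" "0 < w" using z w by auto
  have "(z powr p) powr (1 / p) * (w powr p) powr (1 - 1 / p) \<le> 1 / p * (z powr p) + (1 - 1 / p) * (w powr p)"
    using p pos by (intro Youngs_inequality_0) auto
  moreover have "(z powr p) powr (1 / p) = z" using p pos by (simp add: powr_powr)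
  moreover have "(w powr p) powr (1 - 1 / p) = w powr (p - 1)" using p by (simp add: powr_powr algebra_simps)
  ultimately have "z * w powr (p - 1) \<le> 1 / p * (z powr p) + (1 - 1 / p) * (w powr p)" by simp
  then have "p * (z * w powr (p - 1)) \<le> p * (1 / p * (z powr p) + (1 - 1 / p) * (w powr p))"
    using p by (intro mult_left_mono) auto
  also have "\<dots> = z powr p + (p - 1) * w powr p" using p by (simp add: field_simps)
  finally show ?thesis .
qed

text \<open>The finiteness part of Minkowski's integral inequality. Let \<open>r \<xi>\<close> be at least the \<open>L\<^sup>p\<close> norm of
  \<open>V(\<sqdot>,\<xi>)\<close>, with integral \<open>A\<close>. Jensen's inequality for the probability density \<open>r / A\<close> bounds the
  \<open>p\<close>-th power of the inner integral by the integral of \<open>\<bar>V\<bar>\<^sup>p (A / r)\<^sup>p\<^sup>-\<^sup>1\<close>. Integrating first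
  over \<open>x\<close>, by Tonelli's theorem, leaves at most \<open>A\<^sup>p\<^sup>-\<^sup>1\<close> times the integral of \<open>r\<close>.\<close>

lemma minkowski_finite:
  fixes V :: "real \<Rightarrow> real \<Rightarrow> complex"
  assumes p: "1 \<le> p"
    and V [measurable]: "(\<lambda>(x, \<xi>). V x \<xi>) \<in> borel_measurable (borel \<Otimes>\<^sub>M borel)"
    and N: "(\<integral>\<^sup>+\<xi>. Lp_norm p (\<lambda>x. V x \<xi>) \<partial>lborel) < \<infinity>"
    and M: "\<And>x. integrable lborel (V x)"
  shows "(\<integral>\<^sup>+x. ennreal ((\<integral>\<xi>. cmod (V x \<xi>) \<partial>lborel) powr p) \<partial>lborel) < \<infinity>"
proof -
  have p0: "0 < p" using p by simp
  define nV where "nV \<xi> = Lp_norm p (\<lambda>x. V x \<xi>)" for \<xi>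
  have nV_meas [measurable]: "nV \<in> borel_measurable borel" unfolding nV_def by (rule Lp_norm_measurable[OF V])
  have AE_good: "AE \<xi> in lborel. nV \<xi> < \<infinity>"
    using nn_integral_PInf_AE[of nV lborel] N unfolding nV_def[symmetric]
    by (auto simp: less_top infinity_ennreal_def)
  \<comment> \<open>the summand \<open>1 / (1 + \<xi>\<^sup>2)\<close> keeps the density positive where the norm vanishes\<close>
  define r where "r \<xi> = enn2real (nV \<xi>) + 1 / (1 + \<xi>\<^sup>2)" for \<xi>
  have r_meas [measurable]: "r \<in> borel_measurable borel" unfolding r_def by measurable
  have r_pos: "0 < r \<xi>" for \<xi> unfolding r_def by (intro add_nonneg_pos) (auto simp: add_pos_nonneg)
  have r_int: "integrable lborel r"
    unfolding r_def
  proof (intro Bochner_Integration.integrable_add integrable_inverse_quadratic integrableI_bounded)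
    have "(\<integral>\<^sup>+\<xi>. ennreal (norm (enn2real (nV \<xi>))) \<partial>lborel) \<le> (\<integral>\<^sup>+\<xi>. nV \<xi> \<partial>lborel)"
      by (intro nn_integral_mono) (simp add: ennreal_enn2real_if)
    also have "\<dots> < \<infinity>" using N by (simp add: nV_def)
    finally show "(\<integral>\<^sup>+\<xi>. ennreal (norm (enn2real (nV \<xi>))) \<partial>lborel) < \<infinity>" .
  qed measurable
  define A where "A = (\<integral>\<xi>. r \<xi> \<partial>lborel)"
  have A: "0 < A"
  proof -
    have "pi = (\<integral>\<xi>. 1 / (1 + \<xi>\<^sup>2) \<partial>lborel)" by (rule integral_inverse_quadratic[symmetric])
    also have "\<dots> \<le> A" unfolding A_def by (intro integral_mono integrable_inverse_quadratic r_int) (simp add: r_def)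
    finally show ?thesis using pi_gt_zero by linarith
  qed
  define S where "S x = (\<integral>\<^sup>+\<xi>. ennreal (cmod (V x \<xi>) powr p * (A / r \<xi>) powr (p - 1)) \<partial>lborel)" for x
  have V1 [measurable]: "V x \<in> borel_measurable borel" for x
    using M[of x] by auto
  have jensen: "ennreal ((\<integral>\<xi>. cmod (V x \<xi>) \<partial>lborel) powr p) \<le> S x" for x
  proof (cases "S x")
    case (real s)
    define w where "w = (\<integral>\<xi>. cmod (V x \<xi>) \<partial>lborel)"
    have w0: "0 \<le> w" unfolding w_def by (intro integral_nonneg_AE) auto
    have "integrable lborel (\<lambda>\<xi>. cmod (V x \<xi>) powr p * (A / r \<xi>) powr (p - 1))"
      using real by (intro integrableI_bounded) (auto simp: S_def abs_mult)
    note Si = this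
    have Ss: "(\<integral>\<xi>. cmod (V x \<xi>) powr p * (A / r \<xi>) powr (p - 1) \<partial>lborel) = s"
      using real nn_integral_eq_integral[OF Si] by (auto simp: S_def intro!: integral_nonneg_AE)
    \<comment> \<open>Jensen's inequality in the form of \<open>young_tangent\<close> at the mean value \<open>w\<close>, multiplied by the
      density \<open>r / A\<close>\<close>
    have pointw: "p * w powr (p - 1) * cmod (V x \<xi>) \<le> cmod (V x \<xi>) powr p * (A / r \<xi>) powr (p - 1) + (p - 1) * w powr p / A * r \<xi>" for \<xi>
    proof -
      define z where "z = cmod (V x \<xi>) * (A / r \<xi>)"
      have "p * (z * w powr (p - 1)) \<le> z powr p + (p - 1) * w powr p"
        using A r_pos[of \<xi>] w0 by (intro young_tangent p) (auto simp: z_def)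
      then have "p * (z * w powr (p - 1)) * (r \<xi> / A) \<le> (z powr p + (p - 1) * w powr p) * (r \<xi> / A)"
        using A r_pos[of \<xi>] by (intro mult_right_mono) auto
      also have "p * (z * w powr (p - 1)) * (r \<xi> / A) = p * w powr (p - 1) * cmod (V x \<xi>)"
        using A r_pos[of \<xi>] by (simp add: z_def)
      also have "(z powr p + (p - 1) * w powr p) * (r \<xi> / A) = z powr p * (r \<xi> / A) + (p - 1) * w powr p / A * r \<xi>"
        by (simp add: distrib_right add_divide_distrib)
      also have "z powr p * (r \<xi> / A) = cmod (V x \<xi>) powr p * (A / r \<xi>) powr (p - 1)"
        using A r_pos[of \<xi>] by (simp add: z_def powr_mult powr_divide powr_diff)
      finally show ?thesis .
    qed
    have "p * w powr (p - 1) * w = (\<integral>\<xi>. p * w powr (p - 1) * cmod (V x \<xi>) \<partial>lborel)"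
      by (simp add: w_def)
    also have "\<dots> \<le> (\<integral>\<xi>. cmod (V x \<xi>) powr p * (A / r \<xi>) powr (p - 1) + (p - 1) * w powr p / A * r \<xi> \<partial>lborel)"
      by (intro integral_mono pointw Bochner_Integration.integrable_add integrable_mult_right integrable_norm M Si r_int)
    also have "\<dots> = s + (p - 1) * w powr p / A * A"
      using Si r_int by (subst Bochner_Integration.integral_add) (simp_all add: Ss flip: A_def)
    finally have "p * (w powr (p - 1) * w) \<le> s + (p - 1) * w powr p" using A by (simp add: mult.assoc)
    moreover have "w powr (p - 1) * w = w powr p" using w0 by (cases "w = 0") (auto simp: powr_diff)
    ultimately have "w powr p \<le> s" by (simp add: algebra_simps)
    then show ?thesis using real by (simp add: w_def ennreal_leI)
  qed simp
  have "(\<integral>\<^sup>+x. ennreal ((\<integral>\<xi>. cmod (V x \<xi>) \<partial>lborel) powr p) \<partial>lborel) \<le> (\<integral>\<^sup>+x. S x \<partial>lborel)"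
    by (intro nn_integral_mono jensen)
  also have "\<dots> = (\<integral>\<^sup>+\<xi>. \<integral>\<^sup>+x. ennreal (cmod (V x \<xi>) powr p * (A / r \<xi>) powr (p - 1)) \<partial>lborel \<partial>lborel)"
    unfolding S_def by (rule lborel_pair.Fubini') measurable
  also have "\<dots> \<le> (\<integral>\<^sup>+\<xi>. ennreal (A powr (p - 1) * r \<xi>) \<partial>lborel)"
  proof (rule nn_integral_mono_AE, use AE_good in eventually_elim)
    case (elim \<xi>)
    define n where "n = enn2real (nV \<xi>)"
    have [measurable]: "(\<lambda>x. V x \<xi>) \<in> borel_measurable borel" by measurable
    have "(\<integral>\<^sup>+x. ennreal (cmod (V x \<xi>) powr p) \<partial>lborel) = ennreal (n powr p)"
    proof (cases rule: Lp_norm_cases[OF p0, of "\<lambda>x. V x \<xi>", case_names meas infinite zero pos])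
      case zero
      have "(\<integral>\<^sup>+x. ennreal (cmod (V x \<xi>) powr p) \<partial>lborel) = (\<integral>\<^sup>+x. 0 \<partial>(lborel :: real measure))"
        using zero(2) p0 by (intro nn_integral_cong_AE) auto
      then show ?thesis using zero(1) p0 by (simp add: n_def nV_def)
    next
      case (pos B)
      then show ?thesis by (simp add: n_def nV_def)
    qed (use elim in \<open>auto simp: nV_def\<close>)
    moreover have "(\<integral>\<^sup>+x. ennreal (cmod (V x \<xi>) powr p * (A / r \<xi>) powr (p - 1)) \<partial>lborel) = (\<integral>\<^sup>+x. ennreal (cmod (V x \<xi>) powr p) \<partial>lborel) * ennreal ((A / r \<xi>) powr (p - 1))"
      by (subst nn_integral_multc[symmetric]) (auto simp: ennreal_mult)
    ultimately have "(\<integral>\<^sup>+x. ennreal (cmod (V x \<xi>) powr p * (A / r \<xi>) powr (p - 1)) \<partial>lborel) = ennreal (n powr p * (A / r \<xi>) powr (p - 1))"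
      by (simp add: ennreal_mult)
    also have "\<dots> \<le> ennreal (A powr (p - 1) * r \<xi>)"
    proof (rule ennreal_leI)
      have "n \<le> r \<xi>" by (simp add: r_def n_def)
      then have "n powr p \<le> r \<xi> powr p" using p0 by (intro powr_mono2) (auto simp: n_def)
      then have "n powr p * (A / r \<xi>) powr (p - 1) \<le> r \<xi> powr p * (A / r \<xi>) powr (p - 1)" by (intro mult_right_mono) auto
      also have "\<dots> = A powr (p - 1) * r \<xi>" using A r_pos[of \<xi>] by (simp add: powr_divide powr_diff)
      finally show "n powr p * (A / r \<xi>) powr (p - 1) \<le> A powr (p - 1) * r \<xi>" .
    qed
    finally show ?case .
  qed
  also have "\<dots> = ennreal (A powr (p - 1) * A)"
    using nn_integral_eq_integral[OF integrable_mult_right[OF r_int, of "A powr (p - 1)"]] r_pos by (simp add: A_def less_imp_le)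
  finally show ?thesis by (rule le_less_trans) simp
qed

lemma cnj_shift_schwartz: "\<phi> \<in> schwartz \<Longrightarrow> (\<lambda>t. cnj (\<phi> (t - x))) \<in> schwartz"
  by (rule schwartz_shift[OF schwartz_cnj(1)])

lemma bounded_inverse_fourier:
  assumes "integrable lborel H"
  shows "cmod (1 / (2 * pi) * fourier H (- t)) \<le> 1 / (2 * pi) * (\<integral>\<eta>. cmod (H \<eta>) \<partial>lborel)"
  using mult_left_mono[OF cmod_fourier_le[of H "- t"], of "1 / (2 * pi)"] by (simp add: norm_mult norm_divide)

lemma inverse_fourier_measurable:
  assumes "integrable lborel H" shows "(\<lambda>t. 1 / (2 * pi) * fourier H (- t)) \<in> borel_measurable borel"
proof -
  have [measurable]: "H \<in> borel_measurable borel" using assms by auto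
  show ?thesis by measurable
qed

text \<open>Now \<open>u\<close> is a function with integrable Fourier transform \<open>H\<close>, and the short-time transform has two
  descriptions: as the Fourier transform of a product and as a convolution of \<open>H\<close> with a Schwartz
  function.\<close>

lemma STFT_eq_fourier:
  fixes H :: "real \<Rightarrow> complex"
  assumes u: "u \<in> tempered_distributions" and H: "integrable lborel H"
    and rep: "\<And>q. q \<in> schwartz \<Longrightarrow> dist_fourier u q = (\<integral>\<eta>. H \<eta> * q \<eta> \<partial>lborel)" and \<phi>: "\<phi> \<in> schwartz"
  shows "STFT \<phi> u x \<xi> = fourier (\<lambda>t. 1 / (2 * pi) * fourier H (- t) * cnj (\<phi> (t - x))) \<xi>"
    and "fourier (\<lambda>t. 1 / (2 * pi) * fourier H (- t) * cnj (\<phi> (t - x))) \<xi> = 1 / (2 * pi) * (\<integral>\<eta>. H \<eta> * fourier (\<lambda>t. cnj (\<phi> (t - x))) (\<xi> - \<eta>) \<partial>lborel)"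
proof -
  have k: "(\<lambda>t. cnj (\<phi> (t - x))) \<in> schwartz" by (rule cnj_shift_schwartz[OF \<phi>])
  have "(\<lambda>t. cnj (\<phi> (t - x)) * cis (- (t * \<xi>))) \<in> schwartz" by (rule lip_family_schwartz[OF STFT_families(1)[OF \<phi>]])
  from fourier_L1_represents[OF u H rep this]
  show "STFT \<phi> u x \<xi> = fourier (\<lambda>t. 1 / (2 * pi) * fourier H (- t) * cnj (\<phi> (t - x))) \<xi>"
    by (simp only: STFT_def fourier_def mult.assoc)
  have "fourier (\<lambda>t. 1 / (2 * pi) * fourier H (- t) * cnj (\<phi> (t - x))) \<xi> = fourier (\<lambda>t. 1 / (2 * pi) * (fourier H (- t) * cnj (\<phi> (t - x)))) \<xi>"
    by (simp add: mult.assoc)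
  also have "\<dots> = 1 / (2 * pi) * fourier (\<lambda>t. fourier H (- t) * cnj (\<phi> (t - x))) \<xi>"
    by (subst fourier_cmult) simp
  finally show "fourier (\<lambda>t. 1 / (2 * pi) * fourier H (- t) * cnj (\<phi> (t - x))) \<xi> = 1 / (2 * pi) * (\<integral>\<eta>. H \<eta> * fourier (\<lambda>t. cnj (\<phi> (t - x))) (\<xi> - \<eta>) \<partial>lborel)"
    unfolding fourier_product_convolution[OF H schwartz_integrable[OF k]] .
qed

text \<open>The second description shows that \<open>STFT \<phi> u x\<close> is integrable. So Fourier inversion applies to the
  product in the first description and bounds it pointwise by the integral of \<open>\<bar>STFT \<phi> u x\<bar>\<close>.\<close>

lemma STFT_integrable_freq:
  fixes H :: "real \<Rightarrow> complex"
  assumes u: "u \<in> tempered_distributions" and H: "integrable lborel H"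
    and rep: "\<And>q. q \<in> schwartz \<Longrightarrow> dist_fourier u q = (\<integral>\<eta>. H \<eta> * q \<eta> \<partial>lborel)" and \<phi>: "\<phi> \<in> schwartz"
  shows "integrable lborel (\<lambda>\<xi>. STFT \<phi> u x \<xi>)"
    and "2 * pi * (cmod (1 / (2 * pi) * fourier H (- y)) * cmod (\<phi> (y - x))) \<le> (\<integral>\<xi>. cmod (STFT \<phi> u x \<xi>) \<partial>lborel)"
proof -
  define f where "f t = 1 / (2 * pi) * fourier H (- t)" for t
  define g where "g t = f t * cnj (\<phi> (t - x))" for t
  have V: "STFT \<phi> u x = fourier g"
    unfolding g_def[abs_def] f_def using STFT_eq_fourier(1)[OF u H rep \<phi>] by blast
  have k: "(\<lambda>t. cnj (\<phi> (t - x))) \<in> schwartz" by (rule cnj_shift_schwartz[OF \<phi>])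
  show Vi: "integrable lborel (\<lambda>\<xi>. STFT \<phi> u x \<xi>)"
  proof -
    have eq: "STFT \<phi> u x \<xi> = 1 / (2 * pi) * (\<integral>\<eta>. H \<eta> * fourier (\<lambda>t. cnj (\<phi> (t - x))) (\<xi> - \<eta>) \<partial>lborel)" for \<xi>
      using STFT_eq_fourier[OF u H rep \<phi>, of x \<xi>] by (rule trans)
    show ?thesis
      unfolding eq by (rule integrable_mult_right[OF convolution_integrable(1)[OF H schwartz_integrable[OF schwartz_fourier[OF k]]]])
  qed
  have [measurable]: "f \<in> borel_measurable borel" unfolding f_def by (rule inverse_fourier_measurable[OF H])
  define B where "B = 1 / (2 * pi) * (\<integral>\<eta>. cmod (H \<eta>) \<partial>lborel)"
  have fB: "cmod (f t) \<le> B" for t unfolding f_def B_def by (rule bounded_inverse_fourier[OF H])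
  obtain D where D: "0 \<le> D" "\<And>t. cmod (cnj (\<phi> (t - x))) \<le> D" using schwartz_bounded[OF k] by blast
  have gi: "integrable lborel g"
    unfolding g_def[abs_def] by (rule integrable_mult_bounded(2)[OF schwartz_integrable[OF k] _ fB]) simp
  have gb: "cmod (g t) \<le> B * D" for t
    unfolding g_def norm_mult using fB D(1) order_trans[OF norm_ge_zero fB] D(2) by (intro mult_mono) auto
  have fc: "isCont f t" for t
  proof -
    have "isCont (\<lambda>t. fourier H (- t)) t"
      by (rule isCont_o2[of t uminus "fourier H"]) (auto intro: fourier_continuous[OF H])
    then show ?thesis unfolding f_def by (intro continuous_intros) auto
  qed
  have gc: "isCont g y"
    unfolding g_def by (intro continuous_intros fc schwartz_isCont[OF k])
  have "fourier (fourier g) (- y) = 2 * pi * g y"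
    using Vi by (intro fourier_inversion[OF gi gb _ gc]) (simp add: V)
  then have "2 * pi * cmod (g y) = cmod (fourier (fourier g) (- y))" by (simp add: norm_mult)
  also have "\<dots> \<le> (\<integral>\<xi>. cmod (fourier g \<xi>) \<partial>lborel)" by (rule cmod_fourier_le)
  finally show "2 * pi * (cmod (1 / (2 * pi) * fourier H (- y)) * cmod (\<phi> (y - x))) \<le> (\<integral>\<xi>. cmod (STFT \<phi> u x \<xi>) \<partial>lborel)"
    unfolding V f_def[symmetric] by (simp add: g_def norm_mult)
qed

lemma dist_Lp_norm_le: "represents g u \<Longrightarrow> dist_Lp_norm p u \<le> Lp_norm p g"
  unfolding dist_Lp_norm_def by (rule INF_lower) simp

lemma representsI_L1:
  assumes H: "integrable lborel H" and rep: "\<And>q. q \<in> schwartz \<Longrightarrow> w q = (\<integral>\<eta>. H \<eta> * q \<eta> \<partial>lborel)"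
  shows "represents H w"
  unfolding represents_def
proof (intro conjI ballI)
  fix q assume q: "q \<in> schwartz"
  obtain D where "\<And>x. cmod (q x) \<le> D" using schwartz_bounded[OF q] by blast
  then show "integrable lborel (\<lambda>x. H x * q x)"
    using schwartz_measurable[OF q] by (intro integrable_mult_bounded(1)[OF H]) auto
qed (use H rep in auto)

lemma representsI_bounded:
  assumes f: "f \<in> borel_measurable borel" "\<And>t. cmod (f t) \<le> B" and rep: "\<And>q. q \<in> schwartz \<Longrightarrow> w q = (\<integral>\<eta>. f \<eta> * q \<eta> \<partial>lborel)"
  shows "represents f w"
  unfolding represents_def
proof (intro conjI ballI)
  fix q assume q: "q \<in> schwartz"
  show "integrable lborel (\<lambda>x. f x * q x)"
    using f by (intro integrable_mult_bounded(2)[OF schwartz_integrable[OF q]]) auto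
qed (use f rep in auto)

lemma Lp_norm_1_finite: "integrable lborel H \<Longrightarrow> Lp_norm 1 H < \<infinity>"
  unfolding Lp_norm_1 by (simp add: integrable_iff_bounded)

text \<open>That the Fourier transform is integrable is \<open>modulation_fourier_L1\<close>. For the \<open>L\<^sup>p\<close> norm choose \<open>a\<close>
  with \<open>\<phi> a \<noteq> 0\<close> and use \<open>STFT_integrable_freq\<close> at \<open>x = y - a\<close>: then \<open>\<bar>f y\<bar>\<close> is at most a multiple
  of the integral of \<open>\<bar>STFT \<phi> u (y - a)\<bar>\<close>, and \<open>minkowski_finite\<close> applies.\<close>

lemma modulation_subset_fourier_segal:
  assumes p: "1 \<le> p" "p \<le> 2" and \<phi>: "\<phi> \<in> schwartz" "\<phi> \<noteq> (\<lambda>x. 0)"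
  shows "modulation_space \<phi> p \<subseteq> fourier_segal p"
proof
  fix u assume u: "u \<in> modulation_space \<phi> p"
  then have ut: "u \<in> tempered_distributions" and fin: "(\<integral>\<^sup>+\<xi>. Lp_norm p (\<lambda>x. STFT \<phi> u x \<xi>) \<partial>lborel) < \<infinity>"
    by (auto simp: modulation_space_def modulation_norm_def)
  obtain H where H: "integrable lborel H" and rep: "\<And>q. q \<in> schwartz \<Longrightarrow> dist_fourier u q = (\<integral>\<eta>. H \<eta> * q \<eta> \<partial>lborel)"
    using modulation_fourier_L1[OF p \<phi> u] by blast
  define f where "f t = 1 / (2 * pi) * fourier H (- t)" for t
  have [measurable]: "f \<in> borel_measurable borel" unfolding f_def by (rule inverse_fourier_measurable[OF H])
  have frep: "represents f u"
  proof (rule representsI_bounded)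
    show "cmod (f t) \<le> 1 / (2 * pi) * (\<integral>\<eta>. cmod (H \<eta>) \<partial>lborel)" for t
      unfolding f_def by (rule bounded_inverse_fourier[OF H])
    show "u q = (\<integral>t. f t * q t \<partial>lborel)" if "q \<in> schwartz" for q
      unfolding f_def by (rule fourier_L1_represents[OF ut H rep that])
  qed simp
  obtain a where a: "\<phi> a \<noteq> 0" using \<phi>(2) by auto
  define W where "W x = (\<integral>\<xi>. cmod (STFT \<phi> u x \<xi>) \<partial>lborel)" for x
  define k where "k = 1 / (2 * pi * cmod (\<phi> a))"
  have k: "0 < k" using a by (simp add: k_def)
  note [measurable] = STFT_measurable[OF ut \<phi>(1)]
  have [measurable]: "W \<in> borel_measurable borel" unfolding W_def by measurable
  have W0: "0 \<le> W x" for x unfolding W_def by (intro integral_nonneg_AE) auto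
  have fW: "cmod (f y) \<le> k * W (y - a)" for y
    using STFT_integrable_freq(2)[OF ut H rep \<phi>(1), of y "y - a"] a unfolding k_def W_def f_def
    by (simp add: field_simps norm_mult norm_divide)
  have "(\<integral>\<^sup>+y. ennreal (cmod (f y) powr p) \<partial>lborel) \<le> (\<integral>\<^sup>+y. ennreal (k powr p) * ennreal (W (y - a) powr p) \<partial>lborel)"
  proof (rule nn_integral_mono)
    fix y
    have "cmod (f y) powr p \<le> (k * W (y - a)) powr p" using p fW by (intro powr_mono2) auto
    also have "\<dots> = k powr p * W (y - a) powr p" using k W0 by (simp add: powr_mult)
    finally show "ennreal (cmod (f y) powr p) \<le> ennreal (k powr p) * ennreal (W (y - a) powr p)"
      by (simp flip: ennreal_mult add: ennreal_leI)
  qed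
  also have "\<dots> = ennreal (k powr p) * (\<integral>\<^sup>+y. ennreal (W y powr p) \<partial>lborel)"
    by (subst nn_integral_cmult) (simp_all add: nn_integral_lborel_shift[of "\<lambda>y. ennreal (W y powr p)"])
  also have "\<dots> < \<infinity>"
    using minkowski_finite[OF p(1) STFT_measurable[OF ut \<phi>(1)] fin STFT_integrable_freq(1)[OF ut H rep \<phi>(1)]]
    by (simp add: W_def ennreal_mult_less_top)
  finally have "Lp_norm p f < \<infinity>" unfolding Lp_norm_def ennreal_root_less_top .
  then have "dist_Lp_norm p u < \<infinity>" by (rule le_less_trans[OF dist_Lp_norm_le[OF frep]])
  moreover have "dist_Lp_norm 1 (dist_fourier u) < \<infinity>"
    by (rule le_less_trans[OF dist_Lp_norm_le[OF representsI_L1[OF H rep]] Lp_norm_1_finite[OF H]])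
  ultimately show "u \<in> fourier_segal p" using ut by (simp add: fourier_segal_def FA_norm_def)
qed

section \<open>The modulation space is dense in the Segal algebra\<close>

text \<open>The products of the Gaussian with monomials span a set that is closed under differentiation, which
  the principle for families covers with a parameter that does not occur.\<close>

lemma gaussian_schwartz:
  assumes a: "0 < a" shows "(\<lambda>t. complex_of_real (exp (- (a * t\<^sup>2)))) \<in> schwartz"
proof -
  define G where "G t = complex_of_real (exp (- (a * t\<^sup>2)))" for t
  define X where "X = {K :: real \<Rightarrow> real \<Rightarrow> complex. \<exists>c n. K = (\<lambda>x t. c * of_real t ^ n * G t)}"
  have mem: "(\<lambda>x t. c * of_real t ^ n * G t) \<in> X" for c n unfolding X_def by blast
  have dG: "(G has_vector_derivative - (2 * of_real a * of_real t * G t)) (at t)" for t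
  proof -
    have "((\<lambda>t. exp (- (a * t\<^sup>2))) has_real_derivative exp (- (a * t\<^sup>2)) * (- (a * (2 * t)))) (at t)"
      by (auto intro!: derivative_eq_intros)
    from has_vector_derivative_of_real[where 'a = complex, OF this] show ?thesis by (simp add: G_def[abs_def] mult_ac)
  qed
  have dt: "\<exists>K'\<in>kspan X. \<forall>x t. (K x has_vector_derivative K' x t) (at t)" if KX: "K \<in> X" for K
  proof -
    obtain c n where K: "K = (\<lambda>x t. c * of_real t ^ n * G t)" using KX unfolding X_def by auto
    define K' :: "real \<Rightarrow> real \<Rightarrow> complex" where "K' = (\<lambda>x t. (- 2 * of_real a * c) * of_real t ^ Suc n * G t + (of_nat n * c) * of_real t ^ (n - 1) * G t)"
    have 1: "K' \<in> kspan X" unfolding K'_def by (intro kspan.add kspan.base mem)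
    have "(K x has_vector_derivative K' x t) (at t)" for x t
    proof -
      have "((\<lambda>t. complex_of_real t ^ n) has_vector_derivative of_nat n * of_real t ^ (n - 1)) (at t)"
        using has_vector_derivative_of_real[OF DERIV_pow[of n t]] by simp
      from bounded_linear.has_vector_derivative[OF bounded_linear_mult_right[of c] has_vector_derivative_mult[OF this dG]]
      show ?thesis unfolding K K'_def by (simp add: algebra_simps)
    qed
    then show ?thesis by (intro bexI[OF _ 1] allI)
  qed
  have dx: "\<exists>K'\<in>kspan X. \<forall>x t. ((\<lambda>x. K x t) has_vector_derivative K' x t) (at x)" if K: "K \<in> X" for K
  proof -
    have 1: "(\<lambda>x t. 0 * of_real t ^ 0 * G t) \<in> kspan X" by (intro kspan.base mem)
    show ?thesis using K by (intro bexI[OF _ 1]) (auto simp: X_def)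
  qed
  have b: "\<exists>C. \<forall>x t. \<bar>x\<bar> \<le> R \<longrightarrow> \<bar>t\<bar> ^ j * cmod (K x t) \<le> C" if K: "K \<in> X" for K j R
  proof -
    obtain c n where K: "K = (\<lambda>x t. c * of_real t ^ n * G t)" using K unfolding X_def by auto
    define m where "m = Suc (j + n)"
    have "\<bar>t\<bar> ^ j * cmod (K x t) \<le> cmod c * (1 + (real m / a) ^ m)" for x t
    proof -
      have "(a * t\<^sup>2 / real m) ^ m \<le> (1 + a * t\<^sup>2 / real m) ^ m" using a by (intro power_mono) auto
      also have "\<dots> \<le> exp (a * t\<^sup>2)"
      proof (rule exp_ge_one_plus_x_over_n_power_n)
        have "0 \<le> a * t\<^sup>2" using a by simp
        then show "- real m \<le> a * t\<^sup>2" by linarith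
      qed (simp add: m_def)
      finally have "(real m / a) ^ m * (a * t\<^sup>2 / real m) ^ m \<le> (real m / a) ^ m * exp (a * t\<^sup>2)"
        using a by (intro mult_left_mono) auto
      moreover have "(real m / a) ^ m * (a * t\<^sup>2 / real m) ^ m = (t\<^sup>2) ^ m"
        using a by (simp add: power_mult_distrib[symmetric] m_def)
      ultimately have "(t\<^sup>2) ^ m \<le> (real m / a) ^ m * exp (a * t\<^sup>2)" by simp
      then have e: "(t\<^sup>2) ^ m * exp (- (a * t\<^sup>2)) \<le> (real m / a) ^ m"
        by (simp add: exp_minus field_simps)
      have "\<bar>t\<bar> ^ (j + n) \<le> 1 + (t\<^sup>2) ^ m"
      proof (cases "\<bar>t\<bar> \<le> 1")
        case True
        then have "\<bar>t\<bar> ^ (j + n) \<le> 1" by (intro power_le_one) auto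
        then show ?thesis by (rule add_increasing2[rotated]) simp
      next
        case False
        then have "\<bar>t\<bar> ^ (j + n) \<le> \<bar>t\<bar> ^ (2 * m)" by (intro power_increasing) (auto simp: m_def)
        then show ?thesis by (simp add: power_mult)
      qed
      then have "\<bar>t\<bar> ^ (j + n) * exp (- (a * t\<^sup>2)) \<le> (1 + (t\<^sup>2) ^ m) * exp (- (a * t\<^sup>2))" by (rule mult_right_mono) simp
      also have "\<dots> = exp (- (a * t\<^sup>2)) + (t\<^sup>2) ^ m * exp (- (a * t\<^sup>2))" by (simp add: distrib_right)
      also have "\<dots> \<le> 1 + (real m / a) ^ m" using a e by (intro add_mono) auto
      finally have "cmod c * (\<bar>t\<bar> ^ (j + n) * exp (- (a * t\<^sup>2))) \<le> cmod c * (1 + (real m / a) ^ m)" by (rule mult_left_mono) simp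
      then show ?thesis by (simp add: K G_def norm_mult norm_power power_add mult_ac)
    qed
    then show ?thesis by blast
  qed
  have "lip_family (\<lambda>x t. 1 * of_real t ^ 0 * G t)"
  proof (rule lip_family_coinduct[where X = "kspan X"])
    show "(\<lambda>x t. 1 * of_real t ^ 0 * G t) \<in> kspan X" by (intro kspan.base mem)
    show "\<exists>C. \<forall>x t. \<bar>x\<bar> \<le> R \<longrightarrow> \<bar>t\<bar> ^ j * cmod (K x t) \<le> C" if "K \<in> kspan X" for K j R
      by (rule kspan_bound[OF b _ that]) auto
  qed (rule kspan_dt[OF dt] kspan_dx[OF dx]; assumption)+
  from lip_family_schwartz[OF this] show ?thesis by (simp add: G_def)
qed

lemma gaussian_cutoff_Lp:
  assumes p: "1 \<le> p" and [measurable]: "f \<in> borel_measurable borel" and fin: "Lp_norm p f < \<infinity>"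
  shows "(\<lambda>n. Lp_norm p (\<lambda>t. f t - f t * complex_of_real (exp (- (t\<^sup>2 / (4 * (real (Suc n))\<^sup>2)))))) \<longlonglongrightarrow> 0"
proof (rule Lp_norm_dominated_tendsto[OF _ _ _ fin])
  fix n t
  define G where "G n = exp (- (t\<^sup>2 / (4 * (real (Suc n))\<^sup>2)))" for n
  have eq: "f t - f t * complex_of_real (G n) = f t * complex_of_real (1 - G n)" for n by (simp add: right_diff_distrib)
  have "cmod (f t) * \<bar>1 - G n\<bar> \<le> cmod (f t) * 1" by (intro mult_left_mono) (auto simp: G_def)
  then show "cmod (f t - f t * complex_of_real (exp (- (t\<^sup>2 / (4 * (real (Suc n))\<^sup>2))))) \<le> cmod (f t)"
    unfolding G_def[symmetric] eq norm_mult norm_of_real by simp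
  have "G \<longlonglongrightarrow> 1" unfolding G_def by real_asymp
  then have "(\<lambda>n. f t - f t * complex_of_real (G n)) \<longlonglongrightarrow> f t - f t * complex_of_real 1" by (intro tendsto_intros)
  then show "(\<lambda>n. f t - f t * complex_of_real (exp (- (t\<^sup>2 / (4 * (real (Suc n))\<^sup>2))))) \<longlonglongrightarrow> 0" by (simp add: G_def)
qed (use p in auto)

lemma gauss_kernel_props:
  "integrable lborel (gauss_kernel n)" "(\<integral>\<^sup>+z. ennreal (cmod (gauss_kernel n z)) \<partial>lborel) = 1"
proof -
  define N where "N = real (Suc n)"
  have N: "0 < N" by (simp add: N_def)
  have i: "integrable lborel (\<lambda>z. exp (- (N\<^sup>2 * z\<^sup>2)))"
    using fourier_gaussian(1)[of "N\<^sup>2"] N by (simp add: complex_of_real_integrable_eq)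
  then have i': "integrable lborel (\<lambda>z. N / sqrt pi * exp (- (N\<^sup>2 * z\<^sup>2)))" by (rule integrable_mult_right)
  then show "integrable lborel (gauss_kernel n)" 
    unfolding gauss_kernel_def[abs_def] N_def[symmetric] complex_of_real_integrable_eq .
  have "(\<integral>\<^sup>+z. ennreal (cmod (gauss_kernel n z)) \<partial>lborel) = (\<integral>\<^sup>+z. ennreal (N / sqrt pi * exp (- (N\<^sup>2 * z\<^sup>2))) \<partial>lborel)"
    using N unfolding gauss_kernel_def norm_of_real N_def[symmetric] by (simp add: abs_mult)
  also have "\<dots> = ennreal (\<integral>z. N / sqrt pi * exp (- (N\<^sup>2 * z\<^sup>2)) \<partial>lborel)"
    using N by (intro nn_integral_eq_integral i') auto
  also have "(\<integral>z. N / sqrt pi * exp (- (N\<^sup>2 * z\<^sup>2)) \<partial>lborel) = 1"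
    using integral_gaussian[of "N\<^sup>2"] N by (simp add: real_sqrt_divide)
  finally show "(\<integral>\<^sup>+z. ennreal (cmod (gauss_kernel n z)) \<partial>lborel) = 1" by simp
qed

lemma fourier_gauss_cutoff:
  "fourier (\<lambda>t. complex_of_real (exp (- (t\<^sup>2 / (4 * (real (Suc n))\<^sup>2))))) z = 2 * pi * gauss_kernel n z"
proof -
  define N where "N = real (Suc n)"
  have N: "0 < N" by (simp add: N_def)
  have eq: "(\<lambda>t. complex_of_real (exp (- (t\<^sup>2 / (4 * N\<^sup>2))))) = (\<lambda>t. complex_of_real (exp (- (1 / (4 * N\<^sup>2) * t\<^sup>2))))"
    by simp
  have "sqrt (pi / (1 / (4 * N\<^sup>2))) * exp (- (z\<^sup>2 / (4 * (1 / (4 * N\<^sup>2))))) = 2 * pi * (N / sqrt pi * exp (- (N\<^sup>2 * z\<^sup>2)))"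
    using N real_sqrt_mult_self[of pi] by (simp add: real_sqrt_mult field_simps)
  then show ?thesis
    unfolding gauss_kernel_def N_def[symmetric] eq using N
    by (subst fourier_gaussian(2)) (simp_all flip: of_real_mult)
qed

lemma convol_norm:
  fixes a b :: "real \<Rightarrow> complex"
  assumes a: "integrable lborel a" and b: "integrable lborel b"
  shows "(\<integral>\<^sup>+x. ennreal (cmod (convol a b x)) \<partial>lborel) \<le> (\<integral>\<^sup>+y. ennreal (cmod (a y)) \<partial>lborel) * (\<integral>\<^sup>+y. ennreal (cmod (b y)) \<partial>lborel)"
proof -
  have [measurable]: "a \<in> borel_measurable borel" "b \<in> borel_measurable borel" using a b by auto
  have "(\<integral>\<^sup>+x. ennreal (cmod (convol a b x)) \<partial>lborel) \<le> (\<integral>\<^sup>+x. \<integral>\<^sup>+y. ennreal (cmod (a y)) * ennreal (cmod (b (x - y))) \<partial>lborel \<partial>lborel)"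
  proof (rule nn_integral_mono_AE)
    have "AE x in lborel. integrable lborel (\<lambda>y. a y * b (x - y))"
      using lborel_pair.AE_integrable_snd[OF convolution_integrable(2)[OF a b]] by simp
    then show "AE x in lborel. ennreal (cmod (convol a b x)) \<le> (\<integral>\<^sup>+y. ennreal (cmod (a y)) * ennreal (cmod (b (x - y))) \<partial>lborel)"
    proof eventually_elim
      case (elim x)
      from integral_norm_bound_ennreal[OF this] show ?case by (simp add: convol_def norm_mult ennreal_mult)
    qed
  qed
  also have "\<dots> = (\<integral>\<^sup>+y. \<integral>\<^sup>+x. ennreal (cmod (a y)) * ennreal (cmod (b (x - y))) \<partial>lborel \<partial>lborel)"
    by (rule lborel_pair.Fubini'[symmetric]) measurable
  also have "\<dots> = (\<integral>\<^sup>+y. ennreal (cmod (a y)) * (\<integral>\<^sup>+x. ennreal (cmod (b x)) \<partial>lborel) \<partial>lborel)"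
    by (subst nn_integral_cmult) (simp_all add: nn_integral_lborel_shift[of "\<lambda>x. ennreal (cmod (b x))"])
  also have "\<dots> = (\<integral>\<^sup>+y. ennreal (cmod (a y)) \<partial>lborel) * (\<integral>\<^sup>+y. ennreal (cmod (b y)) \<partial>lborel)"
    by (rule nn_integral_multc) measurable
  finally show ?thesis .
qed

text \<open>These means replace an integrable function by a bounded continuous one without increasing its
  \<open>L\<^sup>1\<close> norm.\<close>

definition box_average :: "real \<Rightarrow> (real \<Rightarrow> complex) \<Rightarrow> real \<Rightarrow> complex" where
  "box_average h f x = integral {x..x + h} f /\<^sub>R h"

lemma box_average_props:
  fixes f :: "real \<Rightarrow> complex"
  assumes f: "integrable lborel f" and h: "0 < h"
  shows "isCont (box_average h f) x"
    and "cmod (box_average h f x) \<le> (\<integral>y. cmod (f y) \<partial>lborel) / h"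
    and "(\<integral>\<^sup>+x. ennreal (cmod (box_average h f x)) \<partial>lborel) \<le> (\<integral>\<^sup>+x. ennreal (cmod (f x)) \<partial>lborel)"
proof -
  have [measurable]: "f \<in> borel_measurable borel" using f by auto
  have si: "set_integrable lborel {a..b} f" for a b
    unfolding set_integrable_def using integrable_mult_indicator[OF _ f, of "{a..b}"] by simp
  have fi: "f integrable_on {a..b}" for a b by (rule set_borel_integral_eq_integral(1)[OF si])
  have bi: "integral {a..b} f = (\<integral>y. indicator {a..b} y *\<^sub>R f y \<partial>lborel)" for a b
    using set_borel_integral_eq_integral(2)[OF si[of a b]] by (simp add: set_lebesgue_integral_def)
  have nb: "cmod (integral {a..b} f) \<le> (\<integral>y. indicator {a..b} y * cmod (f y) \<partial>lborel)" for a b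
    unfolding bi by (rule order_trans[OF integral_norm_bound]) (simp add: abs_mult)
  have "cmod (integral {x..x + h} f) \<le> (\<integral>y. cmod (f y) \<partial>lborel)"
    by (rule order_trans[OF nb integral_mono])
       (use f integrable_mult_indicator[OF _ integrable_norm[OF f], of "{x..x+h}"] in \<open>auto simp: indicator_def\<close>)
  then show "cmod (box_average h f x) \<le> (\<integral>y. cmod (f y) \<partial>lborel) / h"
    unfolding box_average_def using h by (simp add: field_simps)
  show "isCont (box_average h f) x"
  proof -
    define F where "F y = integral {x - 1..y} f" for y
    have "continuous_on {x - 1..x + h + 1} F"
      unfolding F_def by (rule indefinite_integral_continuous_1[OF fi])
    then have F: "isCont F y" if "x - 1 < y" "y < x + h + 1" for y
      using that by (intro continuous_on_interior[of "{x - 1..x + h + 1}"]) auto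
    have eq: "box_average h f y = (F (y + h) - F y) /\<^sub>R h" if "x - 1 < y" for y
    proof -
      have "integral {x - 1..y} f + integral {y..y + h} f = integral {x - 1..y + h} f"
        using that h by (intro Henstock_Kurzweil_Integration.integral_combine fi) auto
      then have "integral {y..y + h} f = F (y + h) - F y" by (simp add: F_def eq_diff_eq add.commute)
      then show ?thesis by (simp add: box_average_def)
    qed
    have c: "isCont (\<lambda>y. (F (y + h) - F y) /\<^sub>R h) x"
      using h by (intro continuous_intros isCont_o2[of x "\<lambda>y. y + h" F] F) auto
    have "eventually (\<lambda>y. (F (y + h) - F y) /\<^sub>R h = box_average h f y) (nhds x)"
      unfolding eventually_nhds_metric using eq by (intro exI[of _ 1]) (auto simp: dist_real_def)
    from isCont_cong[OF this] c show ?thesis by simp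
  qed
  have "(\<integral>\<^sup>+x. ennreal (cmod (box_average h f x)) \<partial>lborel) \<le> (\<integral>\<^sup>+x. \<integral>\<^sup>+y. ennreal (indicator {0..h} (y - x) / h) * ennreal (cmod (f y)) \<partial>lborel \<partial>lborel)"
  proof (rule nn_integral_mono)
    fix x
    have "cmod (box_average h f x) \<le> (\<integral>y. indicator {x..x + h} y * cmod (f y) \<partial>lborel) / h"
      unfolding box_average_def using nb[of x "x + h"] h by (simp add: field_simps)
    also have "\<dots> = (\<integral>y. indicator {0..h} (y - x) / h * cmod (f y) \<partial>lborel)"
      by (subst integral_divide_zero[symmetric]) (intro Bochner_Integration.integral_cong, auto simp: indicator_def)
    finally have "ennreal (cmod (box_average h f x)) \<le> ennreal (\<integral>y. indicator {0..h} (y - x) / h * cmod (f y) \<partial>lborel)" by (rule ennreal_leI)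
    also have "\<dots> \<le> (\<integral>\<^sup>+y. ennreal (indicator {0..h} (y - x) / h * cmod (f y)) \<partial>lborel)"
    proof -
      have "integrable lborel (\<lambda>y. indicator {x..x + h} y *\<^sub>R cmod (f y) / h)"
        by (intro integrable_divide integrable_mult_indicator integrable_norm f) auto
      then have "integrable lborel (\<lambda>y. indicator {0..h} (y - x) / h * cmod (f y))"
      proof (rule back_subst)
        have "indicator {x..x + h} y = (indicator {0..h} (y - x) :: real)" for y by (auto simp: indicator_def)
        then show "integrable lborel (\<lambda>y. indicator {x..x + h} y *\<^sub>R cmod (f y) / h) = integrable lborel (\<lambda>y. indicator {0..h} (y - x) / h * cmod (f y))"
          by simp
      qed
      from nn_integral_eq_integral[OF this] show ?thesis using h by simp
    qed
    finally show "ennreal (cmod (box_average h f x)) \<le> (\<integral>\<^sup>+y. ennreal (indicator {0..h} (y - x) / h) * ennreal (cmod (f y)) \<partial>lborel)"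
      using h by (simp add: ennreal_mult del: times_divide_eq_left)
  qed
  also have "\<dots> = (\<integral>\<^sup>+y. \<integral>\<^sup>+x. ennreal (indicator {0..h} (y - x) / h) * ennreal (cmod (f y)) \<partial>lborel \<partial>lborel)"
    by (rule lborel_pair.Fubini'[symmetric]) measurable
  also have "\<dots> = (\<integral>\<^sup>+y. ennreal (cmod (f y)) \<partial>lborel)"
  proof (rule nn_integral_cong)
    fix y
    have "(\<integral>\<^sup>+x. ennreal (indicator {0..h} (y - x) / h) \<partial>lborel) = (\<integral>\<^sup>+x. ennreal (1 / h) * indicator {y - h..y} x \<partial>lborel)"
      using h by (intro nn_integral_cong) (auto simp: indicator_def)
    also have "\<dots> = 1" using h by (simp add: nn_integral_cmult flip: ennreal_mult ennreal_1)
    finally have "(\<integral>\<^sup>+x. ennreal (indicator {0..h} (y - x) / h) \<partial>lborel) = 1" .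
    then show "(\<integral>\<^sup>+x. ennreal (indicator {0..h} (y - x) / h) * ennreal (cmod (f y)) \<partial>lborel) = ennreal (cmod (f y))"
      by (simp add: nn_integral_multc)
  qed
  finally show "(\<integral>\<^sup>+x. ennreal (cmod (box_average h f x)) \<partial>lborel) \<le> (\<integral>\<^sup>+x. ennreal (cmod (f x)) \<partial>lborel)" .
qed

text \<open>Lebesgue's differentiation theorem gives convergence almost everywhere. Since the norms do not
  exceed the norm of the limit, Scheffe's lemma turns this into convergence in \<open>L\<^sup>1\<close>.\<close>

lemma box_average_L1:
  fixes f :: "real \<Rightarrow> complex"
  assumes f: "integrable lborel f"
  shows "(\<lambda>n. \<integral>\<^sup>+x. ennreal (cmod (box_average (1 / real (Suc n)) f x - f x)) \<partial>lborel) \<longlonglongrightarrow> 0"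
proof (rule Scheffe_lemma2[OF _ f])
  have [measurable]: "f \<in> borel_measurable borel" using f by auto
  show "box_average (1 / real (Suc n)) f \<in> borel_measurable lborel" for n
    using box_average_props(1)[OF f] by (simp add: borel_measurable_continuous_onI continuous_at_imp_continuous_on)
  show "(\<integral>\<^sup>+x. ennreal (norm (box_average (1 / real (Suc n)) f x)) \<partial>lborel) \<le> (\<integral>\<^sup>+x. ennreal (norm (f x)) \<partial>lborel)" for n
    by (rule box_average_props(3)[OF f]) simp
  have fi: "f integrable_on cbox a b" for a b
  proof -
    have "set_integrable lborel {a..b} f"
      unfolding set_integrable_def using integrable_mult_indicator[OF _ f, of "{a..b}"] by simp
    from set_borel_integral_eq_integral(1)[OF this] show ?thesis by simp
  qed
  obtain N where N: "negligible N" "\<And>x e. x \<notin> N \<Longrightarrow> 0 < e \<Longrightarrow>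
      \<exists>d>0. \<forall>h. 0 < h \<and> h < d \<longrightarrow> norm (integral (cbox x (x + h *\<^sub>R One)) f /\<^sub>R h ^ DIM(real) - f x) < e"
    using integrable_ccontinuous_explicit[of f, OF fi] by metis
  have "N \<in> null_sets lebesgue" using N(1) by (simp add: negligible_iff_null_sets)
  from AE_not_in[OF this] have "AE x in lborel. x \<notin> N" by (simp add: AE_completion_iff)
  then show "AE x in lborel. (\<lambda>n. box_average (1 / real (Suc n)) f x) \<longlonglongrightarrow> f x"
  proof eventually_elim
    case (elim x)
    show ?case
    proof (rule metric_LIMSEQ_I)
      fix e :: real assume e: "0 < e"
      obtain d where d: "0 < d" "\<And>h. 0 < h \<Longrightarrow> h < d \<Longrightarrow> norm (integral (cbox x (x + h *\<^sub>R One)) f /\<^sub>R h ^ DIM(real) - f x) < e"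
        using N(2)[OF elim e] by blast
      obtain n0 where n0: "1 / real (Suc n0) < d" using d(1) nat_approx_posE by blast
      have "dist (box_average (1 / real (Suc n)) f x) (f x) < e" if "n0 \<le> n" for n
      proof -
        have "1 / real (Suc n) \<le> 1 / real (Suc n0)" using that by (simp add: field_simps)
        then have "1 / real (Suc n) < d" using n0 by linarith
        from d(2)[OF _ this] show ?thesis by (simp add: box_average_def dist_norm)
      qed
      then show "\<exists>n0. \<forall>n\<ge>n0. dist (box_average (1 / real (Suc n)) f x) (f x) < e" by blast
    qed
  qed
qed

text \<open>For bounded continuous functions the convolutions converge pointwise, and hence in \<open>L\<^sup>1\<close> by
  Scheffe's lemma. The general case follows since convolution with the kernels does not increase the
  \<open>L\<^sup>1\<close> norm and box averages are bounded and continuous.\<close>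

lemma convol_gauss_L1:
  fixes f :: "real \<Rightarrow> complex"
  assumes f: "integrable lborel f"
  shows "(\<lambda>n. \<integral>\<^sup>+x. ennreal (cmod (f x - convol f (gauss_kernel n) x)) \<partial>lborel) \<longlonglongrightarrow> 0"
proof (rule tendsto_0_if_Limsup_eq_0_ennreal)
  let ?I = "\<lambda>n. \<integral>\<^sup>+x. ennreal (cmod (f x - convol f (gauss_kernel n) x)) \<partial>lborel"
  have [measurable]: "f \<in> borel_measurable borel" using f by auto
  have lim: "limsup ?I \<le> ennreal e" if e: "0 < e" for e
  proof -
    have "eventually (\<lambda>m. (\<integral>\<^sup>+x. ennreal (cmod (box_average (1 / real (Suc m)) f x - f x)) \<partial>lborel) < ennreal (e / 3)) sequentially"
      using order_tendstoD(2)[OF box_average_L1[OF f], of "ennreal (e / 3)"] e by simp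
    then obtain m where m: "(\<integral>\<^sup>+x. ennreal (cmod (box_average (1 / real (Suc m)) f x - f x)) \<partial>lborel) < ennreal (e / 3)"
      by (auto simp: eventually_sequentially)
    define g where "g = box_average (1 / real (Suc m)) f"
    have h: "0 < 1 / real (Suc m)" by simp
    have gc: "isCont g x" for x unfolding g_def by (rule box_average_props(1)[OF f h])
    have gm [measurable]: "g \<in> borel_measurable borel"
      using gc by (simp add: borel_measurable_continuous_onI continuous_at_imp_continuous_on)
    have gi: "integrable lborel g"
    proof (rule integrableI_bounded)
      have "(\<integral>\<^sup>+x. ennreal (norm (g x)) \<partial>lborel) \<le> (\<integral>\<^sup>+x. ennreal (norm (f x)) \<partial>lborel)"
        unfolding g_def by (rule box_average_props(3)[OF f h])
      also have "\<dots> < \<infinity>" using f by (simp add: integrable_iff_bounded)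
      finally show "(\<integral>\<^sup>+x. ennreal (norm (g x)) \<partial>lborel) < \<infinity>" .
    qed simp
    have K: "integrable lborel (gauss_kernel n)" for n by (rule gauss_kernel_props(1))
    have cm [measurable]: "convol g (gauss_kernel n) \<in> borel_measurable borel" "convol f (gauss_kernel n) \<in> borel_measurable borel" for n
      unfolding convol_def by measurable
    have "(\<lambda>n. \<integral>\<^sup>+x. ennreal (cmod (convol g (gauss_kernel n) x - g x)) \<partial>lborel) \<longlonglongrightarrow> 0"
    proof (rule Scheffe_lemma2[OF _ gi])
      show "AE x in lborel. (\<lambda>n. convol g (gauss_kernel n) x) \<longlonglongrightarrow> g x"
        using box_average_props(2)[OF f h] by (intro AE_I2 convol_gauss_tendsto[OF gm _ gc]) (simp add: g_def)
      show "(\<integral>\<^sup>+x. ennreal (norm (convol g (gauss_kernel n) x)) \<partial>lborel) \<le> (\<integral>\<^sup>+x. ennreal (norm (g x)) \<partial>lborel)" for n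
        using convol_norm[OF gi K, of n] by (simp add: gauss_kernel_props(2))
    qed simp
    then have "eventually (\<lambda>n. (\<integral>\<^sup>+x. ennreal (cmod (convol g (gauss_kernel n) x - g x)) \<partial>lborel) < ennreal (e / 3)) sequentially"
      using e by (intro order_tendstoD(2)) auto
    then have "eventually (\<lambda>n. ?I n \<le> ennreal e) sequentially"
    proof eventually_elim
      case (elim n)
      have fg: "integrable lborel (\<lambda>x. g x - f x)" using gi f by simp
      have d: "AE x in lborel. convol g (gauss_kernel n) x - convol f (gauss_kernel n) x = convol (\<lambda>x. g x - f x) (gauss_kernel n) x"
      proof -
        have "AE x in lborel. integrable lborel (\<lambda>y. g y * gauss_kernel n (x - y))" "AE x in lborel. integrable lborel (\<lambda>y. f y * gauss_kernel n (x - y))"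
          using lborel_pair.AE_integrable_snd[OF convolution_integrable(2)[OF gi K]] lborel_pair.AE_integrable_snd[OF convolution_integrable(2)[OF f K]] by simp_all
        then show ?thesis by eventually_elim (simp add: convol_def left_diff_distrib)
      qed
      have "?I n \<le> (\<integral>\<^sup>+x. ennreal (cmod (g x - f x)) + ennreal (cmod (convol g (gauss_kernel n) x - g x)) + ennreal (cmod (convol (\<lambda>x. g x - f x) (gauss_kernel n) x)) \<partial>lborel)"
      proof (rule nn_integral_mono_AE, use d in eventually_elim)
        case (elim x)
        define z1 z2 z3 where "z1 = g x - f x" and "z2 = convol g (gauss_kernel n) x - g x" and "z3 = convol (\<lambda>x. g x - f x) (gauss_kernel n) x"
        have "f x - convol f (gauss_kernel n) x = (- z1 - z2) + z3"
          unfolding z1_def z2_def z3_def by (simp flip: elim)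
        then have "cmod (f x - convol f (gauss_kernel n) x) \<le> cmod z1 + cmod z2 + cmod z3"
          using norm_triangle_ineq[of "- z1 - z2" z3] norm_triangle_ineq4[of "- z1" z2] by simp
        then show ?case unfolding z1_def z2_def z3_def by (simp flip: ennreal_plus add: ennreal_leI)
      qed
      also have "\<dots> = (\<integral>\<^sup>+x. ennreal (cmod (g x - f x)) \<partial>lborel) + (\<integral>\<^sup>+x. ennreal (cmod (convol g (gauss_kernel n) x - g x)) \<partial>lborel)
          + (\<integral>\<^sup>+x. ennreal (cmod (convol (\<lambda>x. g x - f x) (gauss_kernel n) x)) \<partial>lborel)"
      proof -
        have [measurable]: "convol (\<lambda>x. g x - f x) (gauss_kernel n) \<in> borel_measurable borel" unfolding convol_def by measurable
        show ?thesis by (simp add: nn_integral_add)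
      qed
      also have "\<dots> \<le> ennreal (e / 3) + ennreal (e / 3) + ennreal (e / 3)"
      proof (intro add_mono)
        show 1: "(\<integral>\<^sup>+x. ennreal (cmod (g x - f x)) \<partial>lborel) \<le> ennreal (e / 3)" using m by (simp add: g_def)
        show "(\<integral>\<^sup>+x. ennreal (cmod (convol g (gauss_kernel n) x - g x)) \<partial>lborel) \<le> ennreal (e / 3)" using elim by simp
        show "(\<integral>\<^sup>+x. ennreal (cmod (convol (\<lambda>x. g x - f x) (gauss_kernel n) x)) \<partial>lborel) \<le> ennreal (e / 3)"
          using order_trans[OF convol_norm[OF fg K, of n]] 1 by (simp add: gauss_kernel_props(2))
      qed
      also have "\<dots> = ennreal e" using e by (simp flip: ennreal_plus)
      finally show ?case .
    qed
    then show ?thesis by (rule Limsup_bounded)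
  qed
  have "limsup ?I \<le> 0"
  proof (rule ennreal_le_epsilon)
    fix e :: real assume "0 < e"
    from lim[OF this] show "limsup ?I \<le> 0 + ennreal e" by (simp only: add_0)
  qed
  then show "limsup ?I = 0" by simp
qed

lemma weight_powr_le: "1 \<le> p \<Longrightarrow> (1 / (1 + x\<^sup>2)) powr p \<le> 1 / (1 + x\<^sup>2)" for x p :: real
proof -
  assume p: "1 \<le> p"
  have w: "0 < 1 / (1 + x\<^sup>2)" "1 / (1 + x\<^sup>2) \<le> 1" by (auto simp: field_simps add_pos_nonneg)
  have "(1 / (1 + x\<^sup>2)) powr p \<le> (1 / (1 + x\<^sup>2)) powr 1" using w p by (intro powr_mono') auto
  then show ?thesis using w by simp
qed

lemma Lp_norm_quadratic_decay:
  assumes p: "1 \<le> p" and k: "0 \<le> k" and V: "\<And>x. cmod (V x) \<le> k * (1 / (1 + x\<^sup>2))"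
  shows "Lp_norm p V \<le> ennreal (k * pi powr (1 / p))"
proof -
  have p0: "0 < p" using p by simp
  have "(\<integral>\<^sup>+x. ennreal (cmod (V x) powr p) \<partial>lborel) \<le> (\<integral>\<^sup>+x. ennreal (k powr p) * ennreal (1 / (1 + x\<^sup>2)) \<partial>lborel)"
  proof (rule nn_integral_mono)
    fix x
    have "cmod (V x) powr p \<le> (k * (1 / (1 + x\<^sup>2))) powr p" using p V by (intro powr_mono2) auto
    also have "\<dots> = k powr p * (1 / (1 + x\<^sup>2)) powr p" by (rule powr_mult)
    also have "\<dots> \<le> k powr p * (1 / (1 + x\<^sup>2))" by (intro mult_left_mono weight_powr_le p) auto
    finally have "ennreal (cmod (V x) powr p) \<le> ennreal (k powr p * (1 / (1 + x\<^sup>2)))" by (rule ennreal_leI)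
    also have "\<dots> = ennreal (k powr p) * ennreal (1 / (1 + x\<^sup>2))" by (rule ennreal_mult) auto
    finally show "ennreal (cmod (V x) powr p) \<le> ennreal (k powr p) * ennreal (1 / (1 + x\<^sup>2))" .
  qed
  also have "\<dots> = ennreal (k powr p) * (\<integral>\<^sup>+x. ennreal (1 / (1 + x\<^sup>2)) \<partial>lborel)" by (rule nn_integral_cmult) measurable
  also have "(\<integral>\<^sup>+x. ennreal (1 / (1 + x\<^sup>2)) \<partial>(lborel :: real measure)) = ennreal pi"
    using nn_integral_eq_integral[OF integrable_inverse_quadratic] by (simp add: integral_inverse_quadratic)
  also have "ennreal (k powr p) * ennreal pi = ennreal (k powr p * pi)" by (simp add: ennreal_mult)
  finally have "Lp_norm p V \<le> ennreal_root p (ennreal (k powr p * pi))"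
    unfolding Lp_norm_def by (rule ennreal_root_mono[OF p0])
  also have "\<dots> = ennreal ((k powr p * pi) powr (1 / p))" by (rule ennreal_root_simps(2)) simp
  also have "(k powr p * pi) powr (1 / p) = k * pi powr (1 / p)" using p0 k by (simp add: powr_mult powr_powr)
  finally show ?thesis .
qed

lemma represents_diff:
  assumes "represents f u" "represents g v"
  shows "represents (\<lambda>x. f x - g x) (\<lambda>s. u s - v s)"
  using assms by (auto simp: represents_def left_diff_distrib)

lemma fourier_segal_representatives:
  assumes u: "u \<in> fourier_segal p"
  obtains f H where "represents f u" "Lp_norm p f < \<infinity>" "integrable lborel H" "represents H (dist_fourier u)"
proof -
  have "dist_Lp_norm p u < \<infinity>" "dist_Lp_norm 1 (dist_fourier u) < \<infinity>"
    using u by (auto simp: fourier_segal_def FA_norm_def)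
  then obtain f H where f: "represents f u" "Lp_norm p f < \<infinity>" and H: "represents H (dist_fourier u)" "Lp_norm 1 H < \<infinity>"
    unfolding dist_Lp_norm_def INF_less_iff by blast
  have "integrable lborel H" using H by (intro integrableI_bounded) (auto simp: represents_def Lp_norm_1)
  with f H that show ?thesis by blast
qed

text \<open>A quadratic decay of the test function makes the integral converge, and this costs two orders of
  the seminorms.\<close>

lemma bounded_function_tempered:
  assumes f [measurable]: "f \<in> borel_measurable borel" and B: "\<And>t. cmod (f t) \<le> B"
  shows "(\<lambda>s. if s \<in> schwartz then \<integral>t. f t * s t \<partial>lborel else 0) \<in> tempered_distributions" (is "?v \<in> _")
proof (rule temperedI)
  have B0: "0 \<le> B" using order_trans[OF norm_ge_zero B] .
  have i: "integrable lborel (\<lambda>t. f t * s t)" if "s \<in> schwartz" for s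
    by (rule integrable_mult_bounded(2)[OF schwartz_integrable[OF that] _ B]) simp
  show "?v s = 0" if "s \<notin> schwartz" for s using that by simp
  show "?v (\<lambda>x. s x + r x) = ?v s + ?v r" if "s \<in> schwartz" "r \<in> schwartz" for s r
    using that i by (simp add: schwartz_add distrib_left)
  show "?v (\<lambda>x. c * s x) = c * ?v s" if "s \<in> schwartz" for c s
    using that by (simp add: schwartz_cmult(1) mult.left_commute)
  show "cmod (?v s) \<le> (B * 2 * pi) * M" if s: "s \<in> schwartz" and M: "schwartz_bounded_by 2 s M" for s M
  proof -
    have "cmod (?v s) \<le> (\<integral>t. cmod (f t * s t) \<partial>lborel)" using s by (simp add: integral_norm_bound)
    also have "\<dots> \<le> (B * (2 * M)) * pi"
    proof (rule integral_quadratic_decay)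
      show "cmod (f t * s t) \<le> B * (2 * M) * (1 / (1 + t\<^sup>2))" for t
        using mult_mono[OF B schwartz_bounded_by_decay[OF M] B0 norm_ge_zero, of t t] by (simp add: norm_mult mult.assoc)
      show "(\<lambda>t. f t * s t) \<in> borel_measurable borel" using schwartz_measurable[OF s] by measurable
    qed
    finally show ?thesis by (simp add: mult_ac)
  qed
qed

text \<open>The product \<open>v\<close> of \<open>u\<close> with a Gaussian. Its short-time transform at \<open>(x, \<xi>)\<close> is the convolution,
  at \<open>\<xi>\<close>, of \<open>H\<close> with the Fourier transform of the Gaussian times the window at \<open>x\<close>, which is
  \<open>O(1 / ((1 + x\<^sup>2) (1 + \<xi>\<^sup>2)))\<close> by \<open>translated_product_fourier_decay\<close>. So the \<open>L\<^sup>p\<close> norms of the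
  slices are bounded by a multiple of the convolution \<open>k\<close> of \<open>\<bar>H\<bar>\<close> with \<open>1 / (1 + \<xi>\<^sup>2)\<close>, and \<open>k\<close> is
  integrable.\<close>

lemma gaussian_cutoff_distribution:
  fixes H :: "real \<Rightarrow> complex"
  assumes u: "u \<in> tempered_distributions" and H: "integrable lborel H" and Hrep: "represents H (dist_fourier u)"
    and f: "represents f u" and p: "1 \<le> p" and \<phi>: "\<phi> \<in> schwartz"
  defines "G \<equiv> \<lambda>n t. complex_of_real (exp (- (t\<^sup>2 / (4 * (real (Suc n))\<^sup>2))))"
  obtains v where "v \<in> modulation_space \<phi> p" "represents (\<lambda>t. f t * G n t) v"
    "represents (convol H (gauss_kernel n)) (dist_fourier v)"
proof -
  define g where "g = G n"
  have gS: "g \<in> schwartz"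
    using gaussian_schwartz[of "1 / (4 * (real (Suc n))\<^sup>2)"] by (simp add: g_def G_def del: of_nat_Suc)
  have gle: "cmod (g t) \<le> 1" for t unfolding g_def G_def norm_of_real by simp
  have fg: "fourier g z = 2 * pi * gauss_kernel n z" for z unfolding g_def G_def by (rule fourier_gauss_cutoff)
  have [measurable]: "g \<in> borel_measurable borel" by (rule schwartz_measurable[OF gS])
  have rep: "dist_fourier u q = (\<integral>\<eta>. H \<eta> * q \<eta> \<partial>lborel)" if "q \<in> schwartz" for q
    using Hrep that by (simp add: represents_def)
  define f0 where "f0 t = 1 / (2 * pi) * fourier H (- t)" for t
  have f0m [measurable]: "f0 \<in> borel_measurable borel" unfolding f0_def by (rule inverse_fourier_measurable[OF H])
  define B where "B = 1 / (2 * pi) * (\<integral>\<eta>. cmod (H \<eta>) \<partial>lborel)"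
  have fB: "cmod (f0 t) \<le> B" for t unfolding f0_def B_def by (rule bounded_inverse_fourier[OF H])
  have B0: "0 \<le> B" using order_trans[OF norm_ge_zero fB] .
  have gs: "(\<lambda>t. g t * s t) \<in> schwartz" if "s \<in> schwartz" for s
    using schwartz_mult[OF gS schwartz_bounded_smooth[OF that]] .
  have fgB: "cmod (f0 t * g t) \<le> B" for t
    unfolding norm_mult using mult_mono[OF fB gle B0 norm_ge_zero] by simp
  define v where "v s = (if s \<in> schwartz then \<integral>t. f0 t * g t * s t \<partial>lborel else 0)" for s
  have v_eq: "v s = (\<integral>t. f0 t * g t * s t \<partial>lborel)" if "s \<in> schwartz" for s
    using that by (simp add: v_def)
  have uv: "v s = u (\<lambda>t. g t * s t)" if s: "s \<in> schwartz" for s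
    unfolding v_eq[OF s] f0_def using fourier_L1_represents[OF u H rep gs[OF s]] by (simp add: mult.assoc)
  have v: "v \<in> tempered_distributions"
    unfolding v_def[abs_def] by (rule bounded_function_tempered[OF _ fgB]) simp
  have r1: "represents (\<lambda>t. f t * g t) v"
    unfolding represents_def
  proof (intro conjI ballI)
    show "(\<lambda>t. f t * g t) \<in> borel_measurable lborel" using f by (auto simp: represents_def)
    fix s assume s: "s \<in> schwartz"
    have "integrable lborel (\<lambda>x. f x * (g x * s x))" "u (\<lambda>x. g x * s x) = (\<integral>x. f x * (g x * s x) \<partial>lborel)"
      using f gs[OF s] by (auto simp: represents_def)
    then show "integrable lborel (\<lambda>x. f x * g x * s x)" "v s = (\<integral>x. f x * g x * s x \<partial>lborel)"
      using uv[OF s] by (auto simp: mult.assoc)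
  qed
  have Ki: "integrable lborel (gauss_kernel n)" by (rule gauss_kernel_props(1))
  have r2: "represents (convol H (gauss_kernel n)) (dist_fourier v)"
  proof (rule representsI_L1)
    show "integrable lborel (convol H (gauss_kernel n))"
      unfolding convol_def[abs_def] by (rule convolution_integrable(1)[OF H Ki])
    fix q assume q: "q \<in> schwartz"
    have "integrable lborel (\<lambda>t. f0 t * g t)" by (rule integrable_mult_bounded(2)[OF schwartz_integrable[OF gS] _ fB]) simp
    then have "(\<integral>t. fourier q t * (f0 t * g t) \<partial>lborel) = (\<integral>y. q y * fourier (\<lambda>t. f0 t * g t) y \<partial>lborel)"
      by (rule fourier_multiplication_formula[OF schwartz_integrable[OF q]])
    moreover have "fourier (\<lambda>t. f0 t * g t) y = convol H (gauss_kernel n) y" for y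
    proof -
      have "fourier (\<lambda>t. f0 t * g t) y = fourier (\<lambda>t. 1 / (2 * pi) * (fourier H (- t) * g t)) y" by (simp add: f0_def mult.assoc)
      also have "\<dots> = 1 / (2 * pi) * fourier (\<lambda>t. fourier H (- t) * g t) y" by (subst fourier_cmult) simp
      also have "\<dots> = 1 / (2 * pi) * (\<integral>\<eta>. (2 * pi) * (H \<eta> * gauss_kernel n (y - \<eta>)) \<partial>lborel)"
        unfolding fourier_product_convolution[OF H schwartz_integrable[OF gS]] fg by (simp add: mult.left_commute)
      also have "\<dots> = convol H (gauss_kernel n) y" by (subst integral_mult_right_zero) (simp add: convol_def)
      finally show ?thesis .
    qed
    ultimately show "dist_fourier v q = (\<integral>\<eta>. convol H (gauss_kernel n) \<eta> * q \<eta> \<partial>lborel)"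
      using q by (simp add: dist_fourier_def v_eq[OF schwartz_fourier[OF q]] mult_ac)
  qed
  obtain C where C: "0 \<le> C" "\<And>x \<xi>. cmod (fourier (\<lambda>t. g t * cnj (\<phi> (t - x))) \<xi>) \<le> C * (1 / (1 + x\<^sup>2)) * (1 / (1 + \<xi>\<^sup>2))"
    using translated_product_fourier_decay[OF schwartz_cnj(1)[OF \<phi>] gS] by blast
  define w where "w z = complex_of_real (1 / (1 + z\<^sup>2))" for z :: real
  have wi: "integrable lborel w" unfolding w_def[abs_def] complex_of_real_integrable_eq by (rule integrable_inverse_quadratic)
  define a where "a = (\<lambda>\<eta>. complex_of_real (cmod (H \<eta>)))"
  have ai: "integrable lborel a" unfolding a_def complex_of_real_integrable_eq using H by simp
  \<comment> \<open>\<open>a\<close> and \<open>w\<close> are nonnegative; they are complex valued only because \<open>convol\<close> is, so the modulus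
    does not change anything\<close>
  define k where "k \<xi> = cmod (convol a w \<xi>)" for \<xi>
  have V: "AE \<xi> in lborel. \<forall>x. cmod (STFT \<phi> v x \<xi>) \<le> (C / (2 * pi) * k \<xi>) * (1 / (1 + x\<^sup>2))"
  proof -
    have "AE \<xi> in lborel. integrable lborel (\<lambda>\<eta>. a \<eta> * w (\<xi> - \<eta>))"
      using lborel_pair.AE_integrable_snd[OF convolution_integrable(2)[OF ai wi]] by simp
    then show ?thesis
    proof eventually_elim
      case (elim \<xi>)
      have i: "integrable lborel (\<lambda>\<eta>. cmod (H \<eta>) * (1 / (1 + (\<xi> - \<eta>)\<^sup>2)))"
        using elim unfolding a_def w_def by (simp only: of_real_mult[symmetric] complex_of_real_integrable_eq)
      have kI: "k \<xi> = (\<integral>\<eta>. cmod (H \<eta>) * (1 / (1 + (\<xi> - \<eta>)\<^sup>2)) \<partial>lborel)"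
      proof -
        have "convol a w \<xi> = complex_of_real (\<integral>\<eta>. cmod (H \<eta>) * (1 / (1 + (\<xi> - \<eta>)\<^sup>2)) \<partial>lborel)"
          unfolding convol_def a_def w_def by (simp only: of_real_mult[symmetric] integral_complex_of_real)
        then show ?thesis unfolding k_def by (simp only: norm_of_real) (intro abs_of_nonneg integral_nonneg_AE, auto)
      qed
      show ?case
      proof
        fix x
        have ks: "(\<lambda>t. g t * cnj (\<phi> (t - x))) \<in> schwartz"
          by (intro schwartz_mult gS schwartz_bounded_smooth cnj_shift_schwartz \<phi>)
        have ts: "(\<lambda>t. cnj (\<phi> (t - x)) * cis (- (t * \<xi>))) \<in> schwartz" by (rule lip_family_schwartz[OF STFT_families(1)[OF \<phi>]])
        have "STFT \<phi> v x \<xi> = fourier (\<lambda>t. 1 / (2 * pi) * (fourier H (- t) * (g t * cnj (\<phi> (t - x))))) \<xi>"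
          unfolding STFT_def v_eq[OF ts] f0_def by (simp only: fourier_def mult.assoc)
        also have "\<dots> = 1 / (2 * pi) * fourier (\<lambda>t. fourier H (- t) * (g t * cnj (\<phi> (t - x)))) \<xi>" by (subst fourier_cmult) simp
        also have "\<dots> = 1 / (2 * pi) * (\<integral>\<eta>. H \<eta> * fourier (\<lambda>t. g t * cnj (\<phi> (t - x))) (\<xi> - \<eta>) \<partial>lborel)"
          unfolding fourier_product_convolution[OF H schwartz_integrable[OF ks]] ..
        finally have eq: "cmod (STFT \<phi> v x \<xi>) = 1 / (2 * pi) * cmod (\<integral>\<eta>. H \<eta> * fourier (\<lambda>t. g t * cnj (\<phi> (t - x))) (\<xi> - \<eta>) \<partial>lborel)"
          by (simp add: norm_mult norm_divide)
        have I: "cmod (\<integral>\<eta>. H \<eta> * fourier (\<lambda>t. g t * cnj (\<phi> (t - x))) (\<xi> - \<eta>) \<partial>lborel)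
            \<le> (\<integral>\<eta>. (C * (1 / (1 + x\<^sup>2))) * (cmod (H \<eta>) * (1 / (1 + (\<xi> - \<eta>)\<^sup>2))) \<partial>lborel)"
        proof (rule Bochner_Integration.integral_norm_bound_integral)
          obtain D where D: "\<And>z. cmod (fourier (\<lambda>t. g t * cnj (\<phi> (t - x))) z) \<le> D" using schwartz_bounded[OF schwartz_fourier[OF ks]] by blast
          have [measurable]: "fourier (\<lambda>t. g t * cnj (\<phi> (t - x))) \<in> borel_measurable borel" by (rule schwartz_measurable[OF schwartz_fourier[OF ks]])
          show "integrable lborel (\<lambda>\<eta>. H \<eta> * fourier (\<lambda>t. g t * cnj (\<phi> (t - x))) (\<xi> - \<eta>))"
            by (rule integrable_mult_bounded(1)[OF H _ D]) measurable
          show "integrable lborel (\<lambda>\<eta>. (C * (1 / (1 + x\<^sup>2))) * (cmod (H \<eta>) * (1 / (1 + (\<xi> - \<eta>)\<^sup>2))))" by (rule integrable_mult_right[OF i])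
          show "norm (H \<eta> * fourier (\<lambda>t. g t * cnj (\<phi> (t - x))) (\<xi> - \<eta>)) \<le> (C * (1 / (1 + x\<^sup>2))) * (cmod (H \<eta>) * (1 / (1 + (\<xi> - \<eta>)\<^sup>2)))" for \<eta>
            using mult_left_mono[OF C(2)[of x "\<xi> - \<eta>"], of "cmod (H \<eta>)"] by (simp add: norm_mult mult_ac)
        qed
        have "(\<integral>\<eta>. (C * (1 / (1 + x\<^sup>2))) * (cmod (H \<eta>) * (1 / (1 + (\<xi> - \<eta>)\<^sup>2))) \<partial>lborel) = (C * (1 / (1 + x\<^sup>2))) * k \<xi>"
          unfolding kI by (rule integral_mult_right_zero)
        with I have "cmod (STFT \<phi> v x \<xi>) \<le> 1 / (2 * pi) * ((C * (1 / (1 + x\<^sup>2))) * k \<xi>)"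
          unfolding eq by (intro mult_left_mono) auto
        then show "cmod (STFT \<phi> v x \<xi>) \<le> (C / (2 * pi) * k \<xi>) * (1 / (1 + x\<^sup>2))" by (simp only: times_divide_eq_left times_divide_eq_right mult_1 mult_1_right divide_divide_eq_left mult_ac)
      qed
    qed
  qed
  define c where "c = C / (2 * pi) * pi powr (1 / p)"
  have c0: "0 \<le> c" using C(1) by (simp add: c_def)
  have "(\<integral>\<^sup>+\<xi>. Lp_norm p (\<lambda>x. STFT \<phi> v x \<xi>) \<partial>lborel) \<le> (\<integral>\<^sup>+\<xi>. ennreal c * ennreal (k \<xi>) \<partial>lborel)"
  proof (rule nn_integral_mono_AE, use V in eventually_elim)
    case (elim \<xi>)
    have "Lp_norm p (\<lambda>x. STFT \<phi> v x \<xi>) \<le> ennreal ((C / (2 * pi) * k \<xi>) * pi powr (1 / p))"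
      using elim C(1) by (intro Lp_norm_quadratic_decay p) (auto simp: k_def)
    also have "\<dots> = ennreal c * ennreal (k \<xi>)" using c0 by (simp add: c_def k_def mult_ac flip: ennreal_mult)
    finally show ?case .
  qed
  also have "\<dots> \<le> ennreal c * (\<integral>\<^sup>+\<xi>. ennreal (k \<xi>) \<partial>lborel)"
  proof -
    have [measurable]: "a \<in> borel_measurable borel" "w \<in> borel_measurable borel" using ai wi by auto
    have [measurable]: "k \<in> borel_measurable borel" unfolding k_def convol_def by measurable
    show ?thesis by (simp add: nn_integral_cmult)
  qed
  also have "\<dots> < \<infinity>"
  proof -
    have "(\<integral>\<^sup>+\<xi>. ennreal (k \<xi>) \<partial>lborel) < \<infinity>"
      unfolding k_def using convolution_integrable(1)[OF ai wi] unfolding convol_def by (simp add: integrable_iff_bounded)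
    then show ?thesis by (simp add: ennreal_mult_less_top)
  qed
  finally have "v \<in> modulation_space \<phi> p" using v by (simp add: modulation_space_def modulation_norm_def)
  then show ?thesis using that r1 r2 by (simp add: g_def)
qed

lemma modulation_dense:
  assumes p: "1 \<le> p" and \<phi>: "\<phi> \<in> schwartz" and u: "u \<in> fourier_segal p" and e: "(0::real) < e"
  shows "\<exists>v \<in> modulation_space \<phi> p. FA_norm p (\<lambda>f. u f - v f) < ennreal e"
proof -
  have ut: "u \<in> tempered_distributions" using u by (simp add: fourier_segal_def)
  obtain f H where f: "represents f u" "Lp_norm p f < \<infinity>" and H: "integrable lborel H" "represents H (dist_fourier u)"
    using fourier_segal_representatives[OF u] by blast
  define G where "G n t = complex_of_real (exp (- (t\<^sup>2 / (4 * (real (Suc n))\<^sup>2))))" for n t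
  have fm: "f \<in> borel_measurable borel" using f(1) by (simp add: represents_def)
  have "eventually (\<lambda>n. Lp_norm p (\<lambda>t. f t - f t * G n t) < ennreal (e / 2)) sequentially"
    unfolding G_def by (rule order_tendstoD(2)[OF gaussian_cutoff_Lp[OF p fm f(2)]]) (use e in simp)
  moreover have "eventually (\<lambda>n. (\<integral>\<^sup>+x. ennreal (cmod (H x - convol H (gauss_kernel n) x)) \<partial>lborel) < ennreal (e / 2)) sequentially"
    by (rule order_tendstoD(2)[OF convol_gauss_L1[OF H(1)]]) (use e in simp)
  ultimately have "eventually (\<lambda>n. Lp_norm p (\<lambda>t. f t - f t * G n t) < ennreal (e / 2) \<and>
     (\<integral>\<^sup>+x. ennreal (cmod (H x - convol H (gauss_kernel n) x)) \<partial>lborel) < ennreal (e / 2)) sequentially"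
    by (rule eventually_conj)
  then obtain n where n: "Lp_norm p (\<lambda>t. f t - f t * G n t) < ennreal (e / 2)"
     "(\<integral>\<^sup>+x. ennreal (cmod (H x - convol H (gauss_kernel n) x)) \<partial>lborel) < ennreal (e / 2)"
    by (auto simp: eventually_sequentially)
  obtain v where v: "v \<in> modulation_space \<phi> p" "represents (\<lambda>t. f t * G n t) v" "represents (convol H (gauss_kernel n)) (dist_fourier v)"
    using gaussian_cutoff_distribution[OF ut H f(1) p \<phi>, of n] unfolding G_def by blast
  have df: "dist_fourier (\<lambda>s. u s - v s) = (\<lambda>s. dist_fourier u s - dist_fourier v s)" by (auto simp: dist_fourier_def)
  have 1: "dist_Lp_norm p (\<lambda>s. u s - v s) < ennreal (e / 2)"
    by (rule le_less_trans[OF dist_Lp_norm_le[OF represents_diff[OF f(1) v(2)]] n(1)])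
  have 2: "dist_Lp_norm 1 (dist_fourier (\<lambda>s. u s - v s)) < ennreal (e / 2)"
    unfolding df by (rule le_less_trans[OF dist_Lp_norm_le[OF represents_diff[OF H(2) v(3)]]]) (use n(2) in \<open>simp add: Lp_norm_1\<close>)
  have "FA_norm p (\<lambda>f. u f - v f) < ennreal (e / 2) + ennreal (e / 2)"
    unfolding FA_norm_def by (rule add_strict_mono[OF 1 2])
  also have "\<dots> = ennreal e" using e by (simp flip: ennreal_plus)
  finally show ?thesis using v(1) by blast
qed

section \<open>A sum of bumps whose inverse Fourier transform is integrable\<close>

text \<open>The square makes the positive part of \<open>1 - z\<^sup>2\<close> continuously differentiable, as
  \<open>fourier_of_derivative\<close> requires.\<close>

definition bump :: "real \<Rightarrow> real" where "bump z = (max 0 (1 - z\<^sup>2))\<^sup>2"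
definition bump_deriv :: "real \<Rightarrow> real" where "bump_deriv z = - 4 * z * max 0 (1 - z\<^sup>2)"

lemma bump_outside: "1 \<le> \<bar>z\<bar> \<Longrightarrow> bump z = 0" "1 \<le> \<bar>z\<bar> \<Longrightarrow> bump_deriv z = 0"
proof -
  assume "1 \<le> \<bar>z\<bar>"
  then have "1\<^sup>2 \<le> \<bar>z\<bar>\<^sup>2" by (intro power_mono) auto
  then show "bump z = 0" "bump_deriv z = 0" by (auto simp: bump_def bump_deriv_def)
qed

lemma bump_bounds: "0 \<le> bump z" "bump z \<le> 1" "\<bar>z\<bar> \<le> 1 / 2 \<Longrightarrow> 1 / 2 \<le> bump z" "\<bar>bump_deriv z\<bar> \<le> 4"
proof -
  have m: "0 \<le> max 0 (1 - z\<^sup>2)" "max 0 (1 - z\<^sup>2) \<le> 1" by auto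
  show "0 \<le> bump z" by (simp add: bump_def)
  show "bump z \<le> 1" unfolding bump_def using m by (intro power_le_one)
  show "1 / 2 \<le> bump z" if "\<bar>z\<bar> \<le> 1 / 2"
  proof -
    have "\<bar>z\<bar>\<^sup>2 \<le> (1 / 2)\<^sup>2" using that by (intro power_mono) auto
    then have "z\<^sup>2 \<le> 1 / 4" by (simp add: power_divide)
    then have "3 / 4 \<le> 1 - z\<^sup>2" by simp
    then have "3 / 4 \<le> max 0 (1 - z\<^sup>2)" by (rule max.coboundedI2)
    then have "(3 / 4)\<^sup>2 \<le> bump z" unfolding bump_def by (rule power_mono) simp
    moreover have "1 / 2 \<le> (3 / 4 :: real)\<^sup>2" by (simp add: power2_eq_square)
    ultimately show ?thesis by (rule order_trans[rotated])
  qed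
  show "\<bar>bump_deriv z\<bar> \<le> 4"
  proof (cases "1 \<le> \<bar>z\<bar>")
    case False
    then have "4 * (\<bar>z\<bar> * max 0 (1 - z\<^sup>2)) \<le> 4 * (1 * 1)" using m by (intro mult_left_mono mult_mono) auto
    then show ?thesis by (simp add: bump_deriv_def abs_mult)
  qed (simp add: bump_outside)
qed

lemma bump_has_deriv: "(bump has_real_derivative bump_deriv z) (at z)"
proof -
  \<comment> \<open>\<open>bump\<close> is the composition of \<open>1 - z\<^sup>2\<close> with the square of the positive part, which is
    differentiable also at 0\<close>
  have sq: "((\<lambda>y::real. (max 0 y)\<^sup>2) has_real_derivative 2 * max 0 y) (at y)" for y
  proof -
    have "\<bar>(max 0 s)\<^sup>2 - (max 0 y)\<^sup>2 - (s - y) * (2 * max 0 y)\<bar> \<le> 1 * (s - y)\<^sup>2" for s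
    proof (cases "0 \<le> y")
      case y: True
      show ?thesis
      proof (cases "0 \<le> s")
        case True
        have "s\<^sup>2 - y\<^sup>2 - (s - y) * (2 * y) = (s - y)\<^sup>2" by (simp add: power2_eq_square algebra_simps)
        then show ?thesis using y True by simp
      next
        case False
        have 1: "0 - y\<^sup>2 - (s - y) * (2 * y) = y\<^sup>2 - 2 * (y * s)" "(s - y)\<^sup>2 = s\<^sup>2 + (y\<^sup>2 - 2 * (y * s))"
          by (simp_all add: power2_eq_square algebra_simps)
        have "y * s \<le> 0" using y False by (intro mult_nonneg_nonpos) auto
        then have "0 \<le> y\<^sup>2 - 2 * (y * s)" using zero_le_power2[of y] by linarith
        then show ?thesis using y False zero_le_power2[of s] 1 by (simp add: max_def)
      qed
    next
      case False
      then have "0 \<le> s \<Longrightarrow> s\<^sup>2 \<le> (s - y)\<^sup>2" by (intro power_mono) auto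
      then show ?thesis using False by (auto simp: max_def not_le)
    qed
    then have "((\<lambda>y::real. (max 0 y)\<^sup>2) has_vector_derivative 2 * max 0 y) (at y)"
      by (intro has_vector_derivative_quadratic_error[of 1 _ _ _ 1]) auto
    then show ?thesis by (simp add: has_real_derivative_iff_has_vector_derivative)
  qed
  have "((\<lambda>z. 1 - z\<^sup>2) has_real_derivative - (2 * z)) (at z)" by (auto intro!: derivative_eq_intros)
  from DERIV_chain2[OF sq this] show ?thesis by (simp add: bump_def[abs_def] bump_deriv_def mult_ac)
qed

lemma sum_square_single:
  fixes f :: "'i \<Rightarrow> real"
  assumes "finite A" and "\<And>i j. i \<in> A \<Longrightarrow> j \<in> A \<Longrightarrow> f i \<noteq> 0 \<Longrightarrow> f j \<noteq> 0 \<Longrightarrow> i = j"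
  shows "(\<Sum>i\<in>A. f i)\<^sup>2 = (\<Sum>i\<in>A. (f i)\<^sup>2)"
proof -
  have "(\<Sum>i\<in>A. f i)\<^sup>2 = (\<Sum>i\<in>A. \<Sum>j\<in>A. f i * f j)" by (simp add: power2_eq_square sum_product)
  also have "\<dots> = (\<Sum>i\<in>A. \<Sum>j\<in>A. if j = i then (f i)\<^sup>2 else 0)"
  proof (intro sum.cong refl)
    fix i j assume "i \<in> A" "j \<in> A"
    with assms(2)[of i j] show "f i * f j = (if j = i then (f i)\<^sup>2 else 0)"
      by (cases "j = i") (auto simp: power2_eq_square)
  qed
  also have "\<dots> = (\<Sum>i\<in>A. (f i)\<^sup>2)" using assms(1) by (simp add: sum.delta)
  finally show ?thesis .
qed

text \<open>The functions \<open>ctr\<close>, \<open>amp\<close> and \<open>wid\<close> give the centres, heights and half widths of the bumps, whose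
  supports are disjoint because the half widths are at most \<open>1 / 2\<close>. The three sums are, up to
  constants, the \<open>L\<^sup>1\<close> norm of the series, the square of its \<open>L\<^sup>2\<close> norm and the square of the \<open>L\<^sup>2\<close>
  norm of its derivative.\<close>

locale bump_series =
  fixes ctr amp wid :: "nat \<Rightarrow> real"
  assumes ctr: "\<And>n. ctr n = real (Suc n)" and amp: "\<And>n. 0 < amp n" and wid: "\<And>n. 0 < wid n" "\<And>n. wid n \<le> 1 / 2"
    and sum1: "summable (\<lambda>n. amp n * wid n)"
    and sum2: "summable (\<lambda>n. (amp n)\<^sup>2 * wid n)"
    and sum3: "summable (\<lambda>n. (amp n)\<^sup>2 / wid n)"
begin

definition piece :: "nat \<Rightarrow> real \<Rightarrow> real" where "piece n \<eta> = amp n * bump ((\<eta> - ctr n) / wid n)"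
definition dpiece :: "nat \<Rightarrow> real \<Rightarrow> real" where "dpiece n \<eta> = amp n / wid n * bump_deriv ((\<eta> - ctr n) / wid n)"

lemma continuous_bump: "continuous_on UNIV bump" "continuous_on UNIV bump_deriv"
  unfolding bump_def bump_deriv_def by (intro continuous_intros)+

lemma bump_measurable [measurable]: "bump \<in> borel_measurable borel" "bump_deriv \<in> borel_measurable borel"
  using continuous_bump by (auto intro: borel_measurable_continuous_onI)

lemma piece_measurable [measurable]: "piece n \<in> borel_measurable borel" "dpiece n \<in> borel_measurable borel"
  unfolding piece_def[abs_def] dpiece_def[abs_def] by measurable

lemma piece_support: "piece n \<eta> \<noteq> 0 \<Longrightarrow> \<bar>\<eta> - ctr n\<bar> < wid n" "dpiece n \<eta> \<noteq> 0 \<Longrightarrow> \<bar>\<eta> - ctr n\<bar> < wid n"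
  using bump_outside[of "(\<eta> - ctr n) / wid n"] wid(1)[of n]
  by (fastforce simp: piece_def dpiece_def abs_divide field_simps not_le)+

lemma disjoint_support: "\<bar>\<eta> - ctr m\<bar> < wid m \<Longrightarrow> \<bar>\<eta> - ctr n\<bar> < wid n \<Longrightarrow> m = n"
proof -
  assume "\<bar>\<eta> - ctr m\<bar> < wid m" "\<bar>\<eta> - ctr n\<bar> < wid n"
  then have "\<bar>ctr m - ctr n\<bar> < 1" using wid(2)[of m] wid(2)[of n] by linarith
  then show "m = n" by (simp add: ctr)
qed

lemma piece_bounds: "0 \<le> piece n \<eta>" "piece n \<eta> \<le> amp n * indicator {ctr n - wid n..ctr n + wid n} \<eta>"
  "\<bar>dpiece n \<eta>\<bar> \<le> 4 * amp n / wid n * indicator {ctr n - wid n..ctr n + wid n} \<eta>"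
proof -
  show "0 \<le> piece n \<eta>" using amp[of n] bump_bounds(1) by (simp add: piece_def)
  show "piece n \<eta> \<le> amp n * indicator {ctr n - wid n..ctr n + wid n} \<eta>"
  proof (cases "piece n \<eta> = 0")
    case True then show ?thesis using amp[of n] by (simp add: indicator_def)
  next
    case False
    from piece_support(1)[OF this] have "\<eta> \<in> {ctr n - wid n..ctr n + wid n}" by auto
    then show ?thesis using amp[of n] bump_bounds(2) by (simp add: piece_def)
  qed
  show "\<bar>dpiece n \<eta>\<bar> \<le> 4 * amp n / wid n * indicator {ctr n - wid n..ctr n + wid n} \<eta>"
  proof (cases "dpiece n \<eta> = 0")
    case True then show ?thesis using amp[of n] wid(1)[of n] by (simp add: indicator_def)
  next
    case False
    from piece_support(2)[OF this] have *: "\<eta> \<in> {ctr n - wid n..ctr n + wid n}" by auto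
    have "\<bar>dpiece n \<eta>\<bar> = amp n / wid n * \<bar>bump_deriv ((\<eta> - ctr n) / wid n)\<bar>"
      using amp[of n] wid(1)[of n] by (simp add: dpiece_def abs_mult)
    also have "\<dots> \<le> amp n / wid n * 4" using amp[of n] wid(1)[of n] by (intro mult_left_mono bump_bounds) auto
    finally show ?thesis using * by (simp add: mult_ac)
  qed
qed

lemma interval_nn_integral:
  assumes a: "0 \<le> a" and f: "\<And>\<eta>. f \<eta> \<le> a * indicator {ctr n - wid n..ctr n + wid n} \<eta>"
  shows "(\<integral>\<^sup>+\<eta>. ennreal (f \<eta>) \<partial>lborel) \<le> ennreal (a * (2 * wid n))"
proof -
  have "(\<integral>\<^sup>+\<eta>. ennreal (f \<eta>) \<partial>lborel) \<le> (\<integral>\<^sup>+\<eta>. ennreal a * indicator {ctr n - wid n..ctr n + wid n} \<eta> \<partial>lborel)"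
  proof (rule nn_integral_mono)
    fix \<eta> show "ennreal (f \<eta>) \<le> ennreal a * indicator {ctr n - wid n..ctr n + wid n} \<eta>"
      using ennreal_leI[OF f[of \<eta>]] by (auto simp: indicator_def split: if_splits)
  qed
  also have "\<dots> = ennreal a * ennreal (2 * wid n)" using wid(1)[of n] by (simp add: nn_integral_cmult_indicator)
  also have "\<dots> = ennreal (a * (2 * wid n))" using a wid(1)[of n] by (simp add: ennreal_mult)
  finally show ?thesis .
qed

definition total :: "real \<Rightarrow> real" where "total \<eta> = (\<Sum>n. piece n \<eta>)"
definition partial :: "nat \<Rightarrow> real \<Rightarrow> real" where "partial K \<eta> = (\<Sum>n<K. piece n \<eta>)"
definition dpartial :: "nat \<Rightarrow> real \<Rightarrow> real" where "dpartial K \<eta> = (\<Sum>n<K. dpiece n \<eta>)"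

lemma piece_summable: "summable (\<lambda>n. piece n \<eta>)"
proof (cases "\<exists>m. piece m \<eta> \<noteq> 0")
  case True
  then obtain m where m: "piece m \<eta> \<noteq> 0" by blast
  have "piece n \<eta> = 0" if "n \<notin> {m}" for n
    using disjoint_support[OF piece_support(1)[OF m] piece_support(1)[of n \<eta>]] that by auto
  then show ?thesis by (intro summable_finite[of "{m}"]) auto
qed simp

lemma partial_tendsto: "(\<lambda>K. partial K \<eta>) \<longlonglongrightarrow> total \<eta>"
  unfolding partial_def total_def by (rule summable_LIMSEQ[OF piece_summable])

lemma partial_le: "0 \<le> partial K \<eta>" "partial K \<eta> \<le> total \<eta>"
  unfolding partial_def total_def by (intro sum_nonneg piece_bounds sum_le_suminf piece_summable; simp add: piece_bounds)+

lemma total_measurable [measurable]: "total \<in> borel_measurable borel"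
  by (rule borel_measurable_LIMSEQ_real[OF partial_tendsto]) (simp add: partial_def)

lemma partial_measurable [measurable]: "partial K \<in> borel_measurable borel" "dpartial K \<in> borel_measurable borel"
  by (simp_all add: partial_def[abs_def] dpartial_def[abs_def])

lemma total_ge_piece: "piece n \<eta> \<le> total \<eta>"
  unfolding total_def using piece_bounds(1) by (intro sum_le_suminf[OF piece_summable, of "{n}", simplified]) auto

lemma total_integrable: "integrable lborel total"
proof (rule integrableI_bounded)
  have "(\<integral>\<^sup>+\<eta>. ennreal (norm (total \<eta>)) \<partial>lborel) = (\<integral>\<^sup>+\<eta>. (\<Sum>n. ennreal (piece n \<eta>)) \<partial>lborel)"
  proof (rule nn_integral_cong)
    fix \<eta>
    have "0 \<le> total \<eta>" using order_trans[OF piece_bounds(1) total_ge_piece] .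
    moreover have "(\<Sum>n. ennreal (piece n \<eta>)) = ennreal (total \<eta>)"
      unfolding total_def by (rule suminf_ennreal2[OF piece_bounds(1) piece_summable])
    ultimately show "ennreal (norm (total \<eta>)) = (\<Sum>n. ennreal (piece n \<eta>))" by simp
  qed
  also have "\<dots> = (\<Sum>n. \<integral>\<^sup>+\<eta>. ennreal (piece n \<eta>) \<partial>lborel)" by (rule nn_integral_suminf) measurable
  also have "\<dots> \<le> (\<Sum>n. ennreal (amp n * (2 * wid n)))"
    by (intro suminf_le interval_nn_integral piece_bounds less_imp_le[OF amp]) auto
  also have "\<dots> = ennreal (\<Sum>n. amp n * (2 * wid n))"
    using amp wid(1) summable_mult2[OF sum1, of 2] by (intro suminf_ennreal2) (auto simp: mult_ac less_imp_le)
  finally show "(\<integral>\<^sup>+\<eta>. ennreal (norm (total \<eta>)) \<partial>lborel) < \<infinity>" by (rule le_less_trans) simp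
qed measurable

text \<open>At each point at most one summand is nonzero, so that the square of the sum is the sum of the
  squares.\<close>

lemma square_sum_bound:
  assumes f [measurable]: "\<And>n. f n \<in> borel_measurable borel"
    and supp: "\<And>n \<eta>. f n \<eta> \<noteq> 0 \<Longrightarrow> \<bar>\<eta> - ctr n\<bar> < wid n"
    and le: "\<And>n \<eta>. \<bar>f n \<eta>\<bar> \<le> a n * indicator {ctr n - wid n..ctr n + wid n} \<eta>"
    and a: "\<And>n. 0 \<le> a n" and s: "summable (\<lambda>n. (a n)\<^sup>2 * wid n)"
  shows "(\<integral>\<^sup>+\<eta>. ennreal ((\<Sum>n<K. f n \<eta>)\<^sup>2) \<partial>lborel) \<le> ennreal (2 * (\<Sum>n. (a n)\<^sup>2 * wid n))"
proof -
  have "(\<integral>\<^sup>+\<eta>. ennreal ((\<Sum>n<K. f n \<eta>)\<^sup>2) \<partial>lborel) = (\<integral>\<^sup>+\<eta>. (\<Sum>n<K. ennreal ((f n \<eta>)\<^sup>2)) \<partial>lborel)"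
  proof (rule nn_integral_cong)
    fix \<eta>
    have "(\<Sum>n<K. f n \<eta>)\<^sup>2 = (\<Sum>n<K. (f n \<eta>)\<^sup>2)"
      by (rule sum_square_single) (auto dest: disjoint_support[OF supp supp])
    then show "ennreal ((\<Sum>n<K. f n \<eta>)\<^sup>2) = (\<Sum>n<K. ennreal ((f n \<eta>)\<^sup>2))" by simp
  qed
  also have "\<dots> = (\<Sum>n<K. \<integral>\<^sup>+\<eta>. ennreal ((f n \<eta>)\<^sup>2) \<partial>lborel)" by (rule nn_integral_sum) measurable
  also have "\<dots> \<le> (\<Sum>n<K. ennreal ((a n)\<^sup>2 * (2 * wid n)))"
  proof (intro sum_mono interval_nn_integral)
    fix n \<eta>
    have "\<bar>f n \<eta>\<bar>\<^sup>2 \<le> (a n * indicator {ctr n - wid n..ctr n + wid n} \<eta>)\<^sup>2" by (intro power_mono le) simp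
    then show "(f n \<eta>)\<^sup>2 \<le> (a n)\<^sup>2 * indicator {ctr n - wid n..ctr n + wid n} \<eta>"
      by (cases "\<eta> \<in> {ctr n - wid n..ctr n + wid n}") simp_all
  qed simp
  also have "\<dots> = ennreal (2 * (\<Sum>n<K. (a n)\<^sup>2 * wid n))"
    using wid(1) by (simp add: sum_distrib_left less_imp_le mult_ac)
  also have "\<dots> \<le> ennreal (2 * (\<Sum>n. (a n)\<^sup>2 * wid n))"
    using wid(1) s by (intro ennreal_leI mult_left_mono sum_le_suminf) (auto simp: less_imp_le)
  finally show ?thesis .
qed

definition H :: "real \<Rightarrow> complex" where "H \<eta> = of_real (total \<eta>)"

lemma H_integrable: "integrable lborel H"
  unfolding H_def[abs_def] complex_of_real_integrable_eq by (rule total_integrable)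

lemma compact_integrable:
  fixes f :: "real \<Rightarrow> complex"
  assumes c: "continuous_on UNIV f" and supp: "\<And>x. R < \<bar>x\<bar> \<Longrightarrow> f x = 0"
  shows "integrable lborel f"
proof -
  have "integrable lborel (\<lambda>x. indicator {-R..R} x *\<^sub>R f x)"
    using borel_integrable_compact[of "{-R..R}" f] c by (auto intro: continuous_on_subset)
  moreover have "(\<lambda>x. indicator {-R..R} x *\<^sub>R f x) = f"
    using supp by (force simp: indicator_def fun_eq_iff not_le abs_le_iff)
  ultimately show ?thesis by simp
qed

lemma fourier_dpartial:
  "fourier (\<lambda>\<eta>. of_real (dpartial K \<eta>)) x = \<i> * of_real x * fourier (\<lambda>\<eta>. of_real (partial K \<eta>)) x"
  and dpartial_integrable: "integrable lborel (\<lambda>\<eta>. complex_of_real (dpartial K \<eta>))"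
  and partial_integrable: "integrable lborel (\<lambda>\<eta>. complex_of_real (partial K \<eta>))"
proof -
  have d: "(partial K has_real_derivative dpartial K \<eta>) (at \<eta>)" for \<eta>
    unfolding partial_def[abs_def] dpartial_def
  proof (rule DERIV_sum)
    fix n
    have "((\<lambda>\<eta>. (\<eta> - ctr n) / wid n) has_real_derivative 1 / wid n) (at \<eta>)"
      using wid(1)[of n] by (auto intro!: derivative_eq_intros)
    from DERIV_cmult[OF DERIV_chain2[OF bump_has_deriv this], of "amp n"]
    show "((\<lambda>x. piece n x) has_real_derivative dpiece n \<eta>) (at \<eta>)"
      by (simp add: piece_def[abs_def] dpiece_def)
  qed
  have dc: "continuous_on UNIV (\<lambda>\<eta>. complex_of_real (dpartial K \<eta>))"
    unfolding dpartial_def dpiece_def using wid(1)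
    by (intro continuous_intros continuous_on_compose2[OF continuous_bump(2)]) (auto simp: less_imp_neq[symmetric])
  have vd: "((\<lambda>\<eta>. complex_of_real (partial K \<eta>)) has_vector_derivative of_real (dpartial K \<eta>)) (at \<eta>)" for \<eta>
    by (rule has_vector_derivative_of_real[OF d])
  then have pc: "continuous_on UNIV (\<lambda>\<eta>. complex_of_real (partial K \<eta>))"
    by (intro continuous_at_imp_continuous_on ballI has_vector_derivative_continuous)
  have out: "piece n \<eta> = 0" "dpiece n \<eta> = 0" if "real K + 1 < \<bar>\<eta>\<bar>" "n < K" for n \<eta>
  proof -
    have "ctr n \<le> real K" "0 \<le> ctr n" using that by (auto simp: ctr)
    then have "\<not> \<bar>\<eta> - ctr n\<bar> < wid n" using wid(2)[of n] that by linarith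
    then show "piece n \<eta> = 0" "dpiece n \<eta> = 0" using piece_support[of n \<eta>] by auto
  qed
  have supp: "partial K \<eta> = 0" "dpartial K \<eta> = 0" if "real K + 1 < \<bar>\<eta>\<bar>" for \<eta>
    using out[OF that] by (auto simp: partial_def dpartial_def)
  show ip: "integrable lborel (\<lambda>\<eta>. complex_of_real (partial K \<eta>))"
    by (rule compact_integrable[OF pc, of "real K + 1"]) (simp add: supp)
  show id: "integrable lborel (\<lambda>\<eta>. complex_of_real (dpartial K \<eta>))"
    by (rule compact_integrable[OF dc, of "real K + 1"]) (simp add: supp)
  show "fourier (\<lambda>\<eta>. of_real (dpartial K \<eta>)) x = \<i> * of_real x * fourier (\<lambda>\<eta>. of_real (partial K \<eta>)) x"
  proof (rule fourier_of_derivative[OF vd dc _ _ ip id])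
    have "eventually (\<lambda>\<eta>. complex_of_real (partial K \<eta>) = 0) at_top"
      using eventually_gt_at_top[of "real K + 1"] by eventually_elim (simp add: supp)
    then show "((\<lambda>\<eta>. complex_of_real (partial K \<eta>)) \<longlongrightarrow> 0) at_top" by (rule tendsto_eventually)
    have "eventually (\<lambda>\<eta>. \<eta> < - (real K + 1)) at_bot" by (rule eventually_gt_at_bot)
    then have "eventually (\<lambda>\<eta>. complex_of_real (partial K \<eta>) = 0) at_bot"
      by eventually_elim (simp add: supp)
    then show "((\<lambda>\<eta>. complex_of_real (partial K \<eta>)) \<longlongrightarrow> 0) at_bot" by (rule tendsto_eventually)
  qed
qed

text \<open>The transform of a square integrable function with square integrable derivative is integrable: it
  is square integrable with the weight \<open>1 + x\<^sup>2\<close>, and \<open>1 / (1 + x\<^sup>2)\<close> is integrable. The square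
  norms are computed for the partial sums, which have compact support, and Fatou's lemma passes to
  the limit.\<close>

lemma fourier_H_integrable: "integrable lborel (fourier H)"
proof (rule integrableI_bounded)
  have Hm [measurable]: "H \<in> borel_measurable borel" using H_integrable by auto
  define hK where "hK K = (\<lambda>\<eta>. complex_of_real (partial K \<eta>))" for K
  define dK where "dK K = (\<lambda>\<eta>. complex_of_real (dpartial K \<eta>))" for K
  note ints = partial_integrable[folded hK_def] dpartial_integrable[folded dK_def]
  have [measurable]: "hK K \<in> borel_measurable borel" "dK K \<in> borel_measurable borel" for K
    using ints[of K] by auto
  have conv: "(\<lambda>K. fourier (hK K) x) \<longlonglongrightarrow> fourier H x" for x
    unfolding fourier_def
  proof (rule integral_dominated_convergence[where w = total])
    show "AE \<eta> in lborel. (\<lambda>K. hK K \<eta> * cis (- (\<eta> * x))) \<longlonglongrightarrow> H \<eta> * cis (- (\<eta> * x))"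
      unfolding hK_def H_def by (intro AE_I2 tendsto_intros partial_tendsto)
    show "AE \<eta> in lborel. norm (hK K \<eta> * cis (- (\<eta> * x))) \<le> total \<eta>" for K
      using partial_le[of K] by (simp add: hK_def norm_mult)
  qed (use total_integrable in measurable)
  define M1 where "M1 = 2 * (\<Sum>n. (amp n)\<^sup>2 * wid n)"
  define M2 where "M2 = 2 * (\<Sum>n. (4 * amp n / wid n)\<^sup>2 * wid n)"
  have h2: "(\<integral>\<^sup>+x. ennreal ((cmod (fourier (hK K) x))\<^sup>2) \<partial>lborel) \<le> 2 * pi * ennreal M1" for K
  proof (rule order_trans[OF fourier_L2_bound[OF ints(1)]], rule mult_left_mono)
    have "(\<integral>\<^sup>+\<eta>. ennreal ((\<Sum>n<K. piece n \<eta>)\<^sup>2) \<partial>lborel) \<le> ennreal M1"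
      unfolding M1_def by (rule square_sum_bound) (use piece_support piece_bounds amp sum2 in \<open>auto simp: less_imp_le\<close>)
    then show "(\<integral>\<^sup>+\<eta>. ennreal ((cmod (hK K \<eta>))\<^sup>2) \<partial>lborel) \<le> ennreal M1"
      by (simp add: hK_def partial_def[symmetric] del: of_real_sum)
  qed simp
  have d2: "(\<integral>\<^sup>+x. ennreal ((cmod (fourier (dK K) x))\<^sup>2) \<partial>lborel) \<le> 2 * pi * ennreal M2" for K
  proof (rule order_trans[OF fourier_L2_bound[OF ints(2)]], rule mult_left_mono)
    have eq: "(4 * amp n / wid n)\<^sup>2 * wid n = 16 * ((amp n)\<^sup>2 / wid n)" for n
      using wid(1)[of n] by (simp add: power2_eq_square field_simps)
    have "(\<integral>\<^sup>+\<eta>. ennreal ((\<Sum>n<K. dpiece n \<eta>)\<^sup>2) \<partial>lborel) \<le> ennreal M2"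
      unfolding M2_def
    proof (rule square_sum_bound)
      show "0 \<le> 4 * amp n / wid n" for n using amp[of n] wid(1)[of n] by simp
      show "summable (\<lambda>n. (4 * amp n / wid n)\<^sup>2 * wid n)" unfolding eq by (rule summable_mult[OF sum3])
    qed (use piece_support piece_bounds in auto)
    then show "(\<integral>\<^sup>+\<eta>. ennreal ((cmod (dK K \<eta>))\<^sup>2) \<partial>lborel) \<le> ennreal M2"
      by (simp add: dK_def dpartial_def[symmetric] del: of_real_sum)
  qed simp
  have bnd: "(\<integral>\<^sup>+x. ennreal ((cmod (fourier (hK K) x))\<^sup>2 * (1 + x\<^sup>2)) \<partial>lborel) \<le> 2 * pi * ennreal M1 + 2 * pi * ennreal M2" for K
  proof -
    have eq: "(cmod (fourier (hK K) x))\<^sup>2 * (1 + x\<^sup>2) = (cmod (fourier (hK K) x))\<^sup>2 + (cmod (fourier (dK K) x))\<^sup>2" for x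
      using fourier_dpartial[of K x] by (simp add: hK_def dK_def norm_mult power_mult_distrib algebra_simps)
    show ?thesis
      unfolding eq using add_mono[OF h2[of K] d2[of K]] by (simp add: nn_integral_add ennreal_plus)
  qed
  have "(\<integral>\<^sup>+x. ennreal ((cmod (fourier H x))\<^sup>2 * (1 + x\<^sup>2)) \<partial>lborel) = (\<integral>\<^sup>+x. liminf (\<lambda>K. ennreal ((cmod (fourier (hK K) x))\<^sup>2 * (1 + x\<^sup>2))) \<partial>lborel)"
  proof (rule nn_integral_cong)
    fix x
    have "(\<lambda>K. ennreal ((cmod (fourier (hK K) x))\<^sup>2 * (1 + x\<^sup>2))) \<longlonglongrightarrow> ennreal ((cmod (fourier H x))\<^sup>2 * (1 + x\<^sup>2))"
      by (intro tendsto_intros conv)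
    from lim_imp_Liminf[OF _ this]
    show "ennreal ((cmod (fourier H x))\<^sup>2 * (1 + x\<^sup>2)) = liminf (\<lambda>K. ennreal ((cmod (fourier (hK K) x))\<^sup>2 * (1 + x\<^sup>2)))" by simp
  qed
  also have "\<dots> \<le> liminf (\<lambda>K. \<integral>\<^sup>+x. ennreal ((cmod (fourier (hK K) x))\<^sup>2 * (1 + x\<^sup>2)) \<partial>lborel)"
    by (rule nn_integral_liminf) measurable
  also have "\<dots> \<le> liminf (\<lambda>K::nat. 2 * pi * ennreal M1 + 2 * pi * ennreal M2)"
    by (intro Liminf_mono always_eventually allI bnd)
  also have "\<dots> = 2 * pi * ennreal M1 + 2 * pi * ennreal M2" by (simp add: Liminf_const)
  also have "\<dots> < \<infinity>" by (simp add: ennreal_mult_less_top)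
  finally have fin: "(\<integral>\<^sup>+x. ennreal ((cmod (fourier H x))\<^sup>2 * (1 + x\<^sup>2)) \<partial>lborel) < \<infinity>" .
  have "(\<integral>\<^sup>+x. ennreal (norm (fourier H x)) \<partial>lborel) \<le> (\<integral>\<^sup>+x. ennreal ((cmod (fourier H x))\<^sup>2 * (1 + x\<^sup>2)) + ennreal (1 / (1 + x\<^sup>2)) \<partial>lborel)"
  proof (rule nn_integral_mono)
    fix x :: real
    define z where "z = cmod (fourier H x)"
    define w where "w = 1 + x\<^sup>2"
    have w: "0 < w" by (simp add: w_def add_pos_nonneg)
    \<comment> \<open>\<open>z \<le> z\<^sup>2 w + 1 / w\<close>, the pointwise form of the Cauchy--Schwarz inequality\<close>
    have "0 \<le> (z * w - 1)\<^sup>2 + z * w" using w by (simp add: z_def)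
    then have "z * w \<le> (z * w)\<^sup>2 + 1" by (simp add: power2_eq_square algebra_simps)
    then have "z \<le> z\<^sup>2 * w + 1 / w" using w by (simp add: field_simps power2_eq_square)
    from ennreal_leI[OF this] show "ennreal (norm (fourier H x)) \<le> ennreal ((cmod (fourier H x))\<^sup>2 * (1 + x\<^sup>2)) + ennreal (1 / (1 + x\<^sup>2))"
      unfolding z_def w_def by (subst (asm) ennreal_plus) auto
  qed
  also have "\<dots> = (\<integral>\<^sup>+x. ennreal ((cmod (fourier H x))\<^sup>2 * (1 + x\<^sup>2)) \<partial>lborel) + (\<integral>\<^sup>+x. ennreal (1 / (1 + x\<^sup>2)) \<partial>(lborel :: real measure))"
    by (rule nn_integral_add) measurable
  also have "\<dots> < \<infinity>"
    using fin nn_integral_eq_integral[OF integrable_inverse_quadratic] by simp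
  finally show "(\<integral>\<^sup>+x. ennreal (norm (fourier H x)) \<partial>lborel) < \<infinity>" .
qed (use H_integrable in measurable)

end

section \<open>The modulation space is a proper subset\<close>

text \<open>Suppose that the transform \<open>H\<close> of \<open>u\<close> is at least \<open>l\<close> on an interval of length \<open>e\<close> around \<open>\<kappa>\<close>,
  where the translated window is at least \<open>\<mu>\<close>. In \<open>STFT_pairing\<close> let \<open>r\<close> be the product of the
  transform of the window with a Gaussian of width \<open>e\<close> at that interval and with the factor
  \<open>1 / sqrt e\<close>. Then the integrand on the right-hand side is nonnegative and the integral is at
  least a multiple of \<open>l / sqrt e\<close> times the length \<open>e\<close>. On the left-hand side
  \<open>weighted_hausdorff_young\<close> bounds the pairing by the \<open>L\<^sup>p\<close> norm of the slice, with a constant that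
  does not depend on \<open>e\<close>: the factor \<open>1 / sqrt e\<close> keeps the square norm of \<open>r\<close> bounded.\<close>

lemma STFT_Lp_lower_bound:
  fixes H :: "real \<Rightarrow> real"
  assumes u: "u \<in> tempered_distributions" and \<phi>: "\<phi> \<in> schwartz" and p: "1 \<le> p" "p \<le> 2"
    and H: "integrable lborel H" "\<And>\<eta>. 0 \<le> H \<eta>"
    and rep: "\<And>q. q \<in> schwartz \<Longrightarrow> dist_fourier u q = (\<integral>\<eta>. of_real (H \<eta>) * q \<eta> \<partial>lborel)"
    and V: "integrable lborel (\<lambda>x. STFT \<phi> u x \<xi>)"
    and e: "0 < e" "e \<le> 1" and l: "0 \<le> l" and \<mu>: "0 \<le> \<mu>"
    and Hl: "\<And>\<eta>. \<bar>\<eta> - \<kappa>\<bar> \<le> e / 2 \<Longrightarrow> l \<le> H \<eta>"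
    and \<gamma>l: "\<And>\<eta>. \<bar>\<eta> - \<kappa>\<bar> \<le> e / 2 \<Longrightarrow> \<mu> \<le> cmod (fourier \<phi> (\<eta> - \<xi>))"
    and D: "0 \<le> D" "\<And>z. cmod (fourier \<phi> z) \<le> D"
  shows "ennreal (l * \<mu>\<^sup>2 * exp (- 1 / 4) * sqrt e) \<le> ennreal (D * sqrt pi + pi + D\<^sup>2 * sqrt pi) * Lp_norm p (\<lambda>x. STFT \<phi> u x \<xi>)"
proof -
  \<comment> \<open>\<open>r\<close> is a function of \<open>\<eta> - \<xi>\<close>, in which the interval is centred at \<open>m\<close>\<close>
  define m where "m = \<kappa> - \<xi>"
  define G where "G z = exp (- (1 / e\<^sup>2 * (z - m)\<^sup>2))" for z
  define \<gamma> where "\<gamma> = fourier \<phi>"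
  have \<gamma>: "\<gamma> \<in> schwartz" unfolding \<gamma>_def by (rule schwartz_fourier[OF \<phi>])
  have a: "0 < 1 / e\<^sup>2" using e by simp
  have GS: "(\<lambda>z. complex_of_real (G z)) \<in> schwartz"
    using schwartz_shift[OF gaussian_schwartz[OF a], of m] by (simp add: G_def)
  have G: "0 < G z" "G z \<le> 1" for z using a by (auto simp: G_def)
  have [measurable]: "G \<in> borel_measurable borel" unfolding G_def[abs_def] by measurable
  have [measurable]: "\<gamma> \<in> borel_measurable borel" by (rule schwartz_measurable[OF \<gamma>])
  define r where "r z = of_real (1 / sqrt e) * (of_real (G z) * \<gamma> z)" for z
  have r: "r \<in> schwartz" unfolding r_def by (intro schwartz_cmult(1) schwartz_mult GS schwartz_bounded_smooth \<gamma>)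
  have [measurable]: "r \<in> borel_measurable borel" by (rule schwartz_measurable[OF r])
  have r_le: "cmod (r z) \<le> D / sqrt e * G z" for z
    using mult_left_mono[OF D(2)[of z], of "G z / sqrt e"] G[of z] e by (simp add: r_def \<gamma>_def norm_mult norm_divide mult_ac)
  have G_int: "(\<integral>\<^sup>+z. ennreal (G z) \<partial>lborel) = ennreal (e * sqrt pi)"
  proof -
    have i: "integrable lborel (\<lambda>z. exp (- (1 / e\<^sup>2 * z\<^sup>2)))"
      using fourier_gaussian(1)[OF a] by (simp only: complex_of_real_integrable_eq)
    have "(\<integral>\<^sup>+z. ennreal (G z) \<partial>lborel) = (\<integral>\<^sup>+z. ennreal (exp (- (1 / e\<^sup>2 * z\<^sup>2))) \<partial>lborel)"
      unfolding G_def by (rule nn_integral_lborel_shift[of "\<lambda>z. ennreal (exp (- (1 / e\<^sup>2 * z\<^sup>2)))"]) measurable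
    also have "\<dots> = ennreal (sqrt (pi / (1 / e\<^sup>2)))"
      using nn_integral_eq_integral[OF i] integral_gaussian[OF a] by simp
    also have "sqrt (pi / (1 / e\<^sup>2)) = e * sqrt pi" using e by (simp add: real_sqrt_mult)
    finally show ?thesis .
  qed
  have r1: "(\<integral>\<^sup>+z. ennreal (cmod (r z)) \<partial>lborel) \<le> ennreal (D * sqrt pi)"
  proof -
    have "(\<integral>\<^sup>+z. ennreal (cmod (r z)) \<partial>lborel) \<le> (\<integral>\<^sup>+z. ennreal (D / sqrt e) * ennreal (G z) \<partial>lborel)"
      using r_le D(1) e G by (intro nn_integral_mono) (simp flip: ennreal_mult del: times_divide_eq_left add: ennreal_leI less_imp_le)
    also have "\<dots> = ennreal (D / sqrt e * (e * sqrt pi))"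
      using D(1) e by (simp add: nn_integral_cmult G_int flip: ennreal_mult)
    also have "\<dots> \<le> ennreal (D * sqrt pi)"
    proof (rule ennreal_leI)
      have "D / sqrt e * (e * sqrt pi) = D * sqrt pi * (e / sqrt e)" by simp
      also have "e / sqrt e = sqrt e" using e by (intro real_div_sqrt) simp
      also have "D * sqrt pi * sqrt e \<le> D * sqrt pi * 1" using D(1) e by (intro mult_left_mono) auto
      finally show "D / sqrt e * (e * sqrt pi) \<le> D * sqrt pi" by simp
    qed
    finally show ?thesis .
  qed
  have r2: "(\<integral>\<^sup>+z. ennreal ((cmod (r z))\<^sup>2) \<partial>lborel) \<le> ennreal (D\<^sup>2 * sqrt pi)"
  proof -
    have "(\<integral>\<^sup>+z. ennreal ((cmod (r z))\<^sup>2) \<partial>lborel) \<le> (\<integral>\<^sup>+z. ennreal (D\<^sup>2 / e) * ennreal (G z) \<partial>lborel)"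
    proof (rule nn_integral_mono)
      fix z
      have "(cmod (r z))\<^sup>2 \<le> (D / sqrt e * G z)\<^sup>2" by (intro power_mono r_le) simp
      also have "\<dots> = D\<^sup>2 / e * (G z)\<^sup>2" using e by (simp add: power_mult_distrib power_divide)
      also have "\<dots> \<le> D\<^sup>2 / e * G z"
        using G[of z] e mult_left_mono[of "G z" 1 "G z"] by (intro mult_left_mono) (auto simp: power2_eq_square)
      finally have "ennreal ((cmod (r z))\<^sup>2) \<le> ennreal (D\<^sup>2 / e * G z)" by (rule ennreal_leI)
      also have "\<dots> = ennreal (D\<^sup>2 / e) * ennreal (G z)" using e G[of z] by (intro ennreal_mult) auto
      finally show "ennreal ((cmod (r z))\<^sup>2) \<le> ennreal (D\<^sup>2 / e) * ennreal (G z)" .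
    qed
    also have "\<dots> = ennreal (D\<^sup>2 / e * (e * sqrt pi))"
      using e by (simp add: nn_integral_cmult G_int flip: ennreal_mult)
    also have "D\<^sup>2 / e * (e * sqrt pi) = D\<^sup>2 * sqrt pi" using e by simp
    finally show ?thesis .
  qed
  have upper: "ennreal (cmod (\<integral>x. STFT \<phi> u x \<xi> * fourier r x \<partial>lborel)) \<le> ennreal (D * sqrt pi + pi + D\<^sup>2 * sqrt pi) * Lp_norm p (\<lambda>x. STFT \<phi> u x \<xi>)"
  proof -
    let ?V = "\<lambda>x. STFT \<phi> u x \<xi>"
    have Vm [measurable]: "?V \<in> borel_measurable borel" using V by auto
    have eq: "(\<integral>x. ?V x * fourier r x \<partial>lborel) = (\<integral>\<eta>. fourier ?V \<eta> * r \<eta> \<partial>lborel)"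
      by (rule fourier_multiplication_formula[OF V schwartz_integrable[OF r], symmetric])
    have "ennreal (cmod (\<integral>\<eta>. fourier ?V \<eta> * r \<eta> \<partial>lborel)) \<le> (\<integral>\<^sup>+\<eta>. ennreal (cmod (fourier ?V \<eta> * r \<eta>)) \<partial>lborel)"
      by (intro integral_norm_bound_ennreal integrable_mult_bounded(2)[OF schwartz_integrable[OF r] _ cmod_fourier_le]) simp
    also have "\<dots> = (\<integral>\<^sup>+\<eta>. ennreal (cmod (fourier ?V \<eta>) * cmod (r \<eta>)) \<partial>lborel)" by (simp add: norm_mult)
    also have "\<dots> \<le> ((\<integral>\<^sup>+\<eta>. ennreal (cmod (r \<eta>)) \<partial>lborel) + pi + (\<integral>\<^sup>+\<eta>. ennreal ((cmod (r \<eta>))\<^sup>2) \<partial>lborel)) * Lp_norm p ?V"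
      by (rule weighted_hausdorff_young[OF p V]) auto
    also have "\<dots> \<le> (ennreal (D * sqrt pi) + pi + ennreal (D\<^sup>2 * sqrt pi)) * Lp_norm p ?V"
      by (intro mult_right_mono add_mono r1 r2) auto
    also have "ennreal (D * sqrt pi) + pi + ennreal (D\<^sup>2 * sqrt pi) = ennreal (D * sqrt pi + pi + D\<^sup>2 * sqrt pi)"
      using D(1) by (simp add: ennreal_plus)
    finally show ?thesis unfolding eq .
  qed
  define q where "q \<eta> = 1 / sqrt e * G (\<eta> - \<xi>) * (cmod (\<gamma> (\<eta> - \<xi>)))\<^sup>2" for \<eta>
  have q_eq: "r (\<eta> - \<xi>) * cnj (fourier \<phi> (\<eta> - \<xi>)) = of_real (q \<eta>)" for \<eta>
    using complex_norm_square[of "\<gamma> (\<eta> - \<xi>)"] by (simp add: r_def q_def \<gamma>_def mult.assoc)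
  have qS: "(\<lambda>\<eta>. complex_of_real (q \<eta>)) \<in> schwartz"
    unfolding q_eq[symmetric] using schwartz_shift[OF schwartz_mult[OF r schwartz_bounded_smooth[OF schwartz_cnj(1)[OF \<gamma>]]], of \<xi>]
    by (simp add: \<gamma>_def)
  have Hc: "integrable lborel (\<lambda>\<eta>. complex_of_real (H \<eta>))" unfolding complex_of_real_integrable_eq by (rule H(1))
  obtain Q where Q: "\<And>\<eta>. cmod (complex_of_real (q \<eta>)) \<le> Q" using schwartz_bounded[OF qS] by blast
  have "integrable lborel (\<lambda>\<eta>. complex_of_real (H \<eta>) * complex_of_real (q \<eta>))"
    by (rule integrable_mult_bounded(1)[OF Hc _ Q]) (use schwartz_measurable[OF qS] in simp)
  then have Hq: "integrable lborel (\<lambda>\<eta>. H \<eta> * q \<eta>)" by (simp only: of_real_mult[symmetric] complex_of_real_integrable_eq)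
  have val: "(\<integral>x. STFT \<phi> u x \<xi> * fourier r x \<partial>lborel) = of_real (\<integral>\<eta>. H \<eta> * q \<eta> \<partial>lborel)"
    unfolding STFT_pairing[OF u \<phi> r] q_eq rep[OF qS] by (simp only: of_real_mult[symmetric] integral_complex_of_real)
  define k where "k = l * (1 / sqrt e * exp (- 1 / 4) * \<mu>\<^sup>2)"
  have k0: "0 \<le> k" using l e by (simp add: k_def)
  have "k * e = (\<integral>\<eta>. k * indicator {\<kappa> - e / 2..\<kappa> + e / 2} \<eta> \<partial>lborel)"
    using e by simp
  also have "\<dots> \<le> (\<integral>\<eta>. H \<eta> * q \<eta> \<partial>lborel)"
  proof (rule integral_mono[OF _ Hq])
    show "integrable lborel (\<lambda>\<eta>. k * indicator {\<kappa> - e / 2..\<kappa> + e / 2} \<eta>)"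
      by (intro integrable_mult_right integrable_real_indicator) (use e in auto)
    fix \<eta>
    show "k * indicator {\<kappa> - e / 2..\<kappa> + e / 2} \<eta> \<le> H \<eta> * q \<eta>"
    proof (cases "\<eta> \<in> {\<kappa> - e / 2..\<kappa> + e / 2}")
      case True
      then have d: "\<bar>\<eta> - \<kappa>\<bar> \<le> e / 2" unfolding atLeastAtMost_iff by linarith
      from power_mono[OF this abs_ge_zero, of 2] have "(\<eta> - \<kappa>)\<^sup>2 \<le> (e / 2)\<^sup>2" by simp
      then have "1 / e\<^sup>2 * (\<eta> - \<kappa>)\<^sup>2 \<le> 1 / 4" using e by (simp add: power_divide field_simps)
      then have "exp (- 1 / 4) \<le> G (\<eta> - \<xi>)" by (simp add: G_def m_def)
      then have "l * (1 / sqrt e * exp (- 1 / 4) * \<mu>\<^sup>2) \<le> H \<eta> * (1 / sqrt e * G (\<eta> - \<xi>) * (cmod (\<gamma> (\<eta> - \<xi>)))\<^sup>2)"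
        using Hl[OF d] \<gamma>l[OF d] l \<mu> e H(2) G[of "\<eta> - \<xi>"] unfolding \<gamma>_def
        by (intro mult_mono power_mono mult_nonneg_nonneg) auto
      then show ?thesis using True by (simp add: k_def q_def)
    next
      case False
      then show ?thesis using H(2)[of \<eta>] e G(1)[of "\<eta> - \<xi>"] by (simp add: q_def less_imp_le)
    qed
  qed
  finally have "k * e \<le> cmod (\<integral>x. STFT \<phi> u x \<xi> * fourier r x \<partial>lborel)" unfolding val norm_of_real by simp
  moreover have "k * e = l * \<mu>\<^sup>2 * exp (- 1 / 4) * sqrt e"
  proof -
    have "k * e = l * \<mu>\<^sup>2 * exp (- 1 / 4) * (e / sqrt e)" by (simp add: k_def)
    also have "e / sqrt e = sqrt e" using e by (intro real_div_sqrt) simp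
    finally show ?thesis .
  qed
  ultimately show ?thesis using order_trans[OF ennreal_leI upper] by simp
qed

context bump_series
begin

definition f :: "real \<Rightarrow> complex" where "f t = 1 / (2 * pi) * fourier H (- t)"

definition bump_dist :: "(real \<Rightarrow> complex) \<Rightarrow> complex" where "bump_dist s = (if s \<in> schwartz then \<integral>t. f t * s t \<partial>lborel else 0)"

lemma f_measurable [measurable]: "f \<in> borel_measurable borel"
  unfolding f_def[abs_def] by (rule inverse_fourier_measurable[OF H_integrable])

lemma f_bound: "cmod (f t) \<le> 1 / (2 * pi) * (\<integral>\<eta>. cmod (H \<eta>) \<partial>lborel)"
  unfolding f_def by (rule bounded_inverse_fourier[OF H_integrable])

lemma f_integrable: "integrable lborel f"
proof -
  have "integrable lborel (\<lambda>t. fourier H (0 + (-1) * t))"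
    by (subst lborel_integrable_real_affine_iff) (auto intro: fourier_H_integrable)
  then show ?thesis unfolding f_def[abs_def] by (intro integrable_mult_right) simp
qed

lemma bump_dist_tempered: "bump_dist \<in> tempered_distributions"
  unfolding bump_dist_def[abs_def] by (rule bounded_function_tempered[OF f_measurable f_bound])

lemma bump_dist_represents: "represents f bump_dist"
  by (rule representsI_L1[OF f_integrable]) (simp add: bump_dist_def)

lemma fourier_bump_dist: "q \<in> schwartz \<Longrightarrow> dist_fourier bump_dist q = (\<integral>\<eta>. H \<eta> * q \<eta> \<partial>lborel)"
proof -
  assume q: "q \<in> schwartz"
  define s where "s = (\<lambda>t. 1 / (2 * pi) * fourier q (- t))"
  have s: "s \<in> schwartz" "fourier s = q" unfolding s_def by (rule schwartz_fourier_surj[OF q])+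
  have "dist_fourier bump_dist q = (\<integral>t. f t * fourier q t \<partial>lborel)"
    using q by (simp add: dist_fourier_def bump_dist_def schwartz_fourier)
  also have "\<dots> = (\<integral>t. f (- t) * fourier q (- t) \<partial>lborel)"
    by (subst lborel_integral_real_affine[where c = "-1" and t = 0]) simp_all
  also have "\<dots> = (\<integral>t. fourier H t * s t \<partial>lborel)"
    by (intro Bochner_Integration.integral_cong refl) (simp add: f_def s_def)
  also have "\<dots> = (\<integral>\<eta>. H \<eta> * fourier s \<eta> \<partial>lborel)"
    by (rule fourier_multiplication_formula[OF H_integrable schwartz_integrable[OF s(1)]])
  finally show ?thesis unfolding s(2) .
qed

text \<open>The function \<open>f\<close> is bounded and integrable.\<close>

lemma f_Lp: "1 \<le> p \<Longrightarrow> Lp_norm p f < \<infinity>"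
proof -
  assume p: "1 \<le> p"
  define B where "B = 1 / (2 * pi) * (\<integral>\<eta>. cmod (H \<eta>) \<partial>lborel)"
  have B: "cmod (f t) \<le> B" for t unfolding B_def by (rule f_bound)
  have "(\<integral>\<^sup>+t. ennreal (cmod (f t) powr p) \<partial>lborel) \<le> (\<integral>\<^sup>+t. ennreal (B powr (p - 1)) * ennreal (cmod (f t)) \<partial>lborel)"
  proof (rule nn_integral_mono)
    fix t
    have "cmod (f t) powr p = cmod (f t) powr (p - 1) * cmod (f t)"
      by (cases "f t = 0") (auto simp: powr_diff)
    also have "\<dots> \<le> B powr (p - 1) * cmod (f t)"
      using p B by (intro mult_right_mono powr_mono2) auto
    finally show "ennreal (cmod (f t) powr p) \<le> ennreal (B powr (p - 1)) * ennreal (cmod (f t))"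
      by (simp flip: ennreal_mult add: ennreal_leI)
  qed
  also have "\<dots> < \<infinity>" using f_integrable by (simp add: nn_integral_cmult integrable_iff_bounded ennreal_mult_less_top)
  finally show "Lp_norm p f < \<infinity>" unfolding Lp_norm_def ennreal_root_less_top .
qed

lemma bump_dist_fourier_segal: "1 \<le> p \<Longrightarrow> bump_dist \<in> fourier_segal p"
proof -
  assume p: "1 \<le> p"
  have "dist_Lp_norm p bump_dist < \<infinity>" by (rule le_less_trans[OF dist_Lp_norm_le[OF bump_dist_represents] f_Lp[OF p]])
  moreover have "dist_Lp_norm 1 (dist_fourier bump_dist) < \<infinity>"
    by (rule le_less_trans[OF dist_Lp_norm_le[OF representsI_L1[OF H_integrable fourier_bump_dist]] Lp_norm_1_finite[OF H_integrable]])
  ultimately show "bump_dist \<in> fourier_segal p" using bump_dist_tempered by (simp add: fourier_segal_def FA_norm_def)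
qed

lemma STFT_bump_dist_integrable:
  assumes \<phi>: "\<phi> \<in> schwartz" shows "integrable lborel (\<lambda>x. STFT \<phi> bump_dist x \<xi>)"
proof -
  have eq: "STFT \<phi> bump_dist x \<xi> = (\<integral>t. (f t * cis (- (t * \<xi>))) * cnj (\<phi> (- (x - t))) \<partial>lborel)" for x
    using lip_family_schwartz[OF STFT_families(1)[OF \<phi>, of \<xi>], of x] by (simp add: STFT_def bump_dist_def mult_ac)
  show ?thesis
    unfolding eq by (rule convolution_integrable(1)[of "\<lambda>t. f t * cis (- (t * \<xi>))" "\<lambda>z. cnj (\<phi> (- z))"])
      (use f_integrable schwartz_integrable[OF schwartz_reflect[OF schwartz_cnj(1)[OF \<phi>]]] in auto)
qed

text \<open>Choose \<open>z0\<close> with \<open>fourier \<phi> z0 \<noteq> 0\<close>. For all \<open>\<xi>\<close> within a fixed distance of \<open>ctr n - z0\<close> the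
  translated window is bounded away from zero on the bump of number \<open>n\<close>, once this bump is narrow.
  There the \<open>L\<^sup>p\<close> norm of the slice is at least a multiple of \<open>amp n * sqrt (wid n)\<close>, by
  \<open>STFT_Lp_lower_bound\<close>. These intervals of \<open>\<xi>\<close> are disjoint and of equal length, so that the
  modulation norm dominates a divergent series.\<close>

lemma bump_dist_not_modulation:
  assumes p: "1 \<le> p" "p \<le> 2" and \<phi>: "\<phi> \<in> schwartz" "\<phi> \<noteq> (\<lambda>x. 0)"
    and wid0: "wid \<longlonglongrightarrow> 0" and div: "\<not> summable (\<lambda>n. amp n * sqrt (wid n))"
  shows "bump_dist \<notin> modulation_space \<phi> p"
proof
  assume "bump_dist \<in> modulation_space \<phi> p"
  then have fin: "(\<integral>\<^sup>+\<xi>. Lp_norm p (\<lambda>x. STFT \<phi> bump_dist x \<xi>) \<partial>lborel) < \<infinity>"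
    by (simp add: modulation_space_def modulation_norm_def)
  define \<gamma> where "\<gamma> = fourier \<phi>"
  have \<gamma>: "\<gamma> \<in> schwartz" unfolding \<gamma>_def by (rule schwartz_fourier[OF \<phi>(1)])
  have "\<exists>z. \<gamma> z \<noteq> 0" using fourier_square_integral_nonzero[OF \<phi>] unfolding \<gamma>_def by (rule contrapos_np) simp
  then obtain z0 where z0: "\<gamma> z0 \<noteq> 0" by blast
  define \<mu> where "\<mu> = cmod (\<gamma> z0) / 2"
  have \<mu>: "0 < \<mu>" using z0 by (simp add: \<mu>_def)
  obtain d where d: "0 < d" "\<And>z. dist z z0 < d \<Longrightarrow> dist (\<gamma> z) (\<gamma> z0) < \<mu>"
    using schwartz_isCont[OF \<gamma>, of z0] \<mu> unfolding continuous_at_eps_delta by metis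
  \<comment> \<open>the bound \<open>1 / 2\<close> keeps the intervals \<open>J n\<close> disjoint\<close>
  define \<delta> where "\<delta> = min (d / 2) (1 / 2)"
  have \<delta>: "0 < \<delta>" "\<delta> < d" "\<delta> \<le> 1 / 2" using d(1) by (auto simp: \<delta>_def)
  have \<gamma>l: "\<mu> \<le> cmod (\<gamma> z)" if "\<bar>z - z0\<bar> \<le> \<delta>" for z
  proof -
    have "cmod (\<gamma> z - \<gamma> z0) < \<mu>" using d(2)[of z] that \<delta> by (simp add: dist_norm)
    then show ?thesis using norm_triangle_ineq2[of "\<gamma> z0" "\<gamma> z"] by (simp add: \<mu>_def norm_minus_commute)
  qed
  obtain D where D: "0 \<le> D" "\<And>z. cmod (\<gamma> z) \<le> D" using schwartz_bounded[OF \<gamma>] by blast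
  define C where "C = D * sqrt pi + pi + D\<^sup>2 * sqrt pi"
  have C: "0 < C" unfolding C_def using D(1) pi_gt_zero by (intro add_pos_nonneg add_nonneg_pos) auto
  define k where "k = 1 / 2 * \<mu>\<^sup>2 * exp (- 1 / 4) / C"
  have k: "0 < k" using \<mu> C by (simp add: k_def)
  obtain n0 where n0: "\<And>n. n0 \<le> n \<Longrightarrow> wid n < \<delta>"
    using order_tendstoD(2)[OF wid0 \<delta>(1)] by (auto simp: eventually_sequentially)
  define J where "J n = {ctr n - z0 - \<delta> / 2..ctr n - z0 + \<delta> / 2}" for n
  define a where "a n = amp n * sqrt (wid n)" for n
  have a0: "0 \<le> a n" for n using amp[of n] wid(1)[of n] by (simp add: a_def)
  have lower: "ennreal (k * a n) \<le> Lp_norm p (\<lambda>x. STFT \<phi> bump_dist x \<xi>)" if n: "n0 \<le> n" and \<xi>: "\<xi> \<in> J n" for n \<xi>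
  proof -
    have "ennreal (amp n / 2 * \<mu>\<^sup>2 * exp (- 1 / 4) * sqrt (wid n)) \<le> ennreal C * Lp_norm p (\<lambda>x. STFT \<phi> bump_dist x \<xi>)"
      unfolding C_def
    proof (rule STFT_Lp_lower_bound[OF bump_dist_tempered \<phi>(1) p total_integrable _ _ STFT_bump_dist_integrable[OF \<phi>(1)]])
      show "0 \<le> total \<eta>" for \<eta> using order_trans[OF piece_bounds(1) total_ge_piece] .
      show "dist_fourier bump_dist q = (\<integral>\<eta>. of_real (total \<eta>) * q \<eta> \<partial>lborel)" if "q \<in> schwartz" for q
        using fourier_bump_dist[OF that] by (simp add: H_def)
      show "amp n / 2 \<le> total \<eta>" if "\<bar>\<eta> - ctr n\<bar> \<le> wid n / 2" for \<eta>
      proof -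
        have "\<bar>(\<eta> - ctr n) / wid n\<bar> \<le> 1 / 2" using that wid(1)[of n] by (simp add: abs_divide field_simps)
        then have "amp n * (1 / 2) \<le> piece n \<eta>"
          unfolding piece_def using amp[of n] by (intro mult_left_mono bump_bounds(3)) auto
        then show ?thesis using total_ge_piece[of n \<eta>] by linarith
      qed
      show "\<mu> \<le> cmod (fourier \<phi> (\<eta> - \<xi>))" if "\<bar>\<eta> - ctr n\<bar> \<le> wid n / 2" for \<eta>
      proof -
        have "\<bar>\<eta> - \<xi> - z0\<bar> \<le> \<delta>" using that \<xi> n0[OF n] unfolding J_def atLeastAtMost_iff by linarith
        then show ?thesis using \<gamma>l by (simp add: \<gamma>_def)
      qed
      show "cmod (fourier \<phi> z) \<le> D" for z using D(2) by (simp add: \<gamma>_def)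
    qed (use amp[of n] wid[of n] \<mu> D(1) in auto)
    then have "ennreal (1 / C) * ennreal (amp n / 2 * \<mu>\<^sup>2 * exp (- 1 / 4) * sqrt (wid n)) \<le> ennreal (1 / C) * (ennreal C * Lp_norm p (\<lambda>x. STFT \<phi> bump_dist x \<xi>))"
      by (rule mult_left_mono) simp
    also have "\<dots> = Lp_norm p (\<lambda>x. STFT \<phi> bump_dist x \<xi>)"
      using C by (simp add: mult.assoc[symmetric] flip: ennreal_mult)
    also have "ennreal (1 / C) * ennreal (amp n / 2 * \<mu>\<^sup>2 * exp (- 1 / 4) * sqrt (wid n)) = ennreal (k * a n)"
      using C amp[of n] wid(1)[of n] by (simp add: k_def a_def mult_ac flip: ennreal_mult)
    finally show ?thesis .
  qed
  define T where "T = enn2real (\<integral>\<^sup>+\<xi>. Lp_norm p (\<lambda>x. STFT \<phi> bump_dist x \<xi>) \<partial>lborel)"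
  have "(\<Sum>i<K. a (i + n0)) \<le> T / (k * \<delta>)" for K
  proof -
    have "ennreal (\<Sum>i<K. k * a (i + n0) * \<delta>) = (\<Sum>i<K. \<integral>\<^sup>+\<xi>. ennreal (k * a (i + n0)) * indicator (J (i + n0)) \<xi> \<partial>lborel)"
      using k a0 \<delta>(1) by (simp add: J_def nn_integral_cmult_indicator flip: ennreal_mult)
    also have "\<dots> = (\<integral>\<^sup>+\<xi>. (\<Sum>i<K. ennreal (k * a (i + n0)) * indicator (J (i + n0)) \<xi>) \<partial>lborel)"
      by (rule nn_integral_sum[symmetric]) (simp add: J_def)
    also have "\<dots> \<le> (\<integral>\<^sup>+\<xi>. Lp_norm p (\<lambda>x. STFT \<phi> bump_dist x \<xi>) \<partial>lborel)"
    proof (rule nn_integral_mono)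
      fix \<xi>
      show "(\<Sum>i<K. ennreal (k * a (i + n0)) * indicator (J (i + n0)) \<xi>) \<le> Lp_norm p (\<lambda>x. STFT \<phi> bump_dist x \<xi>)"
      proof (cases "\<exists>i<K. \<xi> \<in> J (i + n0)")
        case True
        then obtain i where i: "i < K" "\<xi> \<in> J (i + n0)" by blast
        have unique: "j = i" if "\<xi> \<in> J (j + n0)" for j
        proof -
          have "\<bar>ctr (j + n0) - ctr (i + n0)\<bar> < 1" using that i(2) \<delta>(3) unfolding J_def atLeastAtMost_iff by linarith
          then show ?thesis by (simp add: ctr)
        qed
        have "(\<Sum>j<K. ennreal (k * a (j + n0)) * indicator (J (j + n0)) \<xi>) = (\<Sum>j<K. if j = i then ennreal (k * a (j + n0)) else 0)"
        proof (rule sum.cong[OF refl])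
          fix j
          show "ennreal (k * a (j + n0)) * indicator (J (j + n0)) \<xi> = (if j = i then ennreal (k * a (j + n0)) else 0)"
            using i(2) unique[of j] by (cases "j = i") (auto simp: indicator_def)
        qed
        also have "\<dots> = ennreal (k * a (i + n0))" using i by simp
        also have "\<dots> \<le> Lp_norm p (\<lambda>x. STFT \<phi> bump_dist x \<xi>)" by (rule lower[OF _ i(2)]) simp
        finally show ?thesis .
      next
        case False
        then have "(\<Sum>i<K. ennreal (k * a (i + n0)) * indicator (J (i + n0)) \<xi>) = 0" by (intro sum.neutral) (auto simp: indicator_def)
        then show ?thesis by simp
      qed
    qed
    also have "\<dots> = ennreal T" using fin by (simp add: T_def less_top[symmetric])
    finally have "(\<Sum>i<K. k * a (i + n0) * \<delta>) \<le> T" by (simp add: T_def ennreal_le_iff)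
    moreover have "(\<Sum>i<K. k * a (i + n0) * \<delta>) = (\<Sum>i<K. a (i + n0)) * (k * \<delta>)"
      unfolding sum_distrib_right by (intro sum.cong refl) simp
    ultimately show ?thesis using k \<delta>(1) by (simp add: pos_le_divide_eq)
  qed
  then have "summable (\<lambda>i. a (i + n0))" by (intro summableI_nonneg_bounded a0)
  then have "summable a" by (simp add: summable_iff_shift)
  with div show False by (simp add: a_def[abs_def])
qed

end

lemma summable_Suc_powr: "s < -1 \<Longrightarrow> summable (\<lambda>n. real (Suc n) powr s)"
  using summable_real_powr_iff[of s] summable_Suc_iff[of "\<lambda>n. real n powr s"] by simp

theorem theorem8p1:
  fixes p :: real and \<phi> :: "real \<Rightarrow> complex"
  assumes "1 \<le> p" and "p \<le> 2"
    and "\<phi> \<in> schwartz" and "\<phi> \<noteq> (\<lambda>x. 0)"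
  shows "modulation_space \<phi> p \<subset> fourier_segal p \<and>
    (\<forall>u \<in> fourier_segal p. \<forall>\<epsilon>::real. \<epsilon> > 0 \<longrightarrow>
       (\<exists>v \<in> modulation_space \<phi> p. FA_norm p (\<lambda>f. u f - v f) < ennreal \<epsilon>))"
proof -
  \<comment> \<open>For heights \<open>n\<^sup>-\<^sup>\<alpha>\<close> and widths \<open>n\<^sup>-\<^sup>\<beta>\<close> the requirements are \<open>\<alpha> + \<beta> > 1\<close>, \<open>2 \<alpha> + \<beta> > 1\<close>,
    \<open>2 \<alpha> - \<beta> > 1\<close> and \<open>\<alpha> + \<beta> / 2 \<le> 1\<close>. For \<open>\<beta> = 1 / 4\<close> and \<open>\<alpha> = 7 / 8\<close> the last one holds with
    equality, so that the divergent series is the harmonic one.\<close>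
  define amp where "amp n = real (Suc n) powr (- 7 / 8)" for n
  define wid where "wid n = real (Suc n) powr (- 1 / 4) / 2" for n
  have e1: "amp n * wid n = 1 / 2 * real (Suc n) powr (- 9 / 8)" for n
    by (simp add: amp_def wid_def flip: powr_add)
  have e2: "(amp n)\<^sup>2 * wid n = 1 / 2 * real (Suc n) powr (- 2)" for n
    by (simp add: amp_def wid_def power2_eq_square flip: powr_add)
  have e3: "(amp n)\<^sup>2 / wid n = 2 * real (Suc n) powr (- 3 / 2)" for n
  proof -
    have "(amp n)\<^sup>2 / wid n = 2 * (real (Suc n) powr (- 7 / 4) / real (Suc n) powr (- 1 / 4))"
      by (simp add: amp_def wid_def power2_eq_square flip: powr_add)
    also have "\<dots> = 2 * real (Suc n) powr (- 7 / 4 - - 1 / 4)" by (simp only: powr_diff)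
    finally show ?thesis by simp
  qed
  have e4: "amp n * sqrt (wid n) = 1 / sqrt 2 * inverse (real (Suc n))" for n
  proof -
    have "sqrt (wid n) = real (Suc n) powr (- 1 / 8) / sqrt 2"
      by (simp add: wid_def real_sqrt_divide powr_half_sqrt[symmetric] powr_powr)
    then have "amp n * sqrt (wid n) = 1 / sqrt 2 * real (Suc n) powr (- 1)"
      by (simp add: amp_def flip: powr_add)
    then show ?thesis by (simp add: powr_minus)
  qed
  interpret bump_series "\<lambda>n. real (Suc n)" amp wid
  proof
    show "wid n \<le> 1 / 2" for n
      using powr_mono2'[of "- 1 / 4" 1 "real (Suc n)"] by (simp add: wid_def)
    show "summable (\<lambda>n. amp n * wid n)" "summable (\<lambda>n. (amp n)\<^sup>2 * wid n)" "summable (\<lambda>n. (amp n)\<^sup>2 / wid n)"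
      unfolding e1 e2 e3 by (intro summable_mult summable_Suc_powr; simp)+
  qed (auto simp: amp_def wid_def)
  have "wid \<longlonglongrightarrow> 0" unfolding wid_def by real_asymp
  moreover have "\<not> summable (\<lambda>n. amp n * sqrt (wid n))"
  proof -
    have "\<not> summable (\<lambda>n. inverse (real (Suc n)))"
      using not_summable_harmonic[where 'a = real] by (subst summable_Suc_iff)
    then show ?thesis unfolding e4 by (subst summable_cmult_iff) simp
  qed
  ultimately have "bump_dist \<notin> modulation_space \<phi> p" by (rule bump_dist_not_modulation[OF assms])
  with bump_dist_fourier_segal[OF assms(1)] have "modulation_space \<phi> p \<noteq> fourier_segal p" by blast
  with modulation_subset_fourier_segal[OF assms] modulation_dense[OF assms(1,3)] show ?thesis by blast
qed

end
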